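(* Let $T>0$. Let $p>2$, $\alpha>2$, $\beta>2$, $\lambda>0$, $\lambda_0>0$, $\lambda_1>0$ and $\widetilde{\lambda}_0,\widetilde{\lambda}_1\in\mathbb{R}$ with $|\widetilde{\lambda}_0+\widetilde{\lambda}_1|<2\sqrt{\lambda_0\lambda_1}$, and let $\widetilde{h}_0,\widetilde{h}_1\in H^1(0,T)$. Let $(u_0,u_1)\in H^1\times L^2$. Then, for $T_*\in(0,T]$ small enough, the problem $$u_{tt}-u_{xx}+u+\lambda u_t=|u|^{p-2}u,\quad 0<x<1,\ 0<t<T_*,$$ $$u_x(0,t)=-|u(0,t)|^{\alpha-2}u(0,t)+\lambda_0u_t(0,t)+\widetilde{h}_1(t)u(1,t)+\widetilde{\lambda}_1u_t(1,t),$$ $$-u_x(1,t)=-|u(1,t)|^{\beta-2}u(1,t)+\lambda_1u_t(1,t)+\widetilde{h}_0(t)u(0,t)+\widetilde{\lambda}_0u_t(0,t),$$ $$u(x,0)=u_0(x),\quad u_t(x,0)=u_1(x),$$ has a unique local weak solution $u$ with $$u\in C([0,T_*];H^1)\cap C^1([0,T_*];L^2),\quad u(i,\cdot)\in H^1(0,T_* ),\ i=0,1.$$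
   Context: $\Omega=(0,1)$; $L^2=L^2(\Omega)$ and $H^1=W^{1,2}(\Omega)$ are the usual real-valued spaces on $(0,1)$, and $\langle\cdot,\cdot\rangle$ is the $L^2$ inner product. We write $u(t)=u(\cdot,t)$ and $u'=u_t$. A weak solution on $[0,T_*]$ is a function $u$ of the stated regularity with $u(0)=u_0$, $u'(0)=u_1$ such that for every $v\in H^1$, in the sense of distributions in $t\in(0,T_* )$, $$\frac{d}{dt}\langle u'(t),v\rangle+\langle u_x(t),v_x\rangle+\langle u(t),v\rangle+\lambda\langle u'(t),v\rangle+\left(\lambda_0u'(0,t)+\widetilde{h}_1(t)u(1,t)+\widetilde{\lambda}_1u'(1,t)\right)v(0)+\left(\lambda_1u'(1,t)+\widetilde{h}_0(t)u(0,t)+\widetilde{\lambda}_0u'(0,t)\right)v(1)$$ $$=\langle|u|^{p-2}u,v\rangle+|u(0,t)|^{\alpha-2}u(0,t)v(0)+|u(1,t)|^{\beta-2}u(1,t)v(1),$$ where $u'(i,t)$ denotes the (weak) derivative of $t\mapsto u(i,t)\in H^1(0,T_* )$, $i=0,1$. *)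

theory Defs
  imports "HOL-Analysis.Analysis"
begin

text \<open>
  Elements of the spaces \<open>L\<^sup>2(a,b)\<close> and \<open>H\<^sup>1(a,b)\<close> are represented by functions \<open>real \<Rightarrow> real\<close> of
  which only the almost-everywhere class on \<open>(a,b)\<close> matters: all notions below are invariant under
  changes on null sets, equality of elements is equality almost everywhere, and boundary
  values are read off the continuous representative.
\<close>

definition L2 :: "real \<Rightarrow> real \<Rightarrow> (real \<Rightarrow> real) set" where
  "L2 a b = {f \<in> borel_measurable (lebesgue_on {a<..<b}).
               integrable (lebesgue_on {a<..<b}) (\<lambda>x. (f x)\<^sup>2)}"

definition L2_inner :: "real \<Rightarrow> real \<Rightarrow> (real \<Rightarrow> real) \<Rightarrow> (real \<Rightarrow> real) \<Rightarrow> real" where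
  "L2_inner a b f g = (LINT x|lebesgue_on {a<..<b}. f x * g x)"

definition L2_norm :: "real \<Rightarrow> real \<Rightarrow> (real \<Rightarrow> real) \<Rightarrow> real" where
  "L2_norm a b f = sqrt (L2_inner a b f f)"

text \<open>The test functions \<open>C\<^sub>c\<^sup>\<infinity>(a,b)\<close>, extended by zero to the real line.\<close>

definition test_functions :: "real \<Rightarrow> real \<Rightarrow> (real \<Rightarrow> real) set" where
  "test_functions a b = {\<phi>. (\<forall>n x. (deriv ^^ n) \<phi> differentiable (at x)) \<and>
     compact (closure {x. \<phi> x \<noteq> 0}) \<and> closure {x. \<phi> x \<noteq> 0} \<subseteq> {a<..<b}}"

definition locally_integrable :: "real \<Rightarrow> real \<Rightarrow> (real \<Rightarrow> real) \<Rightarrow> bool" where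
  "locally_integrable a b f \<longleftrightarrow>
     (\<forall>K. compact K \<and> K \<subseteq> {a<..<b} \<longrightarrow> set_integrable lebesgue K f)"

text \<open>\<open>g\<close> is the derivative of \<open>f\<close> in the sense of distributions on \<open>(a,b)\<close>.\<close>

definition has_weak_deriv :: "real \<Rightarrow> real \<Rightarrow> (real \<Rightarrow> real) \<Rightarrow> (real \<Rightarrow> real) \<Rightarrow> bool" where
  "has_weak_deriv a b f g \<longleftrightarrow> locally_integrable a b f \<and> locally_integrable a b g \<and>
     (\<forall>\<phi> \<in> test_functions a b.
        (LINT x|lebesgue_on {a<..<b}. f x * deriv \<phi> x) =
        - (LINT x|lebesgue_on {a<..<b}. g x * \<phi> x))"

text \<open>Weak derivatives are unique only up to null sets, hence the choice.\<close>

definition weak_deriv :: "real \<Rightarrow> real \<Rightarrow> (real \<Rightarrow> real) \<Rightarrow> real \<Rightarrow> real" where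
  "weak_deriv a b f = (SOME g. has_weak_deriv a b f g)"

definition H1 :: "real \<Rightarrow> real \<Rightarrow> (real \<Rightarrow> real) set" where
  "H1 a b = {f \<in> L2 a b. \<exists>g \<in> L2 a b. has_weak_deriv a b f g}"

definition H1_norm :: "real \<Rightarrow> real \<Rightarrow> (real \<Rightarrow> real) \<Rightarrow> real" where
  "H1_norm a b f = sqrt ((L2_norm a b f)\<^sup>2 + (L2_norm a b (weak_deriv a b f))\<^sup>2)"

text \<open>
  The representative of \<open>f \<in> H\<^sup>1(a,b)\<close> in \<open>C[a,b]\<close>, evaluated at the end points to obtain boundary values;
  it is unique on \<open>[a,b]\<close>.
\<close>

definition cont_rep :: "real \<Rightarrow> real \<Rightarrow> (real \<Rightarrow> real) \<Rightarrow> real \<Rightarrow> real" where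
  "cont_rep a b f = (SOME g. continuous_on {a..b} g \<and> (AE x in lebesgue_on {a<..<b}. f x = g x))"

text \<open>
  Functions of space and time are written \<open>u t x\<close>; \<open>u t\<close> is the class of \<open>u(\<cdot>,t)\<close>. The space
  interval is \<open>\<Omega> = (0,1)\<close>.
\<close>

definition continuous_L2 :: "real \<Rightarrow> (real \<Rightarrow> real \<Rightarrow> real) \<Rightarrow> bool" where
  "continuous_L2 \<tau> w \<longleftrightarrow> (\<forall>t \<in> {0..\<tau>}. w t \<in> L2 0 1) \<and>
     (\<forall>t \<in> {0..\<tau>}. ((\<lambda>s. L2_norm 0 1 (\<lambda>x. w s x - w t x)) \<longlongrightarrow> 0) (at t within {0..\<tau>}))"

definition continuous_H1 :: "real \<Rightarrow> (real \<Rightarrow> real \<Rightarrow> real) \<Rightarrow> bool" where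
  "continuous_H1 \<tau> u \<longleftrightarrow> (\<forall>t \<in> {0..\<tau>}. u t \<in> H1 0 1) \<and>
     (\<forall>t \<in> {0..\<tau>}. ((\<lambda>s. H1_norm 0 1 (\<lambda>x. u s x - u t x)) \<longlongrightarrow> 0) (at t within {0..\<tau>}))"

text \<open>\<open>u \<in> C\<^sup>1([0,\<tau>]; L\<^sup>2)\<close> with (strong, one-sided at the end points) derivative \<open>u'\<close>.\<close>

definition has_C1_L2_deriv ::
    "real \<Rightarrow> (real \<Rightarrow> real \<Rightarrow> real) \<Rightarrow> (real \<Rightarrow> real \<Rightarrow> real) \<Rightarrow> bool" where
  "has_C1_L2_deriv \<tau> u u' \<longleftrightarrow> continuous_L2 \<tau> u \<and> continuous_L2 \<tau> u' \<and>
     (\<forall>t \<in> {0..\<tau>}. ((\<lambda>s. L2_norm 0 1 (\<lambda>x. (u s x - u t x) / (s - t) - u' t x)) \<longlongrightarrow> 0)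
                     (at t within {0..\<tau>}))"

definition power_source :: "real \<Rightarrow> real \<Rightarrow> real" where
  "power_source q s = \<bar>s\<bar> powr (q - 2) * s"

text \<open>
  In the definition below \<open>u' t\<close> is the \<open>L\<^sup>2\<close>-valued time derivative, whereas \<open>\<gamma>\<^sub>i t\<close> and \<open>\<gamma>\<^sub>i' t\<close> stand
  for \<open>u(i,t)\<close> and for the weak derivative of \<open>t \<mapsto> u(i,t)\<close>. The variational identity is solved for
  the distributional derivative of \<open>t \<mapsto> \<langle>u'(t),v\<rangle>\<close> on \<open>(0,\<tau>)\<close>. The parameters \<open>m0\<close>, \<open>m1\<close>, \<open>h0\<close>, \<open>h1\<close>
  are \<open>\<lambda>\<^sub>0\<close>, \<open>\<lambda>\<^sub>1\<close>, \<open>h\<^sub>0\<close>, \<open>h\<^sub>1\<close> with a tilde, and \<open>l\<close>, \<open>l0\<close>, \<open>l1\<close> are \<open>\<lambda>\<close>, \<open>\<lambda>\<^sub>0\<close>, \<open>\<lambda>\<^sub>1\<close>.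
\<close>

definition weak_solution ::
    "real \<Rightarrow> real \<Rightarrow> real \<Rightarrow> real \<Rightarrow> real \<Rightarrow> real \<Rightarrow> real \<Rightarrow> real \<Rightarrow>
     (real \<Rightarrow> real) \<Rightarrow> (real \<Rightarrow> real) \<Rightarrow> (real \<Rightarrow> real) \<Rightarrow> (real \<Rightarrow> real) \<Rightarrow>
     real \<Rightarrow> (real \<Rightarrow> real \<Rightarrow> real) \<Rightarrow> bool" where
  "weak_solution p \<alpha> \<beta> l l0 l1 m0 m1 h0 h1 u0 u1 \<tau> u \<longleftrightarrow>
     (let \<gamma>\<^sub>0 = (\<lambda>t. cont_rep 0 1 (u t) 0); \<gamma>\<^sub>1 = (\<lambda>t. cont_rep 0 1 (u t) 1);
          \<gamma>\<^sub>0' = weak_deriv 0 \<tau> \<gamma>\<^sub>0; \<gamma>\<^sub>1' = weak_deriv 0 \<tau> \<gamma>\<^sub>1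
      in continuous_H1 \<tau> u \<and> \<gamma>\<^sub>0 \<in> H1 0 \<tau> \<and> \<gamma>\<^sub>1 \<in> H1 0 \<tau> \<and>
         (\<exists>u'. has_C1_L2_deriv \<tau> u u' \<and>
            (AE x in lebesgue_on {0<..<1}. u 0 x = u0 x) \<and>
            (AE x in lebesgue_on {0<..<1}. u' 0 x = u1 x) \<and>
            (\<forall>v \<in> H1 0 1.
               has_weak_deriv 0 \<tau> (\<lambda>t. L2_inner 0 1 (u' t) v)
                 (\<lambda>t. L2_inner 0 1 (\<lambda>x. power_source p (u t x)) v
                      + power_source \<alpha> (\<gamma>\<^sub>0 t) * cont_rep 0 1 v 0
                      + power_source \<beta> (\<gamma>\<^sub>1 t) * cont_rep 0 1 v 1
                      - L2_inner 0 1 (weak_deriv 0 1 (u t)) (weak_deriv 0 1 v)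
                      - L2_inner 0 1 (u t) v
                      - l * L2_inner 0 1 (u' t) v
                      - (l0 * \<gamma>\<^sub>0' t + h1 t * \<gamma>\<^sub>1 t + m1 * \<gamma>\<^sub>1' t) * cont_rep 0 1 v 0
                      - (l1 * \<gamma>\<^sub>1' t + h0 t * \<gamma>\<^sub>0 t + m0 * \<gamma>\<^sub>0' t) * cont_rep 0 1 v 1))))"

end

theory Submission
  imports Defs
begin

text \<open>
  With \<open>k = \<lambda> / 2\<close>, the substitution \<open>w = exp (k t) u\<close> removes the damping, and in the unit square
  d'Alembert's formula represents \<open>w\<close> by two travelling waves and a Duhamel term. At \<open>x = 0\<close> and \<open>x = 1\<close>
  the boundary conditions become a 2 by 2 linear system for the boundary velocities, which is
  uniquely solvable because \<open>\<lambda>\<^sub>0\<lambda>\<^sub>1\<close> exceeds the product of the two coupling coefficients. After truncation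
  of the sources, \<open>w\<close> is thus a fixed point of a Volterra type map on continuous functions, a
  contraction in an exponentially weighted norm; for small times the truncation is inactive.
  Conversely, a weak solution solves a linear Neumann problem with its own source and boundary fluxes
  as data. Tested with \<open>cos (n \<pi> x)\<close>, that problem reduces to oscillator equations, so its weak solution
  is unique and equals d'Alembert's formula. Hence every weak solution is a fixed point, which gives
  uniqueness.
\<close>

section \<open>Smooth test functions\<close>

text \<open>A function that is C^1 in time with values in L2 has no trace of its time derivative,
  yet the boundary velocities multiply \<open>v(0)\<close> and \<open>v(1)\<close> in the weak form.
  The two Neumann fluxes are therefore carried along as unknown L2 functions of time. In
  d'Alembert's formula a flux and the velocity at the same end point are linked by an algebraic
  relation, so both can be expressed by the initial data and by pointwise values of
  \<open>w\<close>; this is why a fixed point argument in a sup norm suffices. Times are restricted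
  to at most 1 because a wave is then reflected at most once, and profiles on (-1,2) are enough.
  Nothing is smooth here: the source is only continuous and the profiles are only L2, so the wave
  equation is used in a form integrated over time. Uniqueness concerns arbitrary weak solutions, for
  which no bound is known in advance; the truncation level may therefore depend on the solutions
  that are compared, and the fixed point map has to contract at every level.\<close>

definition smooth :: "(real \<Rightarrow> real) \<Rightarrow> bool" where
  "smooth f \<longleftrightarrow> (\<forall>n x. (deriv ^^ n) f differentiable (at x))"

lemma smooth_differentiable: "smooth f \<Longrightarrow> f differentiable (at x)"
  unfolding smooth_def by (metis funpow_0)

lemma smooth_deriv: "smooth f \<Longrightarrow> smooth (deriv f)"
  unfolding smooth_def by (metis funpow_Suc_right comp_apply)

text \<open>The iterates \<open>deriv ^^ n\<close> have no convenient closed form. Instead of an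
  induction on the order, one exhibits a class of differentiable functions that \<open>deriv\<close>
  maps into itself.\<close>

lemma smooth_coinduct:
  assumes "X f" and step: "\<And>g. X g \<Longrightarrow> (\<forall>x. g differentiable (at x)) \<and> X (deriv g)"
  shows "smooth f"
proof -
  have "X ((deriv ^^ n) f)" for n
    using assms by (induction n) auto
  then show ?thesis
    unfolding smooth_def using step by blast
qed

lemma smooth_DERIV: "smooth f \<Longrightarrow> (f has_real_derivative deriv f x) (at x)"
  using smooth_differentiable DERIV_deriv_iff_real_differentiable by blast

lemma smooth_continuous: "smooth f \<Longrightarrow> continuous_on S f"
  by (meson smooth_DERIV DERIV_isCont continuous_at_imp_continuous_on)

lemma DERIV_eventually_eq:
  assumes "(g has_real_derivative D) (at x)" "eventually (\<lambda>y. f y = g y) (nhds x)"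
  shows "(f has_real_derivative D) (at x)"
  by (rule iffD2[OF DERIV_cong_ev[OF refl assms(2) refl] assms(1)])

text \<open>The free factor closes the class under \<open>deriv\<close>: the chain rule multiplies
  it by \<open>a\<close> and replaces \<open>f\<close> by \<open>deriv f\<close>.\<close>

lemma smooth_affine:
  assumes "smooth f"
  shows "smooth (\<lambda>x. c * f (a * x + b))"
proof (rule smooth_coinduct[where X = "\<lambda>h. \<exists>c f. smooth f \<and> h = (\<lambda>x. c * f (a * x + b))"])
  fix g assume "\<exists>c f. smooth f \<and> g = (\<lambda>x. c * f (a * x + b))"
  then obtain c f where f: "smooth f" and g: "g = (\<lambda>x. c * f (a * x + b))" by blast
  have d: "(g has_real_derivative (c * a) * deriv f (a * x + b)) (at x)" for x
    unfolding g using f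
    by (auto intro!: derivative_eq_intros DERIV_chain2[OF smooth_DERIV[OF f]])
  have "deriv g = (\<lambda>x. (c * a) * deriv f (a * x + b))"
    using DERIV_imp_deriv[OF d] by auto
  then show "(\<forall>x. g differentiable (at x)) \<and> (\<exists>c f. smooth f \<and> deriv g = (\<lambda>x. c * f (a * x + b)))"
    using d smooth_deriv[OF f] real_differentiable_def by blast
qed (use assms in blast)

text \<open>Products alone are not closed under \<open>deriv\<close>, because the Leibniz rule
  produces sums of products; the finite sums of products are.\<close>

inductive smooth_alg :: "(real \<Rightarrow> real) \<Rightarrow> bool" where
  mult: "smooth f \<Longrightarrow> smooth g \<Longrightarrow> smooth_alg (\<lambda>x. f x * g x)"
| add: "smooth_alg u \<Longrightarrow> smooth_alg v \<Longrightarrow> smooth_alg (\<lambda>x. u x + v x)"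

lemma smooth_alg_step: "smooth_alg h \<Longrightarrow> (\<forall>x. h differentiable (at x)) \<and> smooth_alg (deriv h)"
proof (induction rule: smooth_alg.induct)
  case (mult f g)
  have d: "((\<lambda>x. f x * g x) has_real_derivative deriv f x * g x + f x * deriv g x) (at x)" for x
    by (rule DERIV_cong[OF DERIV_mult[OF smooth_DERIV smooth_DERIV]]) (use mult in auto)
  have "deriv (\<lambda>x. f x * g x) = (\<lambda>x. deriv f x * g x + f x * deriv g x)"
    using DERIV_imp_deriv[OF d] by auto
  moreover have "smooth_alg (\<lambda>x. deriv f x * g x + f x * deriv g x)"
    using mult smooth_deriv by (intro smooth_alg.intros) auto
  ultimately show ?case
    using d real_differentiable_def by auto
next
  case (add u v)
  have d: "((\<lambda>x. u x + v x) has_real_derivative deriv u x + deriv v x) (at x)" for x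
    using add by (intro DERIV_add) (auto simp: DERIV_deriv_iff_real_differentiable)
  have "deriv (\<lambda>x. u x + v x) = (\<lambda>x. deriv u x + deriv v x)"
    using DERIV_imp_deriv[OF d] by auto
  then show ?case
    using d real_differentiable_def add by (auto intro: smooth_alg.intros)
qed

lemma smooth_mult: "smooth f \<Longrightarrow> smooth g \<Longrightarrow> smooth (\<lambda>x. f x * g x)"
  by (rule smooth_coinduct[where X = smooth_alg]) (auto intro: smooth_alg.intros dest: smooth_alg_step)

lemma smooth_const: "smooth (\<lambda>x. c)"
  by (rule smooth_coinduct[where X = "\<lambda>f. \<exists>c. f = (\<lambda>x. c)"]) auto

lemma smooth_add:
  assumes "smooth f" "smooth g"
  shows "smooth (\<lambda>x. f x + g x)"
proof (rule smooth_coinduct[where X = smooth_alg])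
  \<comment> \<open>Multiplication by the constant 1 puts the summands into the class.\<close>
  have "smooth_alg (\<lambda>x. f x * 1 + g x * 1)"
    by (intro smooth_alg.intros assms smooth_const)
  then show "smooth_alg (\<lambda>x. f x + g x)" by simp
qed (use smooth_alg_step in auto)

text \<open>\<open>flat 1\<close> is the classical function exp(-1/x), continued by zero. The
  polynomial in 1/x is carried along because differentiation leads from one function of this kind to
  another.\<close>

definition flat :: "real poly \<Rightarrow> real \<Rightarrow> real" where
  "flat p x = (if x > 0 then poly p (1 / x) * exp (- 1 / x) else 0)"

text \<open>The arbitrary power \<open>j\<close> absorbs the factor \<open>y\<close> that splits off
  with each coefficient of \<open>p\<close>.\<close>

lemma poly_exp_decay: "((\<lambda>y. y ^ j * poly p y * exp (- y)) \<longlongrightarrow> (0::real)) at_top"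
proof (induction p arbitrary: j)
  case (pCons a p)
  have "((\<lambda>y. a * (y ^ j / exp y) + y ^ Suc j * poly p y * exp (- y)) \<longlongrightarrow> a * 0 + 0) at_top"
    by (intro tendsto_intros pCons.IH tendsto_power_div_exp_0)
  then show ?case
    by (simp add: algebra_simps exp_minus divide_inverse)
qed simp

text \<open>With y = 1/x one has dy/dx = - y^2, so p(y) exp(-y) has the derivative y^2 (p(y) -
  p'(y)) exp(-y). At 0 the right difference quotient is y p(y) exp(-y) with y tending to
  infinity.\<close>

lemma flat_DERIV: "(flat p has_real_derivative flat (monom 1 2 * (p - pderiv p)) x) (at x)"
proof -
  consider "x > 0" | "x < 0" | "x = 0" by linarith
  then show ?thesis
  proof cases
    case 1
    have "((\<lambda>x. poly p (1 / x) * exp (- 1 / x)) has_real_derivative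
        flat (monom 1 2 * (p - pderiv p)) x) (at x)"
      using 1 unfolding flat_def
      by (auto intro!: derivative_eq_intros DERIV_chain2[OF poly_DERIV]
          simp: field_simps power2_eq_square poly_monom)
    moreover have "eventually (\<lambda>y. flat p y = poly p (1 / y) * exp (- 1 / y)) (nhds x)"
      using eventually_nhds_in_open[of "{0<..}" x] 1
      by (auto elim!: eventually_mono simp: flat_def)
    ultimately show ?thesis
      by (rule DERIV_eventually_eq)
  next
    case 2
    have "((\<lambda>x. 0::real) has_real_derivative flat (monom 1 2 * (p - pderiv p)) x) (at x)"
      using 2 by (auto simp: flat_def)
    moreover have "eventually (\<lambda>y. flat p y = 0) (nhds x)"
      using eventually_nhds_in_open[of "{..<0}" x] 2
      by (auto elim!: eventually_mono simp: flat_def)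
    ultimately show ?thesis
      by (rule DERIV_eventually_eq)
  next
    case 3
    have "((\<lambda>h. flat p h / h) \<longlongrightarrow> 0) (at_right 0)"
    proof -
      have "((\<lambda>h. inverse h ^ 1 * poly p (inverse h) * exp (- inverse h)) \<longlongrightarrow> (0::real)) (at_right 0)"
        by (rule filterlim_compose[OF poly_exp_decay filterlim_inverse_at_top_right])
      moreover have "eventually (\<lambda>h. inverse h ^ 1 * poly p (inverse h) * exp (- inverse h) = flat p h / h) (at_right (0::real))"
        by (auto simp: eventually_at_filter flat_def divide_inverse)
      ultimately show ?thesis
        by (rule Lim_transform_eventually)
    qed
    moreover have "((\<lambda>h. flat p h / h) \<longlongrightarrow> 0) (at_left 0)"
    proof -
      have "eventually (\<lambda>h. 0 = flat p h / h) (at_left (0::real))"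
        by (auto simp: eventually_at_filter flat_def)
      with tendsto_const show ?thesis
        by (rule Lim_transform_eventually)
    qed
    ultimately have "((\<lambda>h. flat p h / h) \<longlongrightarrow> 0) (at 0)"
      by (simp add: filterlim_split_at)
    then show ?thesis
      using 3 by (simp add: DERIV_def flat_def)
  qed
qed

lemma smooth_flat: "smooth (flat p)"
proof (rule smooth_coinduct[where X = "\<lambda>h. \<exists>p. h = flat p"])
  fix g assume "\<exists>p. g = flat p"
  then obtain p where g: "g = flat p" by blast
  have "deriv g = flat (monom 1 2 * (p - pderiv p))"
    unfolding g using DERIV_imp_deriv[OF flat_DERIV] by auto
  then show "(\<forall>x. g differentiable (at x)) \<and> (\<exists>p. deriv g = flat p)"
    using flat_DERIV g real_differentiable_def by blast
qed blast

text \<open>Smooth functions that increase to the indicator function of \<open>(c,d)\<close>.\<close>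

definition bump :: "real \<Rightarrow> real \<Rightarrow> nat \<Rightarrow> real \<Rightarrow> real" where
  "bump c d n x = flat 1 (real (Suc n) * (x - c)) * flat 1 (real (Suc n) * (d - x))"

lemma smooth_bump: "smooth (bump c d n)"
proof -
  have "smooth (\<lambda>x. (1 * flat 1 (real (Suc n) * x + (- real (Suc n) * c))) *
      (1 * flat 1 ((- real (Suc n)) * x + (real (Suc n) * d))))"
    by (intro smooth_mult smooth_affine smooth_flat)
  then show ?thesis
    by (simp add: bump_def[abs_def] algebra_simps)
qed

lemma flat_1_bounds: "0 \<le> flat 1 x" "flat 1 x \<le> 1"
  by (auto simp: flat_def)

lemma bump_bounds: "0 \<le> bump c d n x" "bump c d n x \<le> 1"
  using flat_1_bounds by (auto simp: bump_def mult_le_one)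

lemma bump_eq_0: "x \<notin> {c<..<d} \<Longrightarrow> bump c d n x = 0"
  by (auto simp: bump_def flat_def zero_less_mult_iff)

lemma bump_pos: "x \<in> {c<..<d} \<Longrightarrow> 0 < bump c d n x"
  by (auto simp: bump_def flat_def)

lemma bump_tendsto: "(\<lambda>n. bump c d n x) \<longlonglongrightarrow> indicator {c<..<d} x"
proof (cases "x \<in> {c<..<d}")
  case True
  have *: "(\<lambda>n. flat 1 (real (Suc n) * r)) \<longlonglongrightarrow> 1" if "r > 0" for r
  proof -
    have "(\<lambda>n. exp (- (inverse r * (1 / real (Suc n))))) \<longlonglongrightarrow> exp (- (inverse r * 0))"
      by (intro tendsto_intros LIMSEQ_Suc lim_1_over_n)
    then show ?thesis
      using that by (simp add: flat_def divide_inverse mult_ac)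
  qed
  have "(\<lambda>n. bump c d n x) \<longlonglongrightarrow> 1 * 1"
    unfolding bump_def using True by (intro tendsto_mult *) auto
  then show ?thesis using True by simp
next
  case False
  then show ?thesis by (simp add: bump_eq_0 del: greaterThanLessThan_iff)
qed

lemma test_functionsI:
  assumes "smooth \<phi>" "\<And>x. x \<notin> {c..d} \<Longrightarrow> \<phi> x = 0" "a < c" "d < b"
  shows "\<phi> \<in> test_functions a b"
proof -
  have "{x. \<phi> x \<noteq> 0} \<subseteq> {c..d}"
  proof
    fix x assume "x \<in> {x. \<phi> x \<noteq> 0}"
    then show "x \<in> {c..d}" using assms(2)[of x] by (cases "x \<in> {c..d}") simp_all
  qed
  then have sub: "closure {x. \<phi> x \<noteq> 0} \<subseteq> {c..d}"
    by (simp add: closure_minimal)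
  moreover have "compact (closure {x. \<phi> x \<noteq> 0})"
    using bounded_subset[OF bounded_closed_interval sub] by (simp add: compact_eq_bounded_closed)
  moreover have "{c..d} \<subseteq> {a<..<b}" using assms(3,4) by auto
  ultimately show ?thesis
    using assms(1) unfolding test_functions_def smooth_def by blast
qed

lemma test_functionsD:
  assumes "\<phi> \<in> test_functions a b" "a < b"
  shows "smooth \<phi>" "\<exists>c d. a < c \<and> c \<le> d \<and> d < b \<and> (\<forall>x. x \<notin> {c..d} \<longrightarrow> \<phi> x = 0)"
proof -
  show "smooth \<phi>" using assms by (auto simp: test_functions_def smooth_def)
  define K where "K = closure {x. \<phi> x \<noteq> 0}"
  have K: "compact K" "K \<subseteq> {a<..<b}" "\<And>x. x \<notin> K \<Longrightarrow> \<phi> x = 0"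
    using assms closure_subset[of "{x. \<phi> x \<noteq> 0}"] by (auto simp: test_functions_def K_def)
  show "\<exists>c d. a < c \<and> c \<le> d \<and> d < b \<and> (\<forall>x. x \<notin> {c..d} \<longrightarrow> \<phi> x = 0)"
  proof (cases "K = {}")
    case True
    then show ?thesis using K(3) assms(2)
      by (intro exI[of _ "(a+b)/2"]) (auto simp: field_simps)
  next
    case False
    obtain c where c: "c \<in> K" "\<forall>x\<in>K. c \<le> x" using compact_attains_inf[OF K(1) False] by blast
    obtain d where d: "d \<in> K" "\<forall>x\<in>K. x \<le> d" using compact_attains_sup[OF K(1) False] by blast
    show ?thesis
      using c d K(2,3) by (intro exI[of _ c] exI[of _ d]) auto
  qed
qed

lemma bump_test_function: "a < c \<Longrightarrow> d < b \<Longrightarrow> bump c d n \<in> test_functions a b"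
  by (rule test_functionsI[where c = c and d = d]) (auto simp: smooth_bump bump_eq_0)

text \<open>The primitive vanishes to the left of \<open>c\<close> by construction and to the right
  of \<open>d\<close> because the mean of \<open>\<theta>\<close> is zero. This is the ingredient
  for the du Bois-Reymond lemma.\<close>

lemma test_function_primitive:
  assumes \<theta>: "smooth \<theta>" "\<And>x. x \<notin> {c..d} \<Longrightarrow> \<theta> x = 0" and cd: "a < c" "c \<le> d" "d < b"
    and zero: "integral {c..d} \<theta> = 0"
  obtains \<phi> where "\<phi> \<in> test_functions a b" "deriv \<phi> = \<theta>"
proof -
  define \<phi> where "\<phi> = (\<lambda>x. integral {a..x} \<theta>)"
  have cont: "continuous_on S \<theta>" for S using \<theta>(1) by (rule smooth_continuous)
  have left: "\<phi> x = 0" if "x < c" for x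
  proof -
    have "integral {a..x} \<theta> = integral {a..x} (\<lambda>_. 0)"
      using that \<theta>(2) by (intro integral_cong) auto
    then show ?thesis by (simp add: \<phi>_def)
  qed
  have right: "\<phi> x = 0" if "x > d" for x
  proof -
    have "integral {a..c} \<theta> = 0" 
    proof -
      have "integral {a..c} \<theta> = integral {a..c} (\<lambda>_. 0)"
        by (rule integral_spike[of "{c}"]) (use \<theta>(2) in auto)
      then show ?thesis by simp
    qed
    moreover have "integral {d..x} \<theta> = 0" 
    proof -
      have "integral {d..x} \<theta> = integral {d..x} (\<lambda>_. 0)"
        by (rule integral_spike[of "{d}"]) (use \<theta>(2) in auto)
      then show ?thesis by simp
    qed
    moreover have "integral {a..c} \<theta> + integral {c..x} \<theta> = integral {a..x} \<theta>"
      using cd that by (intro Henstock_Kurzweil_Integration.integral_combine integrable_continuous_real cont) auto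
    moreover have "integral {c..d} \<theta> + integral {d..x} \<theta> = integral {c..x} \<theta>"
      using cd that by (intro Henstock_Kurzweil_Integration.integral_combine integrable_continuous_real cont) auto
    ultimately show ?thesis using zero by (simp add: \<phi>_def)
  qed
  have D: "(\<phi> has_real_derivative \<theta> x) (at x)" for x
  proof (cases "x < c")
    case True
    have "((\<lambda>x. 0::real) has_real_derivative \<theta> x) (at x)"
      using True \<theta>(2)[of x] by simp
    moreover have "eventually (\<lambda>y. \<phi> y = 0) (nhds x)"
      using eventually_nhds_in_open[of "{..<c}" x] True by (auto elim!: eventually_mono simp: left)
    ultimately show ?thesis by (rule DERIV_eventually_eq)
  next
    case False
    \<comment> \<open>Since a < c and c \<le> x, the interval is a neighbourhood of
      \<open>x\<close>, and the derivative within it is the full one.\<close>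
    have "((\<lambda>u. integral {a..u} \<theta>) has_real_derivative \<theta> x) (at x within {a..x+1})"
      using False cd by (intro integral_has_real_derivative cont) auto
    then show ?thesis
      using False cd at_within_Icc_at[of a x "x+1"] by (simp add: \<phi>_def)
  qed
  have der: "deriv \<phi> = \<theta>" using DERIV_imp_deriv[OF D] by auto
  have "smooth \<phi>"
    by (rule smooth_coinduct[where X = "\<lambda>h. h = \<phi> \<or> smooth h"])
      (use der \<theta>(1) D real_differentiable_def smooth_deriv smooth_differentiable in auto)
  then have "\<phi> \<in> test_functions a b"
    using left right cd by (intro test_functionsI[of _ c d]) force+
  with der that show ?thesis by blast
qed

section \<open>Integration and absolutely continuous functions\<close>

lemma AE_lborel_negligible:
  assumes "AE x in lborel. P x"
  obtains N where "negligible N" "\<And>x::real. x \<notin> N \<Longrightarrow> P x"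
proof -
  have "AE x in lebesgue. P x"
    using assms by (simp add: AE_completion_iff)
  then obtain N where N: "negligible N" "{x. \<not> P x} \<subseteq> N"
    using eventually_ae_filter_negligible by (metis (no_types, lifting) Collect_cong)
  show thesis
    by (rule that[OF N(1)]) (use N(2) in blast)
qed

text \<open>Links the open intervals of the definitions to the closed intervals with negligible
  exceptional sets on which gauge integrals are handled; the end points move into the exceptional
  set.\<close>

lemma AE_Ioo_iff:
  "(AE x in lebesgue_on {a<..<b}. P x) \<longleftrightarrow> (\<exists>N. negligible N \<and> (\<forall>x::real. x \<in> {a..b} \<longrightarrow> x \<notin> N \<longrightarrow> P x))"
proof -
  have "(AE x in lebesgue_on {a<..<b}. P x) \<longleftrightarrow> (AE x in lebesgue. x \<in> {a<..<b} \<longrightarrow> P x)"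
    by (subst AE_restrict_space_iff) auto
  also have "\<dots> \<longleftrightarrow> (\<exists>N. negligible N \<and> {x. \<not> (x \<in> {a<..<b} \<longrightarrow> P x)} \<subseteq> N)"
    using eventually_ae_filter_negligible[of "\<lambda>x. x \<in> {a<..<b} \<longrightarrow> P x"] by simp
  also have "\<dots> \<longleftrightarrow> (\<exists>N. negligible N \<and> (\<forall>x::real. x \<in> {a..b} \<longrightarrow> x \<notin> N \<longrightarrow> P x))"
  proof
    assume "\<exists>N. negligible N \<and> {x. \<not> (x \<in> {a<..<b} \<longrightarrow> P x)} \<subseteq> N"
    then obtain N where N: "negligible N" "{x. \<not> (x \<in> {a<..<b} \<longrightarrow> P x)} \<subseteq> N" by blast
    have "negligible (N \<union> {a, b})" using N(1) by (simp add: negligible_Un)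
    moreover have "\<forall>x. x \<in> {a..b} \<longrightarrow> x \<notin> N \<union> {a, b} \<longrightarrow> P x"
      using N(2) by (auto simp: subset_iff less_le)
    ultimately show "\<exists>N. negligible N \<and> (\<forall>x::real. x \<in> {a..b} \<longrightarrow> x \<notin> N \<longrightarrow> P x)" by blast
  next
    assume "\<exists>N. negligible N \<and> (\<forall>x::real. x \<in> {a..b} \<longrightarrow> x \<notin> N \<longrightarrow> P x)"
    then obtain N where "negligible N" "\<forall>x::real. x \<in> {a..b} \<longrightarrow> x \<notin> N \<longrightarrow> P x" by blast
    then show "\<exists>N. negligible N \<and> {x. \<not> (x \<in> {a<..<b} \<longrightarrow> P x)} \<subseteq> N"
      by (intro exI[of _ N] conjI subsetI) (simp_all, metis less_imp_le)
  qed
  finally show ?thesis .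
qed

lemma AE_IooI: "negligible N \<Longrightarrow> (\<And>x::real. x \<in> {a..b} \<Longrightarrow> x \<notin> N \<Longrightarrow> P x) \<Longrightarrow> AE x in lebesgue_on {a<..<b}. P x"
  unfolding AE_Ioo_iff by blast

lemma AE_IooE:
  assumes "AE x in lebesgue_on {a<..<b}. P x"
  obtains N where "negligible N" "\<And>x::real. x \<in> {a..b} \<Longrightarrow> x \<notin> N \<Longrightarrow> P x"
  using assms unfolding AE_Ioo_iff by blast

lemma integral_AE_cong:
  fixes f g :: "real \<Rightarrow> real"
  assumes "AE x in lebesgue_on {a<..<b}. f x = g x"
  shows "integral {a..b} f = integral {a..b} g"
    and "f absolutely_integrable_on {a..b} \<longleftrightarrow> g absolutely_integrable_on {a..b}"
proof -
  obtain N where N: "negligible N" "\<And>x. x \<in> {a..b} \<Longrightarrow> x \<notin> N \<Longrightarrow> f x = g x"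
    by (rule AE_IooE[OF assms]) blast
  show "integral {a..b} f = integral {a..b} g"
    by (rule integral_spike[OF N(1)]) (use N(2) in auto)
  show "f absolutely_integrable_on {a..b} \<longleftrightarrow> g absolutely_integrable_on {a..b}"
    by (rule absolutely_integrable_spike_eq[OF N(1)]) (use N(2) in auto)
qed

text \<open>Most integrals below are gauge integrals over closed intervals; here the Lebesgue
  integrals of the definitions are converted.\<close>

lemma LINT_Ioo:
  fixes f :: "real \<Rightarrow> real"
  assumes "f absolutely_integrable_on {a..b}"
  shows "(LINT x|lebesgue_on {a<..<b}. f x) = integral {a..b} f"
    and "integrable (lebesgue_on {a<..<b}) f"
proof -
  have "f absolutely_integrable_on {a<..<b}"
    using assms absolutely_integrable_on_Icc_iff_Ioo by blast
  then show *: "integrable (lebesgue_on {a<..<b}) f"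
    by (intro absolutely_integrable_imp_integrable) auto
  show "(LINT x|lebesgue_on {a<..<b}. f x) = integral {a..b} f"
    using lebesgue_integral_eq_integral[OF *] integral_open_interval_real[of a b f] by simp
qed

lemma abs_int_Ioo: "integrable (lebesgue_on {a<..<b}) f \<Longrightarrow> f absolutely_integrable_on {a..b}"
  for f :: "real \<Rightarrow> real"
  unfolding absolutely_integrable_on_Icc_iff_Ioo by (simp add: integrable_restrict_space set_integrable_def)

lemma integral_support:
  fixes g :: "real \<Rightarrow> real"
  assumes "\<And>x. x \<notin> {p..q} \<Longrightarrow> g x = 0" "{p..q} \<subseteq> {r..s}"
  shows "integral {r..s} g = integral {p..q} g"
    and "g absolutely_integrable_on {r..s} \<longleftrightarrow> g absolutely_integrable_on {p..q}"
proof -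
  have *: "(\<lambda>x. if x \<in> {p..q} then g x else 0) = g" "(\<lambda>x. if x \<in> {r..s} then g x else 0) = g"
    using assms by fastforce+
  show "integral {r..s} g = integral {p..q} g"
    using integral_restrict_UNIV[of "{p..q}" g] integral_restrict_UNIV[of "{r..s}" g] * by simp
  show "g absolutely_integrable_on {r..s} \<longleftrightarrow> g absolutely_integrable_on {p..q}"
    using absolutely_integrable_restrict_UNIV[of "{p..q}" g] absolutely_integrable_restrict_UNIV[of "{r..s}" g]
    unfolding * by blast
qed

lemma LINT_support:
  fixes g :: "real \<Rightarrow> real"
  assumes "\<And>x. x \<notin> {p..q} \<Longrightarrow> g x = 0" "{p..q} \<subseteq> {a<..<b}" "g absolutely_integrable_on {p..q}"
  shows "(LINT x|lebesgue_on {a<..<b}. g x) = integral {p..q} g"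
    and "integrable (lebesgue_on {a<..<b}) g"
proof -
  have "{p..q} \<subseteq> {a..b}" using assms(2) by auto
  note * = integral_support[OF assms(1) this]
  show "(LINT x|lebesgue_on {a<..<b}. g x) = integral {p..q} g"
    "integrable (lebesgue_on {a<..<b}) g"
    using LINT_Ioo[of a b g] * assms(3) by simp_all
qed

text \<open>Fubini's theorem is applied to functions that are Borel measurable on the product,
  whereas elements of L2 are only Lebesgue measurable. A change on a null set bridges the
  gap.\<close>

lemma borel_representative:
  fixes f :: "real \<Rightarrow> real"
  assumes "f absolutely_integrable_on {a..b}"
  obtains g N where "g \<in> borel_measurable borel" "integrable lborel g"
    "\<And>x. x \<notin> {a..b} \<Longrightarrow> g x = 0" "negligible N" "\<And>x. x \<in> {a..b} \<Longrightarrow> x \<notin> N \<Longrightarrow> f x = g x"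
proof -
  define f0 where "f0 = (\<lambda>x. indicator {a..b} x * f x)"
  have i: "integrable lebesgue f0"
    using assms by (simp add: set_integrable_def f0_def)
  obtain g' where g': "g' \<in> borel_measurable lborel" "AE x in lborel. f0 x = g' x"
    using completion_ex_borel_measurable_real[OF borel_measurable_integrable[OF i]] by blast
  define g where "g = (\<lambda>x. indicator {a..b} x * g' x)"
  have gm: "g \<in> borel_measurable borel"
    using g'(1) unfolding g_def by simp
  have ae: "AE x in lborel. f0 x = g x"
    using g'(2)
  proof eventually_elim
    case (elim x)
    then show ?case by (cases "x \<in> {a..b}") (simp_all add: g_def f0_def)
  qed
  obtain N where N: "negligible N" "\<And>x. x \<notin> N \<Longrightarrow> f0 x = g x"
    using AE_lborel_negligible[OF ae] by blast
  have "integrable lebesgue g"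
    by (rule integrable_cong_AE_imp[OF i]) (use gm ae in \<open>auto simp: AE_completion_iff measurable_completion\<close>)
  then have "integrable lborel g"
    using gm by (simp add: integrable_completion)
  then show thesis
    using gm N(1)
  proof (intro that[of g N])
    show "g x = 0" if "x \<notin> {a..b}" for x using that by (simp add: g_def indicator_def)
    show "f x = g x" if "x \<in> {a..b}" "x \<notin> N" for x using N(2)[OF that(2)] that(1) by (simp add: f0_def)
  qed
qed

section \<open>Fubini's theorem on rectangles\<close>

lemma abs_int_borel:
  fixes f :: "real \<Rightarrow> real"
  assumes "f \<in> borel_measurable borel"
  shows "f absolutely_integrable_on {a..b} \<longleftrightarrow> integrable lborel (\<lambda>x. indicator {a..b} x * f x)"
  using assms unfolding set_integrable_def by (simp add: integrable_completion)

lemma integral_borel: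
  fixes f :: "real \<Rightarrow> real"
  assumes "integrable lborel (\<lambda>x. indicator {a..b} x * f x)"
  shows "integral {a..b} f = (\<integral>x. indicator {a..b} x * f x \<partial>lborel)"
  using set_borel_integral_eq_integral(2)[of "{a..b}" f] assms
  by (simp add: set_integrable_def set_lebesgue_integral_def)

text \<open>The majorant \<open>m\<close> of the inner absolute integrals gives integrability on the
  product by Tonelli, from which all conclusions follow. Integrability of almost all sections in the
  other variable serves Jensen's inequality for difference quotients.\<close>

lemma fubini_Icc:
  fixes f :: "real \<Rightarrow> real \<Rightarrow> real"
  assumes meas: "(\<lambda>z. f (fst z) (snd z)) \<in> borel_measurable (borel \<Otimes>\<^sub>M borel)"
    and int: "\<And>s. s \<in> {a..b} \<Longrightarrow> f s absolutely_integrable_on {c..d}"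
    and bd: "\<And>s. s \<in> {a..b} \<Longrightarrow> integral {c..d} (\<lambda>x. \<bar>f s x\<bar>) \<le> m s"
    and m: "m integrable_on {a..b}"
  shows "integral {a..b} (\<lambda>s. integral {c..d} (f s)) = integral {c..d} (\<lambda>x. integral {a..b} (\<lambda>s. f s x))"
    and "(\<lambda>x. integral {a..b} (\<lambda>s. f s x)) absolutely_integrable_on {c..d}"
    and "(\<lambda>s. integral {c..d} (f s)) absolutely_integrable_on {a..b}"
    and "AE x in lebesgue_on {c<..<d}. (\<lambda>s. f s x) absolutely_integrable_on {a..b}"
proof -
  define h where "h = (\<lambda>s x. indicator {a..b} s * (indicator {c..d} x * f s x))"
  have hm: "case_prod h \<in> borel_measurable (lborel \<Otimes>\<^sub>M lborel)"
  proof -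
    have "case_prod h \<in> borel_measurable (borel \<Otimes>\<^sub>M borel)"
      unfolding h_def split_beta' using meas by measurable
    then show ?thesis
      by (simp cong: measurable_cong_sets sets_pair_measure_cong)
  qed
  have fm[measurable]: "f s \<in> borel_measurable borel" for s
    using measurable_compose[OF measurable_Pair1' meas, of s] by simp
  have hs: "integrable lborel (h s)" for s
  proof (cases "s \<in> {a..b}")
    case True
    then show ?thesis
      using int[OF True] by (simp add: abs_int_borel h_def)
  qed (simp add: h_def)
  have in1: "(\<integral>x. h s x \<partial>lborel) = indicator {a..b} s * integral {c..d} (f s)" for s
    using int[of s] by (cases "s \<in> {a..b}") (auto simp: h_def abs_int_borel integral_borel)
  have in2: "(\<integral>x. norm (h s x) \<partial>lborel) = indicator {a..b} s * integral {c..d} (\<lambda>x. \<bar>f s x\<bar>)" for s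
  proof (cases "s \<in> {a..b}")
    case True
    have "(\<lambda>x. \<bar>f s x\<bar>) absolutely_integrable_on {c..d}"
      using absolutely_integrable_norm[OF int[OF True]] by (simp add: o_def)
    then have "integral {c..d} (\<lambda>x. \<bar>f s x\<bar>) = (\<integral>x. indicator {c..d} x * \<bar>f s x\<bar> \<partial>lborel)"
      by (intro integral_borel) (simp add: abs_int_borel)
    then show ?thesis using True by (simp add: h_def abs_mult)
  qed (simp add: h_def)
  have hp: "integrable (lborel \<Otimes>\<^sub>M lborel) (case_prod h)"
  proof (rule lborel_pair.Fubini_integrable[OF hm])
    show "AE x in lborel. integrable lborel (\<lambda>y. case_prod h (x, y))"
      using hs by simp
    have m0: "0 \<le> m s" if "s \<in> {a..b}" for s
    proof -
      have "0 \<le> integral {c..d} (\<lambda>x. \<bar>f s x\<bar>)"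
        by (rule Henstock_Kurzweil_Integration.integral_nonneg)
          (use int[OF that] in \<open>auto simp: absolutely_integrable_on_def\<close>)
      then show ?thesis using bd[OF that] by simp
    qed
    \<comment> \<open>\<open>m\<close> is only gauge integrable; being nonnegative it is Lebesgue
      integrable as well.\<close>
    have mi: "integrable lebesgue (\<lambda>s. indicator {a..b} s * m s)"
      using nonnegative_absolutely_integrable_1[OF m m0] by (simp add: set_integrable_def)
    have bm: "(\<lambda>x. \<integral>y. norm (case_prod h (x, y)) \<partial>lborel) \<in> borel_measurable lborel"
      using hm by measurable
    have "integrable lebesgue (\<lambda>x. \<integral>y. norm (case_prod h (x, y)) \<partial>lborel)"
    proof (rule Bochner_Integration.integrable_bound[OF mi])
      show "(\<lambda>x. \<integral>y. norm (case_prod h (x, y)) \<partial>lborel) \<in> borel_measurable lebesgue"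
        using bm by (rule measurable_completion)
      show "AE x in lebesgue. norm (\<integral>y. norm (case_prod h (x, y)) \<partial>lborel) \<le> norm (indicator {a..b} x * m x)"
      proof (rule AE_I2)
        fix x
        have "0 \<le> (\<integral>y. norm (h x y) \<partial>lborel)" by simp
        then show "norm (\<integral>y. norm (case_prod h (x, y)) \<partial>lborel) \<le> norm (indicator {a..b} x * m x)"
          using bd[of x] m0[of x] unfolding case_prod_conv in2
          by (cases "x \<in> {a..b}") auto
      qed
    qed
    then show "integrable lborel (\<lambda>x. \<integral>y. norm (case_prod h (x, y)) \<partial>lborel)"
      using bm by (simp add: integrable_completion)
  qed
  have fub: "(\<integral>y. (\<integral>x. h x y \<partial>lborel) \<partial>lborel) = (\<integral>x. (\<integral>y. h x y \<partial>lborel) \<partial>lborel)"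
    by (rule lborel_pair.Fubini_integral[OF hp])
  have if1: "integrable lborel (\<lambda>s. \<integral>x. h s x \<partial>lborel)"
    using lborel_pair.integrable_fst[OF hp] by simp
  then have if1': "integrable lborel (\<lambda>s. indicator {a..b} s * integral {c..d} (f s))"
    by (simp add: in1)
  have lhs: "(\<integral>x. (\<integral>y. h x y \<partial>lborel) \<partial>lborel) = integral {a..b} (\<lambda>s. integral {c..d} (f s))"
    unfolding in1 using integral_borel[OF if1'] by simp
  have "set_integrable lborel {a..b} (\<lambda>s. integral {c..d} (f s))"
    using if1' by (simp add: set_integrable_def)
  then show "(\<lambda>s. integral {c..d} (f s)) absolutely_integrable_on {a..b}"
    unfolding set_integrable_def by (simp add: integrable_completion borel_measurable_integrable)
  define K where "K = (\<lambda>x. \<integral>s. h s x \<partial>lborel)"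
  have Ki: "integrable lborel K"
    unfolding K_def using lborel_pair.integrable_snd[OF hp] by simp
  have K0: "K x = indicator {c..d} x * K x" for x
    by (cases "x \<in> {c..d}") (auto simp: K_def h_def)
  have "AE x in lborel. integrable lborel (\<lambda>s. h s x)"
    using lborel_pair.AE_integrable_snd[OF hp] by simp
  then have AEi: "AE x in lborel. x \<in> {c..d} \<longrightarrow> integrable lborel (\<lambda>s. indicator {a..b} s * f s x)"
    by eventually_elim (auto simp: h_def)
  obtain N' where N': "negligible N'" "\<And>x. x \<notin> N' \<Longrightarrow> x \<in> {c..d} \<longrightarrow> integrable lborel (\<lambda>s. indicator {a..b} s * f s x)"
    using AE_lborel_negligible[OF AEi] by blast
  have fm': "(\<lambda>s. f s x) \<in> borel_measurable borel" for x
    using measurable_compose[OF measurable_Pair2' meas, of x] by simp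
  show "AE x in lebesgue_on {c<..<d}. (\<lambda>s. f s x) absolutely_integrable_on {a..b}"
    by (rule AE_IooI[OF N'(1)]) (use N'(2) in \<open>simp add: abs_int_borel fm'\<close>)
  from AEi have "AE x in lborel. x \<in> {c..d} \<longrightarrow> K x = integral {a..b} (\<lambda>s. f s x)"
  proof eventually_elim
    case (elim x)
    show ?case
    proof
      assume "x \<in> {c..d}"
      then have "integrable lborel (\<lambda>s. indicator {a..b} s * f s x)" "K x = (\<integral>s. indicator {a..b} s * f s x \<partial>lborel)"
        using elim by (auto simp: h_def K_def)
      then show "K x = integral {a..b} (\<lambda>s. f s x)" by (simp add: integral_borel)
    qed
  qed
  then obtain N where N: "negligible N" "\<And>x. x \<notin> N \<Longrightarrow> x \<in> {c..d} \<longrightarrow> K x = integral {a..b} (\<lambda>s. f s x)"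
    using AE_lborel_negligible by blast
  have Ki': "integrable lborel (\<lambda>x. indicator {c..d} x * K x)"
    using Ki by (subst (asm) K0[abs_def]) 
  have "integral {c..d} K = (\<integral>x. K x \<partial>lborel)"
    using integral_borel[OF Ki'] K0[symmetric] by simp
  moreover have "integral {c..d} K = integral {c..d} (\<lambda>x. integral {a..b} (\<lambda>s. f s x))"
    by (rule integral_spike[OF N(1)]) (use N(2) in auto)
  ultimately show "integral {a..b} (\<lambda>s. integral {c..d} (f s)) = integral {c..d} (\<lambda>x. integral {a..b} (\<lambda>s. f s x))"
    using lhs fub by (simp add: K_def)
  have "K absolutely_integrable_on {c..d}"
    using Ki' borel_measurable_integrable[OF Ki] by (subst abs_int_borel) auto
  then show "(\<lambda>x. integral {a..b} (\<lambda>s. f s x)) absolutely_integrable_on {c..d}"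
    by (rule absolutely_integrable_spike[OF _ N(1)]) (use N(2) in auto)
qed

text \<open>Absolute continuity in integrated form. The density is an explicit argument, determined
  up to null sets, so the calculus rules can be proved without differentiability almost
  everywhere.\<close>

definition AC :: "real \<Rightarrow> real \<Rightarrow> (real \<Rightarrow> real) \<Rightarrow> (real \<Rightarrow> real) \<Rightarrow> bool" where
  "AC a b F f \<longleftrightarrow> f absolutely_integrable_on {a..b} \<and> (\<forall>x\<in>{a..b}. F x = F a + integral {a..x} f)"

lemma ACD:
  assumes "AC a b F f"
  shows "f absolutely_integrable_on {a..b}" "f integrable_on {a..b}" "x \<in> {a..b} \<Longrightarrow> F x = F a + integral {a..x} f"
  using assms set_lebesgue_integral_eq_integral(1) unfolding AC_def by blast+

lemma AC_continuous: "AC a b F f \<Longrightarrow> continuous_on {a..b} F"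
proof -
  assume *: "AC a b F f"
  have "continuous_on {a..b} (\<lambda>x. F a + integral {a..x} f)"
    by (intro continuous_intros indefinite_integral_continuous_1 ACD(2)[OF *])
  then show "continuous_on {a..b} F"
    by (rule continuous_on_eq) (rule ACD(3)[OF *, symmetric])
qed

lemma AC_integral: "f absolutely_integrable_on {a..b} \<Longrightarrow> AC a b (\<lambda>x. c + integral {a..x} f) f"
  by (auto simp: AC_def)

lemma AC_subinterval:
  assumes "AC a b F f" "c \<in> {a..b}" "d \<in> {a..b}"
  shows "AC c d F f"
proof -
  have i: "f integrable_on {a..b}" using ACD[OF assms(1)] by blast
  have "F x = F c + integral {c..x} f" if "x \<in> {c..d}" for x
  proof -
    have "f integrable_on {a..x}"
      by (rule integrable_on_subinterval[OF i]) (use that assms in auto)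
    then have "integral {a..c} f + integral {c..x} f = integral {a..x} f"
      using that assms by (intro Henstock_Kurzweil_Integration.integral_combine) auto
    moreover have "F x = F a + integral {a..x} f" "F c = F a + integral {a..c} f"
      using that assms by (auto intro!: ACD(3)[OF assms(1)])
    ultimately show ?thesis by linarith
  qed
  moreover have "f absolutely_integrable_on {c..d}"
    by (rule absolutely_integrable_on_subinterval[OF ACD(1)[OF assms(1)]]) (use assms in auto)
  ultimately show ?thesis unfolding AC_def by blast
qed

lemma AC_diff:
  assumes "AC a b F f" "a \<le> c" "c \<le> d" "d \<le> b"
  shows "F d - F c = integral {c..d} f"
proof -
  have "AC c d F f" by (rule AC_subinterval[OF assms(1)]) (use assms in auto)
  from ACD(3)[OF this, of d] show ?thesis using assms by simp
qed

lemma AC_add: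
  assumes "AC a b F f" "AC a b G g"
  shows "AC a b (\<lambda>x. F x + G x) (\<lambda>x. f x + g x)"
proof -
  have "F x + G x = F a + G a + integral {a..x} (\<lambda>x. f x + g x)" if "x \<in> {a..b}" for x
  proof -
    have "f integrable_on {a..x}" "g integrable_on {a..x}"
      using ACD(2)[OF assms(1)] ACD(2)[OF assms(2)] that by (auto intro: integrable_on_subinterval)
    then show ?thesis
      using ACD(3)[OF assms(1) that] ACD(3)[OF assms(2) that]
        Henstock_Kurzweil_Integration.integral_add[of f "{a..x}" g] by linarith
  qed
  then show ?thesis
    using set_integral_add(1)[OF ACD(1)[OF assms(1)] ACD(1)[OF assms(2)]] unfolding AC_def by blast
qed

lemma AC_cmult:
  assumes "AC a b F f"
  shows "AC a b (\<lambda>x. c * F x) (\<lambda>x. c * f x)"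
proof -
  have "c * F x = c * F a + integral {a..x} (\<lambda>x. c * f x)" if "x \<in> {a..b}" for x
    unfolding ACD(3)[OF assms that] by (simp add: distrib_left)
  then show ?thesis
    using set_integrable_mult_right[of c lebesgue "{a..b}" f] ACD(1)[OF assms] unfolding AC_def by blast
qed

lemma AC_minus: "AC a b F f \<Longrightarrow> AC a b G g \<Longrightarrow> AC a b (\<lambda>x. F x - G x) (\<lambda>x. f x - g x)"
  using AC_add[of a b F f "\<lambda>x. -1 * G x" "\<lambda>x. -1 * g x"] AC_cmult[of a b G g "-1"] by simp

lemma AC_const: "AC a b (\<lambda>x. c) (\<lambda>x. 0)"
  by (auto simp: AC_def)

lemma AC_cong:
  assumes "AC a b F f" "\<And>x. x \<in> {a..b} \<Longrightarrow> F x = G x" "AE x in lebesgue_on {a<..<b}. f x = g x"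
  shows "AC a b G g"
proof (cases "a \<le> b")
  case True
  obtain N where N: "negligible N" "\<And>x. x \<in> {a..b} \<Longrightarrow> x \<notin> N \<Longrightarrow> f x = g x"
    by (rule AE_IooE[OF assms(3)]) blast
  have "integral {a..x} f = integral {a..x} g" if "x \<in> {a..b}" for x
    by (rule integral_spike[OF N(1)]) (use N(2) that in auto)
  moreover have "F a = G a" using True by (intro assms(2)) auto
  ultimately have "G x = G a + integral {a..x} g" if "x \<in> {a..b}" for x
    using ACD(3)[OF assms(1) that] assms(2)[OF that] that by simp
  then show ?thesis
    using ACD(1)[OF assms(1)] integral_AE_cong(2)[OF assms(3)] unfolding AC_def by blast
next
  case False
  then have "{a..b} = {}" by simp
  then show ?thesis unfolding AC_def by simp
qed

lemma AC_DERIV: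
  assumes "\<And>x. x \<in> {a..b} \<Longrightarrow> (F has_real_derivative f x) (at x within {a..b})" "continuous_on {a..b} f"
  shows "AC a b F f"
proof -
  have "F x = F a + integral {a..x} f" if "x \<in> {a..b}" for x
  proof -
    have "(f has_integral (F x - F a)) {a..x}"
      by (rule fundamental_theorem_of_calculus)
        (use that in \<open>auto intro!: has_vector_derivative_within_subset[of F _ _ "{a..b}"]
            assms(1)[THEN iffD1[OF has_real_derivative_iff_has_vector_derivative]]\<close>)
    from integral_unique[OF this] show ?thesis by linarith
  qed
  then show ?thesis
    using absolutely_integrable_continuous_real[OF assms(2)] unfolding AC_def by blast
qed

lemma abs_int_mult_continuous:
  fixes f G :: "real \<Rightarrow> real"
  assumes "f absolutely_integrable_on {a..b}" "continuous_on {a..b} G"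
  shows "(\<lambda>x. f x * G x) absolutely_integrable_on {a..b}" "(\<lambda>x. G x * f x) absolutely_integrable_on {a..b}"
proof -
  show "(\<lambda>x. G x * f x) absolutely_integrable_on {a..b}"
    by (intro absolutely_integrable_bounded_measurable_product_real assms
        continuous_imp_measurable_on_sets_lebesgue compact_imp_bounded compact_continuous_image) auto
  then show "(\<lambda>x. f x * G x) absolutely_integrable_on {a..b}"
    by (simp add: mult.commute)
qed

text \<open>Both sides are the integral of f(y) g(x) over the triangle y \<le> x, taken in the two
  orders.\<close>

lemma integral_parts_borel:
  fixes f g :: "real \<Rightarrow> real"
  assumes [measurable]: "f \<in> borel_measurable borel" "g \<in> borel_measurable borel"
    and f: "f absolutely_integrable_on {a..b}" and g: "g absolutely_integrable_on {a..b}"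
  shows "integral {a..b} (\<lambda>x. integral {a..x} f * g x) = integral {a..b} (\<lambda>y. f y * integral {y..b} g)"
proof -
  define h where "h = (\<lambda>s x. g s * (indicator {..s} x * f x))"
  have e1: "integral {a..b} (\<lambda>x. indicator {..s} x * k x) = integral {a..s} k" if "s \<in> {a..b}" for s and k :: "real \<Rightarrow> real"
  proof -
    have "integral {a..b} (\<lambda>x. indicator {..s} x * k x) = integral {a..b} (\<lambda>x. if x \<in> {..s} then k x else 0)"
      by (intro integral_cong) (auto simp: indicator_def)
    also have "\<dots> = integral ({..s} \<inter> {a..b}) k" 
      by (rule integral_restrict_Int)
    also have "{..s} \<inter> {a..b} = {a..s}" using that by auto
    finally show ?thesis .
  qed
  have e2: "integral {a..b} (\<lambda>s. g s * (indicator {..s} x * f x)) = f x * integral {x..b} g" if "x \<in> {a..b}" for x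
  proof -
    have "integral {a..b} (\<lambda>s. g s * (indicator {..s} x * f x)) = integral {a..b} (\<lambda>s. if s \<in> {x..} then g s * f x else 0)"
      by (intro integral_cong) (auto simp: indicator_def)
    also have "\<dots> = integral ({x..} \<inter> {a..b}) (\<lambda>s. g s * f x)" 
      by (rule integral_restrict_Int)
    also have "{x..} \<inter> {a..b} = {x..b}" using that by auto
    finally show ?thesis by simp
  qed
  have fi: "(\<lambda>x. indicator {..s} x * f x) absolutely_integrable_on {a..b}" for s
  proof -
    have "integrable lborel (\<lambda>x. indicator {..s} x *\<^sub>R (indicator {a..b} x * f x))"
      using f by (intro integrable_mult_indicator) (auto simp: abs_int_borel)
    then show ?thesis by (subst abs_int_borel) (auto simp: mult_ac)
  qed
  have eq: "integral {a..b} (\<lambda>s. integral {a..b} (h s)) = integral {a..b} (\<lambda>x. integral {a..b} (\<lambda>s. h s x))"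
  proof (rule fubini_Icc)
    show "(\<lambda>z. h (fst z) (snd z)) \<in> borel_measurable (borel \<Otimes>\<^sub>M borel)"
    proof -
      have "(\<lambda>z. h (fst z) (snd z)) = (\<lambda>z. g (fst z) * (if snd z \<le> fst z then f (snd z) else 0))"
        by (auto simp: h_def indicator_def fun_eq_iff)
      then show ?thesis by simp
    qed
    show "h s absolutely_integrable_on {a..b}" for s
      unfolding h_def using fi by simp
    show "integral {a..b} (\<lambda>x. \<bar>h s x\<bar>) \<le> \<bar>g s\<bar> * integral {a..b} (\<lambda>x. \<bar>f x\<bar>)" for s
    proof -
      have "integral {a..b} (\<lambda>x. \<bar>h s x\<bar>) = \<bar>g s\<bar> * integral {a..b} (\<lambda>x. \<bar>indicator {..s} x * f x\<bar>)"
        by (simp add: h_def abs_mult)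
      also have "\<dots> \<le> \<bar>g s\<bar> * integral {a..b} (\<lambda>x. \<bar>f x\<bar>)"
        using fi f by (intro mult_left_mono integral_le)
          (auto simp: absolutely_integrable_on_def indicator_def abs_mult)
      finally show ?thesis .
    qed
    show "(\<lambda>s. \<bar>g s\<bar> * integral {a..b} (\<lambda>x. \<bar>f x\<bar>)) integrable_on {a..b}"
      using g by (auto simp: absolutely_integrable_on_def intro: integrable_on_mult_left)
  qed
  have "integral {a..b} (\<lambda>s. integral {a..b} (h s)) = integral {a..b} (\<lambda>x. integral {a..x} f * g x)"
    by (intro integral_cong) (simp add: h_def e1)
  moreover have "integral {a..b} (\<lambda>x. integral {a..b} (\<lambda>s. h s x)) = integral {a..b} (\<lambda>y. f y * integral {y..b} g)"
    by (intro integral_cong) (simp add: h_def e2)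
  ultimately show ?thesis using eq by simp
qed

text \<open>\<open>F\<close> is expanded from the left end point and \<open>G\<close> from the right
  one. The two double integrals that arise are those of \<open>integral_parts_borel\<close> and
  cancel, leaving the boundary terms.\<close>

lemma AC_mult_borel:
  assumes [measurable]: "f \<in> borel_measurable borel" "g \<in> borel_measurable borel"
    and F: "AC a b F f" and G: "AC a b G g" and "a \<le> b"
  shows "integral {a..b} (\<lambda>x. f x * G x + F x * g x) = F b * G b - F a * G a"
proof -
  note f = ACD[OF F] and g = ACD[OF G]
  have 1: "integral {a..b} (\<lambda>x. F x * g x) = integral {a..b} (\<lambda>x. F a * g x + integral {a..x} f * g x)"
    using f(3) by (intro integral_cong) (metis distrib_right)
  have cI: "continuous_on {a..b} (\<lambda>x. integral {a..x} f)" "continuous_on {a..b} (\<lambda>x. integral {x..b} g)"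
    using f(2) g(2) by (auto intro: indefinite_integral_continuous_1 indefinite_integral_continuous_1')
  have i1: "(\<lambda>x. integral {a..x} f * g x) integrable_on {a..b}"
    using abs_int_mult_continuous(2)[OF g(1) cI(1)] by (auto simp: absolutely_integrable_on_def)
  have i2: "(\<lambda>x. f x * integral {x..b} g) integrable_on {a..b}"
    using abs_int_mult_continuous(1)[OF f(1) cI(2)] by (auto simp: absolutely_integrable_on_def)
  have 1: "integral {a..b} (\<lambda>x. F x * g x) = F a * integral {a..b} g + integral {a..b} (\<lambda>x. integral {a..x} f * g x)"
    unfolding 1 using g(2) i1 integrable_on_cmult_left[OF g(2), of "F a"]
    by (subst Henstock_Kurzweil_Integration.integral_add) auto
  have "G x = G b - integral {x..b} g" if "x \<in> {a..b}" for x
    using AC_diff[OF G, of x b] that by simp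
  then have "integral {a..b} (\<lambda>x. f x * G x) = integral {a..b} (\<lambda>x. f x * G b - f x * integral {x..b} g)"
    by (intro integral_cong) (metis right_diff_distrib)
  also have "\<dots> = integral {a..b} f * G b - integral {a..b} (\<lambda>x. f x * integral {x..b} g)"
    using f(2) i2 by (subst Henstock_Kurzweil_Integration.integral_diff) (auto intro: integrable_on_mult_left)
  finally have 2: "integral {a..b} (\<lambda>x. f x * G x) = integral {a..b} f * G b - integral {a..b} (\<lambda>x. f x * integral {x..b} g)" .
  have 3: "integral {a..b} f = F b - F a" "integral {a..b} g = G b - G a"
    using AC_diff[OF F order_refl \<open>a \<le> b\<close>] AC_diff[OF G order_refl \<open>a \<le> b\<close>] by auto
  have "(\<lambda>x. f x * G x) integrable_on {a..b}" "(\<lambda>x. F x * g x) integrable_on {a..b}"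
    using abs_int_mult_continuous[OF f(1) AC_continuous[OF G]] abs_int_mult_continuous[OF g(1) AC_continuous[OF F]]
    by (auto simp: absolutely_integrable_on_def)
  then have "integral {a..b} (\<lambda>x. f x * G x + F x * g x) = integral {a..b} (\<lambda>x. f x * G x) + integral {a..b} (\<lambda>x. F x * g x)"
    by (rule Henstock_Kurzweil_Integration.integral_add)
  also have "\<dots> = F b * G b - F a * G a"
    unfolding 1 2 integral_parts_borel[OF assms(1,2) f(1) g(1)] 3 by (simp add: algebra_simps)
  finally show ?thesis .
qed

text \<open>Passing to Borel densities changes neither \<open>F\<close> and \<open>G\<close> nor any
  of the integrals.\<close>

lemma AC_mult:
  assumes F: "AC a b F f" and G: "AC a b G g"
  shows "AC a b (\<lambda>x. F x * G x) (\<lambda>x. f x * G x + F x * g x)"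
proof -
  note f = ACD[OF F] and g = ACD[OF G]
  obtain f' N where f': "f' \<in> borel_measurable borel" "negligible N" "\<And>x. x \<in> {a..b} \<Longrightarrow> x \<notin> N \<Longrightarrow> f x = f' x"
    by (rule borel_representative[OF f(1)]) blast
  obtain g' M where g': "g' \<in> borel_measurable borel" "negligible M" "\<And>x. x \<in> {a..b} \<Longrightarrow> x \<notin> M \<Longrightarrow> g x = g' x"
    by (rule borel_representative[OF g(1)]) blast
  have F': "AC a b F f'"
    by (rule AC_cong[OF F]) (use f' in \<open>auto intro!: AE_IooI[of N]\<close>)
  have G': "AC a b G g'"
    by (rule AC_cong[OF G]) (use g' in \<open>auto intro!: AE_IooI[of M]\<close>)
  have "F x * G x = F a * G a + integral {a..x} (\<lambda>x. f x * G x + F x * g x)" if "x \<in> {a..b}" for x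
  proof -
    have "integral {a..x} (\<lambda>x. f x * G x + F x * g x) = integral {a..x} (\<lambda>x. f' x * G x + F x * g' x)"
      by (rule integral_spike[of "N \<union> M"]) (use f' g' that in \<open>auto simp: negligible_Un\<close>)
    also have "\<dots> = F x * G x - F a * G a"
      by (rule AC_mult_borel[OF f'(1) g'(1)]) (use that F' G' in \<open>auto intro: AC_subinterval\<close>)
    finally show ?thesis by simp
  qed
  moreover have "(\<lambda>x. f x * G x + F x * g x) absolutely_integrable_on {a..b}"
    using abs_int_mult_continuous[OF f(1) AC_continuous[OF G]] abs_int_mult_continuous[OF g(1) AC_continuous[OF F]]
    by (auto intro: set_integral_add)
  ultimately show ?thesis unfolding AC_def by blast
qed

lemma AC_by_parts:
  assumes F: "AC a b F f" and G: "AC a b G g" and "a \<le> b"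
  shows "integral {a..b} (\<lambda>x. F x * g x) = F b * G b - F a * G a - integral {a..b} (\<lambda>x. f x * G x)"
proof -
  note f = ACD[OF F] and g = ACD[OF G]
  have "(\<lambda>x. f x * G x) integrable_on {a..b}" "(\<lambda>x. F x * g x) integrable_on {a..b}"
    using abs_int_mult_continuous[OF f(1) AC_continuous[OF G]] abs_int_mult_continuous[OF g(1) AC_continuous[OF F]]
    by (auto simp: absolutely_integrable_on_def)
  then have "integral {a..b} (\<lambda>x. f x * G x + F x * g x) = integral {a..b} (\<lambda>x. f x * G x) + integral {a..b} (\<lambda>x. F x * g x)"
    by (rule Henstock_Kurzweil_Integration.integral_add)
  then show ?thesis using AC_diff[OF AC_mult[OF F G] order_refl \<open>a \<le> b\<close>] by linarith
qed

section \<open>Weak derivatives\<close>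

text \<open>The Borel sets over which a Borel representative of \<open>f\<close> integrates to zero
  contain all half lines and are closed under complements and countable disjoint unions. Half lines
  are stable under intersection and generate the Borel sets, so every Borel set is of this
  kind.\<close>

lemma AE_zero_of_integrals_zero:
  fixes f :: "real \<Rightarrow> real"
  assumes f: "f absolutely_integrable_on {c..d}"
    and zero: "\<And>x. x \<in> {c..d} \<Longrightarrow> integral {c..x} f = 0"
  shows "AE x in lebesgue_on {c<..<d}. f x = 0"
proof (cases "c \<le> d")
  case cd: True
  obtain g N where g: "g \<in> borel_measurable borel" "integrable lborel g" "\<And>x. x \<notin> {c..d} \<Longrightarrow> g x = 0"
    and N: "negligible N" "\<And>x. x \<in> {c..d} \<Longrightarrow> x \<notin> N \<Longrightarrow> f x = g x"
    by (rule borel_representative[OF f]) blast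
  have gA: "set_integrable lborel A g" if "A \<in> sets borel" for A
    unfolding set_integrable_def using g(2) that by (intro integrable_mult_indicator) auto
  have atMost: "set_lebesgue_integral lborel {..u} g = 0" for u
  proof -
    have "set_lebesgue_integral lborel {..u} g = set_lebesgue_integral lborel {c..min u d} g"
      unfolding set_lebesgue_integral_def
      by (intro Bochner_Integration.integral_cong) (use g(3) in \<open>auto simp: indicator_def not_le\<close>)
    also have "\<dots> = integral {c..min u d} g"
      by (intro set_borel_integral_eq_integral gA) auto
    also have "\<dots> = integral {c..min u d} f"
      by (rule integral_spike[OF N(1)]) (use N(2) in auto)
    also have "\<dots> = 0"
      using zero[of "min u d"] cd by (cases "c \<le> u") auto
    finally show ?thesis .
  qed
  \<comment> \<open>The whole line is required in the complement step of the Dynkin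
    argument.\<close>
  have UNIV: "set_lebesgue_integral lborel UNIV g = 0"
  proof -
    have "set_lebesgue_integral lborel UNIV g = set_lebesgue_integral lborel {..d} g"
      unfolding set_lebesgue_integral_def
      by (intro Bochner_Integration.integral_cong) (use g(3) in \<open>auto simp: indicator_def not_le\<close>)
    then show ?thesis using atMost by simp
  qed
  have "set_lebesgue_integral lborel A g = 0" if "A \<in> sets lborel" for A
  proof -
    have st: "Int_stable (range (\<lambda>u::real. {..u}))"
    proof (rule Int_stableI)
      fix a b assume "a \<in> range (\<lambda>u::real. {..u})" "b \<in> range (\<lambda>u::real. {..u})"
      then obtain p q where "a = {..p}" "b = {..q}" by blast
      then have "a \<inter> b = {..min p q}" by auto
      then show "a \<inter> b \<in> range (\<lambda>u::real. {..u})" by blast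
    qed
    have sb: "sets borel = sigma_sets UNIV (range (\<lambda>u::real. {..u}))"
      by (subst borel_eq_atMost) simp
    then have "A \<in> sigma_sets UNIV (range (\<lambda>u::real. {..u}))" using that by simp
    from st subset_UNIV[of "range (\<lambda>u::real. {..u})", folded Pow_UNIV] this show ?thesis
    proof (induction A rule: sigma_sets_induct_disjoint)
      case (basic A)
      then show ?case using atMost by auto
    next
      case empty
      then show ?case by (simp add: set_lebesgue_integral_def)
    next
      case (compl A)
      then have A: "A \<in> sets borel" using sb by simp
      have "set_lebesgue_integral lborel (A \<union> (UNIV - A)) g = set_lebesgue_integral lborel A g + set_lebesgue_integral lborel (UNIV - A) g"
        using A by (intro set_integral_Un gA) auto
      then show ?case using compl UNIV by simp
    next
      case (union A)
      then have A: "A i \<in> sets borel" for i using sb by auto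
      have "set_lebesgue_integral lborel (\<Union>i. A i) g = (\<Sum>i. set_lebesgue_integral lborel (A i) g)"
      proof (rule lebesgue_integral_countable_add)
        show "A i \<inter> A j = {}" if "i \<noteq> j" for i j
          using union(1) that by (auto simp: disjoint_family_on_def)
      qed (use A gA in auto)
      then show ?case using union by simp
    qed
  qed
  then have "AE x in lborel. g x = 0"
    by (intro sigma_finite_measure.density_zero[OF sigma_finite_lborel] g(2)) simp
  then obtain M where M: "negligible M" "\<And>x. x \<notin> M \<Longrightarrow> g x = 0"
    using AE_lborel_negligible by blast
  show ?thesis
    by (rule AE_IooI[of "N \<union> M"]) (use N M in \<open>auto simp: negligible_Un\<close>)
qed (auto simp: AE_Ioo_iff)

lemma locally_integrableD:
  "locally_integrable a b f \<Longrightarrow> a < c \<Longrightarrow> d < b \<Longrightarrow> f absolutely_integrable_on {c..d}"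
  unfolding locally_integrable_def by (drule spec[of _ "{c..d}"]) (auto simp: subset_iff)

lemma abs_int_locally_integrable:
  assumes "f absolutely_integrable_on {a..b}"
  shows "locally_integrable a b f"
  unfolding locally_integrable_def
proof (intro allI impI)
  fix K assume K: "compact K \<and> K \<subseteq> {a<..<b}"
  show "f absolutely_integrable_on K"
    by (rule set_integrable_subset[OF assms]) (use K in \<open>auto dest!: compact_imp_closed\<close>)
qed

lemma test_integrable:
  assumes f: "locally_integrable a b f" and \<phi>: "\<phi> \<in> test_functions a b" and "a < b"
  shows "integrable (lebesgue_on {a<..<b}) (\<lambda>x. f x * \<phi> x)"
    and "integrable (lebesgue_on {a<..<b}) (\<lambda>x. f x * deriv \<phi> x)"
proof -
  obtain c d where cd: "a < c" "c \<le> d" "d < b" and z: "\<And>x. x \<notin> {c..d} \<Longrightarrow> \<phi> x = 0"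
    using test_functionsD(2)[OF \<phi> \<open>a < b\<close>] by blast
  have s: "smooth \<phi>" by (rule test_functionsD(1)[OF \<phi> \<open>a < b\<close>])
  have z': "deriv \<phi> x = 0" if "x \<notin> {c..d}" for x
  proof -
    have "eventually (\<lambda>y. \<phi> y = 0) (nhds x)"
    proof (rule eventually_mono)
      show "eventually (\<lambda>y. y \<in> - {c..d}) (nhds x)"
        using that by (intro eventually_nhds_in_open open_Compl closed_atLeastAtMost) simp
      show "\<phi> y = 0" if "y \<in> - {c..d}" for y
        by (rule z) (use that in simp)
    qed
    then have "(\<phi> has_real_derivative 0) (at x)"
      by (rule DERIV_eventually_eq[OF DERIV_const])
    then show ?thesis by (rule DERIV_imp_deriv)
  qed
  have ff: "f absolutely_integrable_on {c..d}" by (rule locally_integrableD[OF f cd(1,3)])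
  show "integrable (lebesgue_on {a<..<b}) (\<lambda>x. f x * \<phi> x)"
    using z cd s by (intro LINT_support(2)[of c d] abs_int_mult_continuous(1)[OF ff] smooth_continuous) auto
  show "integrable (lebesgue_on {a<..<b}) (\<lambda>x. f x * deriv \<phi> x)"
    using z' cd s by (intro LINT_support(2)[of c d] abs_int_mult_continuous(1)[OF ff] smooth_continuous smooth_deriv) auto
qed

text \<open>As \<open>n\<close> grows the bumps tend to indicator functions, and dominated
  convergence turns the hypothesis into a vanishing integral of f - C over every compact
  subinterval.\<close>

lemma AE_const_of_bumps:
  assumes f: "locally_integrable a b f"
    and bump: "\<And>c d n. a < c \<Longrightarrow> c < d \<Longrightarrow> d < b \<Longrightarrow>
      integral {c..d} (\<lambda>x. f x * bump c d n x) = C * integral {c..d} (bump c d n)"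
  shows "AE x in lebesgue_on {a<..<b}. f x = C"
proof -
  have zero: "integral {c..d} (\<lambda>x. f x - C) = 0" if "a < c" "d < b" for c d
  proof (cases "c < d")
    case True
    have fi: "f absolutely_integrable_on {c..d}" by (rule locally_integrableD[OF f that])
    have bi: "(\<lambda>x. f x * bump c d n x) integrable_on {c..d}" for n
      using abs_int_mult_continuous(1)[OF fi smooth_continuous[OF smooth_bump]]
      by (auto simp: absolutely_integrable_on_def)
    have bi': "bump c d n integrable_on {c..d}" for n
      by (intro integrable_continuous_real smooth_continuous smooth_bump)
    have "(\<lambda>n. integral {c..d} (\<lambda>x. f x * bump c d n x)) \<longlonglongrightarrow> integral {c..d} (\<lambda>x. f x * indicator {c<..<d} x)"
    proof (rule dominated_convergence(2)[OF bi, where h = "\<lambda>x. \<bar>f x\<bar>"])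
      show "(\<lambda>x. \<bar>f x\<bar>) integrable_on {c..d}" using fi by (auto simp: absolutely_integrable_on_def)
      show "norm (f x * bump c d k x) \<le> \<bar>f x\<bar>" for k x
        using bump_bounds[of c d k x] by (simp add: abs_mult mult_left_le)
    qed (auto intro!: tendsto_intros bump_tendsto)
    moreover have "(\<lambda>n. integral {c..d} (bump c d n)) \<longlonglongrightarrow> integral {c..d} (\<lambda>x. indicator {c<..<d} x)"
    proof (rule dominated_convergence(2)[OF bi', where h = "\<lambda>x. 1"])
      show "norm (bump c d k x) \<le> 1" for k x
        using bump_bounds[of c d k x] by simp
    qed (auto intro!: bump_tendsto)
    moreover have "integral {c..d} (\<lambda>x. f x * indicator {c<..<d} x) = integral {c..d} f"
      by (rule integral_spike[of "{c, d}"]) (auto simp: indicator_def)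
    moreover have "integral {c..d} (\<lambda>x. indicator {c<..<d} x) = integral {c..d} (\<lambda>x. 1::real)"
      by (rule integral_spike[of "{c, d}"]) (auto simp: indicator_def)
    ultimately have "(\<lambda>n. C * integral {c..d} (bump c d n)) \<longlonglongrightarrow> integral {c..d} f"
      "(\<lambda>n. C * integral {c..d} (bump c d n)) \<longlonglongrightarrow> C * (d - c)"
      using bump[OF that(1) True that(2)] True by (auto intro!: tendsto_intros)
    then have "integral {c..d} f = C * (d - c)" using LIMSEQ_unique by blast
    then show ?thesis
      using fi True by (subst Henstock_Kurzweil_Integration.integral_diff) (auto simp: absolutely_integrable_on_def)
  next
    case False
    then show ?thesis by (cases "c = d") auto
  qed
  \<comment> \<open>\<open>f\<close> is only locally integrable, so (a,b) is exhausted by compact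
    intervals at distance 1/(n+1) from its ends.\<close>
  have ex: "\<exists>N. negligible N \<and> (\<forall>x \<in> {a + 1 / real (Suc n)..b - 1 / real (Suc n)} - N. f x = C)" for n
  proof -
    have i: "f absolutely_integrable_on {a + 1 / real (Suc n)..b - 1 / real (Suc n)}"
      by (intro locally_integrableD[OF f]) auto
    have "AE x in lebesgue_on {a + 1 / real (Suc n)<..<b - 1 / real (Suc n)}. f x - C = 0"
    proof (rule AE_zero_of_integrals_zero)
      show "(\<lambda>x. f x - C) absolutely_integrable_on {a + 1 / real (Suc n)..b - 1 / real (Suc n)}"
        using i by (intro set_integral_diff) auto
      show "integral {a + 1 / real (Suc n)..x} (\<lambda>x. f x - C) = 0"
        if "x \<in> {a + 1 / real (Suc n)..b - 1 / real (Suc n)}" for x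
      proof (rule zero)
        have "0 < 1 / real (Suc n)" by simp
        then show "a < a + 1 / real (Suc n)" "x < b" using that unfolding atLeastAtMost_iff by linarith+
      qed
    qed
    then show ?thesis by (rule AE_IooE) (auto simp del: of_nat_Suc)
  qed
  obtain N where N: "\<And>n. negligible (N n)" "\<And>n x. x \<in> {a + 1 / real (Suc n)..b - 1 / real (Suc n)} - N n \<Longrightarrow> f x = C"
    using ex by metis
  show ?thesis
  proof (rule AE_IooI)
    show "negligible (insert a (insert b (\<Union>n. N n)))"
      using N(1) by auto
    fix x assume x: "x \<in> {a..b}" "x \<notin> insert a (insert b (\<Union>n. N n))"
    then have "0 < min (x - a) (b - x)" by auto
    then obtain n where "1 / real (Suc n) < min (x - a) (b - x)"
      using nat_approx_posE by blast
    then show "f x = C" using x N(2)[of x n] by auto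
  qed
qed


text \<open>The lemma of du Bois-Reymond. A bump minus the multiple of one fixed bump
  \<open>\<eta>\<close> with the same integral has mean zero, hence is the derivative of a test
  function. So \<open>f\<close> pairs with every bump as the constant \<open>C\<close> does, its
  mean with weight \<open>\<eta>\<close>.\<close>

lemma weak_deriv_zero_imp_const:
  assumes "a < b" and f: "locally_integrable a b f"
    and zero: "\<And>\<phi>. \<phi> \<in> test_functions a b \<Longrightarrow> (LINT x|lebesgue_on {a<..<b}. f x * deriv \<phi> x) = 0"
  obtains C where "AE x in lebesgue_on {a<..<b}. f x = C"
proof -
  \<comment> \<open>The middle third; any interval strictly inside would serve.\<close>
  define c0 d0 where "c0 = (2 * a + b) / 3" and "d0 = (a + 2 * b) / 3"
  have c0: "a < c0" "c0 < d0" "d0 < b" using \<open>a < b\<close> by (auto simp: c0_def d0_def)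
  define \<eta> where "\<eta> = bump c0 d0 0"
  define I where "I = integral {c0..d0} \<eta>"
  have sm: "smooth \<eta>" by (simp add: \<eta>_def smooth_bump)
  have "I > 0"
  proof -
    have "I \<noteq> 0"
    proof
      assume "I = 0"
      then have "\<forall>x\<in>cbox c0 d0. \<eta> x = 0"
        using c0 smooth_continuous[OF sm, of "cbox c0 d0"] bump_bounds
        by (subst (asm) I_def, subst (asm) cbox_interval[symmetric], subst (asm) integral_cbox_eq_0_iff)
          (auto simp: \<eta>_def)
      then have "\<eta> ((c0 + d0) / 2) = 0" using c0 by auto
      then show False using bump_pos[of "(c0 + d0) / 2" c0 d0 0] c0 by (auto simp: \<eta>_def)
    qed
    moreover have "I \<ge> 0"
      unfolding I_def using bump_bounds
      by (intro Henstock_Kurzweil_Integration.integral_nonneg integrable_continuous_real smooth_continuous sm)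
        (auto simp: \<eta>_def)
    ultimately show ?thesis by simp
  qed
  define C where "C = integral {c0..d0} (\<lambda>x. f x * \<eta> x) / I"
  have "AE x in lebesgue_on {a<..<b}. f x = C"
  proof (rule AE_const_of_bumps[OF f])
    fix c d n assume cd: "a < c" "c < d" "d < b"
    define \<psi> where "\<psi> = bump c d n"
    define p q where "p = min c c0" and "q = max d d0"
    have pq: "a < p" "p \<le> q" "q < b" "{c..d} \<subseteq> {p..q}" "{c0..d0} \<subseteq> {p..q}" using cd c0 by (auto simp: p_def q_def)
    have sm': "smooth \<psi>" by (simp add: \<psi>_def smooth_bump)
    have z: "\<psi> x = 0" if "x \<notin> {c..d}" for x using that by (auto simp: \<psi>_def bump_eq_0)
    have z': "\<eta> x = 0" if "x \<notin> {c0..d0}" for x using that by (auto simp: \<eta>_def bump_eq_0)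
    define r where "r = integral {c..d} \<psi> / I"
    \<comment> \<open>Written with \<open>1 * x + 0\<close> to match
      \<open>smooth_affine\<close>.\<close>
    define \<theta> where "\<theta> = (\<lambda>x. \<psi> x + (- r) * \<eta> (1 * x + 0))"
    have s\<theta>: "smooth \<theta>" unfolding \<theta>_def by (intro smooth_add smooth_affine sm sm')
    have \<theta>: "\<theta> = (\<lambda>x. \<psi> x - r * \<eta> x)" by (auto simp: \<theta>_def)
    have ic: "\<psi> integrable_on {p..q}" "\<eta> integrable_on {p..q}"
      by (auto intro: integrable_continuous_real smooth_continuous sm sm')
    have pint: "integral {p..q} \<psi> = integral {c..d} \<psi>" "integral {p..q} \<eta> = I"
      unfolding I_def by (intro integral_support z z' pq; simp)+
    have "integral {p..q} \<theta> = 0"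
      unfolding \<theta>
      using ic \<open>I > 0\<close> Henstock_Kurzweil_Integration.integral_diff[OF ic(1) integrable_on_mult_right[OF ic(2), of r]]
      by (simp add: pint r_def)
    moreover have zt: "\<theta> x = 0" if "x \<notin> {p..q}" for x
      using z[of x] z'[of x] that pq(4,5) by (auto simp: \<theta>)
    ultimately obtain \<phi> where \<phi>: "\<phi> \<in> test_functions a b" "deriv \<phi> = \<theta>"
      using test_function_primitive[OF s\<theta> _ pq(1,2,3)] by blast
    have fi: "f absolutely_integrable_on {p..q}" by (rule locally_integrableD[OF f pq(1,3)])
    have "0 = (LINT x|lebesgue_on {a<..<b}. f x * \<theta> x)"
      using zero[OF \<phi>(1)] \<phi>(2) by simp
    also have "\<dots> = integral {p..q} (\<lambda>x. f x * \<theta> x)"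
      using zt pq s\<theta> by (intro LINT_support abs_int_mult_continuous(1)[OF fi] smooth_continuous) auto
    also have "\<dots> = integral {p..q} (\<lambda>x. f x * \<psi> x - r * (f x * \<eta> x))"
      by (intro integral_cong) (simp add: \<theta> algebra_simps)
    also have "\<dots> = integral {p..q} (\<lambda>x. f x * \<psi> x) - r * integral {p..q} (\<lambda>x. f x * \<eta> x)"
      using abs_int_mult_continuous(1)[OF fi smooth_continuous[OF sm]]
        abs_int_mult_continuous(1)[OF fi smooth_continuous[OF sm']]
      by (subst Henstock_Kurzweil_Integration.integral_diff)
        (auto simp: absolutely_integrable_on_def intro: integrable_on_mult_right)
    also have "integral {p..q} (\<lambda>x. f x * \<psi> x) = integral {c..d} (\<lambda>x. f x * \<psi> x)"
      using z pq by (intro integral_support) auto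
    also have "integral {p..q} (\<lambda>x. f x * \<eta> x) = integral {c0..d0} (\<lambda>x. f x * \<eta> x)"
      using z' pq by (intro integral_support) auto
    also have "\<dots> = C * I" using \<open>I > 0\<close> by (simp add: C_def)
    finally show "integral {c..d} (\<lambda>x. f x * bump c d n x) = C * integral {c..d} (bump c d n)"
      using \<open>I > 0\<close> by (simp add: \<psi>_def r_def)
  qed
  then show thesis by (rule that)
qed

lemma AC_has_weak_deriv:
  assumes "a < b" and F: "AC a b F f"
  shows "has_weak_deriv a b F f"
  unfolding has_weak_deriv_def
proof (intro conjI ballI)
  show "locally_integrable a b F"
    by (intro abs_int_locally_integrable absolutely_integrable_continuous_real AC_continuous[OF F])
  show "locally_integrable a b f"
    by (intro abs_int_locally_integrable ACD(1)[OF F])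
  fix \<phi> assume \<phi>: "\<phi> \<in> test_functions a b"
  have s: "smooth \<phi>" and z: "\<phi> a = 0" "\<phi> b = 0"
    using test_functionsD[OF \<phi> \<open>a < b\<close>] by force+
  have A: "AC a b \<phi> (deriv \<phi>)"
    by (intro AC_DERIV smooth_continuous smooth_deriv s DERIV_subset[OF smooth_DERIV[OF s]]) auto
  have "integral {a..b} (\<lambda>x. F x * deriv \<phi> x) = - integral {a..b} (\<lambda>x. f x * \<phi> x)"
    using AC_by_parts[OF F A] \<open>a < b\<close> z by simp
  then show "(LINT x|lebesgue_on {a<..<b}. F x * deriv \<phi> x) = - (LINT x|lebesgue_on {a<..<b}. f x * \<phi> x)"
    using abs_int_mult_continuous(1)[OF ACD(1)[OF F] smooth_continuous[OF s]]
      absolutely_integrable_continuous_real[OF continuous_on_mult[OF AC_continuous[OF F] smooth_continuous[OF smooth_deriv[OF s]]]]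
    by (simp add: LINT_Ioo)
qed

lemma has_weak_deriv_AE_cong:
  assumes fg: "has_weak_deriv a b f g" and f': "AE x in lebesgue_on {a<..<b}. f x = f' x"
    and g': "AE x in lebesgue_on {a<..<b}. g x = g' x"
  shows "has_weak_deriv a b f' g'"
proof -
  have loc: "locally_integrable a b k'" if k: "locally_integrable a b k" and k': "AE x in lebesgue_on {a<..<b}. k x = k' x" for k k'
    unfolding locally_integrable_def
  proof (intro allI impI)
    fix K assume K: "compact K \<and> K \<subseteq> {a<..<b}"
    obtain N where N: "negligible N" "\<And>x. x \<in> {a..b} \<Longrightarrow> x \<notin> N \<Longrightarrow> k x = k' x"
      by (rule AE_IooE[OF k']) blast
    have "k absolutely_integrable_on K" using k K unfolding locally_integrable_def by blast
    then show "k' absolutely_integrable_on K"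
      by (rule absolutely_integrable_spike[OF _ N(1)]) (use N(2) K in force)
  qed
  have c: "(LINT x|lebesgue_on {a<..<b}. k x * \<psi> x) = (LINT x|lebesgue_on {a<..<b}. k' x * \<psi> x)"
    if "locally_integrable a b k" "locally_integrable a b k'" "integrable (lebesgue_on {a<..<b}) (\<lambda>x. k x * \<psi> x)"
      "integrable (lebesgue_on {a<..<b}) (\<lambda>x. k' x * \<psi> x)" "AE x in lebesgue_on {a<..<b}. k x = k' x" for k k' \<psi>
    using that by (intro integral_cong_AE borel_measurable_integrable) (auto elim: eventually_mono)
  show ?thesis
    unfolding has_weak_deriv_def
  proof (intro conjI ballI)
    show l: "locally_integrable a b f'" "locally_integrable a b g'"
      using fg f' g' loc unfolding has_weak_deriv_def by blast+
    fix \<phi> assume \<phi>: "\<phi> \<in> test_functions a b"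
    show "(LINT x|lebesgue_on {a<..<b}. f' x * deriv \<phi> x) = - (LINT x|lebesgue_on {a<..<b}. g' x * \<phi> x)"
    proof (cases "a < b")
      case True
      have "(LINT x|lebesgue_on {a<..<b}. f x * deriv \<phi> x) = (LINT x|lebesgue_on {a<..<b}. f' x * deriv \<phi> x)"
        "(LINT x|lebesgue_on {a<..<b}. g x * \<phi> x) = (LINT x|lebesgue_on {a<..<b}. g' x * \<phi> x)"
        using fg l f' g' by (intro c test_integrable[OF _ \<phi> True]; simp add: has_weak_deriv_def)+
      then show ?thesis using fg \<phi> by (simp add: has_weak_deriv_def)
    next
      case False
      then have "{a<..<b} = {}" by simp
      then show ?thesis by simp
    qed
  qed
qed

lemma has_weak_deriv_diff:
  assumes "a < b" "has_weak_deriv a b f g" "has_weak_deriv a b f' g'"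
  shows "has_weak_deriv a b (\<lambda>x. f x - f' x) (\<lambda>x. g x - g' x)"
proof -
  have l: "locally_integrable a b f" "locally_integrable a b f'" "locally_integrable a b g" "locally_integrable a b g'"
    using assms by (auto simp: has_weak_deriv_def)
  have "locally_integrable a b (\<lambda>x. f x - f' x)" "locally_integrable a b (\<lambda>x. g x - g' x)"
    using l unfolding locally_integrable_def by (blast intro: set_integral_diff(1))+
  moreover have "(LINT x|lebesgue_on {a<..<b}. (f x - f' x) * deriv \<phi> x) = - (LINT x|lebesgue_on {a<..<b}. (g x - g' x) * \<phi> x)"
    if "\<phi> \<in> test_functions a b" for \<phi>
    using assms that test_integrable[OF l(1) that \<open>a < b\<close>] test_integrable[OF l(2) that \<open>a < b\<close>]
      test_integrable[OF l(3) that \<open>a < b\<close>] test_integrable[OF l(4) that \<open>a < b\<close>]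
    by (simp add: left_diff_distrib has_weak_deriv_def)
  ultimately show ?thesis by (simp add: has_weak_deriv_def)
qed

text \<open>The difference of the two derivatives pairs to zero with every bump, which is the case C
  = 0 of \<open>AE_const_of_bumps\<close>.\<close>

lemma has_weak_deriv_unique:
  assumes "a < b" "has_weak_deriv a b f g" "has_weak_deriv a b f g'"
  shows "AE x in lebesgue_on {a<..<b}. g x = g' x"
proof -
  have w: "has_weak_deriv a b (\<lambda>x. 0) (\<lambda>x. g x - g' x)"
    using has_weak_deriv_diff[OF assms] by simp
  then have l: "locally_integrable a b (\<lambda>x. g x - g' x)" by (simp add: has_weak_deriv_def)
  have "AE x in lebesgue_on {a<..<b}. g x - g' x = 0"
  proof (rule AE_const_of_bumps[OF l])
    fix c d n assume cd: "a < c" "c < d" "d < b"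
    have "0 = (LINT x|lebesgue_on {a<..<b}. (g x - g' x) * bump c d n x)"
      using w bump_test_function[OF cd(1,3), of n] by (simp add: has_weak_deriv_def)
    also have "\<dots> = integral {c..d} (\<lambda>x. (g x - g' x) * bump c d n x)"
      using cd by (intro LINT_support abs_int_mult_continuous(1)[OF locally_integrableD[OF l]] smooth_continuous smooth_bump)
        (auto simp: bump_eq_0)
    finally show "integral {c..d} (\<lambda>x. (g x - g' x) * bump c d n x) = 0 * integral {c..d} (bump c d n)" by simp
  qed
  then show ?thesis by simp
qed

text \<open>Subtracting the primitive of \<open>g\<close> leaves a function with zero weak
  derivative, hence a constant.\<close>

lemma has_weak_deriv_imp_AC:
  assumes "a < b" and w: "has_weak_deriv a b f g" and g: "g absolutely_integrable_on {a..b}"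
  obtains F where "AC a b F g" "AE x in lebesgue_on {a<..<b}. f x = F x"
proof -
  have A: "AC a b (\<lambda>x. 0 + integral {a..x} g) g" by (rule AC_integral[OF g])
  have w': "has_weak_deriv a b (\<lambda>x. f x - (0 + integral {a..x} g)) (\<lambda>x. g x - g x)"
    by (rule has_weak_deriv_diff[OF \<open>a < b\<close> w AC_has_weak_deriv[OF \<open>a < b\<close> A]])
  obtain C where C: "AE x in lebesgue_on {a<..<b}. f x - (0 + integral {a..x} g) = C"
    by (rule weak_deriv_zero_imp_const[OF \<open>a < b\<close>, of "\<lambda>x. f x - (0 + integral {a..x} g)"])
      (use w' in \<open>auto simp: has_weak_deriv_def\<close>)
  show thesis
  proof (rule that)
    show "AC a b (\<lambda>x. C + integral {a..x} g) g" by (rule AC_integral[OF g])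
    show "AE x in lebesgue_on {a<..<b}. f x = C + integral {a..x} g"
      using C by eventually_elim auto
  qed
qed

lemma weak_deriv_AE:
  assumes "a < b" "has_weak_deriv a b f g"
  shows "AE x in lebesgue_on {a<..<b}. weak_deriv a b f x = g x"
  by (rule has_weak_deriv_unique[OF \<open>a < b\<close> _ assms(2)])
    (unfold weak_deriv_def, rule someI[of "has_weak_deriv a b f", OF assms(2)])

lemma AE_eq_continuous_imp_eq:
  fixes f g :: "real \<Rightarrow> real"
  assumes "a < b" "continuous_on {a..b} f" "continuous_on {a..b} g" "AE x in lebesgue_on {a<..<b}. f x = g x"
    and "x \<in> {a..b}"
  shows "f x = g x"
proof -
  have "AE x in lebesgue_on {a<..<b}. \<bar>f x - g x\<bar> = 0"
    using assms(4) by eventually_elim simp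
  from integral_AE_cong(1)[OF this] have "integral (cbox a b) (\<lambda>x. \<bar>f x - g x\<bar>) = 0" by simp
  then have "\<forall>x\<in>cbox a b. \<bar>f x - g x\<bar> = 0"
    using assms(1,2,3) by (subst (asm) integral_cbox_eq_0_iff) (auto intro!: continuous_intros)
  then show ?thesis using assms(5) by auto
qed

lemma cont_rep_eq:
  assumes "a < b" "continuous_on {a..b} F" "AE x in lebesgue_on {a<..<b}. f x = F x" "x \<in> {a..b}"
  shows "cont_rep a b f x = F x"
proof -
  have "continuous_on {a..b} (cont_rep a b f) \<and> (AE x in lebesgue_on {a<..<b}. f x = cont_rep a b f x)"
    unfolding cont_rep_def
    by (rule someI[of "\<lambda>g. continuous_on {a..b} g \<and> (AE x in lebesgue_on {a<..<b}. f x = g x)" F])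
      (use assms in simp)
  moreover from this assms(3) have "AE x in lebesgue_on {a<..<b}. cont_rep a b f x = F x"
    by (auto elim!: eventually_elim2)
  ultimately show ?thesis
    using AE_eq_continuous_imp_eq assms by blast
qed

section \<open>The spaces L2 and H1\<close>

text \<open>The squared norm. Limits in L2 are taken for it, so that \<open>sq_add_le\<close>
  replaces the triangle inequality and square roots occur only at the interface to the
  definitions.\<close>

definition sq :: "real \<Rightarrow> real \<Rightarrow> (real \<Rightarrow> real) \<Rightarrow> real" where
  "sq a b f = integral {a..b} (\<lambda>x. (f x)\<^sup>2)"

text \<open>On a bounded interval square integrable functions are integrable; the first conjunct
  also carries the measurability of \<open>f\<close>.\<close>

lemma L2_iff:
  "f \<in> L2 a b \<longleftrightarrow> f absolutely_integrable_on {a..b} \<and> (\<lambda>x. (f x)\<^sup>2) absolutely_integrable_on {a..b}"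
proof
  assume f: "f \<in> L2 a b"
  have "finite_measure (lebesgue_on {a<..<b})"
    by (rule finite_measure_lebesgue_on) (rule bounded_set_imp_lmeasurable, auto)
  then have "integrable (lebesgue_on {a<..<b}) f"
    by (rule finite_measure.square_integrable_imp_integrable) (use f in \<open>auto simp: L2_def\<close>)
  then show "f absolutely_integrable_on {a..b} \<and> (\<lambda>x. (f x)\<^sup>2) absolutely_integrable_on {a..b}"
    using f abs_int_Ioo[of a b f] abs_int_Ioo[of a b "\<lambda>x. (f x)\<^sup>2"] by (simp add: L2_def)
next
  assume f: "f absolutely_integrable_on {a..b} \<and> (\<lambda>x. (f x)\<^sup>2) absolutely_integrable_on {a..b}"
  then show "f \<in> L2 a b"
    using LINT_Ioo(2)[of a b f] LINT_Ioo(2)[of a b "\<lambda>x. (f x)\<^sup>2"] by (auto simp: L2_def)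
qed

lemma L2D:
  assumes "f \<in> L2 a b"
  shows "f absolutely_integrable_on {a..b}" "(\<lambda>x. (f x)\<^sup>2) absolutely_integrable_on {a..b}"
    "f integrable_on {a..b}" "(\<lambda>x. (f x)\<^sup>2) integrable_on {a..b}"
  using assms by (auto simp: L2_iff intro: set_lebesgue_integral_eq_integral(1))

lemma L2_mult_abs_int:
  assumes "f \<in> L2 a b" "g \<in> L2 a b"
  shows "(\<lambda>x. f x * g x) absolutely_integrable_on {a..b}" "(\<lambda>x. f x * g x) integrable_on {a..b}"
proof -
  have "integrable (lebesgue_on {a<..<b}) (\<lambda>x. f x * g x)"
  proof (rule Bochner_Integration.integrable_bound)
    show "integrable (lebesgue_on {a<..<b}) (\<lambda>x. (f x)\<^sup>2 + (g x)\<^sup>2)"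
      using assms by (auto simp: L2_def)
    show "(\<lambda>x. f x * g x) \<in> borel_measurable (lebesgue_on {a<..<b})"
      using assms by (auto simp: L2_def)
    show "AE x in lebesgue_on {a<..<b}. norm (f x * g x) \<le> norm ((f x)\<^sup>2 + (g x)\<^sup>2)"
    proof (rule AE_I2)
      fix x
      have "2 * \<bar>f x * g x\<bar> \<le> (f x)\<^sup>2 + (g x)\<^sup>2"
        using sum_squares_bound[of "\<bar>f x\<bar>" "\<bar>g x\<bar>"] by (simp add: abs_mult)
      then have "\<bar>f x * g x\<bar> \<le> (f x)\<^sup>2 + (g x)\<^sup>2" using abs_ge_zero[of "f x * g x"] by linarith
      then show "norm (f x * g x) \<le> norm ((f x)\<^sup>2 + (g x)\<^sup>2)"
        by simp
    qed
  qed
  then show "(\<lambda>x. f x * g x) absolutely_integrable_on {a..b}" by (rule abs_int_Ioo)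
  then show "(\<lambda>x. f x * g x) integrable_on {a..b}" by (rule set_lebesgue_integral_eq_integral(1))
qed

lemma L2_add:
  assumes "f \<in> L2 a b" "g \<in> L2 a b"
  shows "(\<lambda>x. f x + g x) \<in> L2 a b"
proof -
  have "(\<lambda>x. (f x)\<^sup>2 + (g x)\<^sup>2 + 2 * (f x * g x)) absolutely_integrable_on {a..b}"
    using L2D[OF assms(1)] L2D[OF assms(2)] L2_mult_abs_int[OF assms]
    by (intro set_integral_add set_integrable_mult_right) auto
  then have "(\<lambda>x. (f x + g x)\<^sup>2) absolutely_integrable_on {a..b}"
    by (simp add: power2_sum mult.assoc)
  then show ?thesis
    using L2D[OF assms(1)] L2D[OF assms(2)] by (auto simp: L2_iff)
qed

lemma L2_cmult: "f \<in> L2 a b \<Longrightarrow> (\<lambda>x. c * f x) \<in> L2 a b"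
  by (auto simp: L2_iff power_mult_distrib)

lemma L2_minus: "f \<in> L2 a b \<Longrightarrow> g \<in> L2 a b \<Longrightarrow> (\<lambda>x. f x - g x) \<in> L2 a b"
  using L2_add[of f a b "\<lambda>x. -1 * g x"] L2_cmult[of g a b "-1"] by simp

lemma L2_continuous: "continuous_on {a..b} f \<Longrightarrow> f \<in> L2 a b"
  by (auto simp: L2_iff intro!: absolutely_integrable_continuous_real continuous_intros)

lemma L2_mult_continuous:
  assumes "f \<in> L2 a b" "continuous_on {a..b} g"
  shows "(\<lambda>x. g x * f x) \<in> L2 a b"
  using abs_int_mult_continuous(2)[OF L2D(1)[OF assms(1)] assms(2)]
    abs_int_mult_continuous(2)[OF L2D(2)[OF assms(1)] continuous_on_power[OF assms(2), of 2]]
  by (auto simp: L2_iff power_mult_distrib)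

lemma L2_AE_cong:
  assumes f: "f \<in> L2 a b" and ae: "AE x in lebesgue_on {a<..<b}. f x = g x"
  shows "g \<in> L2 a b"
proof -
  have "AE x in lebesgue_on {a<..<b}. (f x)\<^sup>2 = (g x)\<^sup>2" using ae by eventually_elim simp
  from integral_AE_cong(2)[OF this] integral_AE_cong(2)[OF ae] show ?thesis
    using f by (simp add: L2_iff)
qed

lemma L2_subinterval: "f \<in> L2 a b \<Longrightarrow> a \<le> c \<Longrightarrow> d \<le> b \<Longrightarrow> f \<in> L2 c d"
  by (auto simp: L2_iff intro: absolutely_integrable_on_subinterval)

lemma L2_inner_eq: "f \<in> L2 a b \<Longrightarrow> g \<in> L2 a b \<Longrightarrow> L2_inner a b f g = integral {a..b} (\<lambda>x. f x * g x)"
  unfolding L2_inner_def by (intro LINT_Ioo L2_mult_abs_int)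

lemma sq_nonneg: "0 \<le> sq a b f"
  unfolding sq_def by (cases "(\<lambda>x. (f x)\<^sup>2) integrable_on {a..b}")
    (auto simp: not_integrable_integral intro: Henstock_Kurzweil_Integration.integral_nonneg)

lemma L2_norm_eq: "f \<in> L2 a b \<Longrightarrow> L2_norm a b f = sqrt (sq a b f)"
  by (simp add: L2_norm_def L2_inner_eq sq_def power2_eq_square)

lemma sq_cmult: "sq a b (\<lambda>x. c * f x) = c\<^sup>2 * sq a b f"
  by (simp add: sq_def power_mult_distrib)

lemma sq_AE_cong: "AE x in lebesgue_on {a<..<b}. f x = g x \<Longrightarrow> sq a b f = sq a b g"
  unfolding sq_def by (intro integral_AE_cong) (auto elim: eventually_mono)

lemma sq_add_le:
  assumes "f \<in> L2 a b" "g \<in> L2 a b"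
  shows "sq a b (\<lambda>x. f x + g x) \<le> 2 * sq a b f + 2 * sq a b g"
proof -
  have "sq a b (\<lambda>x. f x + g x) \<le> integral {a..b} (\<lambda>x. 2 * (f x)\<^sup>2 + 2 * (g x)\<^sup>2)"
    unfolding sq_def
  proof (rule integral_le)
    show "(\<lambda>x. (f x + g x)\<^sup>2) integrable_on {a..b}" by (intro L2D(4) L2_add assms)
    show "(\<lambda>x. 2 * (f x)\<^sup>2 + 2 * (g x)\<^sup>2) integrable_on {a..b}"
      using L2D[OF assms(1)] L2D[OF assms(2)] by (intro integrable_add integrable_on_mult_right) auto
    show "(f x + g x)\<^sup>2 \<le> 2 * (f x)\<^sup>2 + 2 * (g x)\<^sup>2" for x
      using sum_squares_bound[of "f x" "g x"] by (simp add: power2_sum)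
  qed
  also have "\<dots> = 2 * sq a b f + 2 * sq a b g"
    unfolding sq_def using L2D[OF assms(1)] L2D[OF assms(2)]
    by (subst Henstock_Kurzweil_Integration.integral_add) (auto intro: integrable_on_mult_right)
  finally show ?thesis .
qed

lemma sq_expand:
  assumes "f \<in> L2 a b" "g \<in> L2 a b"
  shows "sq a b (\<lambda>x. t * f x + g x) = t\<^sup>2 * sq a b f + 2 * t * integral {a..b} (\<lambda>x. f x * g x) + sq a b g"
proof -
  have "sq a b (\<lambda>x. t * f x + g x) = integral {a..b} (\<lambda>x. (t\<^sup>2 * (f x)\<^sup>2 + 2 * t * (f x * g x)) + (g x)\<^sup>2)"
    unfolding sq_def by (intro integral_cong) (simp add: power2_eq_square algebra_simps)
  also have "\<dots> = integral {a..b} (\<lambda>x. t\<^sup>2 * (f x)\<^sup>2 + 2 * t * (f x * g x)) + sq a b g"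
    unfolding sq_def using L2D[OF assms(1)] L2D[OF assms(2)] L2_mult_abs_int[OF assms]
    by (intro Henstock_Kurzweil_Integration.integral_add integrable_add integrable_on_mult_right)
  also have "integral {a..b} (\<lambda>x. t\<^sup>2 * (f x)\<^sup>2 + 2 * t * (f x * g x)) =
      integral {a..b} (\<lambda>x. t\<^sup>2 * (f x)\<^sup>2) + integral {a..b} (\<lambda>x. 2 * t * (f x * g x))"
    using L2D[OF assms(1)] L2D[OF assms(2)] L2_mult_abs_int[OF assms]
    by (intro Henstock_Kurzweil_Integration.integral_add integrable_on_mult_right)
  finally show ?thesis by (simp add: sq_def)
qed

text \<open>The squared norm of t f + g is a nonnegative polynomial in t of degree at most two. It
  is evaluated at its minimum, or, if it degenerates to an affine function, where a nonzero slope
  would make it negative.\<close>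

lemma integral_Cauchy_Schwarz:
  assumes "f \<in> L2 a b" "g \<in> L2 a b"
  shows "(integral {a..b} (\<lambda>x. f x * g x))\<^sup>2 \<le> sq a b f * sq a b g"
proof -
  define I where "I = integral {a..b} (\<lambda>x. f x * g x)"
  have pos: "0 \<le> t\<^sup>2 * sq a b f + 2 * t * I + sq a b g" for t
    using sq_nonneg[of a b "\<lambda>x. t * f x + g x"] by (simp add: sq_expand[OF assms] I_def)
  show ?thesis
  proof (cases "sq a b f = 0")
    case True
    have "I = 0"
    proof (rule ccontr)
      assume "I \<noteq> 0"
      \<comment> \<open>At this point the affine function takes the value -1.\<close>
      then show False using pos[of "- (sq a b g + 1) / (2 * I)"] True by (simp add: field_simps)
    qed
    then show ?thesis using True by (simp add: I_def)
  next
    case False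
    then have p: "sq a b f > 0" using sq_nonneg[of a b f] by simp
    have "0 \<le> (- I / sq a b f)\<^sup>2 * sq a b f + 2 * (- I / sq a b f) * I + sq a b g" by (rule pos)
    also have "\<dots> = (sq a b f * sq a b g - I\<^sup>2) / sq a b f"
      using p by (simp add: field_simps power2_eq_square)
    finally show ?thesis using p by (simp add: zero_le_divide_iff I_def)
  qed
qed

lemma integral_square_le:
  assumes "f \<in> L2 a b" "a \<le> b"
  shows "(integral {a..b} f)\<^sup>2 \<le> (b - a) * sq a b f"
  using integral_Cauchy_Schwarz[OF assms(1) L2_continuous[of a b "\<lambda>x. 1"]] assms(2)
  by (simp add: sq_def mult.commute)

text \<open>The embedding of H1 into the continuous functions: any two values of \<open>F\<close>
  differ by at most the norm of \<open>g\<close>, and averaging over the second point replaces its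
  value by an integral.\<close>

lemma AC_sup_bound:
  assumes F: "AC 0 1 F g" and g: "g \<in> L2 0 1" and x: "x \<in> {0..1}"
  shows "(F x)\<^sup>2 \<le> 2 * sq 0 1 F + 2 * sq 0 1 g"
proof -
  have *: "(F d - F c)\<^sup>2 \<le> sq 0 1 g" if "0 \<le> c" "c \<le> d" "d \<le> 1" for c d
  proof -
    have "(F d - F c)\<^sup>2 = (integral {c..d} g)\<^sup>2" using AC_diff[OF F] that by simp
    also have "\<dots> \<le> (d - c) * sq c d g"
      using that by (intro integral_square_le L2_subinterval[OF g]) auto
    also have "\<dots> \<le> 1 * sq 0 1 g"
    proof (rule mult_mono)
      show "sq c d g \<le> sq 0 1 g"
        unfolding sq_def using that L2D(4)[OF g]
        by (intro integral_subset_le) (auto intro: integrable_on_subinterval)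
    qed (use that sq_nonneg in auto)
    finally show ?thesis by simp
  qed
  have **: "(F x)\<^sup>2 \<le> 2 * (F y)\<^sup>2 + 2 * sq 0 1 g" if "y \<in> {0..1}" for y
  proof -
    have "(F x - F y)\<^sup>2 \<le> sq 0 1 g"
      using *[of x y] *[of y x] x that by (cases "x \<le> y") (auto simp: power2_commute)
    moreover have "(F x)\<^sup>2 \<le> 2 * (F y)\<^sup>2 + 2 * (F x - F y)\<^sup>2"
      using sum_squares_bound[of "F y" "F x - F y"] power2_sum[of "F y" "F x - F y"] by simp
    ultimately show ?thesis by linarith
  qed
  have FL: "F \<in> L2 0 1" by (intro L2_continuous AC_continuous[OF F])
  have "integral {0..1} (\<lambda>y::real. (F x)\<^sup>2) \<le> integral {0..1} (\<lambda>y. 2 * (F y)\<^sup>2 + 2 * sq 0 1 g)"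
    using ** L2D(4)[OF FL] by (intro integral_le) (auto intro!: integrable_add integrable_on_mult_right)
  also have "\<dots> = 2 * sq 0 1 F + 2 * sq 0 1 g"
    unfolding sq_def using L2D(4)[OF FL]
    by (subst Henstock_Kurzweil_Integration.integral_add) (auto intro!: integrable_on_mult_right)
  finally show ?thesis by simp
qed

text \<open>Together with \<open>H1I\<close> the dictionary used from here on: elements of H1 agree
  almost everywhere with a function that has an L2 density. The choices inside
  \<open>weak_deriv\<close> and \<open>cont_rep\<close> are controlled through it.\<close>

lemma H1_AC:
  assumes "f \<in> H1 a b" "a < b"
  shows "AC a b (cont_rep a b f) (weak_deriv a b f)" "weak_deriv a b f \<in> L2 a b"
    "AE x in lebesgue_on {a<..<b}. f x = cont_rep a b f x"
proof -
  obtain g where g: "g \<in> L2 a b" "has_weak_deriv a b f g" using assms by (auto simp: H1_def)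
  have ae: "AE x in lebesgue_on {a<..<b}. weak_deriv a b f x = g x"
    by (rule weak_deriv_AE[OF assms(2) g(2)])
  then have ae': "AE x in lebesgue_on {a<..<b}. g x = weak_deriv a b f x"
    by (auto elim: eventually_mono)
  show "weak_deriv a b f \<in> L2 a b" by (rule L2_AE_cong[OF g(1) ae'])
  obtain F where F: "AC a b F g" "AE x in lebesgue_on {a<..<b}. f x = F x"
    by (rule has_weak_deriv_imp_AC[OF assms(2) g(2) L2D(1)[OF g(1)]]) blast
  have *: "cont_rep a b f x = F x" if "x \<in> {a..b}" for x
    by (rule cont_rep_eq[OF assms(2) AC_continuous[OF F(1)] F(2) that])
  show "AC a b (cont_rep a b f) (weak_deriv a b f)"
    by (rule AC_cong[OF F(1) _ ae']) (simp add: *)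
  obtain N where N: "negligible N" "\<And>x. x \<in> {a..b} \<Longrightarrow> x \<notin> N \<Longrightarrow> f x = F x"
    by (rule AE_IooE[OF F(2)]) blast
  show "AE x in lebesgue_on {a<..<b}. f x = cont_rep a b f x"
    by (rule AE_IooI[OF N(1)]) (simp add: * N(2))
qed

lemma H1I:
  assumes "a < b" "AC a b F g" "g \<in> L2 a b" "AE x in lebesgue_on {a<..<b}. f x = F x"
  shows "f \<in> H1 a b" "AE x in lebesgue_on {a<..<b}. weak_deriv a b f x = g x"
    "x \<in> {a..b} \<Longrightarrow> cont_rep a b f x = F x"
proof -
  have ae: "AE x in lebesgue_on {a<..<b}. F x = f x" using assms(4) by (auto elim: eventually_mono)
  have "has_weak_deriv a b f g"
    by (rule has_weak_deriv_AE_cong[OF AC_has_weak_deriv[OF assms(1,2)] ae]) simp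
  then show "AE x in lebesgue_on {a<..<b}. weak_deriv a b f x = g x"
    by (rule weak_deriv_AE[OF assms(1)])
  have "f \<in> L2 a b" by (rule L2_AE_cong[OF L2_continuous[OF AC_continuous[OF assms(2)]] ae])
  then show "f \<in> H1 a b" using \<open>has_weak_deriv a b f g\<close> assms(3) by (auto simp: H1_def)
  show "x \<in> {a..b} \<Longrightarrow> cont_rep a b f x = F x"
    by (rule cont_rep_eq[OF assms(1) AC_continuous[OF assms(2)] assms(4)])
qed

lemma H1_norm_eq:
  assumes "f \<in> H1 a b" "a < b"
  shows "(H1_norm a b f)\<^sup>2 = sq a b f + sq a b (weak_deriv a b f)"
  using assms H1_AC(2)[OF assms] sq_nonneg
  by (simp add: H1_norm_def L2_norm_eq H1_def)

section \<open>Continuity and differentiability in time\<close>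

lemma tendsto_sqrt_iff:
  assumes "\<And>s. 0 \<le> f s"
  shows "((\<lambda>s. sqrt (f s)) \<longlongrightarrow> 0) F \<longleftrightarrow> (f \<longlongrightarrow> 0) F"
proof
  assume "((\<lambda>s. sqrt (f s)) \<longlongrightarrow> 0) F"
  then have "((\<lambda>s. (sqrt (f s))\<^sup>2) \<longlongrightarrow> 0\<^sup>2) F" by (rule tendsto_power)
  then show "(f \<longlongrightarrow> 0) F" using assms by simp
next
  assume "(f \<longlongrightarrow> 0) F"
  from tendsto_real_sqrt[OF this] show "((\<lambda>s. sqrt (f s)) \<longlongrightarrow> 0) F" by simp
qed

lemma continuous_L2_iff:
  "continuous_L2 \<tau> w \<longleftrightarrow> (\<forall>t \<in> {0..\<tau>}. w t \<in> L2 0 1) \<and>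
     (\<forall>t \<in> {0..\<tau>}. ((\<lambda>s. sq 0 1 (\<lambda>x. w s x - w t x)) \<longlongrightarrow> 0) (at t within {0..\<tau>}))"
proof -
  have "((\<lambda>s. L2_norm 0 1 (\<lambda>x. w s x - w t x)) \<longlongrightarrow> 0) (at t within {0..\<tau>}) \<longleftrightarrow>
      ((\<lambda>s. sq 0 1 (\<lambda>x. w s x - w t x)) \<longlongrightarrow> 0) (at t within {0..\<tau>})"
    if w: "\<forall>t \<in> {0..\<tau>}. w t \<in> L2 0 1" and t: "t \<in> {0..\<tau>}" for t
  proof -
    have "((\<lambda>s. L2_norm 0 1 (\<lambda>x. w s x - w t x)) \<longlongrightarrow> 0) (at t within {0..\<tau>}) \<longleftrightarrow>
      ((\<lambda>s. sqrt (sq 0 1 (\<lambda>x. w s x - w t x))) \<longlongrightarrow> 0) (at t within {0..\<tau>})"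
      by (rule filterlim_cong) (use w t in \<open>auto simp: eventually_at_filter L2_norm_eq L2_minus\<close>)
    also have "\<dots> \<longleftrightarrow> ((\<lambda>s. sq 0 1 (\<lambda>x. w s x - w t x)) \<longlongrightarrow> 0) (at t within {0..\<tau>})"
      by (rule tendsto_sqrt_iff) (rule sq_nonneg)
    finally show ?thesis .
  qed
  then show ?thesis unfolding continuous_L2_def by blast
qed

lemma continuous_L2D:
  assumes "continuous_L2 \<tau> w" "t \<in> {0..\<tau>}"
  shows "w t \<in> L2 0 1" "((\<lambda>s. sq 0 1 (\<lambda>x. w s x - w t x)) \<longlongrightarrow> 0) (at t within {0..\<tau>})"
  using assms by (auto simp: continuous_L2_iff)

lemma tendsto_zero_bound:
  fixes f g :: "real \<Rightarrow> real"
  assumes "(g \<longlongrightarrow> 0) (at t within S)" "\<And>s. s \<in> S \<Longrightarrow> 0 \<le> f s" "\<And>s. s \<in> S \<Longrightarrow> f s \<le> g s"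
  shows "(f \<longlongrightarrow> 0) (at t within S)"
  by (rule tendsto_sandwich[OF _ _ tendsto_const assms(1)]) (auto simp: eventually_at_filter assms)

lemma continuous_L2_add:
  assumes "continuous_L2 \<tau> v" "continuous_L2 \<tau> w"
  shows "continuous_L2 \<tau> (\<lambda>t x. v t x + w t x)"
  unfolding continuous_L2_iff
proof (intro conjI ballI)
  fix t assume t: "t \<in> {0..\<tau>}"
  show "(\<lambda>x. v t x + w t x) \<in> L2 0 1" by (intro L2_add continuous_L2D[OF _ t] assms)
  show "((\<lambda>s. sq 0 1 (\<lambda>x. (v s x + w s x) - (v t x + w t x))) \<longlongrightarrow> 0) (at t within {0..\<tau>})"
  proof (rule tendsto_zero_bound)
    show "((\<lambda>s. 2 * sq 0 1 (\<lambda>x. v s x - v t x) + 2 * sq 0 1 (\<lambda>x. w s x - w t x)) \<longlongrightarrow> 0) (at t within {0..\<tau>})"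
      using continuous_L2D(2)[OF assms(1) t] continuous_L2D(2)[OF assms(2) t]
      by (auto intro!: tendsto_eq_intros)
    fix s assume s: "s \<in> {0..\<tau>}"
    show "sq 0 1 (\<lambda>x. (v s x + w s x) - (v t x + w t x)) \<le> 2 * sq 0 1 (\<lambda>x. v s x - v t x) + 2 * sq 0 1 (\<lambda>x. w s x - w t x)"
      using sq_add_le[OF L2_minus[OF continuous_L2D(1)[OF assms(1) s] continuous_L2D(1)[OF assms(1) t]]
          L2_minus[OF continuous_L2D(1)[OF assms(2) s] continuous_L2D(1)[OF assms(2) t]]]
      by (simp add: algebra_simps)
  qed (rule sq_nonneg)
qed

lemma continuous_L2_scale:
  assumes w: "continuous_L2 \<tau> w" and c: "continuous_on {0..\<tau>} c"
  shows "continuous_L2 \<tau> (\<lambda>t x. c t * w t x)"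
  unfolding continuous_L2_iff
proof (intro conjI ballI)
  fix t assume t: "t \<in> {0..\<tau>}"
  show "(\<lambda>x. c t * w t x) \<in> L2 0 1" by (intro L2_cmult continuous_L2D[OF _ t] assms)
  have ct: "(c \<longlongrightarrow> c t) (at t within {0..\<tau>})" using c t by (auto simp: continuous_on_def)
  show "((\<lambda>s. sq 0 1 (\<lambda>x. c s * w s x - c t * w t x)) \<longlongrightarrow> 0) (at t within {0..\<tau>})"
  proof (rule tendsto_zero_bound)
    show "((\<lambda>s. 2 * ((c s)\<^sup>2 * sq 0 1 (\<lambda>x. w s x - w t x)) + 2 * ((c s - c t)\<^sup>2 * sq 0 1 (w t))) \<longlongrightarrow> 0) (at t within {0..\<tau>})"
      using continuous_L2D(2)[OF w t] ct by (auto intro!: tendsto_eq_intros)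
    fix s assume s: "s \<in> {0..\<tau>}"
    have "sq 0 1 (\<lambda>x. c s * w s x - c t * w t x) = sq 0 1 (\<lambda>x. c s * (w s x - w t x) + (c s - c t) * w t x)"
      by (simp add: algebra_simps)
    also have "\<dots> \<le> 2 * sq 0 1 (\<lambda>x. c s * (w s x - w t x)) + 2 * sq 0 1 (\<lambda>x. (c s - c t) * w t x)"
      by (intro sq_add_le L2_cmult L2_minus continuous_L2D(1)[OF w] s t)
    finally show "sq 0 1 (\<lambda>x. c s * w s x - c t * w t x) \<le>
        2 * ((c s)\<^sup>2 * sq 0 1 (\<lambda>x. w s x - w t x)) + 2 * ((c s - c t)\<^sup>2 * sq 0 1 (w t))"
      by (simp only: sq_cmult)
  qed (rule sq_nonneg)
qed

lemma continuous_L2_diff: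
  "continuous_L2 \<tau> v \<Longrightarrow> continuous_L2 \<tau> w \<Longrightarrow> continuous_L2 \<tau> (\<lambda>t x. v t x - w t x)"
  using continuous_L2_add[of \<tau> v "\<lambda>t x. -1 * w t x"] continuous_L2_scale[of \<tau> w "\<lambda>t. -1"]
  by simp

lemma continuous_L2_subset: "continuous_L2 \<tau> w \<Longrightarrow> \<sigma> \<le> \<tau> \<Longrightarrow> continuous_L2 \<sigma> w"
  unfolding continuous_L2_iff
  by (auto intro!: tendsto_within_subset[where S = "{0..\<tau>}" and T = "{0..\<sigma>}"])

lemma continuous_L2_continuous:
  assumes "continuous_on ({0..\<tau>} \<times> {0..1}) (\<lambda>z. g (fst z) (snd z))"
  shows "continuous_L2 \<tau> g"
  unfolding continuous_L2_iff
proof (intro conjI ballI)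
  have gt: "continuous_on {0..1} (g t)" if "t \<in> {0..\<tau>}" for t
    by (rule continuous_on_compose2[OF assms, of "{0..1}" "\<lambda>x. (t, x)", simplified])
      (use that in \<open>auto intro!: continuous_intros\<close>)
  fix t assume t: "t \<in> {0..\<tau>}"
  show "g t \<in> L2 0 1" by (intro L2_continuous gt t)
  have "continuous_on {0..\<tau>} (\<lambda>s. integral (cbox 0 1) (\<lambda>x. (g s x - g t x)\<^sup>2))"
  proof (rule integral_continuous_on_param)
    have "continuous_on ({0..\<tau>} \<times> {0..1}) (\<lambda>z. g t (snd z))"
      by (rule continuous_on_compose2[OF gt[OF t]]) (auto intro!: continuous_intros)
    then show "continuous_on ({0..\<tau>} \<times> cbox 0 1) (\<lambda>(s, x). (g s x - g t x)\<^sup>2)"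
      using assms by (auto simp: split_beta' intro!: continuous_intros)
  qed
  from bspec[OF this[unfolded continuous_on_def] t]
  have "((\<lambda>s. sq 0 1 (\<lambda>x. g s x - g t x)) \<longlongrightarrow> sq 0 1 (\<lambda>x. g t x - g t x)) (at t within {0..\<tau>})"
    by (simp add: sq_def)
  moreover have "sq 0 1 (\<lambda>x. g t x - g t x) = 0" by (simp add: sq_def)
  ultimately show "((\<lambda>s. sq 0 1 (\<lambda>x. g s x - g t x)) \<longlongrightarrow> 0) (at t within {0..\<tau>})"
    by simp
qed

text \<open>Norm convergence implies weak convergence, by Cauchy-Schwarz.\<close>

lemma tendsto_integral_mult:
  fixes d :: "real \<Rightarrow> real \<Rightarrow> real"
  assumes "\<And>s. s \<in> S \<Longrightarrow> d s \<in> L2 0 1" "V \<in> L2 0 1" "((\<lambda>s. sq 0 1 (d s)) \<longlongrightarrow> 0) (at t within S)"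
  shows "((\<lambda>s. integral {0..1} (\<lambda>x. d s x * V x)) \<longlongrightarrow> 0) (at t within S)"
proof -
  have "((\<lambda>s. (integral {0..1} (\<lambda>x. d s x * V x))\<^sup>2) \<longlongrightarrow> 0) (at t within S)"
  proof (rule tendsto_zero_bound)
    show "((\<lambda>s. sq 0 1 (d s) * sq 0 1 V) \<longlongrightarrow> 0) (at t within S)"
      using assms(3) by (auto intro!: tendsto_eq_intros)
  qed (use assms(1,2) in \<open>auto intro: integral_Cauchy_Schwarz\<close>)
  then have "((\<lambda>s. sqrt ((integral {0..1} (\<lambda>x. d s x * V x))\<^sup>2)) \<longlongrightarrow> 0) (at t within S)"
    by (subst tendsto_sqrt_iff) auto
  then show ?thesis by (simp add: tendsto_rabs_zero_iff)
qed

lemma continuous_L2_inner: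
  assumes w: "continuous_L2 \<tau> w" and V: "V \<in> L2 0 1"
  shows "continuous_on {0..\<tau>} (\<lambda>t. integral {0..1} (\<lambda>x. w t x * V x))"
  unfolding continuous_on_def
proof
  fix t assume t: "t \<in> {0..\<tau>}"
  have "((\<lambda>s. integral {0..1} (\<lambda>x. (w s x - w t x) * V x)) \<longlongrightarrow> 0) (at t within {0..\<tau>})"
    by (intro tendsto_integral_mult V continuous_L2D[OF w] L2_minus t)
  then have "((\<lambda>s. integral {0..1} (\<lambda>x. (w s x - w t x) * V x) + integral {0..1} (\<lambda>x. w t x * V x)) \<longlongrightarrow>
      0 + integral {0..1} (\<lambda>x. w t x * V x)) (at t within {0..\<tau>})"
    by (intro tendsto_intros)
  moreover have "integral {0..1} (\<lambda>x. (w s x - w t x) * V x) + integral {0..1} (\<lambda>x. w t x * V x) =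
      integral {0..1} (\<lambda>x. w s x * V x)" if "s \<in> {0..\<tau>}" for s
    using L2_mult_abs_int(2)[OF continuous_L2D(1)[OF w that] V] L2_mult_abs_int(2)[OF continuous_L2D(1)[OF w t] V]
    by (simp add: left_diff_distrib Henstock_Kurzweil_Integration.integral_diff)
  ultimately show "((\<lambda>s. integral {0..1} (\<lambda>x. w s x * V x)) \<longlongrightarrow> integral {0..1} (\<lambda>x. w t x * V x)) (at t within {0..\<tau>})"
    by (auto intro: Lim_transform_within_set_eq[THEN iffD1] elim!: Lim_transform_eventually simp: eventually_at_filter)
qed

lemma C1_L2_D:
  assumes "has_C1_L2_deriv \<tau> u u'" "t \<in> {0..\<tau>}"
  shows "((\<lambda>s. sq 0 1 (\<lambda>x. (u s x - u t x) / (s - t) - u' t x)) \<longlongrightarrow> 0) (at t within {0..\<tau>})"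
proof -
  have u: "continuous_L2 \<tau> u" "continuous_L2 \<tau> u'" using assms by (auto simp: has_C1_L2_deriv_def)
  have "((\<lambda>s. L2_norm 0 1 (\<lambda>x. (u s x - u t x) / (s - t) - u' t x)) \<longlongrightarrow> 0) (at t within {0..\<tau>})"
    using assms by (auto simp: has_C1_L2_deriv_def)
  moreover have "L2_norm 0 1 (\<lambda>x. (u s x - u t x) / (s - t) - u' t x) = sqrt (sq 0 1 (\<lambda>x. (u s x - u t x) / (s - t) - u' t x))"
    if "s \<in> {0..\<tau>}" for s
    using L2_cmult[OF L2_minus[OF continuous_L2D(1)[OF u(1) that] continuous_L2D(1)[OF u(1) assms(2)]], of "1 / (s - t)"]
    by (intro L2_norm_eq L2_minus continuous_L2D(1)[OF u(2) assms(2)]) simp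
  ultimately have "((\<lambda>s. sqrt (sq 0 1 (\<lambda>x. (u s x - u t x) / (s - t) - u' t x))) \<longlongrightarrow> 0) (at t within {0..\<tau>})"
    by (auto elim!: Lim_transform_eventually simp: eventually_at_filter)
  then show ?thesis by (subst (asm) tendsto_sqrt_iff) (rule sq_nonneg)
qed

text \<open>Testing with a fixed \<open>V\<close> turns the derivative in L2 into an ordinary one;
  scalar equations in time are obtained in this way.\<close>

lemma C1_L2_inner_DERIV:
  assumes u: "has_C1_L2_deriv \<tau> u u'" and V: "V \<in> L2 0 1" and t: "t \<in> {0..\<tau>}"
  shows "((\<lambda>t. integral {0..1} (\<lambda>x. u t x * V x)) has_real_derivative integral {0..1} (\<lambda>x. u' t x * V x)) (at t within {0..\<tau>})"
proof -
  have c: "continuous_L2 \<tau> u" "continuous_L2 \<tau> u'" using u by (auto simp: has_C1_L2_deriv_def)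
  define q where "q = (\<lambda>s x. (u s x - u t x) / (s - t) - u' t x)"
  have qL: "q s \<in> L2 0 1" if "s \<in> {0..\<tau>}" for s
    using L2_cmult[OF L2_minus[OF continuous_L2D(1)[OF c(1) that] continuous_L2D(1)[OF c(1) t]], of "1 / (s - t)"]
    unfolding q_def by (intro L2_minus continuous_L2D(1)[OF c(2) t]) simp
  have "((\<lambda>s. integral {0..1} (\<lambda>x. q s x * V x)) \<longlongrightarrow> 0) (at t within {0..\<tau>})"
    using qL V C1_L2_D[OF u t] by (intro tendsto_integral_mult) (auto simp: q_def)
  then have "((\<lambda>s. integral {0..1} (\<lambda>x. q s x * V x) + integral {0..1} (\<lambda>x. u' t x * V x)) \<longlongrightarrow>
      0 + integral {0..1} (\<lambda>x. u' t x * V x)) (at t within {0..\<tau>})"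
    by (intro tendsto_intros)
  moreover have "integral {0..1} (\<lambda>x. q s x * V x) + integral {0..1} (\<lambda>x. u' t x * V x) =
      (integral {0..1} (\<lambda>x. u s x * V x) - integral {0..1} (\<lambda>x. u t x * V x)) / (s - t)"
    if s: "s \<in> {0..\<tau>}" "s \<noteq> t" for s
  proof -
    have i: "(\<lambda>x. u s x * V x) integrable_on {0..1}" "(\<lambda>x. u t x * V x) integrable_on {0..1}"
      "(\<lambda>x. u' t x * V x) integrable_on {0..1}" "(\<lambda>x. q s x * V x) integrable_on {0..1}"
      using L2_mult_abs_int(2)[OF _ V] qL[OF s(1)] continuous_L2D(1)[OF c(1)] continuous_L2D(1)[OF c(2)] s t by auto
    have "integral {0..1} (\<lambda>x. q s x * V x) + integral {0..1} (\<lambda>x. u' t x * V x) =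
        integral {0..1} (\<lambda>x. q s x * V x + u' t x * V x)"
      using i by (simp add: Henstock_Kurzweil_Integration.integral_add)
    also have "\<dots> = integral {0..1} (\<lambda>x. (1 / (s - t)) * (u s x * V x - u t x * V x))"
      by (intro integral_cong) (simp add: q_def algebra_simps add_divide_distrib diff_divide_distrib)
    also have "\<dots> = (integral {0..1} (\<lambda>x. u s x * V x) - integral {0..1} (\<lambda>x. u t x * V x)) / (s - t)"
      using i by (simp add: Henstock_Kurzweil_Integration.integral_diff)
    finally show ?thesis .
  qed
  ultimately show ?thesis
    unfolding has_field_derivative_iff by (auto elim!: Lim_transform_eventually simp: eventually_at_filter)
qed

section \<open>Curves in L2\<close>

lemma integral_mono_AE_Ioo:
  fixes f g :: "real \<Rightarrow> real"
  assumes "f integrable_on {a..b}" "g integrable_on {a..b}" "AE x in lebesgue_on {a<..<b}. f x \<le> g x"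
  shows "integral {a..b} f \<le> integral {a..b} g"
proof -
  obtain N where N: "negligible N" "\<And>x. x \<in> {a..b} \<Longrightarrow> x \<notin> N \<Longrightarrow> f x \<le> g x"
    by (rule AE_IooE[OF assms(3)]) blast
  define g' where "g' = (\<lambda>x. if x \<in> N then f x else g x)"
  have "g' integrable_on {a..b}"
    by (rule integrable_spike[OF assms(2) N(1)]) (simp add: g'_def)
  then have "integral {a..b} f \<le> integral {a..b} g'"
    using N(2) assms(1) by (intro integral_le) (auto simp: g'_def)
  also have "\<dots> = integral {a..b} g"
    by (rule integral_spike[OF N(1)]) (simp add: g'_def)
  finally show ?thesis .
qed

lemma borel_L2I:
  assumes "f \<in> borel_measurable borel" "(\<lambda>x. (f x)\<^sup>2) absolutely_integrable_on {a..b}"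
  shows "f \<in> L2 a b"
proof -
  have "f \<in> borel_measurable lebesgue"
    using assms(1) by (simp add: measurable_completion)
  then have "f \<in> borel_measurable (lebesgue_on {a<..<b})"
    by (rule measurable_restrict_space1)
  then show ?thesis using LINT_Ioo(2)[OF assms(2)] by (simp add: L2_def)
qed

text \<open>The difference quotient is an average of \<open>u'\<close>, so by Jensen's inequality its distance to \<open>u' t\<close>
  is at most the average of the distances.\<close>

lemma C1_L2_I:
  assumes u: "continuous_L2 \<tau> u" and u': "continuous_L2 \<tau> u'"
    and meas: "(\<lambda>z. u' (fst z) (snd z)) \<in> borel_measurable (borel \<Otimes>\<^sub>M borel)"
    and eq: "\<And>s t x. 0 \<le> s \<Longrightarrow> s \<le> t \<Longrightarrow> t \<le> \<tau> \<Longrightarrow> x \<in> {0..1} \<Longrightarrow> u t x - u s x = integral {s..t} (\<lambda>r. u' r x)"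
  shows "has_C1_L2_deriv \<tau> u u'"
  unfolding has_C1_L2_deriv_def
proof (intro conjI ballI u u')
  fix t assume t: "t \<in> {0..\<tau>}"
  have m2: "(\<lambda>r. u' r x) \<in> borel_measurable borel" for x
    using measurable_compose[OF measurable_Pair2' meas, of x] by simp
  have m1[measurable]: "u' r \<in> borel_measurable borel" for r
    using measurable_compose[OF measurable_Pair1' meas, of r] by simp
  define q where "q = (\<lambda>s x. (u s x - u t x) / (s - t) - u' t x)"
  have qL: "q s \<in> L2 0 1" if "s \<in> {0..\<tau>}" for s
    using L2_cmult[OF L2_minus[OF continuous_L2D(1)[OF u that] continuous_L2D(1)[OF u t]], of "1 / (s - t)"]
    unfolding q_def by (intro L2_minus continuous_L2D(1)[OF u' t]) simp
  have key: "sq 0 1 (q s) \<le> e"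
    if s: "s \<in> {0..\<tau>}" "s \<noteq> t" and e: "\<And>r. r \<in> {min s t..max s t} \<Longrightarrow> sq 0 1 (\<lambda>x. u' r x - u' t x) \<le> e" for s e
  proof -
    define p d where "p = min s t" and "d = max s t"
    have pd: "p < d" "0 \<le> p" "d \<le> \<tau>" using s t by (auto simp: p_def d_def)
    have quot: "(u s x - u t x) / (s - t) = (u d x - u p x) / (d - p)" for x
      using s(2) by (cases "s < t") (auto simp: p_def d_def divide_simps algebra_simps)
    define f where "f = (\<lambda>r x. (u' r x - u' t x)\<^sup>2)"
    have fm: "(\<lambda>z. f (fst z) (snd z)) \<in> borel_measurable (borel \<Otimes>\<^sub>M borel)"
      unfolding f_def using meas by measurable
    have fi: "f r absolutely_integrable_on {0..1}" if "r \<in> {p..d}" for r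
      unfolding f_def using that pd by (intro L2D(2) L2_minus continuous_L2D(1)[OF u'] t) auto
    have fb: "integral {0..1} (\<lambda>x. \<bar>f r x\<bar>) \<le> e" if "r \<in> {p..d}" for r
      using e[of r] that by (simp add: f_def sq_def p_def d_def)
    have fub: "integral {p..d} (\<lambda>r. integral {0..1} (f r)) = integral {0..1} (\<lambda>x. integral {p..d} (\<lambda>r. f r x))"
      "(\<lambda>x. integral {p..d} (\<lambda>r. f r x)) absolutely_integrable_on {0..1}"
      "(\<lambda>r. integral {0..1} (f r)) absolutely_integrable_on {p..d}"
      "AE x in lebesgue_on {0<..<1}. (\<lambda>r. f r x) absolutely_integrable_on {p..d}"
      by (rule fubini_Icc[OF fm fi fb integrable_const_ivl]; assumption)+
    have "AE x in lebesgue_on {0<..<1::real}. x \<in> {0..1}"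
      by (rule AE_IooI[of "{}"]) auto
    with fub(4) have ae: "AE x in lebesgue_on {0<..<1}. (q s x)\<^sup>2 \<le> (1 / (d - p)) * integral {p..d} (\<lambda>r. f r x)"
    proof eventually_elim
      case (elim x)
      define D where "D = (\<lambda>r. u' r x - u' t x)"
      have DL: "D \<in> L2 p d"
        using elim(1) m2[of x] by (intro borel_L2I) (auto simp: D_def f_def)
      have "(\<lambda>r. D r + u' t x) integrable_on {p..d}"
        using L2D(3)[OF DL] by (intro integrable_add) auto
      then have i: "(\<lambda>r. u' r x) integrable_on {p..d}" by (simp add: D_def)
      have "integral {p..d} D = (u d x - u p x) - (d - p) * u' t x"
        unfolding D_def using i pd elim(2) eq[of p d x]
        by (subst Henstock_Kurzweil_Integration.integral_diff) auto
      then have "q s x = integral {p..d} D / (d - p)"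
        using pd unfolding q_def quot by (simp add: diff_divide_distrib)
      then have "(q s x)\<^sup>2 = (integral {p..d} D)\<^sup>2 / (d - p)\<^sup>2" by (simp add: power_divide)
      also have "\<dots> \<le> ((d - p) * sq p d D) / (d - p)\<^sup>2"
        using integral_square_le[OF DL] pd by (intro divide_right_mono) auto
      also have "\<dots> = (1 / (d - p)) * sq p d D"
        using pd by (simp add: power2_eq_square)
      finally show ?case by (simp add: sq_def D_def f_def)
    qed
    have "sq 0 1 (q s) \<le> integral {0..1} (\<lambda>x. (1 / (d - p)) * integral {p..d} (\<lambda>r. f r x))"
      unfolding sq_def using L2D(4)[OF qL[OF s(1)]] ae set_lebesgue_integral_eq_integral(1)[OF fub(2)]
      by (intro integral_mono_AE_Ioo integrable_on_mult_right)
    also have "\<dots> = (1 / (d - p)) * integral {p..d} (\<lambda>r. integral {0..1} (f r))"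
      by (simp add: fub(1))
    also have "\<dots> \<le> (1 / (d - p)) * integral {p..d} (\<lambda>r. e)"
    proof (intro mult_left_mono integral_le)
      show "integral {0..1} (f r) \<le> e" if "r \<in> {p..d}" for r
        using fb[OF that] by (simp add: f_def)
    qed (use pd set_lebesgue_integral_eq_integral(1)[OF fub(3)] in auto)
    also have "\<dots> = e" using pd by simp
    finally show ?thesis .
  qed
  have "((\<lambda>s. sq 0 1 (q s)) \<longlongrightarrow> 0) (at t within {0..\<tau>})"
  proof (rule tendstoI)
    fix e :: real assume "e > 0"
    \<comment> \<open>Half of \<open>e\<close>, since averaging yields only a non-strict
      bound.\<close>
    then have "eventually (\<lambda>r. dist (sq 0 1 (\<lambda>x. u' r x - u' t x)) 0 < e / 2) (at t within {0..\<tau>})"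
      by (intro tendstoD[OF continuous_L2D(2)[OF u' t]]) simp
    then obtain \<delta> where \<delta>: "\<delta> > 0" "\<And>r. r \<in> {0..\<tau>} \<Longrightarrow> r \<noteq> t \<Longrightarrow> dist r t < \<delta> \<Longrightarrow> sq 0 1 (\<lambda>x. u' r x - u' t x) < e / 2"
      using sq_nonneg unfolding eventually_at by auto
    have "dist (sq 0 1 (q s)) 0 < e" if s: "s \<in> {0..\<tau>}" "s \<noteq> t" "dist s t < \<delta>" for s
    proof -
      have "sq 0 1 (q s) \<le> e / 2"
      proof (rule key[OF s(1,2)])
        fix r assume r: "r \<in> {min s t..max s t}"
        show "sq 0 1 (\<lambda>x. u' r x - u' t x) \<le> e / 2"
        proof (cases "r = t")
          case True
          then show ?thesis using \<open>e > 0\<close> by (simp add: sq_def)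
        next
          case False
          then show ?thesis
            using r s t by (intro less_imp_le \<delta>(2)) (auto simp: dist_real_def min_def max_def split: if_splits)
        qed
      qed
      then show ?thesis using \<open>e > 0\<close> sq_nonneg[of 0 1 "q s"] by simp
    qed
    then show "eventually (\<lambda>s. dist (sq 0 1 (q s)) 0 < e) (at t within {0..\<tau>})"
      unfolding eventually_at using \<delta>(1) by blast
  qed
  then have "((\<lambda>s. sqrt (sq 0 1 (q s))) \<longlongrightarrow> 0) (at t within {0..\<tau>})"
    by (subst tendsto_sqrt_iff) (rule sq_nonneg)
  moreover have "L2_norm 0 1 (q s) = sqrt (sq 0 1 (q s))" if "s \<in> {0..\<tau>}" for s
    by (rule L2_norm_eq[OF qL[OF that]])
  ultimately have "((\<lambda>s. L2_norm 0 1 (q s)) \<longlongrightarrow> 0) (at t within {0..\<tau>})"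
    by (auto elim!: Lim_transform_eventually simp: eventually_at_filter)
  then show "((\<lambda>s. L2_norm 0 1 (\<lambda>x. (u s x - u t x) / (s - t) - u' t x)) \<longlongrightarrow> 0) (at t within {0..\<tau>})"
    by (simp add: q_def)
qed

text \<open>\<open>f\<close> is clipped at a large height \<open>M\<close>, with an error dominated
  by its own square. A measurable function is a pointwise limit of continuous ones off a null set,
  and once these are clipped too, a constant dominates the convergence.\<close>

lemma L2_dense_continuous:
  assumes f: "f \<in> L2 p q" and "\<epsilon> > 0"
  obtains g where "continuous_on UNIV g" "sq p q (\<lambda>x. f x - g x) < \<epsilon>"
proof -
  define cl :: "nat \<Rightarrow> real \<Rightarrow> real" where "cl = (\<lambda>M y. max (- real M) (min (real M) y))"
  have clb: "\<bar>cl M y\<bar> \<le> real M" for M y by (auto simp: cl_def)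
  have clc: "continuous_on S (cl M)" for S M
    unfolding cl_def by (intro continuous_intros)
  have fm: "f \<in> borel_measurable (lebesgue_on {p..q})"
    by (intro absolutely_integrable_imp_borel_measurable L2D(1)[OF f]) auto
  then have "f measurable_on {p..q}"
    by (subst measurable_on_iff_borel_measurable) auto
  then obtain N g where N: "negligible N" and g: "\<And>n. continuous_on UNIV (g n)"
    and lim: "\<And>x. x \<notin> N \<Longrightarrow> (\<lambda>n. g n x) \<longlonglongrightarrow> (if x \<in> {p..q} then f x else 0)"
    unfolding measurable_on_def by blast
  have clf: "(\<lambda>x. cl M (f x)) \<in> L2 p q" for M
  proof -
    have "(\<lambda>x. cl M (f x)) \<in> borel_measurable (lebesgue_on {p..q})"
      by (rule measurable_compose[OF fm]) (rule borel_measurable_continuous_onI[OF clc])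
    then have m: "(\<lambda>x. cl M (f x)) \<in> borel_measurable (lebesgue_on {p..q})" "(\<lambda>x. (cl M (f x))\<^sup>2) \<in> borel_measurable (lebesgue_on {p..q})"
      by auto
    have "(\<lambda>x. cl M (f x)) absolutely_integrable_on {p..q}"
      by (rule measurable_bounded_by_integrable_imp_absolutely_integrable[OF m(1), where g = "\<lambda>_. real M"])
        (auto simp: clb)
    moreover have "(\<lambda>x. (cl M (f x))\<^sup>2) absolutely_integrable_on {p..q}"
      by (rule measurable_bounded_by_integrable_imp_absolutely_integrable[OF m(2), where g = "\<lambda>_. (real M)\<^sup>2"])
        (rule integrable_const_ivl | simp add: clb abs_le_square_iff[symmetric])+
    ultimately show ?thesis by (simp add: L2_iff)
  qed
  have clg: "(\<lambda>x. cl M (g n x)) \<in> L2 p q" for M n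
    by (intro L2_continuous continuous_on_compose2[OF clc continuous_on_subset[OF g]]) auto
  have "(\<lambda>M. sq p q (\<lambda>x. f x - cl M (f x))) \<longlonglongrightarrow> integral {p..q} (\<lambda>x. 0::real)"
    unfolding sq_def
  proof (rule dominated_convergence(2)[where h = "\<lambda>x. (f x)\<^sup>2"])
    show "(\<lambda>x. (f x - cl M (f x))\<^sup>2) integrable_on {p..q}" for M
      by (intro L2D(4) L2_minus f clf)
    show "norm ((f x - cl M (f x))\<^sup>2) \<le> (f x)\<^sup>2" for M x
      by (auto simp: cl_def abs_le_square_iff[symmetric])
    show "(\<lambda>M. (f x - cl M (f x))\<^sup>2) \<longlonglongrightarrow> 0" for x
    proof (rule tendsto_eventually)
      obtain M0 where "\<bar>f x\<bar> \<le> real M0" using real_arch_simple by blast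
      then show "eventually (\<lambda>M. (f x - cl M (f x))\<^sup>2 = 0) sequentially"
        unfolding eventually_sequentially by (intro exI[of _ M0]) (auto simp: cl_def)
    qed
  qed (use L2D(4)[OF f] in auto)
  \<comment> \<open>\<open>sq_add_le\<close> doubles both errors, so each of them may take a
    quarter.\<close>
  then have "eventually (\<lambda>M. sq p q (\<lambda>x. f x - cl M (f x)) < \<epsilon> / 4) sequentially"
    using \<open>\<epsilon> > 0\<close> by (intro order_tendstoD(2)) auto
  then obtain M where M: "sq p q (\<lambda>x. f x - cl M (f x)) < \<epsilon> / 4"
    by (auto simp: eventually_sequentially)
  define h where "h = (\<lambda>n x. if x \<in> N then 0 else (cl M (f x) - cl M (g n x))\<^sup>2)"
  have h: "h n integrable_on {p..q}" "integral {p..q} (h n) = sq p q (\<lambda>x. cl M (f x) - cl M (g n x))" for n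
  proof -
    have "(\<lambda>x. (cl M (f x) - cl M (g n x))\<^sup>2) integrable_on {p..q}"
      by (intro L2D(4) L2_minus clf clg)
    then show "h n integrable_on {p..q}"
      by (rule integrable_spike[OF _ N]) (simp add: h_def)
    show "integral {p..q} (h n) = sq p q (\<lambda>x. cl M (f x) - cl M (g n x))"
      unfolding sq_def by (rule integral_spike[OF N]) (simp add: h_def)
  qed
  have "(\<lambda>n. integral {p..q} (h n)) \<longlonglongrightarrow> integral {p..q} (\<lambda>x. 0::real)"
  proof (rule dominated_convergence(2)[OF h(1), where h = "\<lambda>x. (2 * real M)\<^sup>2"])
    show "norm (h n x) \<le> (2 * real M)\<^sup>2" for n x
    proof -
      have "\<bar>cl M (f x) - cl M (g n x)\<bar> \<le> \<bar>2 * real M\<bar>"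
        using clb[of M "f x"] clb[of M "g n x"] by linarith
      then have "(cl M (f x) - cl M (g n x))\<^sup>2 \<le> (2 * real M)\<^sup>2"
        by (simp only: abs_le_square_iff)
      then show ?thesis by (cases "x \<in> N") (simp_all add: h_def)
    qed
    show "(\<lambda>n. h n x) \<longlonglongrightarrow> 0" if "x \<in> {p..q}" for x
    proof (cases "x \<in> N")
      case False
      have "isCont (cl M) (f x)" using clc[of UNIV M] by (simp add: continuous_on_eq_continuous_at)
      moreover have "(\<lambda>n. g n x) \<longlonglongrightarrow> f x" using lim[OF False] that by simp
      ultimately have "(\<lambda>n. cl M (g n x)) \<longlonglongrightarrow> cl M (f x)" by (rule isCont_tendsto_compose)
      then have "(\<lambda>n. (cl M (f x) - cl M (g n x))\<^sup>2) \<longlonglongrightarrow> (cl M (f x) - cl M (f x))\<^sup>2"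
        by (intro tendsto_intros)
      then show ?thesis using False by (simp add: h_def)
    qed (simp add: h_def)
  qed auto
  then have "eventually (\<lambda>n. integral {p..q} (h n) < \<epsilon> / 4) sequentially"
    using \<open>\<epsilon> > 0\<close> by (intro order_tendstoD(2)) auto
  then obtain n where n: "sq p q (\<lambda>x. cl M (f x) - cl M (g n x)) < \<epsilon> / 4"
    by (auto simp: eventually_sequentially h(2))
  show thesis
  proof (rule that)
    show "continuous_on UNIV (\<lambda>x. cl M (g n x))"
      by (intro continuous_on_compose2[OF clc g]) auto
    have "sq p q (\<lambda>x. f x - cl M (g n x)) = sq p q (\<lambda>x. (f x - cl M (f x)) + (cl M (f x) - cl M (g n x)))"
      by simp
    also have "\<dots> \<le> 2 * sq p q (\<lambda>x. f x - cl M (f x)) + 2 * sq p q (\<lambda>x. cl M (f x) - cl M (g n x))"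
      by (intro sq_add_le L2_minus f clf clg)
    finally show "sq p q (\<lambda>x. f x - cl M (g n x)) < \<epsilon>" using M n by linarith
  qed
qed

lemma abs_int_shift:
  fixes f :: "real \<Rightarrow> real"
  assumes "f absolutely_integrable_on {c..d}"
  shows "(\<lambda>x. f (x + h)) absolutely_integrable_on {c - h..d - h}"
  using assms integrable_shift_real_ivl[of f c d h] integrable_shift_real_ivl[of "\<lambda>x. norm (f x)" c d h]
  by (simp add: absolutely_integrable_on_def)

lemma L2_shift: "f \<in> L2 c d \<Longrightarrow> (\<lambda>x. f (x + h)) \<in> L2 (c - h) (d - h)"
  using abs_int_shift[where f = f and c = c and d = d and h = h]
    abs_int_shift[where f = "\<lambda>x. (f x)\<^sup>2" and c = c and d = d and h = h] by (simp add: L2_iff)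

text \<open>(-1,2) is the region swept out by (0,1) under shifts of length at most 1, hence the
  domain of the wave profiles up to time 1.\<close>

lemma L2_shift_01:
  assumes "f \<in> L2 (-1) 2" "\<bar>h\<bar> \<le> 1"
  shows "(\<lambda>x. f (x + h)) \<in> L2 0 1" "sq 0 1 (\<lambda>x. f (x + h)) \<le> sq (-1) 2 f"
proof -
  have *: "(\<lambda>x. f (x + h)) \<in> L2 (-1 - h) (2 - h)" by (rule L2_shift[OF assms(1)])
  then show "(\<lambda>x. f (x + h)) \<in> L2 0 1" by (rule L2_subinterval) (use assms(2) in auto)
  then have "sq 0 1 (\<lambda>x. f (x + h)) \<le> sq (-1 - h) (2 - h) (\<lambda>x. f (x + h))"
    unfolding sq_def using assms(2) L2D(4)[OF *] L2D(4)[of "\<lambda>x. f (x + h)" 0 1] by (intro integral_subset_le) auto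
  also have "\<dots> = sq (-1) 2 f"
    unfolding sq_def by (rule integral_shift_real_ivl)
  finally show "sq 0 1 (\<lambda>x. f (x + h)) \<le> sq (-1) 2 f" .
qed

text \<open>Continuity of translations: clear for continuous profiles, while the norm of a
  translated remainder on (0,1) is bounded by its norm on (-1,2), uniformly in time.\<close>

lemma translation_continuous_L2:
  assumes a: "a \<in> L2 (-1) 2" and \<sigma>: "\<sigma> \<in> {-1, 1::real}"
  shows "continuous_L2 1 (\<lambda>t x. a (x + \<sigma> * t))"
  unfolding continuous_L2_iff
proof (intro conjI ballI)
  have h: "\<bar>\<sigma> * t\<bar> \<le> 1" if "t \<in> {0..1}" for t using \<sigma> that by (auto simp: abs_mult)
  fix t :: real assume t: "t \<in> {0..1}"
  show "(\<lambda>x. a (x + \<sigma> * t)) \<in> L2 0 1" by (intro L2_shift_01 a h t)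
  show "((\<lambda>s. sq 0 1 (\<lambda>x. a (x + \<sigma> * s) - a (x + \<sigma> * t))) \<longlongrightarrow> 0) (at t within {0..1})"
  proof (rule tendstoI)
    fix e :: real assume "e > 0"
    \<comment> \<open>The two translated remainders enter with weight 4 each and the continuous part
      with weight 2, so a 24th leaves room.\<close>
    then have "e / 24 > 0" by simp
    then obtain g where g: "continuous_on UNIV g" "sq (-1) 2 (\<lambda>x. a x - g x) < e / 24"
      by (rule L2_dense_continuous[OF a])
    define d where "d = (\<lambda>x. a x - g x)"
    have gL: "g \<in> L2 (-1) 2" by (rule L2_continuous[OF continuous_on_subset[OF g(1)]]) simp
    have dL: "d \<in> L2 (-1) 2" unfolding d_def by (intro L2_minus a gL)
    have cg: "continuous_L2 1 (\<lambda>s x. g (x + \<sigma> * s))"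
      by (intro continuous_L2_continuous continuous_on_compose2[OF g(1)]) (auto intro!: continuous_intros)
    have "eventually (\<lambda>s. sq 0 1 (\<lambda>x. g (x + \<sigma> * s) - g (x + \<sigma> * t)) < e / 24) (at t within {0..1})"
      using \<open>e > 0\<close> by (intro order_tendstoD(2)[OF continuous_L2D(2)[OF cg t]]) simp
    moreover have "eventually (\<lambda>s. s \<in> {0..1}) (at t within {0..1})"
      by (simp add: eventually_at_filter)
    ultimately show "eventually (\<lambda>s. dist (sq 0 1 (\<lambda>x. a (x + \<sigma> * s) - a (x + \<sigma> * t))) 0 < e) (at t within {0..1})"
    proof eventually_elim
      case (elim s)
      have ds: "(\<lambda>x. d (x + \<sigma> * s)) \<in> L2 0 1" "(\<lambda>x. d (x + \<sigma> * t)) \<in> L2 0 1"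
        "(\<lambda>x. g (x + \<sigma> * s)) \<in> L2 0 1" "(\<lambda>x. g (x + \<sigma> * t)) \<in> L2 0 1"
        by (intro L2_shift_01 dL gL h elim t)+
      have b: "sq 0 1 (\<lambda>x. d (x + \<sigma> * s)) < e / 24" "sq 0 1 (\<lambda>x. d (x + \<sigma> * t)) < e / 24"
        using L2_shift_01(2)[OF dL h[OF elim(2)]] L2_shift_01(2)[OF dL h[OF t]] g(2) by (auto simp: d_def)
      have "sq 0 1 (\<lambda>x. a (x + \<sigma> * s) - a (x + \<sigma> * t)) =
          sq 0 1 (\<lambda>x. (d (x + \<sigma> * s) + (- 1) * d (x + \<sigma> * t)) + (g (x + \<sigma> * s) - g (x + \<sigma> * t)))"
        by (simp add: d_def)
      also have "\<dots> \<le> 2 * sq 0 1 (\<lambda>x. d (x + \<sigma> * s) + (- 1) * d (x + \<sigma> * t)) +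
          2 * sq 0 1 (\<lambda>x. g (x + \<sigma> * s) - g (x + \<sigma> * t))"
        by (intro sq_add_le L2_add L2_minus L2_cmult ds)
      also have "sq 0 1 (\<lambda>x. d (x + \<sigma> * s) + (- 1) * d (x + \<sigma> * t)) \<le>
          2 * sq 0 1 (\<lambda>x. d (x + \<sigma> * s)) + 2 * sq 0 1 (\<lambda>x. (- 1) * d (x + \<sigma> * t))"
        by (intro sq_add_le L2_cmult ds)
      finally have "sq 0 1 (\<lambda>x. a (x + \<sigma> * s) - a (x + \<sigma> * t)) < e"
        using b elim(1) \<open>e > 0\<close> unfolding sq_cmult by simp
      then show ?case using sq_nonneg[of 0 1 "\<lambda>x. a (x + \<sigma> * s) - a (x + \<sigma> * t)"] by simp
    qed
  qed
qed

lemma AC_shift: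
  assumes "AC p q F f"
  shows "AC (p - h) (q - h) (\<lambda>x. F (x + h)) (\<lambda>x. f (x + h))"
  unfolding AC_def
proof (intro conjI ballI abs_int_shift ACD(1)[OF assms])
  fix x assume x: "x \<in> {p - h..q - h}"
  have "F (x + h) = F p + integral {p..x + h} f" by (rule ACD(3)[OF assms]) (use x in auto)
  also have "integral {p..x + h} f = integral {p - h..x} (\<lambda>x. f (x + h))"
    using integral_shift_real_ivl[of p h "x + h" f] by simp
  finally show "F (x + h) = F (p - h + h) + integral {p - h..x} (\<lambda>x. f (x + h))" by simp
qed

lemma AC_reflect:
  assumes "AC p q F f" "p \<le> q"
  shows "AC (- q) (- p) (\<lambda>x. F (- x)) (\<lambda>x. - f (- x))"
  unfolding AC_def
proof (intro conjI ballI)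
  have "(\<lambda>x. f (- x)) absolutely_integrable_on {- q..- p}"
    using ACD(1)[OF assms(1)] by simp
  then show "(\<lambda>x. - f (- x)) absolutely_integrable_on {- q..- p}"
    using set_integrable_mult_right[of "-1" lebesgue "{- q..- p}" "\<lambda>x. f (- x)"] by simp
  fix x assume x: "x \<in> {- q..- p}"
  have "F q - F (- x) = integral {- x..q} f" by (rule AC_diff[OF assms(1)]) (use x in auto)
  also have "\<dots> = integral {- q..x} (\<lambda>x. f (- x))"
    using Henstock_Kurzweil_Integration.integral_reflect_real[of q "- x" f] by simp
  finally show "F (- x) = F (- (- q)) + integral {- q..x} (\<lambda>x. - f (- x))" by simp
qed

lemma AC_characteristic:
  assumes F: "AC (-1) 2 F f" and \<sigma>: "\<sigma> \<in> {-1, 1::real}" and x: "x \<in> {0..1}"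
  shows "AC 0 1 (\<lambda>t. F (x + \<sigma> * t)) (\<lambda>t. \<sigma> * f (x + \<sigma> * t))"
proof -
  have A: "AC (-1 - x) (2 - x) (\<lambda>t. F (t + x)) (\<lambda>t. f (t + x))" by (rule AC_shift[OF F])
  from \<sigma> consider "\<sigma> = 1" | "\<sigma> = -1" by auto
  then show ?thesis
  proof cases
    case 1
    show ?thesis using AC_subinterval[OF A, of 0 1] x 1 by (simp add: add.commute)
  next
    case 2
    have "AC (- (2 - x)) (- (-1 - x)) (\<lambda>t. F (- t + x)) (\<lambda>t. - f (- t + x))"
      by (rule AC_reflect[OF A]) simp
    from AC_subinterval[OF this, of 0 1] show ?thesis using x 2 by (simp add: add.commute)
  qed
qed

lemma AC_characteristic_space:
  assumes F: "AC (-1) 2 F f" and h: "\<bar>h\<bar> \<le> 1"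
  shows "AC 0 1 (\<lambda>x. F (x + h)) (\<lambda>x. f (x + h))"
  by (rule AC_subinterval[OF AC_shift[OF F]]) (use h in auto)

section \<open>Transport equations\<close>

lemma integral_rescale:
  fixes f :: "real \<Rightarrow> real"
  assumes "0 \<le> t"
  shows "integral {0..t} f = t * integral {0..1} (\<lambda>\<theta>. f (t * \<theta>))"
proof (cases "t = 0")
  case False
  then have "(\<lambda>x. x / t) ` {0..t} = {0..1}"
    using assms by (auto simp: image_divide_atLeastAtMost)
  then show ?thesis
    using integral_stretch_real[OF False, of 0 t f] assms False by simp
qed simp

text \<open>Rescaling to [0,1] turns the upper limit into a parameter of the integrand. The maximum
  with 0 covers negative limits, where the interval is empty and the integral 0.\<close>

lemma continuous_integral_upper:
  fixes f :: "'a::topological_space \<Rightarrow> real \<Rightarrow> real"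
  assumes f: "continuous_on UNIV (\<lambda>z. f (fst z) (snd z))" and T: "continuous_on UNIV T"
  shows "continuous_on UNIV (\<lambda>p. integral {0..T p} (f p))"
proof -
  have *: "integral {0..T p} (f p) = max 0 (T p) * integral (cbox 0 1) (\<lambda>\<theta>. f p (max 0 (T p) * \<theta>))" for p
    using integral_rescale[of "T p" "f p"] by (cases "0 \<le> T p") (auto simp: max_def)
  have "continuous_on (UNIV \<times> cbox 0 1) (\<lambda>(p, \<theta>). f p (max 0 (T p) * \<theta>))"
    unfolding split_beta'
    by (rule continuous_on_compose2[OF f, of _ "\<lambda>z. (fst z, max 0 (T (fst z)) * snd z)", simplified])
      (intro continuous_intros continuous_on_compose2[OF T], auto)
  then have "continuous_on UNIV (\<lambda>p. integral (cbox 0 1) (\<lambda>\<theta>. f p (max 0 (T p) * \<theta>)))"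
    by (rule integral_continuous_on_param)
  then show ?thesis
    unfolding * by (intro continuous_intros T)
qed

lemma continuous_real_measurable_pair:
  fixes g :: "real \<Rightarrow> real \<Rightarrow> real"
  assumes "continuous_on UNIV (\<lambda>z. g (fst z) (snd z))"
  shows "(\<lambda>z. g (fst z) (snd z)) \<in> borel_measurable (borel \<Otimes>\<^sub>M borel)"
  using borel_measurable_continuous_onI[OF assms] by (simp add: borel_prod)

lemma continuous_on_section:
  fixes g :: "real \<Rightarrow> real \<Rightarrow> real"
  assumes "continuous_on UNIV (\<lambda>z. g (fst z) (snd z))" "continuous_on S p" "continuous_on S q"
  shows "continuous_on S (\<lambda>x. g (p x) (q x))"
  using continuous_on_compose2[OF assms(1) continuous_on_Pair[OF assms(2,3)]] by simp

lemma fubini_continuous: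
  fixes g :: "real \<Rightarrow> real \<Rightarrow> real"
  assumes g: "continuous_on UNIV (\<lambda>z. g (fst z) (snd z))"
  shows "integral {a..b} (\<lambda>s. integral {c..d} (g s)) = integral {c..d} (\<lambda>x. integral {a..b} (\<lambda>s. g s x))"
  using integral_swap_continuous[of a c b d g]
  by (simp add: split_beta' continuous_on_subset[OF g])

text \<open>The cut-off to s \<le> r is discontinuous, so Fubini's theorem for measurable functions
  is applied; continuity of \<open>g\<close> supplies measurability and the bound
  \<open>B\<close>.\<close>

lemma triangle_swap:
  fixes g :: "real \<Rightarrow> real \<Rightarrow> real"
  assumes g: "continuous_on UNIV (\<lambda>z. g (fst z) (snd z))"
  shows "integral {0..t} (\<lambda>r. integral {0..r} (g r)) = integral {0..t} (\<lambda>s. integral {s..t} (\<lambda>r. g r s))"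
proof -
  define h where "h = (\<lambda>r s. if s \<le> r then g r s else 0)"
  have 1: "integral {0..t} (h r) = integral {0..r} (g r)" if "r \<in> {0..t}" for r
  proof -
    have "integral {0..t} (h r) = integral {0..t} (\<lambda>s. if s \<in> {..r} then g r s else 0)"
      by (intro integral_cong) (simp add: h_def)
    also have "\<dots> = integral ({..r} \<inter> {0..t}) (g r)" by (rule integral_restrict_Int)
    also have "{..r} \<inter> {0..t} = {0..r}" using that by auto
    finally show ?thesis .
  qed
  have 2: "integral {0..t} (\<lambda>r. h r s) = integral {s..t} (\<lambda>r. g r s)" if "s \<in> {0..t}" for s
  proof -
    have "integral {0..t} (\<lambda>r. h r s) = integral {0..t} (\<lambda>r. if r \<in> {s..} then g r s else 0)"
      by (intro integral_cong) (simp add: h_def)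
    also have "\<dots> = integral ({s..} \<inter> {0..t}) (\<lambda>r. g r s)" by (rule integral_restrict_Int)
    also have "{s..} \<inter> {0..t} = {s..t}" using that by auto
    finally show ?thesis .
  qed
  obtain B where B: "\<And>r s. r \<in> {0..t} \<Longrightarrow> s \<in> {0..t} \<Longrightarrow> \<bar>g r s\<bar> \<le> B"
  proof -
    have "compact ((\<lambda>z. g (fst z) (snd z)) ` ({0..t} \<times> {0..t}))"
      by (intro compact_continuous_image compact_Times continuous_on_subset[OF g]) auto
    then obtain B where "\<forall>y \<in> (\<lambda>z. g (fst z) (snd z)) ` ({0..t} \<times> {0..t}). norm y \<le> B"
      using compact_imp_bounded bounded_iff by metis
    then show thesis by (intro that[of B]) force
  qed
  have hm: "(\<lambda>z. h (fst z) (snd z)) \<in> borel_measurable (borel \<Otimes>\<^sub>M borel)"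
    unfolding h_def using continuous_real_measurable_pair[OF g] by measurable
  have hi: "h r absolutely_integrable_on {0..t}" if "r \<in> {0..t}" for r
  proof -
    have "h r \<in> borel_measurable borel"
      using measurable_compose[OF measurable_Pair1' hm, of r] by simp
    then have "h r \<in> borel_measurable (lebesgue_on {0..t})"
      by (intro measurable_restrict_space1 measurable_completion) simp
    then show ?thesis
      by (rule measurable_bounded_by_integrable_imp_absolutely_integrable[where g = "\<lambda>_. \<bar>B\<bar>"])
        (use B[OF that] in \<open>auto simp: h_def intro: order_trans[OF _ abs_ge_self]\<close>)
  qed
  have hb: "integral {0..t} (\<lambda>s. \<bar>h r s\<bar>) \<le> \<bar>B\<bar> * \<bar>t\<bar>" if "r \<in> {0..t}" for r
  proof -
    have "integral {0..t} (\<lambda>s. \<bar>h r s\<bar>) \<le> integral {0..t} (\<lambda>s. \<bar>B\<bar>)"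
      using hi[OF that] B[OF that]
      by (intro integral_le) (auto simp: absolutely_integrable_on_def h_def intro: order_trans[OF _ abs_ge_self])
    also have "\<dots> = \<bar>B\<bar> * \<bar>t\<bar>" using that by simp
    finally show ?thesis .
  qed
  have "integral {0..t} (\<lambda>r. integral {0..t} (h r)) = integral {0..t} (\<lambda>s. integral {0..t} (\<lambda>r. h r s))"
    by (rule fubini_Icc(1)[OF hm hi hb integrable_const_ivl])
  moreover have "integral {0..t} (\<lambda>r. integral {0..t} (h r)) = integral {0..t} (\<lambda>r. integral {0..r} (g r))"
    by (intro integral_cong 1)
  moreover have "integral {0..t} (\<lambda>s. integral {0..t} (\<lambda>r. h r s)) = integral {0..t} (\<lambda>s. integral {s..t} (\<lambda>r. g r s))"
    by (intro integral_cong 2)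
  ultimately show ?thesis by simp
qed

text \<open>The solution of the transport equation \<open>X\<^sub>t = \<sigma> X\<^sub>x + G\<close> with zero initial values.\<close>

definition duhamel :: "real \<Rightarrow> (real \<Rightarrow> real \<Rightarrow> real) \<Rightarrow> real \<Rightarrow> real \<Rightarrow> real" where
  "duhamel \<sigma> G t x = integral {0..t} (\<lambda>s. G s (x + \<sigma> * (t - s)))"

lemma continuous_duhamel:
  assumes G: "continuous_on UNIV (\<lambda>z. G (fst z) (snd z))"
  shows "continuous_on UNIV (\<lambda>z. duhamel \<sigma> G (fst z) (snd z))"
  unfolding duhamel_def
  by (rule continuous_integral_upper[of "\<lambda>z s. G s (snd z + \<sigma> * (fst z - s))" fst])
    (auto intro!: continuous_intros continuous_on_compose2[OF G, of _ "\<lambda>w. (snd w, snd (fst w) + \<sigma> * (fst (fst w) - snd w))", simplified])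

text \<open>The integral along a characteristic is an increment of the primitive of \<open>g\<close>
  in space. No point reached within unit time lies to the left of the base point -1.\<close>

lemma integral_characteristic:
  assumes \<sigma>: "\<sigma> \<in> {-1, 1::real}" and x: "x \<in> {0..1}" and h: "0 \<le> h" "h \<le> 1" and g: "continuous_on UNIV g"
  shows "integral {s..s + h} (\<lambda>r. g (x + \<sigma> * (r - s))) = \<sigma> * (integral {-1..x + \<sigma> * h} g - integral {-1..x} g)"
proof -
  have gi: "g integrable_on {c..d}" for c d
    by (intro integrable_continuous_real continuous_on_subset[OF g]) auto
  from \<sigma> consider "\<sigma> = 1" | "\<sigma> = -1" by auto
  then show ?thesis
  proof cases
    case 1
    have "integral {s..s + h} (\<lambda>r. g (x + \<sigma> * (r - s))) = integral {x..x + h} g"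
      using integral_shift_real_ivl[of x "x - s" "x + h" g] 1 by (simp add: algebra_simps)
    also have "\<dots> = integral {-1..x + h} g - integral {-1..x} g"
      using Henstock_Kurzweil_Integration.integral_combine[of "-1" x "x + h" g] x h gi by simp
    finally show ?thesis using 1 by simp
  next
    case 2
    have "integral {s..s + h} (\<lambda>r. g (x + \<sigma> * (r - s))) = integral {s..s + h} (\<lambda>r. g (- (r - (s + x))))"
      using 2 by (intro integral_cong) (simp add: algebra_simps)
    also have "\<dots> = integral {-x..h - x} (\<lambda>r. g (- r))"
      using integral_shift_real_ivl[of "-x" "- (s + x)" "h - x" "\<lambda>r. g (- r)"] by (simp add: algebra_simps)
    also have "\<dots> = integral {x - h..x} g"
      using Henstock_Kurzweil_Integration.integral_reflect_real[of x "x - h" g] by simp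
    also have "\<dots> = integral {-1..x} g - integral {-1..x - h} g"
      using Henstock_Kurzweil_Integration.integral_combine[of "-1" "x - h" x g] x h gi by simp
    finally show ?thesis using 2 by simp
  qed
qed

text \<open>Integrating X_t = \<sigma> X_x + G in time and multiplying by \<sigma>, where \<sigma>^2
  = 1, gives the stated density. The integrated form is essential: with a merely continuous
  \<open>G\<close>, the Duhamel term itself need not be differentiable in x.\<close>

lemma duhamel_transport:
  assumes G: "continuous_on UNIV (\<lambda>z. G (fst z) (snd z))" and \<sigma>: "\<sigma> \<in> {-1, 1::real}"
    and t: "t \<in> {0..1}"
  shows "AC 0 1 (\<lambda>x. integral {0..t} (\<lambda>r. duhamel \<sigma> G r x)) (\<lambda>x. \<sigma> * (duhamel \<sigma> G t x - integral {0..t} (\<lambda>s. G s x)))"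
  unfolding AC_def
proof (intro conjI ballI)
  have Gs: "continuous_on UNIV (G s)" for s
    by (rule continuous_on_section[OF G]) (auto intro!: continuous_intros)
  have cX: "continuous_on S (\<lambda>x. duhamel \<sigma> G t x)" for S
    by (rule continuous_on_section[OF continuous_duhamel[OF G]]) (auto intro!: continuous_intros)
  have G': "continuous_on UNIV (\<lambda>z. G (snd z) (fst z))"
    using continuous_on_compose2[OF G continuous_on_Pair[OF continuous_on_snd[OF continuous_on_id] continuous_on_fst[OF continuous_on_id]]]
    by simp
  have cG: "continuous_on UNIV (\<lambda>x. integral {0..t} (\<lambda>s. G s x))"
    by (rule continuous_integral_upper[of "\<lambda>x s. G s x"]) (auto intro!: G' continuous_intros)
  show "(\<lambda>x. \<sigma> * (duhamel \<sigma> G t x - integral {0..t} (\<lambda>s. G s x))) absolutely_integrable_on {0..1}"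
    by (intro absolutely_integrable_continuous_real continuous_intros cX continuous_on_subset[OF cG]) auto
  have cT: "continuous_on UNIV (\<lambda>z. G (fst z) (y + \<sigma> * (snd z - fst z)))" for y
    by (rule continuous_on_compose2[OF G, of _ "\<lambda>z. (fst z, y + \<sigma> * (snd z - fst z))", simplified])
      (auto intro!: continuous_intros)
  have cT': "continuous_on UNIV (\<lambda>z. G (snd z) (y + \<sigma> * (fst z - snd z)))" for y
    by (rule continuous_on_compose2[OF G, of _ "\<lambda>z. (snd z, y + \<sigma> * (fst z - snd z))", simplified])
      (auto intro!: continuous_intros)
  have cZ: "continuous_on UNIV (\<lambda>s. integral {-1..y} (G s))" for y
  proof -
    have "continuous_on UNIV (\<lambda>s. integral (cbox (-1) y) (G s))"
      by (rule integral_continuous_on_param) (simp add: split_beta' continuous_on_subset[OF G])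
    then show ?thesis by simp
  qed
  have T: "integral {0..t} (\<lambda>r. duhamel \<sigma> G r y) =
      integral {0..t} (\<lambda>s. \<sigma> * (integral {-1..y + \<sigma> * (t - s)} (G s) - integral {-1..y} (G s)))"
    if y: "y \<in> {0..1}" for y
  proof -
    have "integral {0..t} (\<lambda>r. duhamel \<sigma> G r y) = integral {0..t} (\<lambda>s. integral {s..t} (\<lambda>r. G s (y + \<sigma> * (r - s))))"
      unfolding duhamel_def by (rule triangle_swap[OF cT'])
    also have "\<dots> = integral {0..t} (\<lambda>s. \<sigma> * (integral {-1..y + \<sigma> * (t - s)} (G s) - integral {-1..y} (G s)))"
    proof (intro integral_cong)
      fix s assume "s \<in> {0..t}"
      then show "integral {s..t} (\<lambda>r. G s (y + \<sigma> * (r - s))) = \<sigma> * (integral {-1..y + \<sigma> * (t - s)} (G s) - integral {-1..y} (G s))"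
        using integral_characteristic[OF \<sigma> y _ _ Gs, of "t - s" s s] t by simp
    qed
    finally show ?thesis .
  qed
  have cZ2: "continuous_on {0..t} (\<lambda>s. integral {-1..y + \<sigma> * (t - s)} (G s))" if y: "y \<in> {0..1}" for y
  proof -
    \<comment> \<open>The shift by 1 moves the lower limit to 0, as
      \<open>continuous_integral_upper\<close> requires.\<close>
    have "continuous_on UNIV (\<lambda>s. integral {0..y + \<sigma> * (t - s) + 1} (\<lambda>z. G s (z - 1)))"
    proof (rule continuous_integral_upper[of "\<lambda>s z. G s (z - 1)"])
      show "continuous_on UNIV (\<lambda>z. G (fst z) (snd z - 1))"
        by (rule continuous_on_compose2[OF G, of _ "\<lambda>z. (fst z, snd z - 1)", simplified])
          (auto intro!: continuous_intros)
    qed (auto intro!: continuous_intros)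
    moreover have "integral {0..y + \<sigma> * (t - s) + 1} (\<lambda>z. G s (z - 1)) = integral {-1..y + \<sigma> * (t - s)} (G s)" for s
      using integral_shift_real_ivl[of "-1" "-1" "y + \<sigma> * (t - s)" "G s"] by simp
    ultimately have "continuous_on UNIV (\<lambda>s. integral {-1..y + \<sigma> * (t - s)} (G s))" by simp
    then show ?thesis by (rule continuous_on_subset) simp
  qed
  have cS: "continuous_on UNIV (\<lambda>z. G (fst z) (snd z + \<sigma> * (t - fst z)))"
    by (rule continuous_on_compose2[OF G, of _ "\<lambda>z. (fst z, snd z + \<sigma> * (t - fst z))", simplified])
      (auto intro!: continuous_intros)
  fix x :: real assume x: "x \<in> {0..1}"
  have Gi: "G s integrable_on {c..d}" for s c d
    by (intro integrable_continuous_real continuous_on_subset[OF Gs]) auto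
  have "integral {0..t} (\<lambda>r. duhamel \<sigma> G r x) - integral {0..t} (\<lambda>r. duhamel \<sigma> G r 0) =
      integral {0..t} (\<lambda>s. \<sigma> * (integral {-1..x + \<sigma> * (t - s)} (G s) - integral {-1..x} (G s))
        - \<sigma> * (integral {-1..0 + \<sigma> * (t - s)} (G s) - integral {-1..0} (G s)))"
    unfolding T[OF x] using T[of 0] x cZ2[of x] cZ2[of 0] continuous_on_subset[OF cZ]
    by (subst Henstock_Kurzweil_Integration.integral_diff)
      (auto intro!: integrable_continuous_real continuous_intros)
  \<comment> \<open>An increment in x of a primitive is an integral of \<open>G\<close> itself,
    after which the order of integration can be exchanged.\<close>
  also have "\<dots> = integral {0..t} (\<lambda>s. integral {0..x} (\<lambda>y. \<sigma> * (G s (y + \<sigma> * (t - s)) - G s y)))"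
  proof (intro integral_cong)
    fix s assume s: "s \<in> {0..t}"
    define h where "h = \<sigma> * (t - s)"
    have "\<bar>h\<bar> \<le> 1" using s t \<sigma> by (auto simp: h_def abs_mult)
    then have h: "-1 \<le> h" "h \<le> 1" by linarith+
    have "integral {-1..x + h} (G s) - integral {-1..0 + h} (G s) = integral {h..x + h} (G s)"
      using Henstock_Kurzweil_Integration.integral_combine[of "-1" h "x + h" "G s"] x h Gi by simp
    also have "\<dots> = integral {0..x} (\<lambda>y. G s (y + h))"
      using integral_shift_real_ivl[of h h "x + h" "G s"] by simp
    finally have 1: "integral {-1..x + h} (G s) - integral {-1..0 + h} (G s) = integral {0..x} (\<lambda>y. G s (y + h))" .
    have 2: "integral {-1..x} (G s) - integral {-1..0} (G s) = integral {0..x} (G s)"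
      using Henstock_Kurzweil_Integration.integral_combine[of "-1" 0 x "G s"] x Gi by simp
    have "integral {0..x} (\<lambda>y. G s (y + h) - G s y) = integral {0..x} (\<lambda>y. G s (y + h)) - integral {0..x} (G s)"
      by (intro Henstock_Kurzweil_Integration.integral_diff Gi integrable_continuous_real continuous_on_compose2[OF Gs])
        (auto intro!: continuous_intros)
    then have e: "integral {0..x} (\<lambda>y. G s (y + h) - G s y) =
        (integral {-1..x + h} (G s) - integral {-1..x} (G s)) - (integral {-1..0 + h} (G s) - integral {-1..0} (G s))"
      using 1 2 by linarith
    have "\<sigma> * integral {0..x} (\<lambda>y. G s (y + h) - G s y) =
        \<sigma> * (integral {-1..x + h} (G s) - integral {-1..x} (G s)) - \<sigma> * (integral {-1..0 + h} (G s) - integral {-1..0} (G s))"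
      unfolding e by (rule right_diff_distrib)
    then show "\<sigma> * (integral {-1..x + \<sigma> * (t - s)} (G s) - integral {-1..x} (G s))
        - \<sigma> * (integral {-1..0 + \<sigma> * (t - s)} (G s) - integral {-1..0} (G s)) =
        integral {0..x} (\<lambda>y. \<sigma> * (G s (y + \<sigma> * (t - s)) - G s y))"
      by (simp add: h_def)
  qed
  also have "\<dots> = integral {0..x} (\<lambda>y. integral {0..t} (\<lambda>s. \<sigma> * (G s (y + \<sigma> * (t - s)) - G s y)))"
    by (rule fubini_continuous) (intro continuous_on_mult_left continuous_on_diff cS G)
  also have "\<dots> = integral {0..x} (\<lambda>x. \<sigma> * (duhamel \<sigma> G t x - integral {0..t} (\<lambda>s. G s x)))"
  proof (intro integral_cong)
    fix y
    have "continuous_on {0..t} (\<lambda>s. G s (y + \<sigma> * (t - s)))" "continuous_on {0..t} (\<lambda>s. G s y)"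
      by (intro continuous_on_section[OF G] continuous_intros)+
    then show "integral {0..t} (\<lambda>s. \<sigma> * (G s (y + \<sigma> * (t - s)) - G s y)) = \<sigma> * (duhamel \<sigma> G t y - integral {0..t} (\<lambda>s. G s y))"
      unfolding duhamel_def by (simp add: Henstock_Kurzweil_Integration.integral_diff integrable_continuous_real)
  qed
  finally show "integral {0..t} (\<lambda>r. duhamel \<sigma> G r x) = integral {0..t} (\<lambda>r. duhamel \<sigma> G r 0) +
      integral {0..x} (\<lambda>x. \<sigma> * (duhamel \<sigma> G t x - integral {0..t} (\<lambda>s. G s x)))" by simp
qed

section \<open>D'Alembert's formula\<close>

lemma DERIV_exp_lin: "((\<lambda>t. exp (c * t)) has_real_derivative c * exp (c * t)) (at t within S)"
  by (auto intro!: derivative_eq_intros)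

lemma AC_exp: "AC a b (\<lambda>t. exp (c * t)) (\<lambda>t. c * exp (c * t))"
  by (intro AC_DERIV DERIV_exp_lin continuous_intros)

lemma AC_exp_mult: "AC a b F f \<Longrightarrow> AC a b (\<lambda>t. exp (c * t) * F t) (\<lambda>t. exp (c * t) * (f t + c * F t))"
  by (rule AC_cong[OF AC_mult[OF AC_exp[of a b c]]]) (auto simp: algebra_simps)

text \<open>D'Alembert's formula: \<open>a\<close> and \<open>b\<close> are the derivatives of the waves travelling to the left and to
  the right.\<close>

locale wave =
  fixes c :: real and a b :: "real \<Rightarrow> real" and G :: "real \<Rightarrow> real \<Rightarrow> real"
  assumes a_meas: "a \<in> borel_measurable borel" and a_L2: "a \<in> L2 (-1) 2"
    and b_meas: "b \<in> borel_measurable borel" and b_L2: "b \<in> L2 (-1) 2"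
    and G_cont: "continuous_on UNIV (\<lambda>z. G (fst z) (snd z))"
begin

definition A where "A y = integral {-1..y} a"
definition B where "B y = integral {-1..y} b"
text \<open>With a continuous source the Duhamel term need not have a space derivative, but its time
  integral has one by \<open>duhamel_transport\<close>.\<close>

definition \<Theta> where "\<Theta> \<sigma> t x = integral {0..t} (\<lambda>r. duhamel \<sigma> G r x)"
text \<open>Normalized so that \<open>w 0 0 = c\<close>. The half sum of the two \<Theta> solves
  w_tt - w_xx = G, since the source enters both transport equations once.\<close>

definition w where "w t x = c + (A (x + t) - A 0) + (B (x - t) - B 0) + (\<Theta> 1 t x + \<Theta> (-1) t x) / 2"
definition wt where "wt t x = a (x + t) - b (x - t) + (duhamel 1 G t x + duhamel (-1) G t x) / 2"
definition wx where "wx t x = a (x + t) + b (x - t) + (duhamel 1 G t x - duhamel (-1) G t x) / 2"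
text \<open>The time integral of \<open>wx\<close>. Unlike \<open>wx\<close>, it is absolutely
  continuous in x, so integration by parts in space is available for it.\<close>

definition Q where "Q t x = (A (x + t) - A x) - (B (x - t) - B x) + (\<Theta> 1 t x - \<Theta> (-1) t x) / 2"

lemma A_AC: "AC (-1) 2 A a" and B_AC: "AC (-1) 2 B b"
  using AC_integral[OF L2D(1)[OF a_L2], of 0] AC_integral[OF L2D(1)[OF b_L2], of 0]
  by (simp_all add: A_def[abs_def] B_def[abs_def])

lemma duhamel_cont: "continuous_on UNIV (\<lambda>z. duhamel \<sigma> G (fst z) (snd z))"
  by (rule continuous_duhamel[OF G_cont])

lemma duhamel_0: "duhamel \<sigma> G 0 x = 0"
  by (simp add: duhamel_def)

lemma duhamel_cont_time: "continuous_on S (\<lambda>t. duhamel \<sigma> G t x)"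
  by (rule continuous_on_section[OF duhamel_cont]) (auto intro!: continuous_intros)

lemma \<Theta>_AC_time: "AC 0 1 (\<lambda>t. \<Theta> \<sigma> t x) (\<lambda>t. duhamel \<sigma> G t x)"
  using AC_integral[OF absolutely_integrable_continuous_real[OF duhamel_cont_time], where c = 0]
  by (simp add: \<Theta>_def)

lemma \<Theta>_AC_space:
  assumes "\<sigma> \<in> {-1, 1}" "t \<in> {0..1}"
  shows "AC 0 1 (\<Theta> \<sigma> t) (\<lambda>x. \<sigma> * (duhamel \<sigma> G t x - integral {0..t} (\<lambda>s. G s x)))"
  using duhamel_transport[OF G_cont assms] by (simp add: \<Theta>_def[abs_def])

lemma A_AC_time: "x \<in> {0..1} \<Longrightarrow> AC 0 1 (\<lambda>t. A (x + t)) (\<lambda>t. a (x + t))"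
  using AC_characteristic[OF A_AC, of 1 x] by simp

lemma B_AC_time: "x \<in> {0..1} \<Longrightarrow> AC 0 1 (\<lambda>t. B (x - t)) (\<lambda>t. - b (x - t))"
  using AC_characteristic[OF B_AC, of "-1" x] by simp

lemma A_AC_space: "t \<in> {0..1} \<Longrightarrow> AC 0 1 (\<lambda>x. A (x + t)) (\<lambda>x. a (x + t))"
  by (intro AC_characteristic_space[OF A_AC]) auto

lemma B_AC_space: "t \<in> {0..1} \<Longrightarrow> AC 0 1 (\<lambda>x. B (x - t)) (\<lambda>x. b (x - t))"
  using AC_characteristic_space[OF B_AC, of "- t"] by simp

text \<open>The time integrals of \<open>G\<close> from the two transport equations carry opposite
  signs and cancel, so \<open>wx\<close> contains only the Duhamel terms.\<close>

lemma w_AC_space: 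
  assumes t: "t \<in> {0..1}"
  shows "AC 0 1 (w t) (wx t)"
proof -
  have "AC 0 1 (\<lambda>x. (c - A 0 - B 0) + ((A (x + t) + B (x - t)) + (1/2) * (\<Theta> 1 t x + \<Theta> (-1) t x)))
     (\<lambda>x. 0 + ((a (x + t) + b (x - t)) + (1/2) * (1 * (duhamel 1 G t x - integral {0..t} (\<lambda>s. G s x))
        + (-1) * (duhamel (-1) G t x - integral {0..t} (\<lambda>s. G s x)))))"
    by (intro AC_add AC_const AC_cmult A_AC_space B_AC_space \<Theta>_AC_space t) auto
  then show ?thesis
    by (rule AC_cong) (auto simp: w_def wx_def algebra_simps diff_divide_distrib add_divide_distrib duhamel_0)
qed

lemma w_AC_time:
  assumes x: "x \<in> {0..1}"
  shows "AC 0 1 (\<lambda>t. w t x) (\<lambda>t. wt t x)"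
proof -
  have "AC 0 1 (\<lambda>t. (c - A 0 - B 0) + ((A (x + t) + B (x - t)) + (1/2) * (\<Theta> 1 t x + \<Theta> (-1) t x)))
     (\<lambda>t. 0 + ((a (x + t) + - b (x - t)) + (1/2) * (duhamel 1 G t x + duhamel (-1) G t x)))"
    by (intro AC_add AC_const AC_cmult A_AC_time B_AC_time \<Theta>_AC_time x)
  then show ?thesis
    by (rule AC_cong) (auto simp: w_def wt_def algebra_simps diff_divide_distrib add_divide_distrib duhamel_0)
qed

lemma Q_AC_time:
  assumes x: "x \<in> {0..1}"
  shows "AC 0 1 (\<lambda>t. Q t x) (\<lambda>t. wx t x)"
proof -
  have "AC 0 1 (\<lambda>t. (B x - A x) + ((A (x + t) - B (x - t)) + (1/2) * (\<Theta> 1 t x - \<Theta> (-1) t x)))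
     (\<lambda>t. 0 + ((a (x + t) - - b (x - t)) + (1/2) * (duhamel 1 G t x - duhamel (-1) G t x)))"
    by (intro AC_add AC_minus AC_const AC_cmult A_AC_time B_AC_time \<Theta>_AC_time x)
  then show ?thesis
    by (rule AC_cong) (auto simp: Q_def wx_def algebra_simps diff_divide_distrib add_divide_distrib duhamel_0)
qed

lemma Q_0: "Q 0 x = 0"
  by (simp add: Q_def \<Theta>_def)

lemma Q_eq: "x \<in> {0..1} \<Longrightarrow> t \<in> {0..1} \<Longrightarrow> Q t x = integral {0..t} (\<lambda>s. wx s x)"
  using ACD(3)[OF Q_AC_time, of x t] by (simp add: Q_0)

lemma wt_0: "wt 0 x = a x - b x"
  by (simp add: wt_def duhamel_def)

text \<open>The wave equation integrated over [0,t]. In contrast to \<open>w_AC_space\<close>, the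
  integrals of \<open>G\<close> from the two transport equations now add up.\<close>

lemma Q_AC_space:
  assumes t: "t \<in> {0..1}"
  shows "AC 0 1 (Q t) (\<lambda>x. wt t x - wt 0 x - integral {0..t} (\<lambda>s. G s x))"
proof -
  have 0: "AC 0 1 (\<lambda>x. A (x + 0)) (\<lambda>x. a (x + 0))" "AC 0 1 (\<lambda>x. B (x - 0)) (\<lambda>x. b (x - 0))"
    by (intro A_AC_space B_AC_space; simp)+
  have "AC 0 1 (\<lambda>x. ((A (x + t) - A (x + 0)) - (B (x - t) - B (x - 0))) + (1/2) * (\<Theta> 1 t x - \<Theta> (-1) t x))
     (\<lambda>x. ((a (x + t) - a (x + 0)) - (b (x - t) - b (x - 0))) + (1/2) * (1 * (duhamel 1 G t x - integral {0..t} (\<lambda>s. G s x))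
        - (-1) * (duhamel (-1) G t x - integral {0..t} (\<lambda>s. G s x))))"
    by (intro AC_add AC_minus AC_const AC_cmult A_AC_space B_AC_space \<Theta>_AC_space t 0) auto
  then show ?thesis
    by (rule AC_cong) (auto simp: Q_def wt_0 wt_def algebra_simps diff_divide_distrib add_divide_distrib duhamel_0)
qed

lemma duhamel_continuous_L2: "continuous_L2 \<tau> (duhamel \<sigma> G)"
  by (rule continuous_L2_continuous[OF continuous_on_subset[OF duhamel_cont]]) simp

lemma wt_continuous_L2: "continuous_L2 1 wt"
proof -
  have "continuous_L2 1 (\<lambda>t x. (a (x + 1 * t) - b (x + (-1) * t)) + (1/2) * (duhamel 1 G t x + duhamel (-1) G t x))"
    by (intro continuous_L2_add continuous_L2_diff translation_continuous_L2 a_L2 b_L2 continuous_L2_scale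
        duhamel_continuous_L2 continuous_intros) auto
  moreover have "wt = (\<lambda>t x. (a (x + 1 * t) - b (x + (-1) * t)) + (1/2) * (duhamel 1 G t x + duhamel (-1) G t x))"
    by (auto simp: wt_def fun_eq_iff)
  ultimately show ?thesis by simp
qed

lemma wx_continuous_L2: "continuous_L2 1 wx"
proof -
  have "continuous_L2 1 (\<lambda>t x. (a (x + 1 * t) + b (x + (-1) * t)) + (1/2) * (duhamel 1 G t x - duhamel (-1) G t x))"
    by (intro continuous_L2_add continuous_L2_diff translation_continuous_L2 a_L2 b_L2 continuous_L2_scale
        duhamel_continuous_L2 continuous_intros) auto
  moreover have "wx = (\<lambda>t x. (a (x + 1 * t) + b (x + (-1) * t)) + (1/2) * (duhamel 1 G t x - duhamel (-1) G t x))"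
    by (auto simp: wx_def fun_eq_iff)
  ultimately show ?thesis by simp
qed

lemma wt_meas: "(\<lambda>z. wt (fst z) (snd z)) \<in> borel_measurable (borel \<Otimes>\<^sub>M borel)"
  and wx_meas: "(\<lambda>z. wx (fst z) (snd z)) \<in> borel_measurable (borel \<Otimes>\<^sub>M borel)"
proof -
  note [measurable] = a_meas b_meas continuous_real_measurable_pair[OF duhamel_cont]
  show "(\<lambda>z. wt (fst z) (snd z)) \<in> borel_measurable (borel \<Otimes>\<^sub>M borel)"
    "(\<lambda>z. wx (fst z) (snd z)) \<in> borel_measurable (borel \<Otimes>\<^sub>M borel)"
    unfolding wt_def wx_def by measurable
qed

lemma w_cont: "continuous_on ({0..1} \<times> {0..1}) (\<lambda>z. w (fst z) (snd z))"
proof -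
  have \<Theta>: "continuous_on UNIV (\<lambda>z. \<Theta> \<sigma> (fst z) (snd z))" for \<sigma>
    unfolding \<Theta>_def
    by (rule continuous_integral_upper[of "\<lambda>z r. duhamel \<sigma> G r (snd z)"])
      (auto intro!: continuous_intros continuous_on_compose2[OF duhamel_cont, of _ "\<lambda>w. (snd w, snd (fst w))", simplified])
  have "continuous_on ({0..1} \<times> {0..1}) (\<lambda>z. A (snd z + fst z))" "continuous_on ({0..1} \<times> {0..1}) (\<lambda>z. B (snd z - fst z))"
    by (auto intro!: continuous_on_compose2[OF AC_continuous[OF A_AC]] continuous_on_compose2[OF AC_continuous[OF B_AC]]
        continuous_intros)
  then show ?thesis
    unfolding w_def by (intro continuous_intros continuous_on_subset[OF \<Theta>]) auto
qed

lemma w_continuous_L2: "continuous_L2 1 w"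
  by (rule continuous_L2_continuous[OF w_cont])

lemma w_C1: "has_C1_L2_deriv 1 w wt"
  by (rule C1_L2_I[OF w_continuous_L2 wt_continuous_L2 wt_meas])
    (rule AC_diff[OF w_AC_time], auto)

text \<open>\<open>wx\<close> is only L2 in x and cannot be integrated by parts. Integrating over
  time and exchanging the integrals replaces it by \<open>Q\<close>, where integration by parts
  applies and \<open>Q_AC_space\<close> supplies the velocity and the source.\<close>

lemma wave_weak_form:
  assumes V: "AC 0 1 V v" and v: "v \<in> L2 0 1"
  shows "AC 0 1 (\<lambda>t. integral {0..1} (\<lambda>x. wt t x * V x))
    (\<lambda>t. integral {0..1} (\<lambda>x. G t x * V x) + wx t 1 * V 1 - wx t 0 * V 0 - integral {0..1} (\<lambda>x. wx t x * v x))"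
proof -
  have VL: "V \<in> L2 0 1" by (rule L2_continuous[OF AC_continuous[OF V]])
  have cGV: "continuous_on {0..1} (\<lambda>t. integral {0..1} (\<lambda>x. G t x * V x))"
    by (intro continuous_L2_inner VL continuous_L2_continuous continuous_on_subset[OF G_cont]) simp
  have cwx: "continuous_on {0..1} (\<lambda>t. integral {0..1} (\<lambda>x. wx t x * v x))"
    by (intro continuous_L2_inner v wx_continuous_L2)
  have bd: "(\<lambda>t. wx t 1) absolutely_integrable_on {0..1}" "(\<lambda>t. wx t 0) absolutely_integrable_on {0..1}"
    by (intro ACD(1)[OF Q_AC_time]; simp)+
  have sub: "f integrable_on {0..t}" if "f absolutely_integrable_on {0..1}" "t \<in> {0..1}" for f :: "real \<Rightarrow> real" and t
    using that by (intro integrable_on_subinterval[OF set_lebesgue_integral_eq_integral(1)[OF that(1)]]) auto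
  have eq: "integral {0..1} (\<lambda>x. wt t x * V x) = integral {0..1} (\<lambda>x. wt 0 x * V x) +
     integral {0..t} (\<lambda>t. integral {0..1} (\<lambda>x. G t x * V x) + wx t 1 * V 1 - wx t 0 * V 0 - integral {0..1} (\<lambda>x. wx t x * v x))"
    if t: "t \<in> {0..1}" for t
  proof -
    obtain v' N where v': "v' \<in> borel_measurable borel" "negligible N" "\<And>x. x \<in> {0..1} \<Longrightarrow> x \<notin> N \<Longrightarrow> v x = v' x"
      by (rule borel_representative[OF L2D(1)[OF v]]) blast
    have ae: "AE x in lebesgue_on {0<..<1}. v x = v' x"
      by (rule AE_IooI[OF v'(2)]) (rule v'(3))
    have v'L: "v' \<in> L2 0 1" by (rule L2_AE_cong[OF v ae])
    have V': "AC 0 1 V v'" by (rule AC_cong[OF V refl ae])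
    have e1: "integral {0..1} (\<lambda>x. wx s x * v x) = integral {0..1} (\<lambda>x. wx s x * v' x)" for s
      by (rule integral_AE_cong) (use ae in \<open>auto elim: eventually_mono\<close>)
      \<comment> \<open>A bound uniform in time, as majorant for Fubini's theorem: the profiles are
        estimated by their norms on (-1,2), the Duhamel part by compactness.\<close>
      obtain K where K: "\<And>s. s \<in> {0..1} \<Longrightarrow> sq 0 1 (wx s) \<le> K"
      proof -
        define Ka where "Ka = sq (-1) 2 a"
        define Kb where "Kb = sq (-1) 2 b"
        have "compact ((\<lambda>z. duhamel 1 G (fst z) (snd z) - duhamel (-1) G (fst z) (snd z)) ` ({0..1} \<times> {0..1}))"
          by (intro compact_continuous_image compact_Times continuous_intros continuous_on_subset[OF duhamel_cont]) auto
        from compact_imp_bounded[OF this, unfolded bounded_iff] obtain M where M: "\<forall>y \<in> (\<lambda>z. duhamel 1 G (fst z) (snd z) - duhamel (-1) G (fst z) (snd z)) ` ({0..1} \<times> {0..1}). norm y \<le> M"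
          by blast
        have "sq 0 1 (wx s) \<le> 2 * (2 * Ka + 2 * Kb) + 2 * (M / 2)\<^sup>2" if s: "s \<in> {0..1}" for s
        proof -
          have al: "(\<lambda>x. a (x + s)) \<in> L2 0 1" "sq 0 1 (\<lambda>x. a (x + s)) \<le> Ka"
            unfolding Ka_def using s by (auto intro!: L2_shift_01 a_L2)
          have bl: "(\<lambda>x. b (x - s)) \<in> L2 0 1" "sq 0 1 (\<lambda>x. b (x - s)) \<le> Kb"
            using L2_shift_01[OF b_L2, of "- s"] s by (auto simp: Kb_def)
          have dc: "continuous_on {0..1} (\<lambda>x. (duhamel 1 G s x - duhamel (-1) G s x) / 2)"
            by (intro continuous_intros continuous_on_section[OF duhamel_cont]) auto
          have "sq 0 1 (\<lambda>x. (duhamel 1 G s x - duhamel (-1) G s x) / 2) \<le> integral {0..1} (\<lambda>x::real. (M / 2)\<^sup>2)"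
            unfolding sq_def
          proof (intro integral_le)
            fix x :: real assume x: "x \<in> {0..1}"
            have "\<bar>duhamel 1 G s x - duhamel (-1) G s x\<bar> \<le> M"
              using M s x by force
            then show "((duhamel 1 G s x - duhamel (-1) G s x) / 2)\<^sup>2 \<le> (M / 2)\<^sup>2"
              by (intro abs_le_square_iff[THEN iffD1]) simp
          qed (auto intro!: integrable_continuous_real continuous_on_power dc)
          then have dl: "sq 0 1 (\<lambda>x. (duhamel 1 G s x - duhamel (-1) G s x) / 2) \<le> (M / 2)\<^sup>2" by simp
          have "sq 0 1 (wx s) \<le> 2 * sq 0 1 (\<lambda>x. a (x + s) + b (x - s)) + 2 * sq 0 1 (\<lambda>x. (duhamel 1 G s x - duhamel (-1) G s x) / 2)"
            unfolding wx_def[abs_def] by (intro sq_add_le L2_add al bl L2_continuous dc)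
          moreover have "sq 0 1 (\<lambda>x. a (x + s) + b (x - s)) \<le> 2 * sq 0 1 (\<lambda>x. a (x + s)) + 2 * sq 0 1 (\<lambda>x. b (x - s))"
            by (intro sq_add_le al bl)
          ultimately show ?thesis
            using al(2) bl(2) dl unfolding add_le_cancel_left
            by (intro order_trans[OF _ add_mono[OF mult_left_mono[of "sq 0 1 (\<lambda>x. a (x + s) + b (x - s))" "2 * Ka + 2 * Kb" 2] mult_left_mono[OF dl, of 2]]]) auto
        qed
        then show thesis by (rule that)
      qed
    have fub: "integral {0..t} (\<lambda>s. integral {0..1} (\<lambda>x. wx s x * v' x)) = integral {0..1} (\<lambda>x. integral {0..t} (\<lambda>s. wx s x * v' x))"
    proof (rule fubini_Icc(1))
      show "(\<lambda>z. wx (fst z) (snd z) * v' (snd z)) \<in> borel_measurable (borel \<Otimes>\<^sub>M borel)"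
        using wx_meas v'(1) by measurable
      have wxL: "wx s \<in> L2 0 1" if "s \<in> {0..t}" for s
        using that t by (intro continuous_L2D(1)[OF wx_continuous_L2]) auto
      show "(\<lambda>x. wx s x * v' x) absolutely_integrable_on {0..1}" if "s \<in> {0..t}" for s
        by (intro L2_mult_abs_int wxL that v'L)
      show "integral {0..1} (\<lambda>x. \<bar>wx s x * v' x\<bar>) \<le> K + sq 0 1 v'" if s: "s \<in> {0..t}" for s
      proof -
        have "integral {0..1} (\<lambda>x. \<bar>wx s x * v' x\<bar>) \<le> integral {0..1} (\<lambda>x. (wx s x)\<^sup>2 + (v' x)\<^sup>2)"
        proof (intro integral_le)
          show "(\<lambda>x. \<bar>wx s x * v' x\<bar>) integrable_on {0..1}"
            using L2_mult_abs_int(1)[OF wxL[OF s] v'L] by (auto simp: absolutely_integrable_on_def)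
          show "(\<lambda>x. (wx s x)\<^sup>2 + (v' x)\<^sup>2) integrable_on {0..1}"
            by (intro integrable_add L2D(4) wxL s v'L)
          fix x
          have "2 * \<bar>wx s x * v' x\<bar> \<le> (wx s x)\<^sup>2 + (v' x)\<^sup>2"
            using sum_squares_bound[of "\<bar>wx s x\<bar>" "\<bar>v' x\<bar>"] by (simp add: abs_mult)
          then show "\<bar>wx s x * v' x\<bar> \<le> (wx s x)\<^sup>2 + (v' x)\<^sup>2"
            using abs_ge_zero[of "wx s x * v' x"] by linarith
        qed
        also have "\<dots> = sq 0 1 (wx s) + sq 0 1 v'"
          unfolding sq_def by (intro Henstock_Kurzweil_Integration.integral_add L2D(4) wxL s v'L)
        finally show ?thesis using K[of s] s t by auto
      qed
    qed (rule integrable_const_ivl)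
    also have "\<dots> = integral {0..1} (\<lambda>x. Q t x * v' x)"
      using t by (intro integral_cong) (simp add: Q_eq)
    \<comment> \<open>The boundary terms are the time integrals of the fluxes \<open>wx\<close> at x
      = 1 and x = 0.\<close>
    also have "\<dots> = Q t 1 * V 1 - Q t 0 * V 0 - integral {0..1} (\<lambda>x. (wt t x - wt 0 x - integral {0..t} (\<lambda>s. G s x)) * V x)"
      by (rule AC_by_parts[OF Q_AC_space[OF t] V']) simp
    finally have main: "integral {0..t} (\<lambda>s. integral {0..1} (\<lambda>x. wx s x * v x)) =
      Q t 1 * V 1 - Q t 0 * V 0 - integral {0..1} (\<lambda>x. (wt t x - wt 0 x - integral {0..t} (\<lambda>s. G s x)) * V x)"
      by (simp add: e1)
    have wtL: "wt t \<in> L2 0 1" "wt 0 \<in> L2 0 1"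
      using t by (auto intro: continuous_L2D(1)[OF wt_continuous_L2])
    have G': "continuous_on UNIV (\<lambda>z. G (snd z) (fst z))"
      using continuous_on_compose2[OF G_cont continuous_on_Pair[OF continuous_on_snd[OF continuous_on_id] continuous_on_fst[OF continuous_on_id]]]
      by simp
    have cG: "continuous_on {0..1} (\<lambda>x. integral {0..t} (\<lambda>s. G s x))"
      by (rule continuous_on_subset[OF continuous_integral_upper[of "\<lambda>x s. G s x"]]) (auto intro!: G' continuous_intros)
    have fub2: "integral {0..1} (\<lambda>x. integral {0..t} (\<lambda>s. G s x) * V x) = integral {0..t} (\<lambda>s. integral {0..1} (\<lambda>x. G s x * V x))"
    proof -
      have "integral {0..t} (\<lambda>s. integral {0..1} (\<lambda>x. G s x * V x)) = integral {0..1} (\<lambda>x. integral {0..t} (\<lambda>s. G s x * V x))"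
      proof -
        have c: "continuous_on ({0..t} \<times> {0..1}) (\<lambda>z. G (fst z) (snd z) * V (snd z))"
          by (intro continuous_intros continuous_on_subset[OF G_cont] continuous_on_compose2[OF AC_continuous[OF V]]) auto
        show ?thesis
          using integral_swap_continuous[of 0 0 t 1 "\<lambda>s x. G s x * V x"] c by (simp add: split_beta' cbox_Pair_eq)
      qed
      then show ?thesis by simp
    qed
    have i: "(\<lambda>x. wt t x * V x) integrable_on {0..1}" "(\<lambda>x. wt 0 x * V x) integrable_on {0..1}"
      "(\<lambda>x. integral {0..t} (\<lambda>s. G s x) * V x) integrable_on {0..1}"
      by (intro L2_mult_abs_int(2) wtL VL L2_continuous cG)+
    have "integral {0..1} (\<lambda>x. (wt t x - wt 0 x - integral {0..t} (\<lambda>s. G s x)) * V x) =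
        integral {0..1} (\<lambda>x. wt t x * V x) - integral {0..1} (\<lambda>x. wt 0 x * V x) - integral {0..t} (\<lambda>s. integral {0..1} (\<lambda>x. G s x * V x))"
      unfolding left_diff_distrib fub2[symmetric] using i
      by (subst Henstock_Kurzweil_Integration.integral_diff | (intro integrable_diff; simp) | simp)+
    moreover have "integral {0..t} (\<lambda>t. integral {0..1} (\<lambda>x. G t x * V x) + wx t 1 * V 1 - wx t 0 * V 0 - integral {0..1} (\<lambda>x. wx t x * v x)) =
      integral {0..t} (\<lambda>s. integral {0..1} (\<lambda>x. G s x * V x)) + Q t 1 * V 1 - Q t 0 * V 0
      - integral {0..t} (\<lambda>s. integral {0..1} (\<lambda>x. wx s x * v x))"
    proof -
      have j: "(\<lambda>s. integral {0..1} (\<lambda>x. G s x * V x)) integrable_on {0..t}" "(\<lambda>s. wx s 1 * V 1) integrable_on {0..t}"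
        "(\<lambda>s. wx s 0 * V 0) integrable_on {0..t}" "(\<lambda>s. integral {0..1} (\<lambda>x. wx s x * v x)) integrable_on {0..t}"
        by (intro integrable_on_mult_left sub[OF bd(1) t] sub[OF bd(2) t] sub[OF absolutely_integrable_continuous_real[OF cGV] t]
            sub[OF absolutely_integrable_continuous_real[OF cwx] t])+
      have "integral {0..t} (\<lambda>t. integral {0..1} (\<lambda>x. G t x * V x) + wx t 1 * V 1 - wx t 0 * V 0 - integral {0..1} (\<lambda>x. wx t x * v x)) =
        integral {0..t} (\<lambda>s. integral {0..1} (\<lambda>x. G s x * V x)) + integral {0..t} (\<lambda>s. wx s 1 * V 1) - integral {0..t} (\<lambda>s. wx s 0 * V 0)
      - integral {0..t} (\<lambda>s. integral {0..1} (\<lambda>x. wx s x * v x))"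
        using j by (simp add: Henstock_Kurzweil_Integration.integral_diff Henstock_Kurzweil_Integration.integral_add integrable_diff integrable_add)
      then show ?thesis using t by (simp add: Q_eq)
    qed
    ultimately show ?thesis using main by linarith
  qed
  show ?thesis
    unfolding AC_def
  proof (intro conjI ballI eq)
    show "(\<lambda>t. integral {0..1} (\<lambda>x. G t x * V x) + wx t 1 * V 1 - wx t 0 * V 0 - integral {0..1} (\<lambda>x. wx t x * v x)) absolutely_integrable_on {0..1}"
      by (intro set_integral_diff(1) set_integral_add(1) absolutely_integrable_continuous_real[OF cGV]
          absolutely_integrable_continuous_real[OF cwx] set_integrable_mult_left) (use bd in auto)
  qed
qed

text \<open>The return from w to exp(-k t) w: its velocity is exp(-k t) (w_t - k w), and the product
  rule in time produces the damping 2 k and the zero order term k^2.\<close>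

lemma damped_weak_form:
  assumes V: "AC 0 1 V v" and v: "v \<in> L2 0 1"
  shows "AC 0 1 (\<lambda>t. integral {0..1} (\<lambda>x. exp (- k * t) * (wt t x - k * w t x) * V x))
    (\<lambda>t. exp (- k * t) * (integral {0..1} (\<lambda>x. G t x * V x) + wx t 1 * V 1 - wx t 0 * V 0)
        - integral {0..1} (\<lambda>x. exp (- k * t) * wx t x * v x) - k\<^sup>2 * integral {0..1} (\<lambda>x. exp (- k * t) * w t x * V x)
        - 2 * k * integral {0..1} (\<lambda>x. exp (- k * t) * (wt t x - k * w t x) * V x))"
proof -
  have VL: "V \<in> L2 0 1" by (rule L2_continuous[OF AC_continuous[OF V]])
  have wV: "AC 0 1 (\<lambda>t. integral {0..1} (\<lambda>x. w t x * V x)) (\<lambda>t. integral {0..1} (\<lambda>x. wt t x * V x))"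
    by (intro AC_DERIV C1_L2_inner_DERIV[OF w_C1 VL] continuous_L2_inner[OF wt_continuous_L2 VL])
  have eq: "integral {0..1} (\<lambda>x. exp (- k * t) * (wt t x - k * w t x) * V x) =
      exp (- k * t) * (integral {0..1} (\<lambda>x. wt t x * V x) - k * integral {0..1} (\<lambda>x. w t x * V x))" if t: "t \<in> {0..1}" for t
  proof -
    have i: "(\<lambda>x. wt t x * V x) integrable_on {0..1}" "(\<lambda>x. k * (w t x * V x)) integrable_on {0..1}"
      using t by (auto intro!: integrable_on_mult_right L2_mult_abs_int(2) VL continuous_L2D(1)[OF wt_continuous_L2] continuous_L2D(1)[OF w_continuous_L2])
    have "integral {0..1} (\<lambda>x. exp (- k * t) * (wt t x - k * w t x) * V x) =
        integral {0..1} (\<lambda>x. exp (- k * t) * (wt t x * V x - k * (w t x * V x)))"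
      by (intro integral_cong) (simp add: algebra_simps)
    then show ?thesis
      using Henstock_Kurzweil_Integration.integral_diff[OF i] by simp
  qed
  show ?thesis
  proof (rule AC_cong[OF AC_exp_mult[OF AC_minus[OF wave_weak_form[OF V v] AC_cmult[OF wV, of k]], of "- k"]])
    show "AE t in lebesgue_on {0<..<1}. exp (- k * t) *
         (integral {0..1} (\<lambda>x. G t x * V x) + wx t 1 * V 1 - wx t 0 * V 0 - integral {0..1} (\<lambda>x. wx t x * v x) -
          k * integral {0..1} (\<lambda>x. wt t x * V x) + - k * (integral {0..1} (\<lambda>x. wt t x * V x) - k * integral {0..1} (\<lambda>x. w t x * V x))) =
      exp (- k * t) * (integral {0..1} (\<lambda>x. G t x * V x) + wx t 1 * V 1 - wx t 0 * V 0)
        - integral {0..1} (\<lambda>x. exp (- k * t) * wx t x * v x) - k\<^sup>2 * integral {0..1} (\<lambda>x. exp (- k * t) * w t x * V x)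
        - 2 * k * integral {0..1} (\<lambda>x. exp (- k * t) * (wt t x - k * w t x) * V x)"
    proof (rule AE_IooI[OF negligible_empty])
      fix t :: real assume "t \<in> {0..1}"
      note eq = eq[OF this]
      have e: "integral {0..1} (\<lambda>x. exp (- k * t) * wx t x * v x) = exp (- k * t) * integral {0..1} (\<lambda>x. wx t x * v x)"
        "integral {0..1} (\<lambda>x. exp (- k * t) * w t x * V x) = exp (- k * t) * integral {0..1} (\<lambda>x. w t x * V x)"
        by (simp_all add: mult.assoc)
      show "exp (- k * t) *
         (integral {0..1} (\<lambda>x. G t x * V x) + wx t 1 * V 1 - wx t 0 * V 0 - integral {0..1} (\<lambda>x. wx t x * v x) -
          k * integral {0..1} (\<lambda>x. wt t x * V x) + - k * (integral {0..1} (\<lambda>x. wt t x * V x) - k * integral {0..1} (\<lambda>x. w t x * V x))) =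
      exp (- k * t) * (integral {0..1} (\<lambda>x. G t x * V x) + wx t 1 * V 1 - wx t 0 * V 0)
        - integral {0..1} (\<lambda>x. exp (- k * t) * wx t x * v x) - k\<^sup>2 * integral {0..1} (\<lambda>x. exp (- k * t) * w t x * V x)
        - 2 * k * integral {0..1} (\<lambda>x. exp (- k * t) * (wt t x - k * w t x) * V x)"
        unfolding eq e by (simp add: algebra_simps power2_eq_square)
    qed
  qed (rule eq[symmetric])
qed

end

section \<open>Uniqueness for the linear Neumann problem\<close>

text \<open>The linear span of the Neumann eigenfunctions of the interval. The product formula for
  cosines makes it an algebra, so that Stone-Weierstrass applies.\<close>

inductive cos_poly :: "(real \<Rightarrow> real) \<Rightarrow> bool" where
  cos: "cos_poly (\<lambda>x. cos (real n * pi * x))"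
| scale: "cos_poly f \<Longrightarrow> cos_poly (\<lambda>x. c * f x)"
| add: "cos_poly f \<Longrightarrow> cos_poly g \<Longrightarrow> cos_poly (\<lambda>x. f x + g x)"

lemma cos_poly_cos_mult: "cos_poly g \<Longrightarrow> cos_poly (\<lambda>x. cos (real n * pi * x) * g x)"
proof (induction rule: cos_poly.induct)
  case (cos m)
  have *: "cos_poly (\<lambda>x. cos (real n * pi * x - real m * pi * x))"
  proof (cases "m \<le> n")
    case True
    have "cos_poly (\<lambda>x. cos (real (n - m) * pi * x))" by (rule cos_poly.cos)
    then show ?thesis using True by (simp add: of_nat_diff left_diff_distrib)
  next
    case False
    have "cos_poly (\<lambda>x. cos (- (real (m - n) * pi * x)))" unfolding cos_minus by (rule cos_poly.cos)
    then show ?thesis using False by (simp add: of_nat_diff left_diff_distrib)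
  qed
  have "cos_poly (\<lambda>x. cos (real (n + m) * pi * x))" by (rule cos_poly.cos)
  then have "cos_poly (\<lambda>x. cos (real n * pi * x + real m * pi * x))"
    by (simp add: distrib_right)
  from cos_poly.scale[OF cos_poly.add[OF * this], of "1/2"]
  show ?case by (simp add: cos_times_cos)
next
  case (scale f c)
  from cos_poly.scale[OF scale.IH, of c] show ?case by (simp add: mult.left_commute)
next
  case (add f g)
  from cos_poly.add[OF add.IH] show ?case by (simp add: distrib_left)
qed

lemma cos_poly_mult: "cos_poly f \<Longrightarrow> cos_poly g \<Longrightarrow> cos_poly (\<lambda>x. f x * g x)"
proof (induction rule: cos_poly.induct)
  case (cos n)
  then show ?case by (rule cos_poly_cos_mult)
next
  case (scale f c)
  from cos_poly.scale[OF scale.IH[OF scale.prems], of c] show ?case by (simp add: mult.assoc)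
next
  case (add f h)
  from cos_poly.add[OF add.IH(1)[OF add.prems] add.IH(2)[OF add.prems]] show ?case by (simp add: distrib_right)
qed

lemma cos_poly_continuous: "cos_poly f \<Longrightarrow> continuous_on S f"
  by (induction rule: cos_poly.induct) (auto intro!: continuous_intros)

text \<open>The mode n = 0 supplies the constants, and n = 1 separates points because cos(pi x) is
  injective on [0,1].\<close>

interpretation cos_ring: function_ring_on "{f. cos_poly f}" "{0..1::real}"
proof
  show "compact {0..1::real}" by simp
  show "continuous_on {0..1} f" if "f \<in> {f. cos_poly f}" for f
    using that by (simp add: cos_poly_continuous)
  show "(\<lambda>x. f x + g x) \<in> {f. cos_poly f}" if "f \<in> {f. cos_poly f}" "g \<in> {f. cos_poly f}" for f g
    using that by (simp add: cos_poly.add)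
  show "(\<lambda>x. f x * g x) \<in> {f. cos_poly f}" if "f \<in> {f. cos_poly f}" "g \<in> {f. cos_poly f}" for f g
    using that by (simp add: cos_poly_mult)
  show "(\<lambda>_. c) \<in> {f. cos_poly f}" for c
    using cos_poly.scale[OF cos_poly.cos[of 0], of c] by simp
  show "\<exists>f\<in>{f. cos_poly f}. f x \<noteq> f y" if "x \<in> {0..1}" "y \<in> {0..1}" "x \<noteq> y" for x y :: real
  proof (intro bexI)
    show "cos (real 1 * pi * x) \<noteq> cos (real 1 * pi * y)"
      using that cos_inj_pi[of "pi * x" "pi * y"] by (auto simp: mult_left_le)
  qed (use cos_poly.cos[of 1] in simp)
qed

text \<open>\<open>F\<close> is orthogonal to the span, so its squared norm equals the integral of F
  (F - g) for every \<open>g\<close> in the span, and F - g can be made uniformly small.\<close>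

lemma cos_complete:
  assumes F: "continuous_on {0..1} F"
    and zero: "\<And>n. integral {0..1} (\<lambda>x. F x * cos (real n * pi * x)) = 0"
    and x: "x \<in> {0..1}"
  shows "F x = (0::real)"
proof -
  have cp: "integral {0..1} (\<lambda>x. F x * g x) = 0" if "cos_poly g" for g
    using that
  proof (induction rule: cos_poly.induct)
    case (cos n)
    then show ?case by (rule zero)
  next
    case (scale f c)
    then show ?case by (simp add: mult.left_commute)
  next
    case (add f g)
    then show ?case
      using F by (simp add: distrib_left Henstock_Kurzweil_Integration.integral_add integrable_continuous_real
          continuous_on_mult cos_poly_continuous)
  qed
  define M where "M = integral {0..1} (\<lambda>x. \<bar>F x\<bar>)"
  have M0: "M \<ge> 0"
    unfolding M_def by (intro Henstock_Kurzweil_Integration.integral_nonneg integrable_continuous_real continuous_intros F) auto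
  have "sq 0 1 F \<le> e" if "e > 0" for e
  proof -
    \<comment> \<open>The added 1 excludes division by zero.\<close>
    have "e / (M + 1) > 0" using that M0 by simp
    from cos_ring.Stone_Weierstrass_basic[OF F this]
    obtain g where g: "cos_poly g" "\<And>x. x \<in> {0..1} \<Longrightarrow> \<bar>F x - g x\<bar> < e / (M + 1)" by blast
    have gc: "continuous_on {0..1} g" by (rule cos_poly_continuous[OF g(1)])
    have "sq 0 1 F = integral {0..1} (\<lambda>x. F x * (F x - g x)) + integral {0..1} (\<lambda>x. F x * g x)"
      unfolding sq_def using F gc
      by (subst Henstock_Kurzweil_Integration.integral_add[symmetric])
        (auto intro!: integrable_continuous_real continuous_intros simp: right_diff_distrib power2_eq_square)
    also have "\<dots> = integral {0..1} (\<lambda>x. F x * (F x - g x))" by (simp add: cp[OF g(1)])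
    also have "\<dots> \<le> integral {0..1} (\<lambda>x. \<bar>F x\<bar> * (e / (M + 1)))"
    proof (intro integral_le integrable_continuous_real continuous_intros F gc)
      fix x :: real assume "x \<in> {0..1}"
      have "F x * (F x - g x) \<le> \<bar>F x\<bar> * \<bar>F x - g x\<bar>" by (metis abs_ge_self abs_mult)
      also have "\<dots> \<le> \<bar>F x\<bar> * (e / (M + 1))"
        using g(2)[OF \<open>x \<in> {0..1}\<close>] by (intro mult_left_mono) auto
      finally show "F x * (F x - g x) \<le> \<bar>F x\<bar> * (e / (M + 1))" .
    qed
    also have "\<dots> = M * (e / (M + 1))" by (simp add: M_def)
    also have "\<dots> \<le> e" using that M0 by (simp add: field_simps)
    finally show ?thesis .
  qed
  then have "sq 0 1 F = 0" using sq_nonneg[of 0 1 F] field_le_epsilon[of "sq 0 1 F" 0] by simp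
  then have "\<forall>x\<in>cbox 0 1. (F x)\<^sup>2 = 0"
    using F integral_cbox_eq_0_iff[of 0 1 "\<lambda>x. (F x)\<^sup>2"] by (auto simp: sq_def intro!: continuous_intros)
  then show ?thesis using x by auto
qed

text \<open>The energy z^2 + \<omega> y^2 starts at zero and has the derivative - 2 d z^2, so it
  cannot grow.\<close>

lemma damped_oscillator_unique:
  assumes y: "AC 0 \<tau> y z" and z: "AC 0 \<tau> z (\<lambda>t. - \<omega> * y t - d * z t)" and "\<omega> > 0" "d \<ge> 0"
    and init: "y 0 = 0" "z 0 = 0" and t: "t \<in> {0..\<tau>}"
  shows "y t = 0"
proof -
  have "AC 0 \<tau> (\<lambda>t. z t * z t + \<omega> * (y t * y t)) (\<lambda>t. ((- \<omega> * y t - d * z t) * z t + z t * (- \<omega> * y t - d * z t)) + \<omega> * (z t * y t + y t * z t))"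
    by (intro AC_add AC_mult AC_cmult y z)
  then have "AC 0 \<tau> (\<lambda>t. z t * z t + \<omega> * (y t * y t)) (\<lambda>t. - (2 * d * (z t * z t)))"
    by (rule AC_cong) (auto simp: algebra_simps)
  from ACD(3)[OF this t] have e: "z t * z t + \<omega> * (y t * y t) = integral {0..t} (\<lambda>t. - (2 * d * (z t * z t)))"
    using init by simp
  have zc: "continuous_on {0..t} z" by (rule continuous_on_subset[OF AC_continuous[OF z]]) (use t in auto)
  have "integral {0..t} (\<lambda>t. - (2 * d * (z t * z t))) \<le> integral {0..t} (\<lambda>t. 0)"
    using \<open>d \<ge> 0\<close> by (intro integral_le integrable_continuous_real continuous_intros zc) auto
  then have "integral {0..t} (\<lambda>t. - (2 * d * (z t * z t))) \<le> 0" by (simp only: Henstock_Kurzweil_Integration.integral_0)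
  then have "\<omega> * (y t * y t) \<le> 0" using e zero_le_square[of "z t"] by linarith
  then have "y t * y t \<le> 0" using \<open>\<omega> > 0\<close> by (simp add: mult_le_0_iff)
  then show ?thesis using zero_le_square[of "y t"] by simp
qed

text \<open>Upgrades a distributional identity for a continuous function, such as the pairing of the
  velocity with a test function, to an integrated identity that holds at every time.\<close>

lemma has_weak_deriv_continuous_AC:
  assumes "a < b" "continuous_on {a..b} f" "has_weak_deriv a b f g" "g absolutely_integrable_on {a..b}"
  shows "AC a b f g"
proof -
  obtain F where F: "AC a b F g" "AE x in lebesgue_on {a<..<b}. f x = F x"
    by (rule has_weak_deriv_imp_AC[OF assms(1,3,4)]) blast
  show ?thesis
    by (rule AC_cong[OF F(1)])
      (use AE_eq_continuous_imp_eq[OF assms(1,2) AC_continuous[OF F(1)] F(2)] in auto)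
qed

lemma AC_unique_density:
  assumes "a < b" "AC a b F f" "AC a b F g"
  shows "AE x in lebesgue_on {a<..<b}. f x = g x"
  using assms AC_has_weak_deriv has_weak_deriv_unique by blast

lemma continuous_H1D: "continuous_H1 \<tau> u \<Longrightarrow> t \<in> {0..\<tau>} \<Longrightarrow> u t \<in> H1 0 1"
  by (simp add: continuous_H1_def)

text \<open>The cosines \<open>cos (n \<pi> x)\<close> satisfy the homogeneous Neumann conditions, so the coefficients of the
  difference of two solutions solve damped oscillator equations with zero initial data.\<close>

lemma modes_unique:
  assumes "0 < \<tau>" "0 < k" and u: "continuous_H1 \<tau> u" and w: "continuous_H1 \<tau> w"
    and u': "has_C1_L2_deriv \<tau> u u'" and w': "has_C1_L2_deriv \<tau> w w'"
    and init: "AE x in lebesgue_on {0<..<1}. u 0 x = w 0 x" "AE x in lebesgue_on {0<..<1}. u' 0 x = w' 0 x"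
    and weak: "\<And>V v. AC 0 1 V v \<Longrightarrow> continuous_on {0..1} v \<Longrightarrow>
      AC 0 \<tau> (\<lambda>t. integral {0..1} (\<lambda>x. u' t x * V x) - integral {0..1} (\<lambda>x. w' t x * V x))
        (\<lambda>t. - (integral {0..1} (\<lambda>x. weak_deriv 0 1 (u t) x * v x) - integral {0..1} (\<lambda>x. weak_deriv 0 1 (w t) x * v x))
           - k\<^sup>2 * (integral {0..1} (\<lambda>x. u t x * V x) - integral {0..1} (\<lambda>x. w t x * V x))
           - 2 * k * (integral {0..1} (\<lambda>x. u' t x * V x) - integral {0..1} (\<lambda>x. w' t x * V x)))"
    and t: "t \<in> {0..\<tau>}" and x: "x \<in> {0..1}"
  shows "cont_rep 0 1 (u t) x = cont_rep 0 1 (w t) x"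
proof -
  define F where "F = (\<lambda>t x. cont_rep 0 1 (u t) x - cont_rep 0 1 (w t) x)"
  have uL: "continuous_L2 \<tau> u" "continuous_L2 \<tau> u'" "continuous_L2 \<tau> w" "continuous_L2 \<tau> w'"
    using u' w' by (auto simp: has_C1_L2_deriv_def)
  have FA: "AC 0 1 (F t) (\<lambda>x. weak_deriv 0 1 (u t) x - weak_deriv 0 1 (w t) x)" if "t \<in> {0..\<tau>}" for t
    unfolding F_def by (intro AC_minus H1_AC continuous_H1D[OF u that] continuous_H1D[OF w that]) auto
  have FV: "integral {0..1} (\<lambda>x. F t x * V x) = integral {0..1} (\<lambda>x. u t x * V x) - integral {0..1} (\<lambda>x. w t x * V x)"
    if t: "t \<in> {0..\<tau>}" and V: "continuous_on {0..1} V" for t V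
  proof -
    have VL: "V \<in> L2 0 1" by (rule L2_continuous[OF V])
    have i: "(\<lambda>x. u t x * V x) integrable_on {0..1}" "(\<lambda>x. w t x * V x) integrable_on {0..1}"
      by (intro L2_mult_abs_int(2) VL continuous_L2D(1)[OF uL(1) t] continuous_L2D(1)[OF uL(3) t])+
    have ae: "AE x in lebesgue_on {0<..<1}. F t x * V x = u t x * V x - w t x * V x"
      using H1_AC(3)[OF continuous_H1D[OF u t]] H1_AC(3)[OF continuous_H1D[OF w t]]
      by (auto simp: F_def left_diff_distrib elim!: eventually_elim2)
    show ?thesis
      unfolding integral_AE_cong(1)[OF ae] by (rule Henstock_Kurzweil_Integration.integral_diff[OF i])
  qed
  have "integral {0..1} (\<lambda>x. F t x * cos (real n * pi * x)) = 0" for n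
  proof -
    define c where "c = real n * pi"
    define V where "V = (\<lambda>x::real. cos (c * x))"
    define v where "v = (\<lambda>x::real. - c * sin (c * x))"
    have Vc: "continuous_on {0..1} V" "continuous_on {0..1} v"
      unfolding V_def v_def by (intro continuous_intros)+
    have VA: "AC 0 1 V v"
      by (rule AC_DERIV[OF _ Vc(2)]) (auto simp: V_def v_def intro!: derivative_eq_intros)
    have vA: "AC 0 1 v (\<lambda>x. - c\<^sup>2 * V x)"
      by (rule AC_DERIV) (auto simp: V_def v_def power2_eq_square intro!: derivative_eq_intros continuous_intros)
    have v0: "v 0 = 0" "v 1 = 0" by (auto simp: v_def c_def)
    define y where "y = (\<lambda>t. integral {0..1} (\<lambda>x. u t x * V x) - integral {0..1} (\<lambda>x. w t x * V x))"
    define z where "z = (\<lambda>t. integral {0..1} (\<lambda>x. u' t x * V x) - integral {0..1} (\<lambda>x. w' t x * V x))"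
    have VL: "V \<in> L2 0 1" by (rule L2_continuous[OF Vc(1)])
    have yA: "AC 0 \<tau> y z"
      unfolding y_def z_def
      by (intro AC_minus AC_DERIV C1_L2_inner_DERIV[OF u' VL] C1_L2_inner_DERIV[OF w' VL] continuous_L2_inner uL VL)
    have parts: "integral {0..1} (\<lambda>x. weak_deriv 0 1 (u t) x * v x) - integral {0..1} (\<lambda>x. weak_deriv 0 1 (w t) x * v x) = c\<^sup>2 * y t"
      if t: "t \<in> {0..\<tau>}" for t
    proof -
      have vL: "v \<in> L2 0 1" by (rule L2_continuous[OF Vc(2)])
      have i: "(\<lambda>x. weak_deriv 0 1 (u t) x * v x) integrable_on {0..1}" "(\<lambda>x. weak_deriv 0 1 (w t) x * v x) integrable_on {0..1}"
        by (intro L2_mult_abs_int(2) vL H1_AC(2) continuous_H1D[OF u t] continuous_H1D[OF w t]; simp)+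
      have "integral {0..1} (\<lambda>x. weak_deriv 0 1 (u t) x * v x) - integral {0..1} (\<lambda>x. weak_deriv 0 1 (w t) x * v x) =
          integral {0..1} (\<lambda>x. (weak_deriv 0 1 (u t) x - weak_deriv 0 1 (w t) x) * v x)"
        using Henstock_Kurzweil_Integration.integral_diff[OF i] by (simp add: left_diff_distrib)
      also have "\<dots> = - integral {0..1} (\<lambda>x. F t x * (- c\<^sup>2 * V x))"
        using AC_by_parts[OF FA[OF t] vA] v0 by simp
      also have "\<dots> = c\<^sup>2 * integral {0..1} (\<lambda>x. F t x * V x)"
        by (simp add: mult.left_commute[of _ "c\<^sup>2"])
      finally show ?thesis by (simp add: FV[OF t Vc(1)] y_def)
    qed
    \<comment> \<open>The frequency collects c^2 from the space derivatives and k^2 from the zero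
      order term; k > 0 makes it positive for the constant mode as well.\<close>
    have zA: "AC 0 \<tau> z (\<lambda>t. - (c\<^sup>2 + k\<^sup>2) * y t - (2 * k) * z t)"
    proof (rule AC_cong[OF weak[OF VA Vc(2)]])
      show "AE t in lebesgue_on {0<..<\<tau>}. - (integral {0..1} (\<lambda>x. weak_deriv 0 1 (u t) x * v x) - integral {0..1} (\<lambda>x. weak_deriv 0 1 (w t) x * v x))
           - k\<^sup>2 * (integral {0..1} (\<lambda>x. u t x * V x) - integral {0..1} (\<lambda>x. w t x * V x))
           - 2 * k * (integral {0..1} (\<lambda>x. u' t x * V x) - integral {0..1} (\<lambda>x. w' t x * V x)) = - (c\<^sup>2 + k\<^sup>2) * y t - (2 * k) * z t"
      proof (rule AE_IooI[OF negligible_empty])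
        fix t assume "t \<in> {0..\<tau>}"
        from parts[OF this] show "- (integral {0..1} (\<lambda>x. weak_deriv 0 1 (u t) x * v x) - integral {0..1} (\<lambda>x. weak_deriv 0 1 (w t) x * v x))
           - k\<^sup>2 * (integral {0..1} (\<lambda>x. u t x * V x) - integral {0..1} (\<lambda>x. w t x * V x))
           - 2 * k * (integral {0..1} (\<lambda>x. u' t x * V x) - integral {0..1} (\<lambda>x. w' t x * V x)) = - (c\<^sup>2 + k\<^sup>2) * y t - (2 * k) * z t"
          unfolding y_def[symmetric] z_def[symmetric] by (simp add: y_def z_def algebra_simps)
      qed
    qed (simp add: z_def)
    have "integral {0..1} (\<lambda>x. u 0 x * V x) = integral {0..1} (\<lambda>x. w 0 x * V x)"
      "integral {0..1} (\<lambda>x. u' 0 x * V x) = integral {0..1} (\<lambda>x. w' 0 x * V x)"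
      by (rule integral_AE_cong; use init in \<open>auto elim: eventually_mono\<close>)+
    then have "y 0 = 0" "z 0 = 0" by (auto simp: y_def z_def)
    then have "y t = 0"
      using \<open>0 < k\<close> by (intro damped_oscillator_unique[OF yA zA _ _ _ _ t]) (auto simp: add_nonneg_pos)
    then show ?thesis using FV[OF t Vc(1)] by (simp add: y_def V_def c_def)
  qed
  from cos_complete[OF AC_continuous[OF FA[OF t]] this x] show ?thesis by (simp add: F_def)
qed

lemma sq_continuous_H1I:
  assumes "\<And>t. t \<in> {0..\<tau>} \<Longrightarrow> AC 0 1 (u t) (ux t)" and u: "continuous_L2 \<tau> u" and ux: "continuous_L2 \<tau> ux"
  shows "continuous_H1 \<tau> u"
  unfolding continuous_H1_def
proof (intro conjI ballI)
  fix t assume t: "t \<in> {0..\<tau>}"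
  show "u t \<in> H1 0 1"
    by (rule H1I(1)[OF _ assms(1)[OF t] continuous_L2D(1)[OF ux t]]) auto
  have "((\<lambda>s. (H1_norm 0 1 (\<lambda>x. u s x - u t x))\<^sup>2) \<longlongrightarrow> 0) (at t within {0..\<tau>})"
  proof (rule tendsto_zero_bound)
    show "((\<lambda>s. sq 0 1 (\<lambda>x. u s x - u t x) + sq 0 1 (\<lambda>x. ux s x - ux t x)) \<longlongrightarrow> 0) (at t within {0..\<tau>})"
      using continuous_L2D(2)[OF u t] continuous_L2D(2)[OF ux t] by (auto intro!: tendsto_eq_intros)
    fix s assume s: "s \<in> {0..\<tau>}"
    have A: "AC 0 1 (\<lambda>x. u s x - u t x) (\<lambda>x. ux s x - ux t x)" by (intro AC_minus assms(1) s t)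
    have L: "(\<lambda>x. ux s x - ux t x) \<in> L2 0 1" by (intro L2_minus continuous_L2D(1)[OF ux] s t)
    have h: "(\<lambda>x. u s x - u t x) \<in> H1 0 1" "AE x in lebesgue_on {0<..<1}. weak_deriv 0 1 (\<lambda>x. u s x - u t x) x = ux s x - ux t x"
      using H1I[OF _ A L, of "\<lambda>x. u s x - u t x"] by auto
    show "(H1_norm 0 1 (\<lambda>x. u s x - u t x))\<^sup>2 \<le> sq 0 1 (\<lambda>x. u s x - u t x) + sq 0 1 (\<lambda>x. ux s x - ux t x)"
      using H1_norm_eq[OF h(1)] sq_AE_cong[OF h(2)] by simp
  qed simp
  then have "((\<lambda>s. sqrt ((H1_norm 0 1 (\<lambda>x. u s x - u t x))\<^sup>2)) \<longlongrightarrow> 0) (at t within {0..\<tau>})"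
    by (subst tendsto_sqrt_iff) auto
  moreover have "0 \<le> H1_norm 0 1 f" for f by (simp add: H1_norm_def)
  ultimately show "((\<lambda>s. H1_norm 0 1 (\<lambda>x. u s x - u t x)) \<longlongrightarrow> 0) (at t within {0..\<tau>})" by simp
qed

lemma C1_L2_subset:
  assumes "has_C1_L2_deriv \<tau> u u'" "\<sigma> \<le> \<tau>"
  shows "has_C1_L2_deriv \<sigma> u u'"
  using assms continuous_L2_subset unfolding has_C1_L2_deriv_def
  by (auto intro!: tendsto_within_subset[where S = "{0..\<tau>}" and T = "{0..\<sigma>}"])

text \<open>The error of the product's difference quotient splits into c(s) times the error for
  \<open>u\<close>, the increment of \<open>c\<close> times u', and the error for \<open>c\<close>
  times u(t).\<close>

lemma C1_L2_scale:
  assumes u: "has_C1_L2_deriv \<tau> u u'" and c: "\<And>t. t \<in> {0..\<tau>} \<Longrightarrow> (c has_real_derivative c' t) (at t within {0..\<tau>})"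
    and c': "continuous_on {0..\<tau>} c'"
  shows "has_C1_L2_deriv \<tau> (\<lambda>t x. c t * u t x) (\<lambda>t x. c t * u' t x + c' t * u t x)"
proof -
  have uL: "continuous_L2 \<tau> u" "continuous_L2 \<tau> u'" using u by (auto simp: has_C1_L2_deriv_def)
  have cc: "continuous_on {0..\<tau>} c" using c by (meson DERIV_continuous_on)
  show ?thesis
    unfolding has_C1_L2_deriv_def
  proof (intro conjI ballI)
    show k1: "continuous_L2 \<tau> (\<lambda>t x. c t * u t x)" by (intro continuous_L2_scale uL cc)
    show k2: "continuous_L2 \<tau> (\<lambda>t x. c t * u' t x + c' t * u t x)" by (intro continuous_L2_add continuous_L2_scale uL cc c')
    fix t assume t: "t \<in> {0..\<tau>}"
    define d where "d = (\<lambda>s x. (u s x - u t x) / (s - t) - u' t x)"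
    define q where "q = (\<lambda>s x. (c s * u s x - c t * u t x) / (s - t) - (c t * u' t x + c' t * u t x))"
    have dL: "d s \<in> L2 0 1" if s: "s \<in> {0..\<tau>}" for s
      using L2_cmult[OF L2_minus[OF continuous_L2D(1)[OF uL(1) s] continuous_L2D(1)[OF uL(1) t]], of "1 / (s - t)"]
      unfolding d_def by (intro L2_minus continuous_L2D(1)[OF uL(2) t]) simp
    have qL: "q s \<in> L2 0 1" if s: "s \<in> {0..\<tau>}" for s
      using L2_cmult[OF L2_minus[OF continuous_L2D(1)[OF k1 s] continuous_L2D(1)[OF k1 t]], of "1 / (s - t)"]
      unfolding q_def by (intro L2_minus continuous_L2D(1)[OF k2 t]) simp
    have ct: "(c \<longlongrightarrow> c t) (at t within {0..\<tau>})" using cc t by (auto simp: continuous_on_def)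
    define r where "r = (\<lambda>s. (c s - c t) / (s - t) - c' t)"
    have rt: "(r \<longlongrightarrow> 0) (at t within {0..\<tau>})"
      using LIM_zero[OF c[OF t, unfolded has_field_derivative_iff]] by (simp add: r_def)
    have dt: "((\<lambda>s. sq 0 1 (d s)) \<longlongrightarrow> 0) (at t within {0..\<tau>})"
      using C1_L2_D[OF u t] by (simp add: d_def)
    have "((\<lambda>s. sq 0 1 (q s)) \<longlongrightarrow> 0) (at t within {0..\<tau>})"
    proof (rule Lim_transform_eventually)
      \<comment> \<open>At s = t division by zero gives the value 0, so \<open>q t\<close> is minus
        the claimed derivative. The limit does not see this point, but
        \<open>tendsto_zero_bound\<close> asks for a bound there too, so it is overwritten.\<close>
      show "((\<lambda>s. if s = t then 0 else sq 0 1 (q s)) \<longlongrightarrow> 0) (at t within {0..\<tau>})"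
      proof (rule tendsto_zero_bound)
        show "((\<lambda>s. 2 * ((c s)\<^sup>2 * sq 0 1 (d s)) + 2 * (2 * ((c s - c t)\<^sup>2 * sq 0 1 (u' t)) + 2 * ((r s)\<^sup>2 * sq 0 1 (u t)))) \<longlongrightarrow> 0) (at t within {0..\<tau>})"
          using dt ct rt by (auto intro!: tendsto_eq_intros)
        fix s assume s: "s \<in> {0..\<tau>}"
        show "(if s = t then 0 else sq 0 1 (q s)) \<le> 2 * ((c s)\<^sup>2 * sq 0 1 (d s)) + 2 * (2 * ((c s - c t)\<^sup>2 * sq 0 1 (u' t)) + 2 * ((r s)\<^sup>2 * sq 0 1 (u t)))"
        proof (cases "s = t")
          case False
          have "q s = (\<lambda>x. c s * d s x + ((c s - c t) * u' t x + (r s) * u t x))"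
            using False by (auto simp: r_def q_def d_def fun_eq_iff divide_simps) (simp add: algebra_simps)
          then have "sq 0 1 (q s) \<le> 2 * sq 0 1 (\<lambda>x. c s * d s x) + 2 * sq 0 1 (\<lambda>x. (c s - c t) * u' t x + (r s) * u t x)"
            by (simp only:) (intro sq_add_le L2_add L2_cmult dL s continuous_L2D(1)[OF uL(1) t] continuous_L2D(1)[OF uL(2) t])
          moreover have "sq 0 1 (\<lambda>x. (c s - c t) * u' t x + (r s) * u t x) \<le>
              2 * sq 0 1 (\<lambda>x. (c s - c t) * u' t x) + 2 * sq 0 1 (\<lambda>x. (r s) * u t x)"
            by (intro sq_add_le L2_cmult continuous_L2D(1)[OF uL(1) t] continuous_L2D(1)[OF uL(2) t])
          ultimately show ?thesis using False unfolding sq_cmult by simp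
        qed (simp add: sq_nonneg)
      qed (simp add: sq_nonneg)
      show "eventually (\<lambda>s. (if s = t then 0 else sq 0 1 (q s)) = sq 0 1 (q s)) (at t within {0..\<tau>})"
        by (simp add: eventually_at_filter)
    qed
    then have "((\<lambda>s. sqrt (sq 0 1 (q s))) \<longlongrightarrow> 0) (at t within {0..\<tau>})"
      by (subst tendsto_sqrt_iff) (rule sq_nonneg)
    moreover have "L2_norm 0 1 (q s) = sqrt (sq 0 1 (q s))" if "s \<in> {0..\<tau>}" for s
      by (rule L2_norm_eq[OF qL[OF that]])
    ultimately have "((\<lambda>s. L2_norm 0 1 (q s)) \<longlongrightarrow> 0) (at t within {0..\<tau>})"
      by (auto elim!: Lim_transform_eventually simp: eventually_at_filter)
    then show "((\<lambda>s. L2_norm 0 1 (\<lambda>x. (c s * u s x - c t * u t x) / (s - t) - (c t * u' t x + c' t * u t x))) \<longlongrightarrow> 0) (at t within {0..\<tau>})"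
      by (simp add: q_def)
  qed
qed

lemma L2_reflect: "f \<in> L2 (- b) (- a) \<Longrightarrow> (\<lambda>x. f (- x)) \<in> L2 a b"
  using absolutely_integrable_reflect_real[where f = f and a = "- b" and b = "- a"]
    absolutely_integrable_reflect_real[where f = "\<lambda>x. (f x)\<^sup>2" and a = "- b" and b = "- a"] by (simp add: L2_iff)

context wave
begin

lemma damped_continuous_H1: "continuous_H1 1 (\<lambda>t x. exp (- k * t) * w t x)"
  by (rule sq_continuous_H1I[where ux = "\<lambda>t x. exp (- k * t) * wx t x"])
    (auto intro!: AC_cmult w_AC_space continuous_L2_scale w_continuous_L2 wx_continuous_L2 continuous_intros)

lemma damped_C1: "has_C1_L2_deriv 1 (\<lambda>t x. exp (- k * t) * w t x) (\<lambda>t x. exp (- k * t) * (wt t x - k * w t x))"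
proof -
  have "has_C1_L2_deriv 1 (\<lambda>t x. exp (- k * t) * w t x) (\<lambda>t x. exp (- k * t) * wt t x + (- k * exp (- k * t)) * w t x)"
    by (rule C1_L2_scale[OF w_C1]) (intro DERIV_exp_lin continuous_intros)+
  then show ?thesis by (simp add: algebra_simps)
qed

lemma damped_weak_deriv:
  assumes "t \<in> {0..1}"
  shows "AE x in lebesgue_on {0<..<1}. weak_deriv 0 1 (\<lambda>x. exp (- k * t) * w t x) x = exp (- k * t) * wx t x"
    "x \<in> {0..1} \<Longrightarrow> cont_rep 0 1 (\<lambda>x. exp (- k * t) * w t x) x = exp (- k * t) * w t x"
  by (rule H1I[OF _ AC_cmult[OF w_AC_space[OF assms]] L2_cmult[OF continuous_L2D(1)[OF wx_continuous_L2 assms]]]; simp)+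

text \<open>Hidden regularity: along a vertical line the velocity consists of the same L2 profiles,
  read in the time variable, and of a continuous Duhamel part. The traces of the solution therefore
  lie in H1 in time.\<close>

lemma wt_time_L2:
  assumes "x \<in> {0, 1}"
  shows "(\<lambda>t. wt t x) \<in> L2 0 1"
proof -
  have "(\<lambda>t. a (t + x)) \<in> L2 (-1 - x) (2 - x)" by (rule L2_shift[OF a_L2])
  then have 1: "(\<lambda>t. a (t + x)) \<in> L2 0 1" by (rule L2_subinterval) (use assms in auto)
  have "(\<lambda>t. b (t + x)) \<in> L2 (-1 - x) (2 - x)" by (rule L2_shift[OF b_L2])
  then have "(\<lambda>t. b (t + x)) \<in> L2 (- 1) (- 0)" by (rule L2_subinterval) (use assms in auto)
  from L2_reflect[OF this] have 2: "(\<lambda>t. b (- t + x)) \<in> L2 0 1" by simp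
  have "(\<lambda>t. (a (t + x) - b (- t + x)) + (duhamel 1 G t x + duhamel (-1) G t x) / 2) \<in> L2 0 1"
    by (intro L2_add L2_minus 1 2 L2_continuous continuous_intros duhamel_cont_time) auto
  then show ?thesis by (simp add: wt_def add.commute)
qed

end

section \<open>Truncated sources and outgoing waves\<close>

text \<open>Away from zero this is the power rule; at zero the difference quotient is
  \<open>\<bar>h\<bar> powr (q - 2)\<close>, which tends to 0 because q > 2.\<close>

lemma power_source_DERIV:
  assumes "q > 2"
  shows "(power_source q has_real_derivative (q - 1) * \<bar>s\<bar> powr (q - 2)) (at s)"
proof -
  consider "s > 0" | "s < 0" | "s = 0" by linarith
  then show ?thesis
  proof cases
    case 1
    have "((\<lambda>y. y powr (q - 2) * y) has_real_derivative (q - 1) * \<bar>s\<bar> powr (q - 2)) (at s)"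
      using 1 powr_mult_base[of s "q - 3"] by (auto intro!: derivative_eq_intros simp: algebra_simps)
    moreover have "eventually (\<lambda>y. power_source q y = y powr (q - 2) * y) (nhds s)"
      using eventually_nhds_in_open[of "{0<..}" s] 1 by (auto elim!: eventually_mono simp: power_source_def)
    ultimately show ?thesis by (rule DERIV_eventually_eq)
  next
    case 2
    have "((\<lambda>y. (- y) powr (q - 2) * y) has_real_derivative (q - 1) * \<bar>s\<bar> powr (q - 2)) (at s)"
    proof -
      have X: "(- s) powr (q - 2) = - (s * (- s) powr (q - 3))"
        using 2 powr_mult_base[of "- s" "q - 3"] by simp
      show ?thesis
        using 2 by (auto intro!: derivative_eq_intros simp: algebra_simps X)
    qed
    moreover have "eventually (\<lambda>y. power_source q y = (- y) powr (q - 2) * y) (nhds s)"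
      using eventually_nhds_in_open[of "{..<0}" s] 2 by (auto elim!: eventually_mono simp: power_source_def)
    ultimately show ?thesis by (rule DERIV_eventually_eq)
  next
    case 3
    have "continuous_on UNIV (\<lambda>h::real. \<bar>h\<bar> powr (q - 2))"
      by (intro continuous_on_powr' continuous_intros) (use assms in auto)
    then have "((\<lambda>h. \<bar>h\<bar> powr (q - 2)) \<longlongrightarrow> \<bar>0\<bar> powr (q - 2)) (at (0::real))"
      unfolding continuous_on_def by blast
    then have "((\<lambda>h. \<bar>h\<bar> powr (q - 2)) \<longlongrightarrow> 0) (at (0::real))"
      using assms by simp
    then have "((\<lambda>h. power_source q h / h) \<longlongrightarrow> 0) (at 0)"
      by (rule Lim_transform_eventually) (auto simp: eventually_at_filter power_source_def)
    then show ?thesis using 3 assms by (simp add: DERIV_def power_source_def)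
  qed
qed

lemma power_source_continuous: "q > 2 \<Longrightarrow> continuous_on S (power_source q)"
  by (rule DERIV_continuous_on[OF DERIV_subset[OF power_source_DERIV]]) auto

definition trunc :: "real \<Rightarrow> real \<Rightarrow> real" where
  "trunc R s = max (- R) (min R s)"

lemma trunc_bound: "R \<ge> 0 \<Longrightarrow> \<bar>trunc R s\<bar> \<le> R"
  and trunc_id: "\<bar>s\<bar> \<le> R \<Longrightarrow> trunc R s = s"
  and trunc_lipschitz: "\<bar>trunc R s - trunc R r\<bar> \<le> \<bar>s - r\<bar>"
  by (auto simp: trunc_def)

lemma trunc_continuous: "continuous_on S f \<Longrightarrow> continuous_on S (\<lambda>x. trunc R (f x))"
  unfolding trunc_def by (intro continuous_intros)

text \<open>The mean value theorem on [-R,R]; truncation itself does not increase distances.\<close>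

lemma power_source_lipschitz:
  assumes "q > 2" "R \<ge> 0"
  shows "\<bar>power_source q (trunc R x) - power_source q (trunc R y)\<bar> \<le> ((q - 1) * R powr (q - 2)) * \<bar>x - y\<bar>"
proof -
  have "norm (power_source q (trunc R x) - power_source q (trunc R y)) \<le> ((q - 1) * R powr (q - 2)) * norm (trunc R x - trunc R y)"
  proof (rule field_differentiable_bound[of "{-R..R}"])
    show "(power_source q has_field_derivative (q - 1) * \<bar>z\<bar> powr (q - 2)) (at z within {-R..R})" for z
      by (rule DERIV_subset[OF power_source_DERIV[OF assms(1)]]) simp
    show "norm ((q - 1) * \<bar>z\<bar> powr (q - 2)) \<le> (q - 1) * R powr (q - 2)" if "z \<in> {-R..R}" for z
      using that assms by (auto simp: abs_mult intro!: mult_left_mono powr_mono2)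
  qed (use trunc_bound[OF assms(2)] in \<open>auto simp: abs_le_iff\<close>, (metis abs_le_D2 minus_le_iff trunc_bound[OF assms(2)])+)
  also have "\<dots> \<le> ((q - 1) * R powr (q - 2)) * \<bar>x - y\<bar>"
    using assms trunc_lipschitz by (intro mult_left_mono) auto
  finally show ?thesis by simp
qed

text \<open>The gain 1/\<mu> is the source of the contraction. For a non-integrable \<open>f\<close>
  or a negative \<open>t\<close> the integral is 0 by convention, so the bound persists.\<close>

lemma integral_exp_bound:
  fixes f :: "real \<Rightarrow> real"
  assumes "\<mu> > 0" "C \<ge> 0" "\<And>s. s \<in> {0..t} \<Longrightarrow> \<bar>f s\<bar> \<le> C * exp (\<mu> * s)"
  shows "\<bar>integral {0..t} f\<bar> \<le> C * exp (\<mu> * t) / \<mu>"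
proof (cases "f integrable_on {0..t} \<and> 0 \<le> t")
  case True
  have "((\<lambda>s. C * exp (\<mu> * s)) has_integral (C * exp (\<mu> * t) / \<mu> - C * exp (\<mu> * 0) / \<mu>)) {0..t}"
    by (rule fundamental_theorem_of_calculus[where f = "\<lambda>s. C * exp (\<mu> * s) / \<mu>"])
      (use True assms(1) in \<open>auto simp flip: has_real_derivative_iff_has_vector_derivative intro!: derivative_eq_intros\<close>)
  then have i: "(\<lambda>s. C * exp (\<mu> * s)) integrable_on {0..t}"
    "integral {0..t} (\<lambda>s. C * exp (\<mu> * s)) = C * exp (\<mu> * t) / \<mu> - C / \<mu>"
    by (auto simp: has_integral_iff)
  have "norm (integral {0..t} f) \<le> integral {0..t} (\<lambda>s. C * exp (\<mu> * s))"
    using True i(1) assms(3) by (intro integral_norm_bound_integral) auto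
  moreover have "0 \<le> C / \<mu>" using assms(1,2) by simp
  ultimately show ?thesis using i(2) unfolding real_norm_def by linarith
next
  case False
  then have "integral {0..t} f = 0"
    using not_integrable_integral by (cases "0 \<le> t") auto
  then show ?thesis using assms(1,2) by simp
qed

lemma duhamel_diff_bound:
  assumes G: "continuous_on UNIV (\<lambda>z. G (fst z) (snd z))" and G': "continuous_on UNIV (\<lambda>z. G' (fst z) (snd z))"
    and "\<mu> > 0" "C \<ge> 0" and bd: "\<And>s y. s \<in> {0..t} \<Longrightarrow> \<bar>G s y - G' s y\<bar> \<le> C * exp (\<mu> * s)"
  shows "\<bar>duhamel \<sigma> G t x - duhamel \<sigma> G' t x\<bar> \<le> C * exp (\<mu> * t) / \<mu>"
proof -
  have "duhamel \<sigma> G t x - duhamel \<sigma> G' t x = integral {0..t} (\<lambda>s. G s (x + \<sigma> * (t - s)) - G' s (x + \<sigma> * (t - s)))"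
    unfolding duhamel_def
    by (intro Henstock_Kurzweil_Integration.integral_diff[symmetric] integrable_continuous_real
        continuous_on_section[OF G] continuous_on_section[OF G'] continuous_intros)
  also have "\<bar>\<dots>\<bar> \<le> C * exp (\<mu> * t) / \<mu>"
    by (rule integral_exp_bound[OF assms(3,4)]) (rule bd)
  finally show ?thesis .
qed

text \<open>Reflects [-1,2] onto [0,1], evenly about both end points. A source continued in this way
  contributes nothing to the x-derivative at the ends, so the fluxes come from the profiles
  alone.\<close>

definition fold01 :: "real \<Rightarrow> real" where
  "fold01 y = max 0 (min \<bar>y\<bar> (2 - \<bar>y\<bar>))"

lemma fold01_mem: "fold01 y \<in> {0..1}"
  and fold01_id: "y \<in> {0..1} \<Longrightarrow> fold01 y = y"
  and fold01_even: "fold01 (- y) = fold01 y"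
  and fold01_even1: "y \<in> {0..1} \<Longrightarrow> fold01 (1 + y) = fold01 (1 - y)"
  by (auto simp: fold01_def)

lemma fold01_continuous: "continuous_on S fold01"
  unfolding fold01_def by (intro continuous_intros)

text \<open>The data on \<open>(0,1)\<close> are continued by the outgoing waves: at \<open>x = 0\<close> the Neumann datum is \<open>n\<close>, at
  \<open>x = 1\<close> it is \<open>- m\<close>.\<close>

definition ext_left :: "(real \<Rightarrow> real) \<Rightarrow> (real \<Rightarrow> real) \<Rightarrow> (real \<Rightarrow> real) \<Rightarrow> real \<Rightarrow> real" where
  "ext_left a0 b0 m y = (if 0 \<le> y \<and> y \<le> 1 then a0 y else if 1 < y \<and> y \<le> 2 then - m (y - 1) - b0 (2 - y) else 0)"

definition ext_right :: "(real \<Rightarrow> real) \<Rightarrow> (real \<Rightarrow> real) \<Rightarrow> (real \<Rightarrow> real) \<Rightarrow> real \<Rightarrow> real" where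
  "ext_right a0 b0 n y = (if 0 \<le> y \<and> y \<le> 1 then b0 y else if -1 \<le> y \<and> y < 0 then n (- y) - a0 (- y) else 0)"

lemma L2_piece:
  assumes "f \<in> L2 c d" "{c..d} \<subseteq> {p..q}"
  shows "(\<lambda>y. if y \<in> {c..d} then f y else 0) \<in> L2 p q"
proof -
  have 1: "(\<lambda>y. if y \<in> {c..d} then f y else 0) absolutely_integrable_on {c..d}"
    by (rule absolutely_integrable_spike[OF L2D(1)[OF assms(1)], of "{}"]) auto
  have 2: "(\<lambda>y. if y \<in> {c..d} then (f y)\<^sup>2 else 0) absolutely_integrable_on {c..d}"
    by (rule absolutely_integrable_spike[OF L2D(2)[OF assms(1)], of "{}"]) auto
  have "(\<lambda>y. if y \<in> {c..d} then f y else 0) absolutely_integrable_on {p..q}"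
    using 1 by (subst integral_support(2)[OF _ assms(2)]) auto
  moreover have "(\<lambda>y. if y \<in> {c..d} then (f y)\<^sup>2 else 0) absolutely_integrable_on {p..q}"
    using 2 by (subst integral_support(2)[OF _ assms(2)]) auto
  moreover have "(\<lambda>y. (if y \<in> {c..d} then f y else 0)\<^sup>2) = (\<lambda>y. if y \<in> {c..d} then (f y)\<^sup>2 else 0)"
    by auto
  ultimately show ?thesis by (simp only: L2_iff)
qed

lemma ext_left_L2:
  assumes "a0 \<in> L2 0 1" "b0 \<in> L2 0 1" "m \<in> L2 0 1"
  shows "ext_left a0 b0 m \<in> L2 (-1) 2"
proof -
  have m: "(\<lambda>y. m (y - 1)) \<in> L2 1 2" using L2_shift[OF assms(3), of "-1"] by simp
  have "(\<lambda>y. b0 (- y)) \<in> L2 (-1) 0" using L2_reflect[of b0 0 "-1"] assms(2) by simp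
  from L2_shift[OF this, of "-2"] have b: "(\<lambda>y. b0 (2 - y)) \<in> L2 1 2" by simp
  have "(\<lambda>y. (if y \<in> {0..1} then a0 y else 0) + (if y \<in> {1..2} then -1 * m (y - 1) - b0 (2 - y) else 0)) \<in> L2 (-1) 2"
    by (intro L2_add L2_piece L2_minus L2_cmult assms m b) auto
  then show ?thesis
    by (rule L2_AE_cong) (auto intro!: AE_IooI[of "{1}"] simp: ext_left_def)
qed

lemma ext_right_L2:
  assumes "a0 \<in> L2 0 1" "b0 \<in> L2 0 1" "n \<in> L2 0 1"
  shows "ext_right a0 b0 n \<in> L2 (-1) 2"
proof -
  have "(\<lambda>y. n (- y)) \<in> L2 (-1) 0" "(\<lambda>y. a0 (- y)) \<in> L2 (-1) 0"
    using L2_reflect[of _ 0 "-1"] assms by simp_all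
  then have "(\<lambda>y. (if y \<in> {0..1} then b0 y else 0) + (if y \<in> {-1..0} then n (- y) - a0 (- y) else 0)) \<in> L2 (-1) 2"
    by (intro L2_add L2_piece L2_minus assms) auto
  then show ?thesis
    by (rule L2_AE_cong) (auto intro!: AE_IooI[of "{0}"] simp: ext_right_def)
qed

lemma ext_meas:
  assumes [measurable]: "a0 \<in> borel_measurable borel" "b0 \<in> borel_measurable borel" "m \<in> borel_measurable borel"
  shows "ext_left a0 b0 m \<in> borel_measurable borel" "ext_right a0 b0 m \<in> borel_measurable borel"
  unfolding ext_left_def ext_right_def by measurable

text \<open>Isolates the contribution of the flux. For y < 1 the interval \<open>{0..y - 1}\<close>
  is empty: the right end has not yet been felt.\<close>

lemma integral_ext_left:
  assumes L: "a0 \<in> L2 0 1" "b0 \<in> L2 0 1" "m \<in> L2 0 1" and y: "y \<in> {0..2}"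
  shows "integral {-1..y} (ext_left a0 b0 m) = integral {-1..y} (ext_left a0 b0 (\<lambda>_. 0)) - integral {0..y - 1} m"
proof -
  define h where "h = (\<lambda>y. ext_left a0 b0 (\<lambda>_. 0) y - ext_left a0 b0 m y)"
  have L0: "(\<lambda>_. 0) \<in> L2 0 1" by (intro L2_continuous) simp
  have hL: "h \<in> L2 (-1) 2" unfolding h_def by (intro L2_minus ext_left_L2 L L0)
  have sub: "f integrable_on {c..d}" if "f \<in> L2 (-1) 2" "-1 \<le> c" "d \<le> 2" for f c d
    by (rule L2D(3)[OF L2_subinterval[OF that]])
  have "integral {-1..y} h = integral {-1..y} (ext_left a0 b0 (\<lambda>_. 0)) - integral {-1..y} (ext_left a0 b0 m)"
    unfolding h_def using y by (intro Henstock_Kurzweil_Integration.integral_diff sub ext_left_L2 L L0) auto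
  moreover have "integral {-1..y} h = integral {0..y - 1} m"
  proof (cases "y \<le> 1")
    case True
    have "integral {-1..y} h = integral {-1..y} (\<lambda>_. 0)"
      using True by (intro integral_cong) (auto simp: h_def ext_left_def)
    moreover have "integral {0..y - 1} m = 0" using True by (cases "y = 1") auto
    ultimately show ?thesis by simp
  next
    case False
    have "integral {-1..1} h = integral {-1..1} (\<lambda>_::real. 0)"
      by (intro integral_cong) (auto simp: h_def ext_left_def)
    moreover have "integral {-1..1} h + integral {1..y} h = integral {-1..y} h"
      using False y by (intro Henstock_Kurzweil_Integration.integral_combine sub hL) auto
    moreover have "integral {1..y} h = integral {1..y} (\<lambda>y. m (y - 1))"
      by (rule integral_spike[of "{1}"]) (use y in \<open>auto simp: h_def ext_left_def\<close>)
    moreover have "integral {1..y} (\<lambda>y. m (y - 1)) = integral {0..y - 1} m"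
      using integral_shift_real_ivl[of 0 "-1" "y - 1" m] by simp
    ultimately show ?thesis by simp
  qed
  ultimately show ?thesis by simp
qed

text \<open>The mirror image at the left end, where \<open>n\<close> contributes for y < 0 only.
  Values at 0 are subtracted to match the term \<open>B (x - t) - B 0\<close> of
  \<open>w\<close>.\<close>

lemma integral_ext_right:
  assumes L: "a0 \<in> L2 0 1" "b0 \<in> L2 0 1" "n \<in> L2 0 1" and y: "y \<in> {-1..1}"
  shows "integral {-1..y} (ext_right a0 b0 n) - integral {-1..0} (ext_right a0 b0 n) =
    integral {-1..y} (ext_right a0 b0 (\<lambda>_. 0)) - integral {-1..0} (ext_right a0 b0 (\<lambda>_. 0)) - integral {0..- y} n"
proof -
  define h where "h = (\<lambda>y. ext_right a0 b0 n y - ext_right a0 b0 (\<lambda>_. 0) y)"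
  have L0: "(\<lambda>_. 0) \<in> L2 0 1" by (intro L2_continuous) simp
  have hL: "h \<in> L2 (-1) 2" unfolding h_def by (intro L2_minus ext_right_L2 L L0)
  have sub: "f integrable_on {c..d}" if "f \<in> L2 (-1) 2" "-1 \<le> c" "d \<le> 2" for f c d
    by (rule L2D(3)[OF L2_subinterval[OF that]])
  have e: "integral {-1..z} h = integral {-1..z} (ext_right a0 b0 n) - integral {-1..z} (ext_right a0 b0 (\<lambda>_. 0))" if "z \<le> 1" for z
    unfolding h_def using that by (intro Henstock_Kurzweil_Integration.integral_diff sub ext_right_L2 L L0) auto
  have "integral {-1..0} h - integral {-1..y} h = integral {0..- y} n"
  proof (cases "0 \<le> y")
    case True
    have "integral {0..y} h = integral {0..y} (\<lambda>_. 0)"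
      using y by (intro integral_cong) (auto simp: h_def ext_right_def)
    moreover have "integral {-1..0} h + integral {0..y} h = integral {-1..y} h"
      using True y by (intro Henstock_Kurzweil_Integration.integral_combine sub hL) auto
    moreover have "integral {0..- y} n = 0" using True by (cases "y = 0") auto
    ultimately show ?thesis by simp
  next
    case False
    have "integral {-1..y} h + integral {y..0} h = integral {-1..0} h"
      using False y by (intro Henstock_Kurzweil_Integration.integral_combine sub hL) auto
    moreover have "integral {y..0} h = integral {y..0} (\<lambda>z. n (- z))"
      by (rule integral_spike[of "{0}"]) (use y in \<open>auto simp: h_def ext_right_def\<close>)
    moreover have "integral {y..0} (\<lambda>z. n (- z)) = integral {0..- y} n"
      using Henstock_Kurzweil_Integration.integral_reflect_real[of "- y" 0 n] by simp
    ultimately show ?thesis by simp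
  qed
  then show ?thesis using e[of 0] e[of y] y by simp
qed

locale ext_wave =
  fixes c :: real and a0 b0 n m :: "real \<Rightarrow> real" and G :: "real \<Rightarrow> real \<Rightarrow> real"
  assumes a0: "a0 \<in> borel_measurable borel" "a0 \<in> L2 0 1"
    and b0: "b0 \<in> borel_measurable borel" "b0 \<in> L2 0 1"
    and n: "n \<in> borel_measurable borel" "n \<in> L2 0 1"
    and m: "m \<in> borel_measurable borel" "m \<in> L2 0 1"
    and G: "continuous_on UNIV (\<lambda>z. G (fst z) (snd z))"
    and G_even: "\<And>s y. G s (- y) = G s y" "\<And>s y. y \<in> {0..1} \<Longrightarrow> G s (1 + y) = G s (1 - y)"
begin

sublocale wave c "ext_left a0 b0 m" "ext_right a0 b0 n" G
  by unfold_locales (intro ext_meas ext_left_L2 ext_right_L2 a0 b0 n m G)+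

text \<open>The parenthesis depends on the initial data only. Two solutions with the same data thus
  differ only by flux integrals and Duhamel terms, the quantities that the contraction estimate has
  to control.\<close>

lemma w_formula:
  assumes "t \<in> {0..1}" "x \<in> {0..1}"
  shows "w t x = (c + integral {-1..x + t} (ext_left a0 b0 (\<lambda>_. 0)) - integral {-1..0} (ext_left a0 b0 (\<lambda>_. 0))
      + integral {-1..x - t} (ext_right a0 b0 (\<lambda>_. 0)) - integral {-1..0} (ext_right a0 b0 (\<lambda>_. 0)))
    - integral {0..x + t - 1} m - integral {0..t - x} n
    + (integral {0..t} (\<lambda>r. duhamel 1 G r x) + integral {0..t} (\<lambda>r. duhamel (-1) G r x)) / 2"
  using integral_ext_left[OF a0(2) b0(2) m(2), of "x + t"] integral_ext_left[OF a0(2) b0(2) m(2), of 0]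
    integral_ext_right[OF a0(2) b0(2) n(2), of "x - t"] assms
  by (simp add: w_def A_def B_def \<Theta>_def)

text \<open>From an end point the backward characteristics of both directions meet the same values
  of the evenly reflected source.\<close>

lemma duhamel_boundary:
  assumes "t \<in> {0..1}"
  shows "duhamel (-1) G t 0 = duhamel 1 G t 0" "duhamel (-1) G t 1 = duhamel 1 G t 1"
proof -
  have "G s (0 + -1 * (t - s)) = G s (0 + 1 * (t - s))" for s
    using G_even(1)[of s "t - s"] by simp
  then show "duhamel (-1) G t 0 = duhamel 1 G t 0" unfolding duhamel_def by simp
  have "G s (1 + -1 * (t - s)) = G s (1 + 1 * (t - s))" if "s \<in> {0..t}" for s
    using G_even(2)[of "t - s" s] that assms by (simp add: algebra_simps)
  then show "duhamel (-1) G t 1 = duhamel 1 G t 1" unfolding duhamel_def by (intro integral_cong)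
qed

text \<open>In \<open>wx\<close> the Duhamel terms cancel and the reflected profile leaves the
  prescribed datum; in \<open>wt\<close> they add. This is the algebraic relation between flux and
  velocity. At t = 0 the extensions take their initial branch, so the interval is open
  there.\<close>

lemma boundary_values:
  assumes t: "t \<in> {0<..<1}"
  shows "wx t 0 = n t" "wx t 1 = - m t"
    "wt t 0 = 2 * a0 t - n t + duhamel 1 G t 0" "wt t 1 = - m t - 2 * b0 (1 - t) + duhamel 1 G t 1"
  using t duhamel_boundary[of t] by (auto simp: wx_def wt_def ext_left_def ext_right_def)

end

section \<open>The fixed point problem\<close>

text \<open>\<open>k\<close> is half the damping, \<open>c\<close> the value of \<open>w\<close> at
  x = t = 0, \<open>g0\<close> and \<open>g1\<close> are continuous versions of the time-dependent
  coefficients, and \<open>a0\<close>, \<open>b0\<close> are the initial wave profiles. T \<le> 1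
  keeps all characteristics inside the domain of the extended profiles.\<close>

locale boundary_problem =
  fixes p \<alpha> \<beta> k l0 l1 m0 m1 T c :: real and g0 g1 a0 b0 :: "real \<Rightarrow> real"
  assumes exponents: "p > 2" "\<alpha> > 2" "\<beta> > 2" and l: "l0 > 0" "l1 > 0"
    and coupling: "\<bar>m0 + m1\<bar> < 2 * sqrt (l0 * l1)" and T: "0 < T" "T \<le> 1"
    and g: "continuous_on UNIV g0" "continuous_on UNIV g1"
    and a0: "a0 \<in> borel_measurable borel" "a0 \<in> L2 0 1"
    and b0: "b0 \<in> borel_measurable borel" "b0 \<in> L2 0 1"
begin

text \<open>The determinant of the system for the boundary velocities, with rows (1 + l0, m1) and
  (m0, 1 + l1). The ones on the diagonal stem from the outgoing waves.\<close>

definition \<Delta> where "\<Delta> = (1 + l0) * (1 + l1) - m0 * m1"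

text \<open>By the arithmetic-geometric mean inequality \<open>m0 m1 \<le> ((m0 + m1) / 2)\<^sup>2 < l0 l1\<close>.\<close>

lemma \<Delta>_pos: "\<Delta> > 0"
proof -
  have "\<bar>m0 + m1\<bar>\<^sup>2 < (2 * sqrt (l0 * l1))\<^sup>2"
    using coupling by (intro power_strict_mono) auto
  then have "(m0 + m1)\<^sup>2 < 4 * (l0 * l1)" using l by (simp add: power_mult_distrib)
  moreover have "4 * (m0 * m1) \<le> (m0 + m1)\<^sup>2"
    using zero_le_power2[of "m0 - m1"] by (simp add: power2_eq_square algebra_simps)
  ultimately have "m0 * m1 < l0 * l1" by linarith
  then show ?thesis using l by (simp add: \<Delta>_def algebra_simps)
qed

text \<open>Freezing time outside [0,T] makes source and boundary terms continuous on the whole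
  plane.\<close>

definition clamp_time :: "real \<Rightarrow> real" where "clamp_time t = max 0 (min T t)"

text \<open>The source for w = exp(k t) u. Truncation acts on u, not on w, so the exponentials
  cancel in the Lipschitz estimate and the constant does not depend on time.\<close>

definition src :: "real \<Rightarrow> real \<Rightarrow> real \<Rightarrow> real \<Rightarrow> real" where
  "src R q t z = exp (k * t) * power_source q (trunc R (exp (- k * t) * z))"

text \<open>Inserting u = exp(-k t) w into the equation removes w_t and leaves w_tt - w_xx = (k^2 -
  1) w plus the transformed source.\<close>

definition GG :: "real \<Rightarrow> (real \<Rightarrow> real \<Rightarrow> real) \<Rightarrow> real \<Rightarrow> real \<Rightarrow> real" where
  "GG R w s y = src R p (clamp_time s) (w (clamp_time s) (fold01 y)) + (k\<^sup>2 - 1) * w (clamp_time s) (fold01 y)"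

text \<open>The part of the flux at x = 0 that contains only values of \<open>w\<close>. The terms
  with \<open>k\<close> arise because exp(k t) u_t = w_t - k w.\<close>

definition J0 :: "real \<Rightarrow> (real \<Rightarrow> real \<Rightarrow> real) \<Rightarrow> real \<Rightarrow> real" where
  "J0 R w s = - src R \<alpha> (clamp_time s) (w (clamp_time s) 0) - k * l0 * w (clamp_time s) 0
     + (g1 (clamp_time s) - k * m1) * w (clamp_time s) 1"

definition J1 :: "real \<Rightarrow> (real \<Rightarrow> real \<Rightarrow> real) \<Rightarrow> real \<Rightarrow> real" where
  "J1 R w s = - src R \<beta> (clamp_time s) (w (clamp_time s) 1) - k * l1 * w (clamp_time s) 1
     + (g0 (clamp_time s) - k * m0) * w (clamp_time s) 0"

text \<open>The boundary velocities \<open>q\<^sub>i\<close> solve the linear system that results from inserting d'Alembert's formula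
  into the boundary conditions; \<open>flux0\<close> and \<open>flux1\<close> are the resulting Neumann data.\<close>

definition r0 where "r0 R w t = 2 * a0 t + duhamel 1 (GG R w) t 0 - J0 R w t"
definition r1 where "r1 R w t = - 2 * b0 (1 - t) + duhamel 1 (GG R w) t 1 - J1 R w t"
definition q0 where "q0 R w t = ((1 + l1) * r0 R w t - m1 * r1 R w t) / \<Delta>"
definition q1 where "q1 R w t = ((1 + l0) * r1 R w t - m0 * r0 R w t) / \<Delta>"
definition flux0 where "flux0 R w t = l0 * q0 R w t + m1 * q1 R w t + J0 R w t"
definition flux1 where "flux1 R w t = l1 * q1 R w t + m0 * q0 R w t + J1 R w t"

definition \<Psi> :: "real \<Rightarrow> (real \<Rightarrow> real \<Rightarrow> real) \<Rightarrow> real \<Rightarrow> real \<Rightarrow> real" where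
  "\<Psi> R w = wave.w c (ext_left a0 b0 (flux1 R w)) (ext_right a0 b0 (flux0 R w)) (GG R w)"

lemma boundary_system:
  "q0 R w t = 2 * a0 t - flux0 R w t + duhamel 1 (GG R w) t 0"
  "q1 R w t = - flux1 R w t - 2 * b0 (1 - t) + duhamel 1 (GG R w) t 1"
proof -
  have "\<Delta> \<noteq> 0" using \<Delta>_pos by simp
  have "(1 + l0) * q0 R w t + m1 * q1 R w t = (((1 + l0) * (1 + l1) - m0 * m1) * r0 R w t) / \<Delta>"
    unfolding q0_def q1_def by (simp add: field_simps \<open>\<Delta> \<noteq> 0\<close>)
  then have 1: "(1 + l0) * q0 R w t + m1 * q1 R w t = r0 R w t"
    using \<open>\<Delta> \<noteq> 0\<close> by (simp add: \<Delta>_def[symmetric])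
  have "m0 * q0 R w t + (1 + l1) * q1 R w t = (((1 + l0) * (1 + l1) - m0 * m1) * r1 R w t) / \<Delta>"
    unfolding q0_def q1_def by (simp add: field_simps \<open>\<Delta> \<noteq> 0\<close>)
  then have 2: "m0 * q0 R w t + (1 + l1) * q1 R w t = r1 R w t"
    using \<open>\<Delta> \<noteq> 0\<close> by (simp add: \<Delta>_def[symmetric])
  show "q0 R w t = 2 * a0 t - flux0 R w t + duhamel 1 (GG R w) t 0"
    using 1 by (simp add: flux0_def r0_def algebra_simps)
  show "q1 R w t = - flux1 R w t - 2 * b0 (1 - t) + duhamel 1 (GG R w) t 1"
    using 2 by (simp add: flux1_def r1_def algebra_simps)
qed

text \<open>The converse of \<open>boundary_system\<close>: velocities and fluxes read off from a
  weak solution satisfy the same equations, hence are the ones given by Cramer's rule.\<close>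

lemma boundary_system_unique:
  assumes "x0 = 2 * a0 t - n + duhamel 1 (GG R w) t 0" "x1 = - m - 2 * b0 (1 - t) + duhamel 1 (GG R w) t 1"
    and "n = l0 * x0 + m1 * x1 + J0 R w t" "m = l1 * x1 + m0 * x0 + J1 R w t"
  shows "n = flux0 R w t" "m = flux1 R w t"
proof -
  have d: "\<Delta> \<noteq> 0" using \<Delta>_pos by simp
  have 1: "r0 R w t = (1 + l0) * x0 + m1 * x1"
    unfolding r0_def distrib_right mult_1_left using assms(1,3) by linarith
  have 2: "r1 R w t = m0 * x0 + (1 + l1) * x1"
    unfolding r1_def distrib_right mult_1_left using assms(2,4) by linarith
  have "(1 + l1) * r0 R w t - m1 * r1 R w t = \<Delta> * x0" "(1 + l0) * r1 R w t - m0 * r0 R w t = \<Delta> * x1"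
    unfolding 1 2 \<Delta>_def by (simp_all add: algebra_simps)
  then have "q0 R w t = x0" "q1 R w t = x1" using d by (auto simp: q0_def q1_def)
  then show "n = flux0 R w t" "m = flux1 R w t" using assms(3,4) by (auto simp: flux0_def flux1_def)
qed

lemma clamp_time_mem: "clamp_time t \<in> {0..T}" and clamp_time_id: "t \<in> {0..T} \<Longrightarrow> clamp_time t = t"
  using T by (auto simp: clamp_time_def)

lemma clamp_time_continuous: "continuous_on S clamp_time"
  unfolding clamp_time_def by (intro continuous_intros)

lemma src_continuous:
  assumes "q > 2" "continuous_on S f" "continuous_on S h"
  shows "continuous_on S (\<lambda>x. src R q (f x) (h x))"
  unfolding src_def
  by (intro continuous_intros continuous_on_compose2[OF power_source_continuous[OF assms(1), of UNIV]] trunc_continuous assms) auto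

lemma GG_continuous:
  assumes w: "continuous_on UNIV (\<lambda>z. w (fst z) (snd z))"
  shows "continuous_on UNIV (\<lambda>z. GG R w (fst z) (snd z))"
proof -
  have c: "continuous_on UNIV (\<lambda>z::real \<times> real. clamp_time (fst z))" "continuous_on UNIV (\<lambda>z::real \<times> real. fold01 (snd z))"
    by (intro continuous_on_compose2[OF clamp_time_continuous[of UNIV]] continuous_on_compose2[OF fold01_continuous[of UNIV]] continuous_intros; simp)+
  have "continuous_on UNIV (\<lambda>z. w (clamp_time (fst z)) (fold01 (snd z)))"
    using continuous_on_compose2[OF w continuous_on_Pair[OF c]] by simp
  then show ?thesis
    unfolding GG_def by (intro continuous_intros src_continuous exponents c)
qed

lemma w_clamp_continuous:
  fixes w :: "real \<Rightarrow> real \<Rightarrow> real"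
  assumes w: "continuous_on UNIV (\<lambda>z. w (fst z) (snd z))"
  shows "continuous_on UNIV (\<lambda>s. w (clamp_time s) x)"
  by (rule continuous_on_section[OF w clamp_time_continuous]) (intro continuous_intros)

lemma J_continuous:
  assumes w: "continuous_on UNIV (\<lambda>z. w (fst z) (snd z))"
  shows "continuous_on UNIV (J0 R w)" "continuous_on UNIV (J1 R w)"
  unfolding J0_def[abs_def] J1_def[abs_def]
  by (intro continuous_intros src_continuous exponents w_clamp_continuous[OF w] clamp_time_continuous
      continuous_on_compose2[OF g(1)] continuous_on_compose2[OF g(2)]; simp)+

lemma flux_L2:
  assumes w: "continuous_on UNIV (\<lambda>z. w (fst z) (snd z))"
  shows "flux0 R w \<in> borel_measurable borel" "flux0 R w \<in> L2 0 1" "flux1 R w \<in> borel_measurable borel" "flux1 R w \<in> L2 0 1"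
proof -
  note G = GG_continuous[OF w, of R]
  have d: "continuous_on UNIV (\<lambda>t. duhamel 1 (GG R w) t x)" for x
    by (rule continuous_on_section[OF continuous_duhamel[OF G]]) (intro continuous_intros)+
  have b: "(\<lambda>t. b0 (1 - t)) \<in> L2 0 1"
  proof -
    have "(\<lambda>t. b0 (- t)) \<in> L2 (-1) 0" using L2_reflect[of b0 0 "-1"] b0 by simp
    from L2_shift[OF this, of "-1"] show ?thesis by simp
  qed
  have c: "h \<in> L2 0 1" "h \<in> borel_measurable borel" if "continuous_on UNIV h" for h
    using that by (auto intro: L2_continuous continuous_on_subset borel_measurable_continuous_onI)
  note J = c[OF J_continuous(1)[OF w, of R]] c[OF J_continuous(2)[OF w, of R]]
  have rL: "r0 R w \<in> L2 0 1" "r1 R w \<in> L2 0 1"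
    unfolding r0_def[abs_def] r1_def[abs_def] by (intro L2_minus L2_add L2_cmult a0 b c[OF d] J)+
  note [measurable] = a0(1) b0(1) c(2)[OF d] J
  have rm[measurable]: "r0 R w \<in> borel_measurable borel" "r1 R w \<in> borel_measurable borel"
    unfolding r0_def[abs_def] r1_def[abs_def] by measurable
  have qL: "q0 R w \<in> L2 0 1" "q1 R w \<in> L2 0 1"
  proof -
    have "(\<lambda>t. (1 / \<Delta>) * ((1 + l1) * r0 R w t - m1 * r1 R w t)) \<in> L2 0 1" "(\<lambda>t. (1 / \<Delta>) * ((1 + l0) * r1 R w t - m0 * r0 R w t)) \<in> L2 0 1"
      by (intro L2_cmult L2_minus rL)+
    then show "q0 R w \<in> L2 0 1" "q1 R w \<in> L2 0 1" by (simp_all add: q0_def[abs_def] q1_def[abs_def])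
  qed
  show "flux0 R w \<in> L2 0 1" "flux1 R w \<in> L2 0 1"
    unfolding flux0_def[abs_def] flux1_def[abs_def] by (intro L2_add L2_cmult qL J)+
  show "flux0 R w \<in> borel_measurable borel" "flux1 R w \<in> borel_measurable borel"
    unfolding flux0_def[abs_def] flux1_def[abs_def] q0_def q1_def by measurable
qed

lemma GG_even: "GG R w s (- y) = GG R w s y" "y \<in> {0..1} \<Longrightarrow> GG R w s (1 + y) = GG R w s (1 - y)"
  by (simp_all only: GG_def fold01_even fold01_even1)

text \<open>The fluxes are kept arbitrary here, since those of a given weak solution are only later
  identified with \<open>flux0\<close> and \<open>flux1\<close>.\<close>

lemma ext_wave_GG:
  assumes w: "continuous_on UNIV (\<lambda>z. w (fst z) (snd z))"
    and "n \<in> borel_measurable borel" "n \<in> L2 0 1" "m \<in> borel_measurable borel" "m \<in> L2 0 1"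
  shows "ext_wave a0 b0 n m (GG R w)"
  by unfold_locales (use assms a0 b0 GG_continuous[OF w] GG_even in auto)

lemma ext_wave_\<Psi>:
  "continuous_on UNIV (\<lambda>z. w (fst z) (snd z)) \<Longrightarrow> ext_wave a0 b0 (flux0 R w) (flux1 R w) (GG R w)"
  by (intro ext_wave_GG flux_L2)

lemma \<Psi>_continuous:
  assumes w: "continuous_on UNIV (\<lambda>z. w (fst z) (snd z))"
  shows "continuous_on ({0..1} \<times> {0..1}) (\<lambda>z. \<Psi> R w (fst z) (snd z))"
proof -
  interpret ext_wave c a0 b0 "flux0 R w" "flux1 R w" "GG R w" by (rule ext_wave_\<Psi>[OF w])
  show ?thesis unfolding \<Psi>_def by (rule w_cont)
qed

lemma src_lipschitz:
  assumes "q > 2" "R \<ge> 0"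
  shows "\<bar>src R q t z - src R q t z'\<bar> \<le> ((q - 1) * R powr (q - 2)) * \<bar>z - z'\<bar>"
proof -
  have "\<bar>src R q t z - src R q t z'\<bar> = exp (k * t) * \<bar>power_source q (trunc R (exp (- k * t) * z)) - power_source q (trunc R (exp (- k * t) * z'))\<bar>"
    by (simp add: src_def abs_mult flip: right_diff_distrib)
  also have "\<dots> \<le> exp (k * t) * (((q - 1) * R powr (q - 2)) * \<bar>exp (- k * t) * z - exp (- k * t) * z'\<bar>)"
    by (intro mult_left_mono power_source_lipschitz assms) auto
  also have "\<dots> = ((q - 1) * R powr (q - 2)) * \<bar>z - z'\<bar>"
    by (simp add: abs_mult exp_minus flip: right_diff_distrib)
  finally show ?thesis .
qed

text \<open>\<open>\<Psi> R\<close> is a contraction in the norm with weight \<open>exp (- \<mu> t)\<close> for large \<open>\<mu>\<close>, on every time interval.\<close>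

lemma \<Psi>_contraction:
  assumes R: "R \<ge> 0"
  obtains \<mu> where "\<mu> > 0"
    "\<And>w w' K \<tau> t x. continuous_on UNIV (\<lambda>z. w (fst z) (snd z)) \<Longrightarrow> continuous_on UNIV (\<lambda>z. w' (fst z) (snd z)) \<Longrightarrow>
      K \<ge> 0 \<Longrightarrow> \<tau> \<le> T \<Longrightarrow> (\<And>s x. s \<in> {0..\<tau>} \<Longrightarrow> x \<in> {0..1} \<Longrightarrow> \<bar>w s x - w' s x\<bar> \<le> K * exp (\<mu> * s)) \<Longrightarrow>
      t \<in> {0..\<tau>} \<Longrightarrow> x \<in> {0..1} \<Longrightarrow> \<bar>\<Psi> R w t x - \<Psi> R w' t x\<bar> \<le> K / 2 * exp (\<mu> * t)"
proof -
  have "compact (g0 ` {0..T})" "compact (g1 ` {0..T})"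
    by (intro compact_continuous_image continuous_on_subset[OF g(1)] continuous_on_subset[OF g(2)]; simp)+
  from compact_imp_bounded[OF this(1), unfolded bounded_iff] compact_imp_bounded[OF this(2), unfolded bounded_iff]
  obtain M0 M1 where M: "\<forall>y \<in> g0 ` {0..T}. norm y \<le> M0" "\<forall>y \<in> g1 ` {0..T}. norm y \<le> M1" by blast
  define Lq where "Lq = (\<lambda>q::real. (q - 1) * R powr (q - 2))"
  have Lq0: "Lq q \<ge> 0" if "q > 2" for q using that by (simp add: Lq_def)
  define A where "A = (\<lambda>x::real. \<bar>x\<bar>)"
  have A0: "A x \<ge> 0" for x by (simp add: A_def)
  \<comment> \<open>One constant that dominates every Lipschitz constant of the source and the
    boundary terms.\<close>
  define L where "L = 1 + Lq p + Lq \<alpha> + Lq \<beta> + A (k\<^sup>2 - 1) + A (k * l0) + A (k * l1) + (A M0 + A (k * m0)) + (A M1 + A (k * m1))"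
  note nonneg = Lq0[OF exponents(1)] Lq0[OF exponents(2)] Lq0[OF exponents(3)]
    A0[of "k\<^sup>2 - 1"] A0[of "k * l0"] A0[of "k * l1"] A0[of M0] A0[of "k * m0"] A0[of M1] A0[of "k * m1"]
  have L1: "L \<ge> 1" unfolding L_def using nonneg by linarith
  have "Lq p + A (k\<^sup>2 - 1) \<le> L" "Lq \<alpha> + A (k * l0) \<le> L" "Lq \<beta> + A (k * l1) \<le> L"
    "A M0 + A (k * m0) \<le> L" "A M1 + A (k * m1) \<le> L"
    unfolding L_def using nonneg by linarith+
  note LB = this[unfolded A_def]
  have L0: "L \<ge> 0" using L1 by simp
  have srcL: "\<bar>src R q t z - src R q t z'\<bar> \<le> Lq q * \<bar>z - z'\<bar>" if "q > 2" for q t z z'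
    using src_lipschitz[OF that R] by (simp add: Lq_def)
  \<comment> \<open>Bounds the coefficients of Cramer's rule, for both boundary velocities at
    once.\<close>
  define C1 where "C1 = (1 + l0 + l1 + \<bar>m0\<bar> + \<bar>m1\<bar>) / \<Delta>"
  have C1: "C1 \<ge> 0" using l \<Delta>_pos by (simp add: C1_def)
  \<comment> \<open>The resulting bound for the fluxes: a velocity error of 3 L, amplified by
    \<open>C1\<close>, plus the error 2 L of \<open>J0\<close> and \<open>J1\<close>.\<close>
  define C2 where "C2 = (l0 + l1 + \<bar>m0\<bar> + \<bar>m1\<bar>) * (C1 * (3 * L)) + 2 * L"
  have C2: "C2 \<ge> 0" unfolding C2_def using l C1 L1 by (intro add_nonneg_nonneg mult_nonneg_nonneg) auto
  \<comment> \<open>The final estimate has the factor (2 C2 + L) / \<mu>, from two flux integrals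
    and the averaged Duhamel terms; this choice makes it at most 1/2.\<close>
  define \<mu> where "\<mu> = 2 * (2 * C2 + L) + 1"
  have \<mu>: "\<mu> \<ge> 1" using C2 L1 by (simp add: \<mu>_def)
  show thesis
  proof (rule that)
    show "\<mu> > 0" using \<mu> by simp
    fix w w' :: "real \<Rightarrow> real \<Rightarrow> real" and K \<tau> t x :: real
    assume w: "continuous_on UNIV (\<lambda>z. w (fst z) (snd z))" and w': "continuous_on UNIV (\<lambda>z. w' (fst z) (snd z))"
      and K: "K \<ge> 0" and \<tau>: "\<tau> \<le> T" and t: "t \<in> {0..\<tau>}" and x: "x \<in> {0..1}"
      and d: "\<And>s x. s \<in> {0..\<tau>} \<Longrightarrow> x \<in> {0..1} \<Longrightarrow> \<bar>w s x - w' s x\<bar> \<le> K * exp (\<mu> * s)"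
    define e where "e = (\<lambda>s. K * exp (\<mu> * s))"
    have e0: "e s \<ge> 0" for s using K by (simp add: e_def)
    have Ge: "\<bar>GG R w s y - GG R w' s y\<bar> \<le> L * e s" if s: "s \<in> {0..\<tau>}" for s y
    proof -
      have c: "clamp_time s = s" using s \<tau> by (intro clamp_time_id) auto
      define z z' where "z = w s (fold01 y)" and "z' = w' s (fold01 y)"
      have z: "\<bar>z - z'\<bar> \<le> e s" unfolding z_def z'_def e_def by (rule d[OF s fold01_mem])
      have eq: "GG R w s y - GG R w' s y = (src R p s z - src R p s z') + (k\<^sup>2 - 1) * (z - z')"
        by (simp add: GG_def c z_def z'_def algebra_simps)
      have "\<bar>GG R w s y - GG R w' s y\<bar> \<le> \<bar>src R p s z - src R p s z'\<bar> + \<bar>(k\<^sup>2 - 1) * (z - z')\<bar>"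
        unfolding eq by (rule abs_triangle_ineq)
      also have "\<dots> \<le> Lq p * \<bar>z - z'\<bar> + \<bar>k\<^sup>2 - 1\<bar> * \<bar>z - z'\<bar>"
        by (intro add_mono srcL exponents) (simp add: abs_mult)
      also have "\<dots> = (Lq p + \<bar>k\<^sup>2 - 1\<bar>) * \<bar>z - z'\<bar>" by (simp add: distrib_right)
      also have "\<dots> \<le> L * e s"
        by (rule mult_mono[OF LB(1) z L0]) simp
      finally show ?thesis .
    qed
    have Je: "\<bar>J0 R w s - J0 R w' s\<bar> \<le> 2 * (L * e s)" "\<bar>J1 R w s - J1 R w' s\<bar> \<le> 2 * (L * e s)" if s: "s \<in> {0..\<tau>}" for s
    proof -
      have c: "clamp_time s = s" using s \<tau> by (intro clamp_time_id) auto
      have s': "s \<in> {0..T}" using s \<tau> by auto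
      have z: "\<bar>w s 0 - w' s 0\<bar> \<le> e s" "\<bar>w s 1 - w' s 1\<bar> \<le> e s" unfolding e_def by (rule d[OF s]; simp)+
      have g1: "\<bar>g1 s - k * m1\<bar> \<le> \<bar>M1\<bar> + \<bar>k * m1\<bar>"
        using bspec[OF M(2) imageI[OF s']] unfolding real_norm_def by linarith
      have g0: "\<bar>g0 s - k * m0\<bar> \<le> \<bar>M0\<bar> + \<bar>k * m0\<bar>"
        using bspec[OF M(1) imageI[OF s']] unfolding real_norm_def by linarith
      have eq: "J0 R w s - J0 R w' s = (- (src R \<alpha> s (w s 0) - src R \<alpha> s (w' s 0)) - k * l0 * (w s 0 - w' s 0)) + (g1 s - k * m1) * (w s 1 - w' s 1)"
        by (simp add: J0_def c algebra_simps)
      have "\<bar>J0 R w s - J0 R w' s\<bar> \<le> (\<bar>src R \<alpha> s (w s 0) - src R \<alpha> s (w' s 0)\<bar> + \<bar>k * l0 * (w s 0 - w' s 0)\<bar>) + \<bar>(g1 s - k * m1) * (w s 1 - w' s 1)\<bar>"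
        unfolding eq by linarith
      also have "\<dots> \<le> (Lq \<alpha> * \<bar>w s 0 - w' s 0\<bar> + \<bar>k * l0\<bar> * \<bar>w s 0 - w' s 0\<bar>) + \<bar>g1 s - k * m1\<bar> * \<bar>w s 1 - w' s 1\<bar>"
        unfolding abs_mult[of _ "w s 0 - w' s 0"] abs_mult[of _ "w s 1 - w' s 1"]
        by (intro add_mono srcL exponents order_refl)
      also have "\<dots> = (Lq \<alpha> + \<bar>k * l0\<bar>) * \<bar>w s 0 - w' s 0\<bar> + \<bar>g1 s - k * m1\<bar> * \<bar>w s 1 - w' s 1\<bar>"
        by (simp add: distrib_right)
      also have "\<dots> \<le> L * e s + L * e s"
        by (intro add_mono mult_mono[OF LB(2) z(1) L0] mult_mono[OF order_trans[OF g1 LB(5)] z(2) L0]) simp_all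
      finally show "\<bar>J0 R w s - J0 R w' s\<bar> \<le> 2 * (L * e s)" by simp
      have eq: "J1 R w s - J1 R w' s = (- (src R \<beta> s (w s 1) - src R \<beta> s (w' s 1)) - k * l1 * (w s 1 - w' s 1)) + (g0 s - k * m0) * (w s 0 - w' s 0)"
        by (simp add: J1_def c algebra_simps)
      have "\<bar>J1 R w s - J1 R w' s\<bar> \<le> (\<bar>src R \<beta> s (w s 1) - src R \<beta> s (w' s 1)\<bar> + \<bar>k * l1 * (w s 1 - w' s 1)\<bar>) + \<bar>(g0 s - k * m0) * (w s 0 - w' s 0)\<bar>"
        unfolding eq by linarith
      also have "\<dots> \<le> (Lq \<beta> * \<bar>w s 1 - w' s 1\<bar> + \<bar>k * l1\<bar> * \<bar>w s 1 - w' s 1\<bar>) + \<bar>g0 s - k * m0\<bar> * \<bar>w s 0 - w' s 0\<bar>"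
        unfolding abs_mult[of _ "w s 1 - w' s 1"] abs_mult[of _ "w s 0 - w' s 0"]
        by (intro add_mono srcL exponents order_refl)
      also have "\<dots> = (Lq \<beta> + \<bar>k * l1\<bar>) * \<bar>w s 1 - w' s 1\<bar> + \<bar>g0 s - k * m0\<bar> * \<bar>w s 0 - w' s 0\<bar>"
        by (simp add: distrib_right)
      also have "\<dots> \<le> L * e s + L * e s"
        by (intro add_mono mult_mono[OF LB(3) z(2) L0] mult_mono[OF order_trans[OF g0 LB(4)] z(1) L0]) simp_all
      finally show "\<bar>J1 R w s - J1 R w' s\<bar> \<le> 2 * (L * e s)" by simp
    qed
    note cG = GG_continuous[OF w, of R] GG_continuous[OF w', of R]
    have De: "\<bar>duhamel \<sigma> (GG R w) s y - duhamel \<sigma> (GG R w') s y\<bar> \<le> L * e s / \<mu>" if s: "s \<in> {0..\<tau>}" for s y \<sigma>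
      using duhamel_diff_bound[OF cG \<open>\<mu> > 0\<close>, of "L * K" s \<sigma> y] Ge s K L1 by (simp add: e_def mult.assoc)
    have De': "\<bar>duhamel \<sigma> (GG R w) s y - duhamel \<sigma> (GG R w') s y\<bar> \<le> L * e s" if s: "s \<in> {0..\<tau>}" for s y \<sigma>
    proof -
      have "L * e s / \<mu> \<le> L * e s / 1" using \<mu> L1 e0 by (intro divide_left_mono) auto
      then show ?thesis using De[OF s, of \<sigma> y] by simp
    qed
    have re: "\<bar>r0 R w s - r0 R w' s\<bar> \<le> 3 * L * e s" "\<bar>r1 R w s - r1 R w' s\<bar> \<le> 3 * L * e s" if s: "s \<in> {0..\<tau>}" for s
      using De'[OF s, of 1 0] De'[OF s, of 1 1] Je[OF s] by (auto simp: r0_def r1_def)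
    have qe: "\<bar>q0 R w s - q0 R w' s\<bar> \<le> C1 * (3 * L * e s)" "\<bar>q1 R w s - q1 R w' s\<bar> \<le> C1 * (3 * L * e s)" if s: "s \<in> {0..\<tau>}" for s
    proof -
      have L3: "0 \<le> 3 * L * e s" using L1 e0[of s] by simp
      have "\<bar>(1 + l1) * (r0 R w s - r0 R w' s) - m1 * (r1 R w s - r1 R w' s)\<bar> \<le> (1 + l1) * \<bar>r0 R w s - r0 R w' s\<bar> + \<bar>m1\<bar> * \<bar>r1 R w s - r1 R w' s\<bar>"
        using l abs_triangle_ineq4[of "(1 + l1) * (r0 R w s - r0 R w' s)" "m1 * (r1 R w s - r1 R w' s)"] by (simp add: abs_mult)
      also have "\<dots> \<le> (1 + l1) * (3 * L * e s) + \<bar>m1\<bar> * (3 * L * e s)"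
        using l re[OF s] by (intro add_mono mult_left_mono) auto
      also have "\<dots> \<le> (1 + l0 + l1 + \<bar>m0\<bar> + \<bar>m1\<bar>) * (3 * L * e s)"
        unfolding distrib_right[symmetric] using l L3 by (intro mult_right_mono) auto
      finally have "\<bar>(1 + l1) * (r0 R w s - r0 R w' s) - m1 * (r1 R w s - r1 R w' s)\<bar> / \<Delta> \<le> (1 + l0 + l1 + \<bar>m0\<bar> + \<bar>m1\<bar>) * (3 * L * e s) / \<Delta>"
        using \<Delta>_pos by (intro divide_right_mono) auto
      moreover have "\<bar>q0 R w s - q0 R w' s\<bar> = \<bar>(1 + l1) * (r0 R w s - r0 R w' s) - m1 * (r1 R w s - r1 R w' s)\<bar> / \<Delta>"
        using \<Delta>_pos unfolding q0_def diff_divide_distrib[symmetric] by (simp add: algebra_simps)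
      ultimately show "\<bar>q0 R w s - q0 R w' s\<bar> \<le> C1 * (3 * L * e s)" by (simp add: C1_def)
      have "\<bar>(1 + l0) * (r1 R w s - r1 R w' s) - m0 * (r0 R w s - r0 R w' s)\<bar> \<le> (1 + l0) * \<bar>r1 R w s - r1 R w' s\<bar> + \<bar>m0\<bar> * \<bar>r0 R w s - r0 R w' s\<bar>"
        using l abs_triangle_ineq4[of "(1 + l0) * (r1 R w s - r1 R w' s)" "m0 * (r0 R w s - r0 R w' s)"] by (simp add: abs_mult)
      also have "\<dots> \<le> (1 + l0) * (3 * L * e s) + \<bar>m0\<bar> * (3 * L * e s)"
        using l re[OF s] by (intro add_mono mult_left_mono) auto
      also have "\<dots> \<le> (1 + l0 + l1 + \<bar>m0\<bar> + \<bar>m1\<bar>) * (3 * L * e s)"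
        unfolding distrib_right[symmetric] using l L3 by (intro mult_right_mono) auto
      finally have "\<bar>(1 + l0) * (r1 R w s - r1 R w' s) - m0 * (r0 R w s - r0 R w' s)\<bar> / \<Delta> \<le> (1 + l0 + l1 + \<bar>m0\<bar> + \<bar>m1\<bar>) * (3 * L * e s) / \<Delta>"
        using \<Delta>_pos by (intro divide_right_mono) auto
      moreover have "\<bar>q1 R w s - q1 R w' s\<bar> = \<bar>(1 + l0) * (r1 R w s - r1 R w' s) - m0 * (r0 R w s - r0 R w' s)\<bar> / \<Delta>"
        using \<Delta>_pos unfolding q1_def diff_divide_distrib[symmetric] by (simp add: algebra_simps)
      ultimately show "\<bar>q1 R w s - q1 R w' s\<bar> \<le> C1 * (3 * L * e s)" by (simp add: C1_def)
    qed
    have fe: "\<bar>flux0 R w s - flux0 R w' s\<bar> \<le> C2 * K * exp (\<mu> * s)" "\<bar>flux1 R w s - flux1 R w' s\<bar> \<le> C2 * K * exp (\<mu> * s)" if s: "s \<in> {0..\<tau>}" for s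
    proof -
      define D where "D = C1 * (3 * L * e s)"
      have D0: "D \<ge> 0" using C1 L1 e0[of s] by (simp add: D_def)
      have C2e: "C2 * K * exp (\<mu> * s) = (l0 + l1 + \<bar>m0\<bar> + \<bar>m1\<bar>) * D + 2 * (L * e s)"
        by (simp add: C2_def D_def e_def algebra_simps)
      have "\<bar>flux0 R w s - flux0 R w' s\<bar> \<le> l0 * \<bar>q0 R w s - q0 R w' s\<bar> + \<bar>m1\<bar> * \<bar>q1 R w s - q1 R w' s\<bar> + \<bar>J0 R w s - J0 R w' s\<bar>"
      proof -
        have "flux0 R w s - flux0 R w' s = l0 * (q0 R w s - q0 R w' s) + m1 * (q1 R w s - q1 R w' s) + (J0 R w s - J0 R w' s)"
          by (simp add: flux0_def algebra_simps)
        then show ?thesis using l abs_mult[of l0 "q0 R w s - q0 R w' s"] abs_mult[of m1 "q1 R w s - q1 R w' s"] by linarith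
      qed
      also have "\<dots> \<le> l0 * D + \<bar>m1\<bar> * D + 2 * (L * e s)"
        using qe[OF s] Je[OF s] l unfolding D_def by (intro add_mono mult_left_mono) auto
      also have "\<dots> \<le> (l0 + l1 + \<bar>m0\<bar> + \<bar>m1\<bar>) * D + 2 * (L * e s)"
        unfolding distrib_right[symmetric] using l D0 by (intro add_right_mono mult_right_mono) auto
      finally show "\<bar>flux0 R w s - flux0 R w' s\<bar> \<le> C2 * K * exp (\<mu> * s)" unfolding C2e .
      have "\<bar>flux1 R w s - flux1 R w' s\<bar> \<le> l1 * \<bar>q1 R w s - q1 R w' s\<bar> + \<bar>m0\<bar> * \<bar>q0 R w s - q0 R w' s\<bar> + \<bar>J1 R w s - J1 R w' s\<bar>"
      proof -
        have "flux1 R w s - flux1 R w' s = l1 * (q1 R w s - q1 R w' s) + m0 * (q0 R w s - q0 R w' s) + (J1 R w s - J1 R w' s)"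
          by (simp add: flux1_def algebra_simps)
        then show ?thesis using l abs_mult[of l1 "q1 R w s - q1 R w' s"] abs_mult[of m0 "q0 R w s - q0 R w' s"] by linarith
      qed
      also have "\<dots> \<le> l1 * D + \<bar>m0\<bar> * D + 2 * (L * e s)"
        using qe[OF s] Je[OF s] l unfolding D_def by (intro add_mono mult_left_mono) auto
      also have "\<dots> \<le> (l0 + l1 + \<bar>m0\<bar> + \<bar>m1\<bar>) * D + 2 * (L * e s)"
        unfolding distrib_right[symmetric] using l D0 by (intro add_right_mono mult_right_mono) auto
      finally show "\<bar>flux1 R w s - flux1 R w' s\<bar> \<le> C2 * K * exp (\<mu> * s)" unfolding C2e .
    qed
    interpret W: ext_wave c a0 b0 "flux0 R w" "flux1 R w" "GG R w" by (rule ext_wave_\<Psi>[OF w])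
    interpret W': ext_wave c a0 b0 "flux0 R w'" "flux1 R w'" "GG R w'" by (rule ext_wave_\<Psi>[OF w'])
    have t1: "t \<in> {0..1}" using t \<tau> T by auto
    \<comment> \<open>\<open>y\<close> stands for t - x or x + t - 1; it is at most t and may be
      negative.\<close>
    have fint: "\<bar>integral {0..y} f - integral {0..y} f'\<bar> \<le> C2 * K * exp (\<mu> * t) / \<mu>"
      if y: "y \<le> t" and f: "f \<in> L2 0 1" "f' \<in> L2 0 1" and b: "\<And>s. s \<in> {0..\<tau>} \<Longrightarrow> \<bar>f s - f' s\<bar> \<le> C2 * K * exp (\<mu> * s)" for f f' y
    proof -
      have "integral {0..y} f - integral {0..y} f' = integral {0..y} (\<lambda>s. f s - f' s)"
        using y t1 by (intro Henstock_Kurzweil_Integration.integral_diff[symmetric] L2D(3)[OF L2_subinterval[OF f(1)]] L2D(3)[OF L2_subinterval[OF f(2)]]) auto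
      also have "\<bar>\<dots>\<bar> \<le> C2 * K * exp (\<mu> * y) / \<mu>"
        using C2 K y t by (intro integral_exp_bound[OF \<open>\<mu> > 0\<close>] b) auto
      also have "\<dots> \<le> C2 * K * exp (\<mu> * t) / \<mu>"
        using C2 K y \<mu> by (intro divide_right_mono mult_left_mono) auto
      finally show ?thesis .
    qed
    have i1: "\<bar>integral {0..x + t - 1} (flux1 R w) - integral {0..x + t - 1} (flux1 R w')\<bar> \<le> C2 * K * exp (\<mu> * t) / \<mu>"
      using x by (intro fint flux_L2 w w' fe) auto
    have i2: "\<bar>integral {0..t - x} (flux0 R w) - integral {0..t - x} (flux0 R w')\<bar> \<le> C2 * K * exp (\<mu> * t) / \<mu>"
      using x by (intro fint flux_L2 w w' fe) auto
    have i3: "\<bar>integral {0..t} (\<lambda>r. duhamel \<sigma> (GG R w) r x) - integral {0..t} (\<lambda>r. duhamel \<sigma> (GG R w') r x)\<bar> \<le> L * K * exp (\<mu> * t) / \<mu>" for \<sigma>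
    proof -
      have "integral {0..t} (\<lambda>r. duhamel \<sigma> (GG R w) r x) - integral {0..t} (\<lambda>r. duhamel \<sigma> (GG R w') r x) =
        integral {0..t} (\<lambda>r. duhamel \<sigma> (GG R w) r x - duhamel \<sigma> (GG R w') r x)"
        by (intro Henstock_Kurzweil_Integration.integral_diff[symmetric] integrable_continuous_real W.duhamel_cont_time W'.duhamel_cont_time)
      also have "\<bar>\<dots>\<bar> \<le> L * K * exp (\<mu> * t) / \<mu>"
        using De' t L1 K by (intro integral_exp_bound[OF \<open>\<mu> > 0\<close>]) (auto simp: e_def mult.assoc)
      finally show ?thesis .
    qed
    have "\<bar>\<Psi> R w t x - \<Psi> R w' t x\<bar> \<le> 2 * (C2 * K * exp (\<mu> * t) / \<mu>) + L * K * exp (\<mu> * t) / \<mu>"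
    proof -
      have arith: "\<bar>i - i'\<bar> \<le> a \<Longrightarrow> \<bar>j - j'\<bar> \<le> a \<Longrightarrow> \<bar>d - d'\<bar> \<le> b \<Longrightarrow> \<bar>e - e'\<bar> \<le> b \<Longrightarrow>
        \<bar>(f - i - j + (d + e) / 2) - (f - i' - j' + (d' + e') / 2)\<bar> \<le> 2 * a + b" for a b d d' e e' f i i' j j' :: real
        unfolding abs_le_iff by (intro conjI; elim conjE; simp add: field_simps)
      show ?thesis
        unfolding \<Psi>_def W.w_formula[OF t1 x] W'.w_formula[OF t1 x]
        by (rule arith[OF i1 i2 i3 i3])
    qed
    also have "\<dots> = (2 * C2 + L) / \<mu> * (K * exp (\<mu> * t))"
      by (simp add: algebra_simps add_divide_distrib)
    also have "\<dots> \<le> 1 / 2 * (K * exp (\<mu> * t))"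
      using C2 L1 K by (intro mult_right_mono) (auto simp: \<mu>_def field_simps)
    finally show "\<bar>\<Psi> R w t x - \<Psi> R w' t x\<bar> \<le> K / 2 * exp (\<mu> * t)" by simp
  qed
qed

text \<open>The two functions are fixed points only on \<open>{0..\<tau>} \<times> {0..1}\<close>,
  so the estimate is iterated directly: each application halves the weighted distance, which
  therefore vanishes.\<close>

lemma fixed_point_unique:
  assumes R: "R \<ge> 0" and w: "continuous_on UNIV (\<lambda>z. w (fst z) (snd z))" and w': "continuous_on UNIV (\<lambda>z. w' (fst z) (snd z))"
    and \<tau>: "\<tau> \<le> T"
    and fw: "\<And>t x. t \<in> {0..\<tau>} \<Longrightarrow> x \<in> {0..1} \<Longrightarrow> w t x = \<Psi> R w t x"
    and fw': "\<And>t x. t \<in> {0..\<tau>} \<Longrightarrow> x \<in> {0..1} \<Longrightarrow> w' t x = \<Psi> R w' t x"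
    and t: "t \<in> {0..\<tau>}" and x: "x \<in> {0..1}"
  shows "w t x = w' t x"
proof -
  obtain \<mu> where "\<mu> > 0" and contr: "\<And>w w' K \<tau> t x. continuous_on UNIV (\<lambda>z. w (fst z) (snd z)) \<Longrightarrow> continuous_on UNIV (\<lambda>z. w' (fst z) (snd z)) \<Longrightarrow>
      K \<ge> 0 \<Longrightarrow> \<tau> \<le> T \<Longrightarrow> (\<And>s x. s \<in> {0..\<tau>} \<Longrightarrow> x \<in> {0..1} \<Longrightarrow> \<bar>w s x - w' s x\<bar> \<le> K * exp (\<mu> * s)) \<Longrightarrow>
      t \<in> {0..\<tau>} \<Longrightarrow> x \<in> {0..1} \<Longrightarrow> \<bar>\<Psi> R w t x - \<Psi> R w' t x\<bar> \<le> K / 2 * exp (\<mu> * t)"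
    by (rule \<Psi>_contraction[OF R]) blast
  have "compact ((\<lambda>z. w (fst z) (snd z) - w' (fst z) (snd z)) ` ({0..\<tau>} \<times> {0..1}))"
    by (intro compact_continuous_image compact_Times continuous_intros continuous_on_subset[OF w] continuous_on_subset[OF w']) auto
  from compact_imp_bounded[OF this, unfolded bounded_iff]
  obtain K0 where K0: "\<forall>y \<in> (\<lambda>z. w (fst z) (snd z) - w' (fst z) (snd z)) ` ({0..\<tau>} \<times> {0..1}). norm y \<le> K0" by blast
  have b0: "\<bar>w s y - w' s y\<bar> \<le> \<bar>K0\<bar> * exp (\<mu> * s)" if "s \<in> {0..\<tau>}" "y \<in> {0..1}" for s y
  proof -
    have "\<bar>w s y - w' s y\<bar> \<le> K0" using bspec[OF K0 imageI[of "(s, y)"]] that by simp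
    also have "\<dots> \<le> \<bar>K0\<bar> * 1" by simp
    also have "\<dots> \<le> \<bar>K0\<bar> * exp (\<mu> * s)" using that \<open>\<mu> > 0\<close> by (intro mult_left_mono) auto
    finally show ?thesis .
  qed
  have bn: "\<bar>w s y - w' s y\<bar> \<le> \<bar>K0\<bar> / 2 ^ j * exp (\<mu> * s)" if "s \<in> {0..\<tau>}" "y \<in> {0..1}" for s y j
    using that
  proof (induction j arbitrary: s y)
    case 0
    then show ?case using b0 by simp
  next
    case (Suc j)
    have "\<bar>\<Psi> R w s y - \<Psi> R w' s y\<bar> \<le> (\<bar>K0\<bar> / 2 ^ j) / 2 * exp (\<mu> * s)"
      by (rule contr[OF w w' _ \<tau>]) (use Suc in auto)
    then show ?case using fw[OF Suc.prems] fw'[OF Suc.prems] by (simp add: mult.commute)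
  qed
  have "(\<lambda>j. \<bar>K0\<bar> * exp (\<mu> * t) * (1 / 2) ^ j) \<longlonglongrightarrow> \<bar>K0\<bar> * exp (\<mu> * t) * 0"
    by (intro tendsto_intros LIMSEQ_realpow_zero) auto
  moreover have "\<bar>w t x - w' t x\<bar> \<le> \<bar>K0\<bar> * exp (\<mu> * t) * (1 / 2) ^ j" for j
    using bn[OF t x, of j] by (simp add: power_one_over field_simps)
  ultimately have "\<bar>w t x - w' t x\<bar> \<le> \<bar>K0\<bar> * exp (\<mu> * t) * 0"
    by (intro LIMSEQ_le_const) auto
  then show ?thesis by simp
qed

definition clamp_space :: "real \<Rightarrow> real" where "clamp_space x = max 0 (min 1 x)"

text \<open>Banach's theorem in the bounded continuous functions on the plane. The unknown is exp(-
  \<mu> t) w, which turns the weighted norm into the plain sup norm.\<close>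

lemma fixed_point_exists:
  assumes R: "R \<ge> 0"
  obtains w where "continuous_on UNIV (\<lambda>z. w (fst z) (snd z))"
    "\<And>t x. t \<in> {0..T} \<Longrightarrow> x \<in> {0..1} \<Longrightarrow> w t x = \<Psi> R w t x"
proof -
  obtain \<mu> where "\<mu> > 0" and contr: "\<And>w w' K \<tau> t x. continuous_on UNIV (\<lambda>z. w (fst z) (snd z)) \<Longrightarrow> continuous_on UNIV (\<lambda>z. w' (fst z) (snd z)) \<Longrightarrow>
      K \<ge> 0 \<Longrightarrow> \<tau> \<le> T \<Longrightarrow> (\<And>s x. s \<in> {0..\<tau>} \<Longrightarrow> x \<in> {0..1} \<Longrightarrow> \<bar>w s x - w' s x\<bar> \<le> K * exp (\<mu> * s)) \<Longrightarrow>
      t \<in> {0..\<tau>} \<Longrightarrow> x \<in> {0..1} \<Longrightarrow> \<bar>\<Psi> R w t x - \<Psi> R w' t x\<bar> \<le> K / 2 * exp (\<mu> * t)"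
    by (rule \<Psi>_contraction[OF R]) blast
  have cs: "clamp_space x \<in> {0..1}" for x by (auto simp: clamp_space_def)
  have csc: "continuous_on S clamp_space" for S unfolding clamp_space_def by (intro continuous_intros)
  have cc: "continuous_on UNIV (\<lambda>z::real \<times> real. (clamp_time (fst z), clamp_space (snd z)))"
    by (intro continuous_intros continuous_on_compose2[OF clamp_time_continuous[of UNIV]] continuous_on_compose2[OF csc[of UNIV]]) auto
  \<comment> \<open>Undoes the exponential weight.\<close>
  define W where "W = (\<lambda>(v :: (real \<times> real) \<Rightarrow>\<^sub>C real) (s :: real) (y :: real). exp (\<mu> * clamp_time s) * apply_bcontfun v (s, y))"
  have Wc: "continuous_on UNIV (\<lambda>z. W v (fst z) (snd z))" for v
    unfolding W_def by (auto intro!: continuous_intros continuous_on_compose2[OF clamp_time_continuous[of UNIV]] 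
        continuous_on_apply_bcontfun)
  \<comment> \<open>Clamping both variables extends the image from the rectangle to a bounded
    continuous function on the plane.\<close>
  define S0 where "S0 = (\<lambda>v z. exp (- \<mu> * clamp_time (fst z)) * \<Psi> R (W v) (clamp_time (fst z)) (clamp_space (snd z)))"
  have S0: "S0 v \<in> bcontfun" for v
  proof -
    define h where "h = (\<lambda>z. exp (- \<mu> * fst z) * \<Psi> R (W v) (fst z) (snd z))"
    have hc: "continuous_on ({0..T} \<times> {0..1}) h"
      unfolding h_def using T by (intro continuous_intros continuous_on_subset[OF \<Psi>_continuous[OF Wc]]) auto
    have im: "(clamp_time (fst z), clamp_space (snd z)) \<in> {0..T} \<times> {0..1}" for z :: "real \<times> real"
      using clamp_time_mem cs by blast
    have eq: "S0 v = (\<lambda>z. h (clamp_time (fst z), clamp_space (snd z)))"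
      by (simp add: S0_def h_def fun_eq_iff)
    have "continuous_on UNIV (S0 v)"
      unfolding eq by (rule continuous_on_compose2[OF hc cc]) (use im in blast)
    moreover have "bounded (range (S0 v))"
    proof (rule bounded_subset)
      show "bounded (h ` ({0..T} \<times> {0..1}))"
        by (intro compact_imp_bounded compact_continuous_image hc compact_Times) auto
      show "range (S0 v) \<subseteq> h ` ({0..T} \<times> {0..1})"
        unfolding eq using im by blast
    qed
    ultimately show ?thesis by (simp add: bcontfun_def)
  qed
  define S where "S = (\<lambda>v. Bcontfun (S0 v))"
  have S_apply: "apply_bcontfun (S v) z = S0 v z" for v z
    unfolding S_def by (simp add: Bcontfun_inverse[OF S0])
  have "\<exists>!v. S v = v"
  proof (rule banach_fix_type[of "1/2"])
    show "\<forall>v v'. dist (S v) (S v') \<le> 1 / 2 * dist v v'"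
    proof (intro allI dist_bound)
      fix v v' z
      have "\<bar>\<Psi> R (W v) (clamp_time (fst z)) (clamp_space (snd z)) - \<Psi> R (W v') (clamp_time (fst z)) (clamp_space (snd z))\<bar>
          \<le> dist v v' / 2 * exp (\<mu> * clamp_time (fst z))"
      proof (rule contr[OF Wc Wc _ order_refl _ clamp_time_mem cs])
        show "0 \<le> dist v v'" by simp
        fix s y :: real assume s: "s \<in> {0..T}"
        have "\<bar>W v s y - W v' s y\<bar> = exp (\<mu> * s) * dist (apply_bcontfun v (s, y)) (apply_bcontfun v' (s, y))"
          by (simp add: W_def clamp_time_id[OF s] dist_real_def abs_mult flip: right_diff_distrib)
        also have "\<dots> \<le> exp (\<mu> * s) * dist v v'"
          by (intro mult_left_mono dist_bounded) auto
        finally show "\<bar>W v s y - W v' s y\<bar> \<le> dist v v' * exp (\<mu> * s)" by (simp add: mult.commute)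
      qed
      then have "exp (- \<mu> * clamp_time (fst z)) * \<bar>\<Psi> R (W v) (clamp_time (fst z)) (clamp_space (snd z)) - \<Psi> R (W v') (clamp_time (fst z)) (clamp_space (snd z))\<bar>
          \<le> exp (- \<mu> * clamp_time (fst z)) * (dist v v' / 2 * exp (\<mu> * clamp_time (fst z)))"
        by (intro mult_left_mono) auto
      also have "\<dots> = 1 / 2 * dist v v'" by (simp add: exp_minus field_simps)
      finally show "dist (apply_bcontfun (S v) z) (apply_bcontfun (S v') z) \<le> 1 / 2 * dist v v'"
        by (simp add: S_apply S0_def dist_real_def abs_mult flip: right_diff_distrib)
    qed
  qed auto
  then obtain v where v: "S v = v" by blast
  show thesis
  proof (rule that[of "W v"])
    show "continuous_on UNIV (\<lambda>z. W v (fst z) (snd z))" by (rule Wc)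
    fix t x :: real assume t: "t \<in> {0..T}" and x: "x \<in> {0..1}"
    have "apply_bcontfun v (t, x) = S0 v (t, x)" using S_apply[of v "(t, x)"] v by simp
    also have "\<dots> = exp (- \<mu> * t) * \<Psi> R (W v) t x"
      using x by (simp add: S0_def clamp_time_id[OF t] clamp_space_def)
    finally show "W v t x = \<Psi> R (W v) t x"
      by (simp add: W_def clamp_time_id[OF t] exp_minus)
  qed
qed

end

section \<open>Weak solutions as fixed points\<close>

lemma H1_diff_rep:
  assumes "f \<in> H1 0 1" "g \<in> H1 0 1"
  shows "(\<lambda>x. f x - g x) \<in> H1 0 1"
    "AE x in lebesgue_on {0<..<1}. weak_deriv 0 1 (\<lambda>x. f x - g x) x = weak_deriv 0 1 f x - weak_deriv 0 1 g x"
    "x \<in> {0..1} \<Longrightarrow> cont_rep 0 1 (\<lambda>x. f x - g x) x = cont_rep 0 1 f x - cont_rep 0 1 g x"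
proof -
  have A: "AC 0 1 (\<lambda>x. cont_rep 0 1 f x - cont_rep 0 1 g x) (\<lambda>x. weak_deriv 0 1 f x - weak_deriv 0 1 g x)"
    by (intro AC_minus H1_AC assms) auto
  have L: "(\<lambda>x. weak_deriv 0 1 f x - weak_deriv 0 1 g x) \<in> L2 0 1"
    by (intro L2_minus H1_AC assms) auto
  have ae: "AE x in lebesgue_on {0<..<1}. f x - g x = cont_rep 0 1 f x - cont_rep 0 1 g x"
    using H1_AC(3)[OF assms(1)] H1_AC(3)[OF assms(2)] by (auto elim!: eventually_elim2)
  note H = H1I[OF _ A L ae]
  show "(\<lambda>x. f x - g x) \<in> H1 0 1" 
    "AE x in lebesgue_on {0<..<1}. weak_deriv 0 1 (\<lambda>x. f x - g x) x = weak_deriv 0 1 f x - weak_deriv 0 1 g x"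
    "x \<in> {0..1} \<Longrightarrow> cont_rep 0 1 (\<lambda>x. f x - g x) x = cont_rep 0 1 f x - cont_rep 0 1 g x"
    by (rule H; simp)+
qed

lemma H1_sup_bound:
  assumes "f \<in> H1 0 1" "x \<in> {0..1}"
  shows "\<bar>cont_rep 0 1 f x\<bar> \<le> 2 * H1_norm 0 1 f"
proof -
  have "(cont_rep 0 1 f x)\<^sup>2 \<le> 2 * sq 0 1 (cont_rep 0 1 f) + 2 * sq 0 1 (weak_deriv 0 1 f)"
    by (intro AC_sup_bound H1_AC assms) auto
  also have "sq 0 1 (cont_rep 0 1 f) = sq 0 1 f"
    by (rule sq_AE_cong) (use H1_AC(3)[OF assms(1)] in \<open>auto elim: eventually_mono\<close>)
  finally have "(cont_rep 0 1 f x)\<^sup>2 \<le> 2 * (H1_norm 0 1 f)\<^sup>2"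
    by (simp add: H1_norm_eq[OF assms(1)])
  also have "\<dots> \<le> (2 * H1_norm 0 1 f)\<^sup>2" by (simp add: power_mult_distrib)
  finally have "\<bar>cont_rep 0 1 f x\<bar> \<le> \<bar>2 * H1_norm 0 1 f\<bar>" by (simp only: abs_le_square_iff)
  then show ?thesis by (simp add: H1_norm_def)
qed

lemma continuous_H1_weak_deriv:
  assumes u: "continuous_H1 \<tau> u"
  shows "continuous_L2 \<tau> (\<lambda>t. weak_deriv 0 1 (u t))" and "continuous_L2 \<tau> u"
proof -
  note uH = continuous_H1D[OF u]
  have lim: "((\<lambda>s. (H1_norm 0 1 (\<lambda>x. u s x - u t x))\<^sup>2) \<longlongrightarrow> 0) (at t within {0..\<tau>})" if "t \<in> {0..\<tau>}" for t
    using u that by (auto simp: continuous_H1_def intro!: tendsto_eq_intros)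
  have eq: "(H1_norm 0 1 (\<lambda>x. u s x - u t x))\<^sup>2 = sq 0 1 (\<lambda>x. u s x - u t x) + sq 0 1 (\<lambda>x. weak_deriv 0 1 (u s) x - weak_deriv 0 1 (u t) x)"
    if "s \<in> {0..\<tau>}" "t \<in> {0..\<tau>}" for s t
    using H1_norm_eq[OF H1_diff_rep(1)[OF uH[OF that(1)] uH[OF that(2)]]]
      sq_AE_cong[OF H1_diff_rep(2)[OF uH[OF that(1)] uH[OF that(2)]]] by simp
  show "continuous_L2 \<tau> (\<lambda>t. weak_deriv 0 1 (u t))"
    unfolding continuous_L2_iff
  proof (intro conjI ballI)
    fix t assume t: "t \<in> {0..\<tau>}"
    show "weak_deriv 0 1 (u t) \<in> L2 0 1" by (rule H1_AC(2)[OF uH[OF t]]) simp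
    show "((\<lambda>s. sq 0 1 (\<lambda>x. weak_deriv 0 1 (u s) x - weak_deriv 0 1 (u t) x)) \<longlongrightarrow> 0) (at t within {0..\<tau>})"
      by (rule tendsto_zero_bound[OF lim[OF t]]) (use eq t sq_nonneg in auto)
  qed
  show "continuous_L2 \<tau> u"
    unfolding continuous_L2_iff
  proof (intro conjI ballI)
    fix t assume t: "t \<in> {0..\<tau>}"
    show "u t \<in> L2 0 1" using uH[OF t] by (simp add: H1_def)
    show "((\<lambda>s. sq 0 1 (\<lambda>x. u s x - u t x)) \<longlongrightarrow> 0) (at t within {0..\<tau>})"
      by (rule tendsto_zero_bound[OF lim[OF t]]) (use eq t sq_nonneg in auto)
  qed
qed

text \<open>By \<open>H1_sup_bound\<close> the continuous representatives converge uniformly in x as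
  time varies; with continuity in x at a fixed time this gives joint continuity.\<close>

lemma continuous_H1_rep:
  assumes u: "continuous_H1 \<tau> u"
  shows "continuous_on ({0..\<tau>} \<times> {0..1}) (\<lambda>z. cont_rep 0 1 (u (fst z)) (snd z))"
  unfolding continuous_on_iff
proof (intro ballI allI impI)
  note uH = continuous_H1D[OF u]
  fix z :: "real \<times> real" and e :: real assume z: "z \<in> {0..\<tau>} \<times> {0..1}" and e: "0 < e"
  obtain t x where tx: "z = (t, x)" "t \<in> {0..\<tau>}" "x \<in> {0..1}" using z by auto
  have "((\<lambda>s. H1_norm 0 1 (\<lambda>x. u s x - u t x)) \<longlongrightarrow> 0) (at t within {0..\<tau>})"
    using u tx by (auto simp: continuous_H1_def)
  then have "eventually (\<lambda>s. dist (H1_norm 0 1 (\<lambda>x. u s x - u t x)) 0 < e / 4) (at t within {0..\<tau>})"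
    by (rule tendstoD) (use e in simp)
  then obtain d1 where d1': "d1 > 0" "\<forall>s\<in>{0..\<tau>}. s \<noteq> t \<and> dist s t < d1 \<longrightarrow> dist (H1_norm 0 1 (\<lambda>x. u s x - u t x)) 0 < e / 4"
    unfolding eventually_at by blast
  then have d1: "d1 > 0" "\<And>s. s \<in> {0..\<tau>} \<Longrightarrow> s \<noteq> t \<Longrightarrow> dist s t < d1 \<Longrightarrow> H1_norm 0 1 (\<lambda>x. u s x - u t x) < e / 4"
    by (auto simp: dist_real_def)
  have "continuous_on {0..1} (cont_rep 0 1 (u t))" by (intro AC_continuous[OF H1_AC(1)] uH tx) auto
  then obtain d2 where d2: "d2 > 0" "\<And>y. y \<in> {0..1} \<Longrightarrow> dist y x < d2 \<Longrightarrow> dist (cont_rep 0 1 (u t) y) (cont_rep 0 1 (u t) x) < e / 2"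
    using tx(3) e unfolding continuous_on_iff by (meson half_gt_zero)
  show "\<exists>d>0. \<forall>z'\<in>{0..\<tau>} \<times> {0..1}. dist z' z < d \<longrightarrow> dist (cont_rep 0 1 (u (fst z')) (snd z')) (cont_rep 0 1 (u (fst z)) (snd z)) < e"
  proof (intro exI[of _ "min d1 d2"] conjI ballI impI)
    fix z' :: "real \<times> real" assume z': "z' \<in> {0..\<tau>} \<times> {0..1}" "dist z' z < min d1 d2"
    obtain s y where sy: "z' = (s, y)" "s \<in> {0..\<tau>}" "y \<in> {0..1}" using z' by auto
    have ds: "dist s t < d1" "dist y x < d2"
      using z'(2) dist_fst_le[of z' z] dist_snd_le[of z' z] by (auto simp: sy tx)
    have "\<bar>cont_rep 0 1 (u s) y - cont_rep 0 1 (u t) y\<bar> < e / 2"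
    proof (cases "s = t")
      case False
      have "\<bar>cont_rep 0 1 (u s) y - cont_rep 0 1 (u t) y\<bar> \<le> 2 * H1_norm 0 1 (\<lambda>x. u s x - u t x)"
        using H1_sup_bound[OF H1_diff_rep(1)[OF uH[OF sy(2)] uH[OF tx(2)]] sy(3)]
          H1_diff_rep(3)[OF uH[OF sy(2)] uH[OF tx(2)] sy(3)] by simp
      then show ?thesis using d1(2)[OF sy(2) False ds(1)] by simp
    qed (use e in simp)
    then show "dist (cont_rep 0 1 (u (fst z')) (snd z')) (cont_rep 0 1 (u (fst z)) (snd z)) < e"
      using d2(2)[OF sy(3) ds(2)] unfolding sy tx fst_conv snd_conv dist_real_def by linarith
  qed (use d1 d2 in auto)
qed

lemma AE_Ioo_subset:
  assumes "AE x in lebesgue_on {a<..<b}. P x" "a \<le> c" "d \<le> b"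
  shows "AE x::real in lebesgue_on {c<..<d}. P x"
proof -
  obtain N where N: "negligible N" "\<And>x. x \<in> {a..b} \<Longrightarrow> x \<notin> N \<Longrightarrow> P x" by (rule AE_IooE[OF assms(1)]) blast
  show ?thesis by (rule AE_IooI[OF N(1)]) (use N(2) assms(2,3) in auto)
qed

lemma AE_Ioo_mem: "AE x::real in lebesgue_on {a<..<b}. x \<in> {a<..<b}"
  by (rule AE_IooI[of "{a, b}"]) auto

text \<open>The fluxes of a weak solution are L2 on (0,\<tau>) and fixed only up to null sets, while
  d'Alembert's formula takes Borel data on (0,1); zero is used after time \<tau>.\<close>

lemma borel_extension:
  assumes f: "f \<in> L2 0 \<tau>" and "\<tau> \<le> 1"
  obtains n where "n \<in> borel_measurable borel" "n \<in> L2 0 1" "AE t in lebesgue_on {0<..<\<tau>}. n t = f t"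
proof -
  obtain n N where n: "n \<in> borel_measurable borel" "\<And>x. x \<notin> {0..\<tau>} \<Longrightarrow> n x = 0"
    and N: "negligible N" "\<And>x. x \<in> {0..\<tau>} \<Longrightarrow> x \<notin> N \<Longrightarrow> f x = n x"
    by (rule borel_representative[OF L2D(1)[OF f]]) blast
  have ae: "AE t in lebesgue_on {0<..<\<tau>}. f t = n t" by (rule AE_IooI[OF N])
  have "(\<lambda>y. if y \<in> {0..\<tau>} then n y else 0) \<in> L2 0 1"
    by (rule L2_piece[OF L2_AE_cong[OF f ae]]) (use assms(2) in auto)
  moreover have "(\<lambda>y. if y \<in> {0..\<tau>} then n y else 0) = n" using n(2) by auto
  moreover have "AE t in lebesgue_on {0<..<\<tau>}. n t = f t" by (rule eventually_mono[OF ae]) simp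
  ultimately show thesis using that[OF n(1)] by simp
qed

text \<open>The profiles solve a0 + b0 = u0' and a0 - b0 = u1 + k u0, the initial slope and velocity
  of w = exp(k t) u.\<close>

locale weak_problem = boundary_problem +
  fixes h0 h1 u0 u1 :: "real \<Rightarrow> real"
  assumes k: "k > 0" and c: "c = cont_rep 0 1 u0 0"
    and u0: "u0 \<in> H1 0 1" and u1: "u1 \<in> L2 0 1"
    and a0_eq: "AE x in lebesgue_on {0<..<1}. a0 x = (weak_deriv 0 1 u0 x + u1 x + k * cont_rep 0 1 u0 x) / 2"
    and b0_eq: "AE x in lebesgue_on {0<..<1}. b0 x = (weak_deriv 0 1 u0 x - u1 x - k * cont_rep 0 1 u0 x) / 2"
    and h0_eq: "AE t in lebesgue_on {0<..<T}. h0 t = g0 t"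
    and h1_eq: "AE t in lebesgue_on {0<..<T}. h1 t = g1 t"
begin

definition weak_sol :: "real \<Rightarrow> (real \<Rightarrow> real \<Rightarrow> real) \<Rightarrow> bool" where
  "weak_sol \<tau> u \<longleftrightarrow> weak_solution p \<alpha> \<beta> (2 * k) l0 l1 m0 m1 h0 h1 u0 u1 \<tau> u"

text \<open>The right-hand side of the weak form with all boundary terms merged into the fluxes;
  \<open>V\<close> stands for the continuous representative of the test function and
  \<open>v\<close> for its derivative.\<close>

definition rhs where
  "rhs u u' n m V v t = integral {0..1} (\<lambda>x. power_source p (u t x) * V x)
     - exp (- k * t) * n t * V 0 - exp (- k * t) * m t * V 1
     - integral {0..1} (\<lambda>x. weak_deriv 0 1 (u t) x * v x) - integral {0..1} (\<lambda>x. u t x * V x)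
     - 2 * k * integral {0..1} (\<lambda>x. u' t x * V x)"

definition trace0 where "trace0 u t = cont_rep 0 1 (u t) 0"
definition trace1 where "trace1 u t = cont_rep 0 1 (u t) 1"

text \<open>\<open>exp (- k * t) * n t\<close> plays the role of u_x(0,t); in
  \<open>flux_eq1\<close>, \<open>exp (- k * t) * m t\<close> is - u_x(1,t).\<close>

definition flux_eq0 where
  "flux_eq0 \<tau> u n \<longleftrightarrow> (AE t in lebesgue_on {0<..<\<tau>}. exp (- k * t) * n t =
      l0 * weak_deriv 0 \<tau> (trace0 u) t + h1 t * trace1 u t + m1 * weak_deriv 0 \<tau> (trace1 u) t - power_source \<alpha> (trace0 u t))"

definition flux_eq1 where
  "flux_eq1 \<tau> u m \<longleftrightarrow> (AE t in lebesgue_on {0<..<\<tau>}. exp (- k * t) * m t =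
      l1 * weak_deriv 0 \<tau> (trace1 u) t + h0 t * trace0 u t + m0 * weak_deriv 0 \<tau> (trace0 u) t - power_source \<beta> (trace1 u t))"

lemma source_L2:
  assumes "f \<in> H1 0 1"
  shows "(\<lambda>x. power_source p (f x)) \<in> L2 0 1"
proof -
  have "continuous_on {0..1} (\<lambda>x. power_source p (cont_rep 0 1 f x))"
    by (intro continuous_on_compose2[OF power_source_continuous[OF exponents(1), of UNIV]] AC_continuous[OF H1_AC(1)] assms) auto
  then show ?thesis
    by (rule L2_AE_cong[OF L2_continuous]) (use H1_AC(3)[OF assms] in \<open>auto elim: eventually_mono\<close>)
qed

text \<open>The power sources at the end points cancel against those inside the fluxes, so the
  boundary velocities disappear from the weak form.\<close>

lemma rhs_AE:
  assumes \<tau>: "0 < \<tau>" "\<tau> \<le> T" and u: "continuous_H1 \<tau> u" and u': "continuous_L2 \<tau> u'" and v: "v \<in> H1 0 1"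
    and n: "flux_eq0 \<tau> u n" and m: "flux_eq1 \<tau> u m"
  shows "AE t in lebesgue_on {0<..<\<tau>}. L2_inner 0 1 (\<lambda>x. power_source p (u t x)) v
      + power_source \<alpha> (trace0 u t) * cont_rep 0 1 v 0 + power_source \<beta> (trace1 u t) * cont_rep 0 1 v 1
      - L2_inner 0 1 (weak_deriv 0 1 (u t)) (weak_deriv 0 1 v) - L2_inner 0 1 (u t) v - 2 * k * L2_inner 0 1 (u' t) v
      - (l0 * weak_deriv 0 \<tau> (trace0 u) t + h1 t * trace1 u t + m1 * weak_deriv 0 \<tau> (trace1 u) t) * cont_rep 0 1 v 0
      - (l1 * weak_deriv 0 \<tau> (trace1 u) t + h0 t * trace0 u t + m0 * weak_deriv 0 \<tau> (trace0 u) t) * cont_rep 0 1 v 1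
    = rhs u u' n m (cont_rep 0 1 v) (weak_deriv 0 1 v) t"
  using n[unfolded flux_eq0_def] m[unfolded flux_eq1_def] AE_Ioo_mem
proof eventually_elim
  case (elim t)
  then have t: "t \<in> {0..\<tau>}" by auto
  have vL: "v \<in> L2 0 1" using v by (simp add: H1_def)
  have ae: "AE x in lebesgue_on {0<..<1}. v x = cont_rep 0 1 v x" by (rule H1_AC(3)[OF v]) simp
  have I: "L2_inner 0 1 f v = integral {0..1} (\<lambda>x. f x * cont_rep 0 1 v x)" if "f \<in> L2 0 1" for f
    unfolding L2_inner_eq[OF that vL] by (rule integral_AE_cong) (use ae in \<open>auto elim: eventually_mono\<close>)
  have uH: "u t \<in> H1 0 1" by (rule continuous_H1D[OF u t])
  have J: "L2_inner 0 1 (weak_deriv 0 1 (u t)) (weak_deriv 0 1 v) = integral {0..1} (\<lambda>x. weak_deriv 0 1 (u t) x * weak_deriv 0 1 v x)"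
    by (intro L2_inner_eq H1_AC(2) uH v) auto
  have n: "l0 * weak_deriv 0 \<tau> (trace0 u) t + h1 t * trace1 u t + m1 * weak_deriv 0 \<tau> (trace1 u) t
     = exp (- k * t) * n t + power_source \<alpha> (trace0 u t)" using elim(1) by simp
  have m: "l1 * weak_deriv 0 \<tau> (trace1 u) t + h0 t * trace0 u t + m0 * weak_deriv 0 \<tau> (trace0 u) t
     = exp (- k * t) * m t + power_source \<beta> (trace1 u t)" using elim(2) by simp
  show ?case
    unfolding n m J I[OF source_L2[OF uH]] I[OF continuous_L2D(1)[OF continuous_H1_weak_deriv(2)[OF u] t]]
      I[OF continuous_L2D(1)[OF u' t]] rhs_def
    by (simp add: algebra_simps)
qed

lemma weak_sol_iff:
  "weak_sol \<tau> u \<longleftrightarrow> continuous_H1 \<tau> u \<and> trace0 u \<in> H1 0 \<tau> \<and> trace1 u \<in> H1 0 \<tau> \<and>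
    (\<exists>u'. has_C1_L2_deriv \<tau> u u' \<and> (AE x in lebesgue_on {0<..<1}. u 0 x = u0 x) \<and> (AE x in lebesgue_on {0<..<1}. u' 0 x = u1 x) \<and>
      (\<forall>v \<in> H1 0 1. has_weak_deriv 0 \<tau> (\<lambda>t. L2_inner 0 1 (u' t) v)
        (\<lambda>t. L2_inner 0 1 (\<lambda>x. power_source p (u t x)) v
      + power_source \<alpha> (trace0 u t) * cont_rep 0 1 v 0 + power_source \<beta> (trace1 u t) * cont_rep 0 1 v 1
      - L2_inner 0 1 (weak_deriv 0 1 (u t)) (weak_deriv 0 1 v) - L2_inner 0 1 (u t) v - 2 * k * L2_inner 0 1 (u' t) v
      - (l0 * weak_deriv 0 \<tau> (trace0 u) t + h1 t * trace1 u t + m1 * weak_deriv 0 \<tau> (trace1 u) t) * cont_rep 0 1 v 0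
      - (l1 * weak_deriv 0 \<tau> (trace1 u) t + h0 t * trace0 u t + m0 * weak_deriv 0 \<tau> (trace0 u) t) * cont_rep 0 1 v 1)))"
  unfolding weak_sol_def weak_solution_def Let_def trace0_def[abs_def] trace1_def[abs_def] ..

text \<open>At time 0, \<open>w\<close> and the representative of \<open>u0\<close> have the same
  density and, by the choice of \<open>c\<close>, the same value at 0.\<close>

lemma initial_values:
  assumes "ext_wave a0 b0 n m G"
  shows "x \<in> {0..1} \<Longrightarrow> wave.w c (ext_left a0 b0 m) (ext_right a0 b0 n) G 0 x = cont_rep 0 1 u0 x"
    and "AE x in lebesgue_on {0<..<1}. wave.wt (ext_left a0 b0 m) (ext_right a0 b0 n) G 0 x
        - k * wave.w c (ext_left a0 b0 m) (ext_right a0 b0 n) G 0 x = u1 x"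
proof -
  interpret ext_wave c a0 b0 n m G by (rule assms)
  have U: "AC 0 1 (cont_rep 0 1 u0) (weak_deriv 0 1 u0)" by (rule H1_AC(1)[OF u0]) simp
  have W: "AC 0 1 (w 0) (wx 0)" by (rule w_AC_space) simp
  have "AE x in lebesgue_on {0<..<1}. wx 0 x = weak_deriv 0 1 u0 x"
    using a0_eq b0_eq AE_Ioo_mem by eventually_elim (auto simp: wx_def ext_left_def ext_right_def duhamel_0 field_simps)
  from AC_cong[OF W refl this] have W: "AC 0 1 (w 0) (weak_deriv 0 1 u0)" .
  have w0: "w 0 0 = cont_rep 0 1 u0 0" by (simp add: w_def \<Theta>_def flip: c)
  show eq: "w 0 x = cont_rep 0 1 u0 x" if "x \<in> {0..1}" for x
    using ACD(3)[OF W that] ACD(3)[OF U that] w0 by simp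
  show "AE x in lebesgue_on {0<..<1}. wt 0 x - k * w 0 x = u1 x"
    using a0_eq b0_eq AE_Ioo_mem
    by eventually_elim (auto simp: eq wt_def ext_left_def ext_right_def duhamel_0 field_simps)
qed

lemma exp_cancel: "exp (- k * t) * (exp (k * t) * z) = z" "exp (k * t) * (exp (- k * t) * z) = z"
  by (simp_all add: exp_minus)

lemma src_small: "\<bar>z\<bar> \<le> R \<Longrightarrow> src R q t (exp (k * t) * z) = exp (k * t) * power_source q z"
  by (simp only: src_def exp_cancel trunc_id)

end

lemma continuous_H1_subset: "continuous_H1 \<tau> u \<Longrightarrow> \<sigma> \<le> \<tau> \<Longrightarrow> continuous_H1 \<sigma> u"
  unfolding continuous_H1_def
  by (auto intro!: tendsto_within_subset[where S = "{0..\<tau>}" and T = "{0..\<sigma>}"])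

context ext_wave
begin

text \<open>The traces of \<open>wx\<close> are now replaced by the prescribed Neumann data, and the
  space derivative is the one used in the weak formulation.\<close>

lemma damped_form:
  assumes \<tau>: "0 < \<tau>" "\<tau> \<le> 1" and V: "AC 0 1 V v" and v: "v \<in> L2 0 1"
  shows "AC 0 \<tau> (\<lambda>t. integral {0..1} (\<lambda>x. exp (- k * t) * (wt t x - k * w t x) * V x))
    (\<lambda>t. exp (- k * t) * integral {0..1} (\<lambda>x. G t x * V x) - exp (- k * t) * n t * V 0 - exp (- k * t) * m t * V 1
      - integral {0..1} (\<lambda>x. weak_deriv 0 1 (\<lambda>x. exp (- k * t) * w t x) x * v x)
      - k\<^sup>2 * integral {0..1} (\<lambda>x. exp (- k * t) * w t x * V x)
      - 2 * k * integral {0..1} (\<lambda>x. exp (- k * t) * (wt t x - k * w t x) * V x))"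
proof (rule AC_cong[OF AC_subinterval[OF damped_weak_form[OF V v]] refl])
  have "AE t in lebesgue_on {0<..<\<tau>}. t \<in> {0<..<\<tau>}" by (rule AE_Ioo_mem)
  then show "AE t in lebesgue_on {0<..<\<tau>}. exp (- k * t) * (integral {0..1} (\<lambda>x. G t x * V x) + wx t 1 * V 1 - wx t 0 * V 0)
      - integral {0..1} (\<lambda>x. exp (- k * t) * wx t x * v x)
      - k\<^sup>2 * integral {0..1} (\<lambda>x. exp (- k * t) * w t x * V x)
      - 2 * k * integral {0..1} (\<lambda>x. exp (- k * t) * (wt t x - k * w t x) * V x)
    = exp (- k * t) * integral {0..1} (\<lambda>x. G t x * V x) - exp (- k * t) * n t * V 0 - exp (- k * t) * m t * V 1
      - integral {0..1} (\<lambda>x. weak_deriv 0 1 (\<lambda>x. exp (- k * t) * w t x) x * v x)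
      - k\<^sup>2 * integral {0..1} (\<lambda>x. exp (- k * t) * w t x * V x)
      - 2 * k * integral {0..1} (\<lambda>x. exp (- k * t) * (wt t x - k * w t x) * V x)"
  proof eventually_elim
    case (elim t)
    then have t: "t \<in> {0<..<1}" using \<tau> by auto
    have "integral {0..1} (\<lambda>x. weak_deriv 0 1 (\<lambda>x. exp (- k * t) * w t x) x * v x) = integral {0..1} (\<lambda>x. exp (- k * t) * wx t x * v x)"
      by (rule integral_AE_cong) (use damped_weak_deriv(1)[of t k] t in \<open>auto elim!: eventually_mono\<close>)
    then show ?case unfolding boundary_values(1,2)[OF t] by (simp add: algebra_simps)
  qed
qed (use \<tau> in auto)

end

context weak_problem
begin

lemma rhs_cong:
  assumes V: "\<And>x. x \<in> {0..1} \<Longrightarrow> V x = V' x" and v: "AE x in lebesgue_on {0<..<1}. v x = v' x"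
  shows "rhs u u' n m V v t = rhs u u' n m V' v' t"
proof -
  have "integral {0..1} (\<lambda>x. weak_deriv 0 1 (u t) x * v x) = integral {0..1} (\<lambda>x. weak_deriv 0 1 (u t) x * v' x)"
    by (rule integral_AE_cong) (use v in \<open>auto elim: eventually_mono\<close>)
  moreover have "integral {0..1} (\<lambda>x. f x * V x) = integral {0..1} (\<lambda>x. f x * V' x)" for f
    using V by (intro integral_cong) simp
  ultimately show ?thesis using V[of 0] V[of 1] by (simp add: rhs_def)
qed

text \<open>Below the level \<open>R\<close> the truncation is the identity. The velocities of the
  wave at the ends are \<open>q0\<close> and \<open>q1\<close>, so \<open>flux0\<close> and
  \<open>flux1\<close> become the boundary conditions of the original problem.\<close>

lemma fixed_point_weak_sol:
  assumes w: "continuous_on UNIV (\<lambda>z. w (fst z) (snd z))"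
    and fixed: "\<And>t x. t \<in> {0..T} \<Longrightarrow> x \<in> {0..1} \<Longrightarrow> w t x = \<Psi> R w t x"
    and \<tau>: "0 < \<tau>" "\<tau> \<le> T"
    and bd: "\<And>t x. t \<in> {0..\<tau>} \<Longrightarrow> x \<in> {0..1} \<Longrightarrow> \<bar>exp (- k * t) * w t x\<bar> \<le> R"
  shows "weak_sol \<tau> (\<lambda>t x. exp (- k * t) * \<Psi> R w t x)"
proof -
  interpret W: ext_wave c a0 b0 "flux0 R w" "flux1 R w" "GG R w" by (rule ext_wave_\<Psi>[OF w])
  have \<Psi>: "\<Psi> R w = W.w" by (simp add: \<Psi>_def)
  define u where "u = (\<lambda>t x. exp (- k * t) * W.w t x)"
  define u' where "u' = (\<lambda>t x. exp (- k * t) * (W.wt t x - k * W.w t x))"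
  have \<tau>1: "\<tau> \<le> 1" using \<tau> T by simp
  have wW: "w t x = W.w t x" if "t \<in> {0..\<tau>}" "x \<in> {0..1}" for t x
    using fixed[of t x] that \<tau> by (simp add: \<Psi>)
  have ubd: "\<bar>u t x\<bar> \<le> R" if "t \<in> {0..\<tau>}" "x \<in> {0..1}" for t x
    using bd[OF that] wW[OF that] by (simp add: u_def)
  have wu: "w t x = exp (k * t) * u t x" if "t \<in> {0..\<tau>}" "x \<in> {0..1}" for t x
    unfolding u_def exp_cancel by (rule wW[OF that])
  have uH: "continuous_H1 \<tau> u" unfolding u_def by (rule continuous_H1_subset[OF W.damped_continuous_H1 \<tau>1])
  have uC: "has_C1_L2_deriv \<tau> u u'" unfolding u_def u'_def by (rule C1_L2_subset[OF W.damped_C1 \<tau>1])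
  have u'L: "continuous_L2 \<tau> u'" using uC by (simp add: has_C1_L2_deriv_def)
  have rep: "cont_rep 0 1 (u t) x = u t x" if "t \<in> {0..\<tau>}" "x \<in> {0..1}" for t x
    unfolding u_def by (rule W.damped_weak_deriv(2)) (use that \<tau>1 in auto)
  have tr: "cont_rep 0 1 (u t) i = u t i" if "t \<in> {0..\<tau>}" "i \<in> {0, 1}" for t i
    using rep[OF that(1), of i] that by auto
  have traces: "(\<lambda>t. cont_rep 0 1 (u t) i) \<in> H1 0 \<tau>"
      "AE t in lebesgue_on {0<..<\<tau>}. weak_deriv 0 \<tau> (\<lambda>t. cont_rep 0 1 (u t) i) t = exp (- k * t) * (W.wt t i - k * W.w t i)"
    if i: "i \<in> {0, 1}" for i
  proof -
    have i': "i \<in> {0..1}" using i by auto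
    have "AC 0 \<tau> (\<lambda>t. exp (- k * t) * W.w t i) (\<lambda>t. exp (- k * t) * (W.wt t i + - k * W.w t i))"
      by (rule AC_exp_mult[OF AC_subinterval[OF W.w_AC_time[OF i']]]) (use \<tau> \<tau>1 in auto)
    then have A: "AC 0 \<tau> (\<lambda>t. cont_rep 0 1 (u t) i) (\<lambda>t. exp (- k * t) * (W.wt t i - k * W.w t i))"
      by (rule AC_cong) (use tr i in \<open>auto simp: u_def\<close>)
    have "(\<lambda>t. W.w t i) \<in> L2 0 1" by (rule L2_continuous[OF AC_continuous[OF W.w_AC_time[OF i']]])
    then have "(\<lambda>t. exp (- k * t) * (W.wt t i - k * W.w t i)) \<in> L2 0 1"
      by (intro L2_mult_continuous L2_minus L2_cmult W.wt_time_L2 i continuous_intros)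
    then have L: "(\<lambda>t. exp (- k * t) * (W.wt t i - k * W.w t i)) \<in> L2 0 \<tau>"
      by (rule L2_subinterval) (use \<tau>1 in auto)
    show "(\<lambda>t. cont_rep 0 1 (u t) i) \<in> H1 0 \<tau>"
      "AE t in lebesgue_on {0<..<\<tau>}. weak_deriv 0 \<tau> (\<lambda>t. cont_rep 0 1 (u t) i) t = exp (- k * t) * (W.wt t i - k * W.w t i)"
      using H1I[OF \<tau>(1) A L, of "\<lambda>t. cont_rep 0 1 (u t) i"] by auto
  qed
  have tH: "trace0 u \<in> H1 0 \<tau>" "trace1 u \<in> H1 0 \<tau>"
    using traces(1)[of 0] traces(1)[of 1] by (simp_all add: trace0_def[abs_def] trace1_def[abs_def])
  have tD: "AE t in lebesgue_on {0<..<\<tau>}. weak_deriv 0 \<tau> (trace0 u) t = exp (- k * t) * (W.wt t 0 - k * W.w t 0)"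
    "AE t in lebesgue_on {0<..<\<tau>}. weak_deriv 0 \<tau> (trace1 u) t = exp (- k * t) * (W.wt t 1 - k * W.w t 1)"
    using traces(2)[of 0] traces(2)[of 1] by (simp_all add: trace0_def[abs_def] trace1_def[abs_def])
  \<comment> \<open>The trace formulas and \<open>boundary_system\<close> have the same right-hand
    sides.\<close>
  have bv: "W.wt t 0 = q0 R w t" "W.wt t 1 = q1 R w t" if "t \<in> {0<..<\<tau>}" for t
    using W.boundary_values(3,4)[of t] boundary_system[of R w t] that \<tau>1 by auto
  have Jv: "exp (- k * t) * J0 R w t = - power_source \<alpha> (u t 0) - k * l0 * u t 0 + (g1 t - k * m1) * u t 1"
    "exp (- k * t) * J1 R w t = - power_source \<beta> (u t 1) - k * l1 * u t 1 + (g0 t - k * m0) * u t 0"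
    if t: "t \<in> {0..\<tau>}" for t
  proof -
    have ct: "clamp_time t = t" using t \<tau> by (intro clamp_time_id) auto
    have "src R \<alpha> t (w t 0) = exp (k * t) * power_source \<alpha> (u t 0)" "src R \<beta> t (w t 1) = exp (k * t) * power_source \<beta> (u t 1)"
      unfolding wu[OF t, of 0, simplified] wu[OF t, of 1, simplified] by (intro src_small ubd t; simp)+
    then have "J0 R w t = exp (k * t) * (- power_source \<alpha> (u t 0) - k * l0 * u t 0 + (g1 t - k * m1) * u t 1)"
      "J1 R w t = exp (k * t) * (- power_source \<beta> (u t 1) - k * l1 * u t 1 + (g0 t - k * m0) * u t 0)"
      unfolding J0_def J1_def ct wu[OF t, of 0, simplified] wu[OF t, of 1, simplified] by (simp_all add: algebra_simps)
    then show "exp (- k * t) * J0 R w t = - power_source \<alpha> (u t 0) - k * l0 * u t 0 + (g1 t - k * m1) * u t 1"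
      "exp (- k * t) * J1 R w t = - power_source \<beta> (u t 1) - k * l1 * u t 1 + (g0 t - k * m0) * u t 0"
      by (simp_all only: exp_cancel)
  qed
  have fl0: "flux_eq0 \<tau> u (flux0 R w)"
    unfolding flux_eq0_def
    using tD AE_Ioo_subset[OF h1_eq order_refl \<tau>(2)] AE_Ioo_mem
  proof eventually_elim
    case (elim t)
    then have t: "t \<in> {0..\<tau>}" by auto
    have J: "exp (- k * t) * J0 R w t = - power_source \<alpha> (u t 0) - k * l0 * u t 0 + (g1 t - k * m1) * u t 1" by (rule Jv[OF t])
    have "exp (- k * t) * flux0 R w t = l0 * (exp (- k * t) * W.wt t 0) + m1 * (exp (- k * t) * W.wt t 1) + exp (- k * t) * J0 R w t"
      unfolding bv[OF elim(4)] by (simp add: flux0_def algebra_simps)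
    then show ?case
      unfolding J elim(1,2,3) trace0_def trace1_def tr[OF t, of 0, simplified] tr[OF t, of 1, simplified]
      by (simp add: u_def algebra_simps)
  qed
  have fl1: "flux_eq1 \<tau> u (flux1 R w)"
    unfolding flux_eq1_def
    using tD AE_Ioo_subset[OF h0_eq order_refl \<tau>(2)] AE_Ioo_mem
  proof eventually_elim
    case (elim t)
    then have t: "t \<in> {0..\<tau>}" by auto
    have J: "exp (- k * t) * J1 R w t = - power_source \<beta> (u t 1) - k * l1 * u t 1 + (g0 t - k * m0) * u t 0" by (rule Jv[OF t])
    have "exp (- k * t) * flux1 R w t = l1 * (exp (- k * t) * W.wt t 1) + m0 * (exp (- k * t) * W.wt t 0) + exp (- k * t) * J1 R w t"
      unfolding bv[OF elim(4)] by (simp add: flux1_def algebra_simps)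
    then show ?case
      unfolding J elim(1,2,3) trace0_def trace1_def tr[OF t, of 0, simplified] tr[OF t, of 1, simplified]
      by (simp add: u_def algebra_simps)
  qed
  have "weak_sol \<tau> u"
    unfolding weak_sol_iff
  proof (intro conjI exI[of _ u'] ballI uH uC tH)
    show "AE x in lebesgue_on {0<..<1}. u 0 x = u0 x"
      using H1_AC(3)[OF u0 zero_less_one] AE_Ioo_mem
      by eventually_elim (auto simp: u_def initial_values(1)[OF W.ext_wave_axioms])
    show "AE x in lebesgue_on {0<..<1}. u' 0 x = u1 x"
      using initial_values(2)[OF W.ext_wave_axioms] by (simp add: u'_def)
    fix v assume v: "v \<in> H1 0 1"
    define V where "V = cont_rep 0 1 v"
    have V: "AC 0 1 V (weak_deriv 0 1 v)" unfolding V_def by (rule H1_AC(1)[OF v]) simp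
    have vL: "weak_deriv 0 1 v \<in> L2 0 1" by (rule H1_AC(2)[OF v]) simp
    have VL: "V \<in> L2 0 1" by (rule L2_continuous[OF AC_continuous[OF V]])
    have "AC 0 \<tau> (\<lambda>t. integral {0..1} (\<lambda>x. u' t x * V x)) (rhs u u' (flux0 R w) (flux1 R w) V (weak_deriv 0 1 v))"
    proof (rule AC_cong[OF W.damped_form[OF \<tau>(1) \<tau>1 V vL, of k]])
      show "AE t in lebesgue_on {0<..<\<tau>}. exp (- k * t) * integral {0..1} (\<lambda>x. GG R w t x * V x) - exp (- k * t) * flux0 R w t * V 0 - exp (- k * t) * flux1 R w t * V 1
      - integral {0..1} (\<lambda>x. weak_deriv 0 1 (\<lambda>x. exp (- k * t) * W.w t x) x * weak_deriv 0 1 v x)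
      - k\<^sup>2 * integral {0..1} (\<lambda>x. exp (- k * t) * W.w t x * V x)
      - 2 * k * integral {0..1} (\<lambda>x. exp (- k * t) * (W.wt t x - k * W.w t x) * V x) = rhs u u' (flux0 R w) (flux1 R w) V (weak_deriv 0 1 v) t"
      proof (rule AE_IooI[OF negligible_empty])
        fix t assume t: "t \<in> {0..\<tau>}"
        have ct: "clamp_time t = t" using t \<tau> by (intro clamp_time_id) auto
        have uHt: "u t \<in> H1 0 1" by (rule continuous_H1D[OF uH t])
        have i: "(\<lambda>x. power_source p (u t x) * V x) integrable_on {0..1}" "(\<lambda>x. (k\<^sup>2 - 1) * (u t x * V x)) integrable_on {0..1}"
          using uHt by (auto intro!: L2_mult_abs_int(2) source_L2 VL integrable_on_mult_right simp: H1_def)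
        have "integral {0..1} (\<lambda>x. GG R w t x * V x) = integral {0..1} (\<lambda>x. exp (k * t) * (power_source p (u t x) * V x + (k\<^sup>2 - 1) * (u t x * V x)))"
        proof (intro integral_cong)
          fix x :: real assume x: "x \<in> {0..1}"
          have "GG R w t x = src R p t (exp (k * t) * u t x) + (k\<^sup>2 - 1) * (exp (k * t) * u t x)"
            by (simp only: GG_def ct fold01_id[OF x] wu[OF t x])
          also have "src R p t (exp (k * t) * u t x) = exp (k * t) * power_source p (u t x)"
            by (rule src_small[OF ubd[OF t x]])
          finally have e: "GG R w t x = exp (k * t) * power_source p (u t x) + (k\<^sup>2 - 1) * (exp (k * t) * u t x)" .
          show "GG R w t x * V x = exp (k * t) * (power_source p (u t x) * V x + (k\<^sup>2 - 1) * (u t x * V x))"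
            unfolding e by (simp add: algebra_simps)
        qed
        also have "\<dots> = exp (k * t) * (integral {0..1} (\<lambda>x. power_source p (u t x) * V x) + (k\<^sup>2 - 1) * integral {0..1} (\<lambda>x. u t x * V x))"
          using Henstock_Kurzweil_Integration.integral_add[OF i] by simp
        \<comment> \<open>Combined with the term - k^2 of the damped form, k^2 - 1 leaves the
          coefficient -1 of u in the weak form.\<close>
        finally have G: "exp (- k * t) * integral {0..1} (\<lambda>x. GG R w t x * V x) =
          integral {0..1} (\<lambda>x. power_source p (u t x) * V x) + (k\<^sup>2 - 1) * integral {0..1} (\<lambda>x. u t x * V x)"
          by (simp only: exp_cancel)
        show "exp (- k * t) * integral {0..1} (\<lambda>x. GG R w t x * V x) - exp (- k * t) * flux0 R w t * V 0 - exp (- k * t) * flux1 R w t * V 1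
      - integral {0..1} (\<lambda>x. weak_deriv 0 1 (\<lambda>x. exp (- k * t) * W.w t x) x * weak_deriv 0 1 v x)
      - k\<^sup>2 * integral {0..1} (\<lambda>x. exp (- k * t) * W.w t x * V x)
      - 2 * k * integral {0..1} (\<lambda>x. exp (- k * t) * (W.wt t x - k * W.w t x) * V x) = rhs u u' (flux0 R w) (flux1 R w) V (weak_deriv 0 1 v) t"
          unfolding G rhs_def u_def[symmetric, THEN fun_cong] u'_def[symmetric, THEN fun_cong]
          by (simp add: u_def u'_def left_diff_distrib)
      qed
    qed (simp add: u'_def)
    from AC_has_weak_deriv[OF \<tau>(1) this]
    show "has_weak_deriv 0 \<tau> (\<lambda>t. L2_inner 0 1 (u' t) v)
        (\<lambda>t. L2_inner 0 1 (\<lambda>x. power_source p (u t x)) v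
      + power_source \<alpha> (trace0 u t) * cont_rep 0 1 v 0 + power_source \<beta> (trace1 u t) * cont_rep 0 1 v 1
      - L2_inner 0 1 (weak_deriv 0 1 (u t)) (weak_deriv 0 1 v) - L2_inner 0 1 (u t) v - 2 * k * L2_inner 0 1 (u' t) v
      - (l0 * weak_deriv 0 \<tau> (trace0 u) t + h1 t * trace1 u t + m1 * weak_deriv 0 \<tau> (trace1 u) t) * cont_rep 0 1 v 0
      - (l1 * weak_deriv 0 \<tau> (trace1 u) t + h0 t * trace0 u t + m0 * weak_deriv 0 \<tau> (trace0 u) t) * cont_rep 0 1 v 1)"
    proof (rule has_weak_deriv_AE_cong)
      show "AE t in lebesgue_on {0<..<\<tau>}. integral {0..1} (\<lambda>x. u' t x * V x) = L2_inner 0 1 (u' t) v"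
      proof (rule AE_IooI[OF negligible_empty])
        fix t assume t: "t \<in> {0..\<tau>}"
        have "L2_inner 0 1 (u' t) v = integral {0..1} (\<lambda>x. u' t x * v x)"
          using v by (intro L2_inner_eq continuous_L2D(1)[OF u'L t]) (simp add: H1_def)
        also have "\<dots> = integral {0..1} (\<lambda>x. u' t x * V x)"
          by (rule integral_AE_cong) (use H1_AC(3)[OF v] in \<open>auto simp: V_def elim: eventually_mono\<close>)
        finally show "integral {0..1} (\<lambda>x. u' t x * V x) = L2_inner 0 1 (u' t) v" by simp
      qed
      show "AE t in lebesgue_on {0<..<\<tau>}. rhs u u' (flux0 R w) (flux1 R w) V (weak_deriv 0 1 v) t =
        L2_inner 0 1 (\<lambda>x. power_source p (u t x)) v
      + power_source \<alpha> (trace0 u t) * cont_rep 0 1 v 0 + power_source \<beta> (trace1 u t) * cont_rep 0 1 v 1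
      - L2_inner 0 1 (weak_deriv 0 1 (u t)) (weak_deriv 0 1 v) - L2_inner 0 1 (u t) v - 2 * k * L2_inner 0 1 (u' t) v
      - (l0 * weak_deriv 0 \<tau> (trace0 u) t + h1 t * trace1 u t + m1 * weak_deriv 0 \<tau> (trace1 u) t) * cont_rep 0 1 v 0
      - (l1 * weak_deriv 0 \<tau> (trace1 u) t + h0 t * trace0 u t + m0 * weak_deriv 0 \<tau> (trace0 u) t) * cont_rep 0 1 v 1"
        using rhs_AE[OF \<tau> uH u'L v fl0 fl1] unfolding V_def by (rule eventually_mono) (rule sym)
    qed
  qed
  then show ?thesis by (simp add: \<Psi> u_def)
qed

end

context weak_problem
begin

text \<open>The fluxes are read off from the solution and inserted, with its own source, into
  d'Alembert's formula. By \<open>modes_unique\<close> the result is the solution itself, so its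
  velocities at the ends obey the boundary system and the fluxes are \<open>flux0\<close> and
  \<open>flux1\<close>. Every level above the sup norm of the solution is admissible.\<close>

lemma weak_sol_fixed_point:
  assumes \<tau>: "0 < \<tau>" "\<tau> \<le> T" and u: "weak_sol \<tau> u"
  obtains w R0 where "continuous_on UNIV (\<lambda>z. w (fst z) (snd z))" "0 \<le> R0"
    "\<And>t x. t \<in> {0..\<tau>} \<Longrightarrow> x \<in> {0..1} \<Longrightarrow> w t x = exp (k * t) * cont_rep 0 1 (u t) x"
    "\<And>R t x. R0 \<le> R \<Longrightarrow> t \<in> {0..\<tau>} \<Longrightarrow> x \<in> {0..1} \<Longrightarrow> w t x = \<Psi> R w t x"
proof -
  have \<tau>1: "\<tau> \<le> 1" using \<tau> T by simp
  obtain u' where uH: "continuous_H1 \<tau> u" and tH: "trace0 u \<in> H1 0 \<tau>" "trace1 u \<in> H1 0 \<tau>"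
    and uC: "has_C1_L2_deriv \<tau> u u'" and init: "AE x in lebesgue_on {0<..<1}. u 0 x = u0 x" "AE x in lebesgue_on {0<..<1}. u' 0 x = u1 x"
    and weak: "\<And>v. v \<in> H1 0 1 \<Longrightarrow> has_weak_deriv 0 \<tau> (\<lambda>t. L2_inner 0 1 (u' t) v)
        (\<lambda>t. L2_inner 0 1 (\<lambda>x. power_source p (u t x)) v
      + power_source \<alpha> (trace0 u t) * cont_rep 0 1 v 0 + power_source \<beta> (trace1 u t) * cont_rep 0 1 v 1
      - L2_inner 0 1 (weak_deriv 0 1 (u t)) (weak_deriv 0 1 v) - L2_inner 0 1 (u t) v - 2 * k * L2_inner 0 1 (u' t) v
      - (l0 * weak_deriv 0 \<tau> (trace0 u) t + h1 t * trace1 u t + m1 * weak_deriv 0 \<tau> (trace1 u) t) * cont_rep 0 1 v 0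
      - (l1 * weak_deriv 0 \<tau> (trace1 u) t + h0 t * trace0 u t + m0 * weak_deriv 0 \<tau> (trace0 u) t) * cont_rep 0 1 v 1)"
    using u unfolding weak_sol_iff by blast
  have uL: "continuous_L2 \<tau> u" "continuous_L2 \<tau> u'" using uC by (auto simp: has_C1_L2_deriv_def)
  define U where "U = (\<lambda>t x. cont_rep 0 1 (u t) x)"
  have Uc: "continuous_on ({0..\<tau>} \<times> {0..1}) (\<lambda>z. U (fst z) (snd z))"
    unfolding U_def by (rule continuous_H1_rep[OF uH])
  have UA: "AC 0 1 (U t) (weak_deriv 0 1 (u t))" "AE x in lebesgue_on {0<..<1}. u t x = U t x" if "t \<in> {0..\<tau>}" for t
    unfolding U_def by (rule H1_AC[OF continuous_H1D[OF uH that]]; simp)+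
  have Ut: "continuous_on {0..\<tau>} (\<lambda>t. U t i)" if "i \<in> {0..1}" for i
    by (rule continuous_on_compose2[OF Uc, of "{0..\<tau>}" "\<lambda>t. (t, i)", simplified])
      (use that in \<open>auto intro!: continuous_intros\<close>)
  define cT where "cT = (\<lambda>t. max 0 (min \<tau> t))"
  \<comment> \<open>Clamping extends the transformed solution continuously to the plane, as
    \<open>\<Psi>\<close> requires.\<close>
  define w where "w = (\<lambda>t x. exp (k * cT t) * U (cT t) (clamp_space x))"
  have cT: "cT t \<in> {0..\<tau>}" "t \<in> {0..\<tau>} \<Longrightarrow> cT t = t" for t using \<tau> by (auto simp: cT_def)
  have cs: "clamp_space x \<in> {0..1}" "x \<in> {0..1} \<Longrightarrow> clamp_space x = x" for x by (auto simp: clamp_space_def)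
  have wc: "continuous_on UNIV (\<lambda>z. w (fst z) (snd z))"
  proof -
    have c: "continuous_on UNIV (\<lambda>z::real \<times> real. (cT (fst z), clamp_space (snd z)))"
      unfolding cT_def clamp_space_def by (intro continuous_intros)
    have "continuous_on UNIV (\<lambda>z::real \<times> real. U (cT (fst z)) (clamp_space (snd z)))"
      using continuous_on_compose2[OF Uc c] cT cs by (auto simp: image_subset_iff)
    moreover have "continuous_on UNIV (\<lambda>z::real \<times> real. exp (k * cT (fst z)))"
      unfolding cT_def by (intro continuous_intros)
    ultimately show ?thesis unfolding w_def by (intro continuous_on_mult)
  qed
  have wU: "w t x = exp (k * t) * U t x" if "t \<in> {0..\<tau>}" "x \<in> {0..1}" for t x
    using that by (simp add: w_def cT cs)
  have "compact ((\<lambda>z. U (fst z) (snd z)) ` ({0..\<tau>} \<times> {0..1}))"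
    by (intro compact_continuous_image compact_Times Uc) auto
  from compact_imp_bounded[OF this, unfolded bounded_iff]
  obtain B where B: "\<forall>y \<in> (\<lambda>z. U (fst z) (snd z)) ` ({0..\<tau>} \<times> {0..1}). norm y \<le> B" by blast
  have Ubd: "\<bar>U t x\<bar> \<le> \<bar>B\<bar>" if "t \<in> {0..\<tau>}" "x \<in> {0..1}" for t x
    using bspec[OF B imageI[of "(t, x)"]] that by simp
  define d0 d1 where "d0 = weak_deriv 0 \<tau> (trace0 u)" and "d1 = weak_deriv 0 \<tau> (trace1 u)"
  have tr: "trace0 u t = U t 0" "trace1 u t = U t 1" for t by (auto simp: trace0_def trace1_def U_def)
  have dL: "d0 \<in> L2 0 \<tau>" "d1 \<in> L2 0 \<tau>" unfolding d0_def d1_def by (intro H1_AC(2) tH \<tau>)+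
  have dA: "AC 0 \<tau> (\<lambda>t. U t 0) d0" "AC 0 \<tau> (\<lambda>t. U t 1) d1"
  proof -
    have t: "(\<lambda>t. U t 0) = trace0 u" "(\<lambda>t. U t 1) = trace1 u" using tr by auto
    have e: "cont_rep 0 \<tau> (trace0 u) t = U t 0" "cont_rep 0 \<tau> (trace1 u) t = U t 1" if "t \<in> {0..\<tau>}" for t
      using cont_rep_eq[OF \<tau>(1) Ut[of 0], of "trace0 u" t] cont_rep_eq[OF \<tau>(1) Ut[of 1], of "trace1 u" t] that by (auto simp: tr)
    show "AC 0 \<tau> (\<lambda>t. U t 0) d0"
      by (rule AC_cong[OF H1_AC(1)[OF tH(1) \<tau>(1)]]) (simp_all add: e d0_def)
    show "AC 0 \<tau> (\<lambda>t. U t 1) d1"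
      by (rule AC_cong[OF H1_AC(1)[OF tH(2) \<tau>(1)]]) (simp_all add: e d1_def)
  qed
  have psc: "continuous_on {0..\<tau>} (\<lambda>t. power_source q (U t i))" if "q > 2" "i \<in> {0..1}" for q i
    by (intro continuous_on_compose2[OF power_source_continuous[OF that(1), of UNIV] Ut[OF that(2)]]) auto
  have gc: "continuous_on S g0" "continuous_on S g1" for S
    using g continuous_on_subset by blast+
  \<comment> \<open>The boundary condition at x = 0, solved for the flux and scaled to
    \<open>w\<close>.\<close>
  have "(\<lambda>t. exp (k * t) * (l0 * d0 t + g1 t * U t 1 + m1 * d1 t - power_source \<alpha> (U t 0))) \<in> L2 0 \<tau>"
    by (intro L2_mult_continuous L2_minus L2_add L2_cmult dL L2_continuous psc exponents continuous_intros gc Ut) auto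
  then obtain n where n: "n \<in> borel_measurable borel" "n \<in> L2 0 1"
    and n_eq: "AE t in lebesgue_on {0<..<\<tau>}. n t = exp (k * t) * (l0 * d0 t + g1 t * U t 1 + m1 * d1 t - power_source \<alpha> (U t 0))"
    by (rule borel_extension[OF _ \<tau>1])
  have "(\<lambda>t. exp (k * t) * (l1 * d1 t + g0 t * U t 0 + m0 * d0 t - power_source \<beta> (U t 1))) \<in> L2 0 \<tau>"
    by (intro L2_mult_continuous L2_minus L2_add L2_cmult dL L2_continuous psc exponents continuous_intros gc Ut) auto
  then obtain m where m: "m \<in> borel_measurable borel" "m \<in> L2 0 1"
    and m_eq: "AE t in lebesgue_on {0<..<\<tau>}. m t = exp (k * t) * (l1 * d1 t + g0 t * U t 0 + m0 * d0 t - power_source \<beta> (U t 1))"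
    by (rule borel_extension[OF _ \<tau>1])
  have fl0: "flux_eq0 \<tau> u n"
    unfolding flux_eq0_def tr d0_def[symmetric] d1_def[symmetric]
    using n_eq AE_Ioo_subset[OF h1_eq order_refl \<tau>(2)]
    by eventually_elim (simp only: exp_cancel)
  have fl1: "flux_eq1 \<tau> u m"
    unfolding flux_eq1_def tr d0_def[symmetric] d1_def[symmetric]
    using m_eq AE_Ioo_subset[OF h0_eq order_refl \<tau>(2)]
    by eventually_elim (simp only: exp_cancel)
  \<comment> \<open>The pairing with the velocity is continuous in time, so the distributional
    identity holds in integrated form.\<close>
  have weak_AC: "AC 0 \<tau> (\<lambda>t. integral {0..1} (\<lambda>x. u' t x * V x)) (rhs u u' n m V v)"
    if V: "AC 0 1 V v" and v: "continuous_on {0..1} v" for V v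
  proof (rule has_weak_deriv_continuous_AC[OF \<tau>(1)])
    have vL: "v \<in> L2 0 1" by (rule L2_continuous[OF v])
    have VL: "V \<in> L2 0 1" by (rule L2_continuous[OF AC_continuous[OF V]])
    have VH: "V \<in> H1 0 1" "AE x in lebesgue_on {0<..<1}. weak_deriv 0 1 V x = v x" "\<And>x. x \<in> {0..1} \<Longrightarrow> cont_rep 0 1 V x = V x"
      using H1I[OF _ V vL, of V] by auto
    show "continuous_on {0..\<tau>} (\<lambda>t. integral {0..1} (\<lambda>x. u' t x * V x))"
      by (rule continuous_L2_inner[OF uL(2) VL])
    show "has_weak_deriv 0 \<tau> (\<lambda>t. integral {0..1} (\<lambda>x. u' t x * V x)) (rhs u u' n m V v)"
    proof (rule has_weak_deriv_AE_cong[OF weak[OF VH(1)]])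
      show "AE t in lebesgue_on {0<..<\<tau>}. L2_inner 0 1 (u' t) V = integral {0..1} (\<lambda>x. u' t x * V x)"
        by (rule AE_IooI[OF negligible_empty]) (intro L2_inner_eq VL continuous_L2D(1)[OF uL(2)])
      have "rhs u u' n m (cont_rep 0 1 V) (weak_deriv 0 1 V) t = rhs u u' n m V v t" for t
        by (rule rhs_cong[OF VH(3,2)])
      with rhs_AE[OF \<tau> uH uL(2) VH(1) fl0 fl1]
      show "AE t in lebesgue_on {0<..<\<tau>}. L2_inner 0 1 (\<lambda>x. power_source p (u t x)) V
      + power_source \<alpha> (trace0 u t) * cont_rep 0 1 V 0 + power_source \<beta> (trace1 u t) * cont_rep 0 1 V 1
      - L2_inner 0 1 (weak_deriv 0 1 (u t)) (weak_deriv 0 1 V) - L2_inner 0 1 (u t) V - 2 * k * L2_inner 0 1 (u' t) V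
      - (l0 * weak_deriv 0 \<tau> (trace0 u) t + h1 t * trace1 u t + m1 * weak_deriv 0 \<tau> (trace1 u) t) * cont_rep 0 1 V 0
      - (l1 * weak_deriv 0 \<tau> (trace1 u) t + h0 t * trace0 u t + m0 * weak_deriv 0 \<tau> (trace0 u) t) * cont_rep 0 1 V 1
       = rhs u u' n m V v t" by simp
    qed
    have "continuous_L2 \<tau> (\<lambda>t x. power_source p (U t x))"
      by (intro continuous_L2_continuous continuous_on_compose2[OF power_source_continuous[OF exponents(1), of UNIV] Uc]) auto
    from continuous_L2_inner[OF this VL]
    have "continuous_on {0..\<tau>} (\<lambda>t. integral {0..1} (\<lambda>x. power_source p (u t x) * V x))"
    proof (rule continuous_on_eq)
      fix t assume "t \<in> {0..\<tau>}"
      then show "integral {0..1} (\<lambda>x. power_source p (U t x) * V x) = integral {0..1} (\<lambda>x. power_source p (u t x) * V x)"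
        by (intro integral_AE_cong eventually_mono[OF UA(2)]) auto
    qed
    then have "(\<lambda>t. integral {0..1} (\<lambda>x. power_source p (u t x) * V x)) \<in> L2 0 \<tau>" by (rule L2_continuous)
    moreover have "(\<lambda>t. exp (- k * t) * n t) \<in> L2 0 \<tau>" "(\<lambda>t. exp (- k * t) * m t) \<in> L2 0 \<tau>"
      by (intro L2_mult_continuous L2_subinterval[OF n(2)] L2_subinterval[OF m(2)] continuous_intros; use \<tau>1 in simp)+
    moreover have "(\<lambda>t. integral {0..1} (\<lambda>x. weak_deriv 0 1 (u t) x * v x)) \<in> L2 0 \<tau>"
      "(\<lambda>t. integral {0..1} (\<lambda>x. u t x * V x)) \<in> L2 0 \<tau>" "(\<lambda>t. integral {0..1} (\<lambda>x. u' t x * V x)) \<in> L2 0 \<tau>"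
      by (intro L2_continuous continuous_L2_inner continuous_H1_weak_deriv uH uL VL vL)+
    ultimately have "(\<lambda>t. integral {0..1} (\<lambda>x. power_source p (u t x) * V x)
     - V 0 * (exp (- k * t) * n t) - V 1 * (exp (- k * t) * m t)
     - integral {0..1} (\<lambda>x. weak_deriv 0 1 (u t) x * v x) - integral {0..1} (\<lambda>x. u t x * V x)
     - (2 * k) * integral {0..1} (\<lambda>x. u' t x * V x)) \<in> L2 0 \<tau>"
      by (intro L2_minus L2_cmult)
    then have "rhs u u' n m V v \<in> L2 0 \<tau>" by (simp add: rhs_def[abs_def] mult_ac)
    then show "rhs u u' n m V v absolutely_integrable_on {0..\<tau>}" by (rule L2D(1))
  qed
  have fixed: "w t x = \<Psi> R w t x" if R: "\<bar>B\<bar> \<le> R" and t: "t \<in> {0..\<tau>}" and x: "x \<in> {0..1}" for R t x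
  proof -
    \<comment> \<open>\<open>W\<close> uses the fluxes of the given solution, \<open>P\<close> those
      prescribed by \<open>\<Psi>\<close>; the source is the same.\<close>
    interpret W: ext_wave c a0 b0 n m "GG R w" by (rule ext_wave_GG[OF wc n m])
    interpret P: ext_wave c a0 b0 "flux0 R w" "flux1 R w" "GG R w" by (rule ext_wave_\<Psi>[OF wc])
    have Ub: "\<bar>U s y\<bar> \<le> R" if "s \<in> {0..\<tau>}" "y \<in> {0..1}" for s y using Ubd[OF that] R by simp
    have ct: "clamp_time s = s" if "s \<in> {0..\<tau>}" for s using that \<tau> by (intro clamp_time_id) auto
    define y where "y = (\<lambda>t x. exp (- k * t) * W.w t x)"
    define y' where "y' = (\<lambda>t x. exp (- k * t) * (W.wt t x - k * W.w t x))"
    have yH: "continuous_H1 \<tau> y" unfolding y_def by (rule continuous_H1_subset[OF W.damped_continuous_H1 \<tau>1])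
    have yC: "has_C1_L2_deriv \<tau> y y'" unfolding y_def y'_def by (rule C1_L2_subset[OF W.damped_C1 \<tau>1])
    have GV: "exp (- k * s) * integral {0..1} (\<lambda>x. GG R w s x * V x) =
        integral {0..1} (\<lambda>x. power_source p (u s x) * V x) + (k\<^sup>2 - 1) * integral {0..1} (\<lambda>x. u s x * V x)"
      if s: "s \<in> {0..\<tau>}" and VL: "V \<in> L2 0 1" for s V
    proof -
      have sH: "u s \<in> H1 0 1" by (rule continuous_H1D[OF uH s])
      have i: "(\<lambda>x. power_source p (u s x) * V x) integrable_on {0..1}" "(\<lambda>x. (k\<^sup>2 - 1) * (u s x * V x)) integrable_on {0..1}"
        using sH by (auto intro!: L2_mult_abs_int(2) source_L2 VL integrable_on_mult_right simp: H1_def)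
      have "AE x in lebesgue_on {0<..<1}. GG R w s x * V x = exp (k * s) * (power_source p (u s x) * V x + (k\<^sup>2 - 1) * (u s x * V x))"
        using UA(2)[OF s] AE_Ioo_mem
      proof eventually_elim
        case (elim x)
        then have x: "x \<in> {0..1}" by auto
        have "GG R w s x = src R p s (exp (k * s) * U s x) + (k\<^sup>2 - 1) * (exp (k * s) * U s x)"
          by (simp only: GG_def ct[OF s] fold01_id[OF x] wU[OF s x])
        also have "src R p s (exp (k * s) * U s x) = exp (k * s) * power_source p (U s x)"
          by (rule src_small[OF Ub[OF s x]])
        finally have e: "GG R w s x = exp (k * s) * power_source p (U s x) + (k\<^sup>2 - 1) * (exp (k * s) * U s x)" .
        show ?case unfolding e elim(1) by (simp add: algebra_simps)
      qed
      from integral_AE_cong(1)[OF this]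
      have "integral {0..1} (\<lambda>x. GG R w s x * V x) = exp (k * s) * (integral {0..1} (\<lambda>x. power_source p (u s x) * V x) + (k\<^sup>2 - 1) * integral {0..1} (\<lambda>x. u s x * V x))"
        using Henstock_Kurzweil_Integration.integral_add[OF i] by simp
      then show ?thesis by (simp only: exp_cancel)
    qed
    \<comment> \<open>Both functions have the same initial data, source and fluxes, so their
      difference solves the homogeneous Neumann problem.\<close>
    have eq: "cont_rep 0 1 (u s) z = cont_rep 0 1 (y s) z" if s: "s \<in> {0..\<tau>}" and z: "z \<in> {0..1}" for s z
    proof (rule modes_unique[OF \<tau>(1) k uH yH uC yC _ _ _ s z])
      have "AE x in lebesgue_on {0<..<1}. y 0 x = cont_rep 0 1 u0 x"
        using AE_Ioo_mem by eventually_elim (auto simp: y_def initial_values(1)[OF W.ext_wave_axioms])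
      then show "AE x in lebesgue_on {0<..<1}. u 0 x = y 0 x"
        using init(1) H1_AC(3)[OF u0 zero_less_one] by eventually_elim simp
      have "AE x in lebesgue_on {0<..<1}. y' 0 x = u1 x"
        using initial_values(2)[OF W.ext_wave_axioms] by (simp add: y'_def)
      then show "AE x in lebesgue_on {0<..<1}. u' 0 x = y' 0 x"
        using init(2) by eventually_elim simp
      fix V v assume V: "AC 0 1 V v" and v: "continuous_on {0..1} v"
      have vL: "v \<in> L2 0 1" by (rule L2_continuous[OF v])
      have VL: "V \<in> L2 0 1" by (rule L2_continuous[OF AC_continuous[OF V]])
      show "AC 0 \<tau> (\<lambda>t. integral {0..1} (\<lambda>x. u' t x * V x) - integral {0..1} (\<lambda>x. y' t x * V x))
        (\<lambda>t. - (integral {0..1} (\<lambda>x. weak_deriv 0 1 (u t) x * v x) - integral {0..1} (\<lambda>x. weak_deriv 0 1 (y t) x * v x))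
           - k\<^sup>2 * (integral {0..1} (\<lambda>x. u t x * V x) - integral {0..1} (\<lambda>x. y t x * V x))
           - 2 * k * (integral {0..1} (\<lambda>x. u' t x * V x) - integral {0..1} (\<lambda>x. y' t x * V x)))"
      proof (rule AC_cong[OF AC_minus[OF weak_AC[OF V v] W.damped_form[OF \<tau>(1) \<tau>1 V vL, of k]]])
        show "AE t in lebesgue_on {0<..<\<tau>}. rhs u u' n m V v t -
          (exp (- k * t) * integral {0..1} (\<lambda>x. GG R w t x * V x) - exp (- k * t) * n t * V 0 - exp (- k * t) * m t * V 1
           - integral {0..1} (\<lambda>x. weak_deriv 0 1 (\<lambda>x. exp (- k * t) * W.w t x) x * v x)
           - k\<^sup>2 * integral {0..1} (\<lambda>x. exp (- k * t) * W.w t x * V x)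
           - 2 * k * integral {0..1} (\<lambda>x. exp (- k * t) * (W.wt t x - k * W.w t x) * V x)) =
          - (integral {0..1} (\<lambda>x. weak_deriv 0 1 (u t) x * v x) - integral {0..1} (\<lambda>x. weak_deriv 0 1 (y t) x * v x))
           - k\<^sup>2 * (integral {0..1} (\<lambda>x. u t x * V x) - integral {0..1} (\<lambda>x. y t x * V x))
           - 2 * k * (integral {0..1} (\<lambda>x. u' t x * V x) - integral {0..1} (\<lambda>x. y' t x * V x))"
        proof (rule AE_IooI[OF negligible_empty])
          fix t assume t: "t \<in> {0..\<tau>}"
          show "rhs u u' n m V v t -
          (exp (- k * t) * integral {0..1} (\<lambda>x. GG R w t x * V x) - exp (- k * t) * n t * V 0 - exp (- k * t) * m t * V 1
           - integral {0..1} (\<lambda>x. weak_deriv 0 1 (\<lambda>x. exp (- k * t) * W.w t x) x * v x)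
           - k\<^sup>2 * integral {0..1} (\<lambda>x. exp (- k * t) * W.w t x * V x)
           - 2 * k * integral {0..1} (\<lambda>x. exp (- k * t) * (W.wt t x - k * W.w t x) * V x)) =
          - (integral {0..1} (\<lambda>x. weak_deriv 0 1 (u t) x * v x) - integral {0..1} (\<lambda>x. weak_deriv 0 1 (y t) x * v x))
           - k\<^sup>2 * (integral {0..1} (\<lambda>x. u t x * V x) - integral {0..1} (\<lambda>x. y t x * V x))
           - 2 * k * (integral {0..1} (\<lambda>x. u' t x * V x) - integral {0..1} (\<lambda>x. y' t x * V x))"
            unfolding GV[OF t VL] rhs_def y_def y'_def by (simp add: algebra_simps)
        qed
      qed (simp add: y'_def)
    qed
    have UW: "exp (k * s) * U s z = W.w s z" if s: "s \<in> {0..\<tau>}" and z: "z \<in> {0..1}" for s z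
    proof -
      have "cont_rep 0 1 (y s) z = exp (- k * s) * W.w s z"
        unfolding y_def by (rule W.damped_weak_deriv(2)) (use s z \<tau>1 in auto)
      then show ?thesis using eq[OF s z] by (simp add: U_def exp_minus)
    qed
    \<comment> \<open>The boundary value of the wave has two densities in time, its own velocity and
      the one inherited from the trace of \<open>u\<close>; they agree almost everywhere.\<close>
    have dens: "AE t in lebesgue_on {0<..<\<tau>}. W.wt t i = exp (k * t) * (d t + k * U t i)"
      if i: "i \<in> {0..1}" and d: "AC 0 \<tau> (\<lambda>t. U t i) d" for i d
    proof (rule AC_unique_density[OF \<tau>(1)])
      show "AC 0 \<tau> (\<lambda>t. W.w t i) (\<lambda>t. W.wt t i)"
        by (rule AC_subinterval[OF W.w_AC_time[OF i]]) (use \<tau> \<tau>1 in auto)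
      show "AC 0 \<tau> (\<lambda>t. W.w t i) (\<lambda>t. exp (k * t) * (d t + k * U t i))"
        by (rule AC_cong[OF AC_exp_mult[OF d, of k]], rule UW[OF _ i]) simp_all
    qed
    have flux: "AE t in lebesgue_on {0<..<\<tau>}. n t = flux0 R w t \<and> m t = flux1 R w t"
      using n_eq m_eq dens[of 0, OF _ dA(1), simplified] dens[of 1, OF _ dA(2), simplified] AE_Ioo_mem
    proof eventually_elim
      case (elim t)
      have D: "W.wt t 0 = exp (k * t) * (d0 t + k * U t 0)" "W.wt t 1 = exp (k * t) * (d1 t + k * U t 1)"
        using elim by auto
      have t: "t \<in> {0..\<tau>}" "t \<in> {0<..<1}" using elim(5) \<tau>1 by auto
      have s: "src R \<alpha> t (exp (k * t) * U t 0) = exp (k * t) * power_source \<alpha> (U t 0)"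
        "src R \<beta> t (exp (k * t) * U t 1) = exp (k * t) * power_source \<beta> (U t 1)"
        by (intro src_small Ub t; simp)+
      have w01: "w t 0 = exp (k * t) * U t 0" "w t 1 = exp (k * t) * U t 1" by (intro wU t; simp)+
      have "n t = l0 * W.wt t 0 + m1 * W.wt t 1 + J0 R w t" "m t = l1 * W.wt t 1 + m0 * W.wt t 0 + J1 R w t"
        unfolding D elim(1,2) J0_def J1_def ct[OF t(1)] w01 s by (simp_all add: algebra_simps)
      then show ?case
        using boundary_system_unique[OF W.boundary_values(3,4)[OF t(2)]] by blast
    qed
    \<comment> \<open>The fluxes agree only up to a null set, which the integrals in
      \<open>w_formula\<close> do not see.\<close>
    obtain N where N: "negligible N" "\<And>t. t \<in> {0..\<tau>} \<Longrightarrow> t \<notin> N \<Longrightarrow> n t = flux0 R w t \<and> m t = flux1 R w t"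
      by (rule AE_IooE[OF flux]) blast
    have t1: "t \<in> {0..1}" using t \<tau>1 by auto
    have "integral {0..x + t - 1} m = integral {0..x + t - 1} (flux1 R w)"
      by (rule integral_spike[OF N(1)]) (use N(2) x t in auto)
    moreover have "integral {0..t - x} n = integral {0..t - x} (flux0 R w)"
      by (rule integral_spike[OF N(1)]) (use N(2) x t in auto)
    ultimately have "W.w t x = P.w t x"
      unfolding W.w_formula[OF t1 x] P.w_formula[OF t1 x] by simp
    then show ?thesis using UW[OF t x] wU[OF t x] by (simp add: \<Psi>_def)
  qed
  show thesis
    by (rule that[of w "\<bar>B\<bar>"]) (use wc wU fixed in \<open>auto simp: U_def\<close>)
qed

text \<open>The truncation level is the larger of the two levels of the given solutions, so both are
  fixed points of the same contraction.\<close>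

lemma weak_sol_unique:
  assumes \<tau>: "0 < \<tau>" "\<tau> \<le> T" and u: "weak_sol \<tau> u" and v: "weak_sol \<tau> v" and t: "t \<in> {0..\<tau>}"
  shows "AE x in lebesgue_on {0<..<1}. u t x = v t x"
proof -
  obtain w R where w: "continuous_on UNIV (\<lambda>z. w (fst z) (snd z))" "0 \<le> R"
    "\<And>t x. t \<in> {0..\<tau>} \<Longrightarrow> x \<in> {0..1} \<Longrightarrow> w t x = exp (k * t) * cont_rep 0 1 (u t) x"
    "\<And>S t x. R \<le> S \<Longrightarrow> t \<in> {0..\<tau>} \<Longrightarrow> x \<in> {0..1} \<Longrightarrow> w t x = \<Psi> S w t x"
    using weak_sol_fixed_point[OF \<tau> u] by blast
  obtain w' R' where w': "continuous_on UNIV (\<lambda>z. w' (fst z) (snd z))" "0 \<le> R'"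
    "\<And>t x. t \<in> {0..\<tau>} \<Longrightarrow> x \<in> {0..1} \<Longrightarrow> w' t x = exp (k * t) * cont_rep 0 1 (v t) x"
    "\<And>S t x. R' \<le> S \<Longrightarrow> t \<in> {0..\<tau>} \<Longrightarrow> x \<in> {0..1} \<Longrightarrow> w' t x = \<Psi> S w' t x"
    using weak_sol_fixed_point[OF \<tau> v] by blast
  have eq: "cont_rep 0 1 (u t) x = cont_rep 0 1 (v t) x" if x: "x \<in> {0..1}" for x
  proof -
    have "w t x = w' t x"
    proof (rule fixed_point_unique[of "max R R'" w w' \<tau>])
      show "0 \<le> max R R'" using w(2) by simp
      show "w t x = \<Psi> (max R R') w t x" if "t \<in> {0..\<tau>}" "x \<in> {0..1}" for t x
        by (rule w(4)[OF _ that]) simp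
      show "w' t x = \<Psi> (max R R') w' t x" if "t \<in> {0..\<tau>}" "x \<in> {0..1}" for t x
        by (rule w'(4)[OF _ that]) simp
    qed (fact w w' \<tau> t x)+
    then show ?thesis using w(3)[OF t x] w'(3)[OF t x] by simp
  qed
  have "u t \<in> H1 0 1" "v t \<in> H1 0 1"
    using u v t by (auto simp: weak_sol_iff continuous_H1_def)
  from H1_AC(3)[OF this(1) zero_less_one] H1_AC(3)[OF this(2) zero_less_one] AE_Ioo_mem show ?thesis
    by eventually_elim (simp add: eq)
qed

text \<open>One solution of the truncated problem on [0,T] is fixed. By continuity it stays below
  the truncation level for a short time, and on each shorter interval it is a weak solution, so a
  single \<open>T0\<close> serves all \<tau>.\<close>

lemma local_existence:
  obtains T0 where "T0 \<in> {0<..T}" "\<And>\<tau>. \<tau> \<in> {0<..T0} \<Longrightarrow> \<exists>u. weak_sol \<tau> u"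
proof -
  have "continuous_on {0..1} (cont_rep 0 1 u0)" by (rule AC_continuous[OF H1_AC(1)[OF u0]]) simp
  then have "compact (cont_rep 0 1 u0 ` {0..1})" by (rule compact_continuous_image) simp
  from compact_imp_bounded[OF this, unfolded bounded_iff]
  obtain B where B: "\<forall>y \<in> cont_rep 0 1 u0 ` {0..1}. norm y \<le> B" by blast
  \<comment> \<open>The margin 1 over the sup norm of the initial value is the room the solution may
    use before the truncation acts.\<close>
  define R where "R = \<bar>B\<bar> + 1"
  have R: "0 \<le> R" by (simp add: R_def)
  obtain w where w: "continuous_on UNIV (\<lambda>z. w (fst z) (snd z))"
    and fixed: "\<And>t x. t \<in> {0..T} \<Longrightarrow> x \<in> {0..1} \<Longrightarrow> w t x = \<Psi> R w t x"
    by (rule fixed_point_exists[OF R]) blast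
  define f where "f = (\<lambda>z. exp (- k * fst z) * w (fst z) (snd z))"
  have fc: "continuous_on ({0..T} \<times> {0..1}) f"
    unfolding f_def by (intro continuous_intros continuous_on_subset[OF w]) auto
  have "uniformly_continuous_on ({0..T} \<times> {0..1}) f"
    by (intro compact_uniformly_continuous fc compact_Times) auto
  then obtain \<delta> where \<delta>: "\<delta> > 0" "\<And>z z'. z \<in> {0..T} \<times> {0..1} \<Longrightarrow> z' \<in> {0..T} \<times> {0..1} \<Longrightarrow> dist z' z < \<delta> \<Longrightarrow> dist (f z') (f z) < 1"
    unfolding uniformly_continuous_on_def by (metis zero_less_one)
  have bd: "\<bar>exp (- k * t) * w t x\<bar> \<le> R" if t: "t \<in> {0..min T (\<delta> / 2)}" and x: "x \<in> {0..1}" for t x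
  proof -
    interpret P: ext_wave c a0 b0 "flux0 R w" "flux1 R w" "GG R w" by (rule ext_wave_\<Psi>[OF w])
    have "f (0, x) = cont_rep 0 1 u0 x"
      using fixed[of 0 x] x T initial_values(1)[OF P.ext_wave_axioms x] by (simp add: f_def \<Psi>_def)
    then have "\<bar>f (0, x)\<bar> \<le> \<bar>B\<bar>" using bspec[OF B imageI[OF x]] by simp
    moreover have "dist (f (t, x)) (f (0, x)) < 1"
      using t x T \<delta>(1) by (intro \<delta>(2)) (auto simp: dist_Pair_Pair)
    ultimately have "\<bar>f (t, x)\<bar> \<le> R" unfolding R_def dist_real_def by linarith
    then show ?thesis by (simp add: f_def)
  qed
  show thesis
  proof (rule that)
    \<comment> \<open>Half of \<delta>, so that distances in time stay strictly below it.\<close>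
    show "min T (\<delta> / 2) \<in> {0<..T}" using T \<delta> by auto
    fix \<tau> assume \<tau>: "\<tau> \<in> {0<..min T (\<delta> / 2)}"
    have "weak_sol \<tau> (\<lambda>t x. exp (- k * t) * \<Psi> R w t x)"
      by (rule fixed_point_weak_sol[OF w fixed]) (use \<tau> bd in auto)
    then show "\<exists>u. weak_sol \<tau> u" by blast
  qed
qed

end

theorem theorem2p4:
  fixes T p \<alpha> \<beta> l l0 l1 m0 m1 :: real
    and h0 h1 u0 u1 :: "real \<Rightarrow> real"
  assumes "T > 0"
    and "p > 2" and "\<alpha> > 2" and "\<beta> > 2"
    and "l > 0" and "l0 > 0" and "l1 > 0"
    and "\<bar>m0 + m1\<bar> < 2 * sqrt (l0 * l1)"
    and "h0 \<in> H1 0 T" and "h1 \<in> H1 0 T"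
    and "u0 \<in> H1 0 1" and "u1 \<in> L2 0 1"
  shows "\<exists>T\<^sub>0 \<in> {0<..T}. \<forall>\<tau> \<in> {0<..T\<^sub>0}.
           \<exists>u. weak_solution p \<alpha> \<beta> l l0 l1 m0 m1 h0 h1 u0 u1 \<tau> u \<and>
               (\<forall>w. weak_solution p \<alpha> \<beta> l l0 l1 m0 m1 h0 h1 u0 u1 \<tau> w \<longrightarrow>
                    (\<forall>t \<in> {0..\<tau>}. AE x in lebesgue_on {0<..<1}. w t x = u t x))"
proof -
  define k where "k = l / 2"
  \<comment> \<open>The continuous representative of a coefficient, frozen outside [0,T], is
    continuous on the whole line.\<close>
  define g where "g = (\<lambda>h t. cont_rep 0 T h (max 0 (min T t)))"
  have gc: "continuous_on UNIV (g h)" and ge: "AE t in lebesgue_on {0<..<min 1 T}. h t = g h t" if h: "h \<in> H1 0 T" for h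
  proof -
    have "continuous_on {0..T} (cont_rep 0 T h)" by (rule AC_continuous[OF H1_AC(1)[OF h assms(1)]])
    then show "continuous_on UNIV (g h)"
      unfolding g_def by (rule continuous_on_compose2) (use assms(1) in \<open>auto intro!: continuous_intros\<close>)
    have "AE t in lebesgue_on {0<..<T}. h t = g h t"
      using H1_AC(3)[OF h assms(1)] AE_Ioo_mem by eventually_elim (auto simp: g_def min_def max_def)
    then show "AE t in lebesgue_on {0<..<min 1 T}. h t = g h t" by (rule AE_Ioo_subset) auto
  qed
  define U where "U = cont_rep 0 1 u0"
  have UL: "U \<in> L2 0 1" unfolding U_def by (rule L2_continuous[OF AC_continuous[OF H1_AC(1)[OF assms(11)]]]) simp
  have dL: "weak_deriv 0 1 u0 \<in> L2 0 1" by (rule H1_AC(2)[OF assms(11)]) simp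
  have "(\<lambda>x. (1 / 2) * (weak_deriv 0 1 u0 x + u1 x + k * U x)) \<in> L2 0 1"
    by (intro L2_add L2_cmult UL dL assms(12))
  then obtain a0 where a0: "a0 \<in> borel_measurable borel" "a0 \<in> L2 0 1"
    "AE x in lebesgue_on {0<..<1}. a0 x = (1 / 2) * (weak_deriv 0 1 u0 x + u1 x + k * U x)"
    by (rule borel_extension[OF _ order_refl])
  have "(\<lambda>x. (1 / 2) * (weak_deriv 0 1 u0 x - u1 x - k * U x)) \<in> L2 0 1"
    by (intro L2_minus L2_cmult UL dL assms(12))
  then obtain b0 where b0: "b0 \<in> borel_measurable borel" "b0 \<in> L2 0 1"
    "AE x in lebesgue_on {0<..<1}. b0 x = (1 / 2) * (weak_deriv 0 1 u0 x - u1 x - k * U x)"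
    by (rule borel_extension[OF _ order_refl])
  \<comment> \<open>The claim is local in time, so the bound T \<le> 1 is met by passing to
    \<open>min 1 T\<close>.\<close>
  interpret weak_problem p \<alpha> \<beta> k l0 l1 m0 m1 "min 1 T" "cont_rep 0 1 u0 0" "g h0" "g h1" a0 b0 h0 h1 u0 u1
  proof unfold_locales
    show "AE x in lebesgue_on {0<..<1}. a0 x = (weak_deriv 0 1 u0 x + u1 x + k * cont_rep 0 1 u0 x) / 2"
      using a0(3) by eventually_elim (simp add: U_def)
    show "AE x in lebesgue_on {0<..<1}. b0 x = (weak_deriv 0 1 u0 x - u1 x - k * cont_rep 0 1 u0 x) / 2"
      using b0(3) by eventually_elim (simp add: U_def)
  qed (use assms a0 b0 gc ge in \<open>auto simp: k_def\<close>)
  have sol: "weak_solution p \<alpha> \<beta> l l0 l1 m0 m1 h0 h1 u0 u1 \<tau> u \<longleftrightarrow> weak_sol \<tau> u" for \<tau> u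
    unfolding weak_sol_def by (simp add: k_def)
  obtain T0 where T0: "T0 \<in> {0<..min 1 T}" "\<And>\<tau>. \<tau> \<in> {0<..T0} \<Longrightarrow> \<exists>u. weak_sol \<tau> u"
    by (rule local_existence) blast
  show ?thesis
    unfolding sol
  proof (intro bexI[of _ T0] ballI)
    fix \<tau> assume \<tau>: "\<tau> \<in> {0<..T0}"
    then obtain u where u: "weak_sol \<tau> u" using T0(2) by blast
    have "0 < \<tau>" "\<tau> \<le> min 1 T" using \<tau> T0(1) by auto
    then show "\<exists>u. weak_sol \<tau> u \<and> (\<forall>w. weak_sol \<tau> w \<longrightarrow> (\<forall>t\<in>{0..\<tau>}. AE x in lebesgue_on {0<..<1}. w t x = u t x))"
      using u weak_sol_unique by blast
  qed (use T0 in auto)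
qed

end
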